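(* Fix $T>0$. For each $n\ge2$ let $(\mathbf x_n^\circ,\mathbf b_n^\circ)\in\mathcal Z_n$ and $\kappa_n^\circ:=\frac1n\sum_{i=1}^nb^\circ_{n,i}\delta_{x^\circ_{n,i}}$. Assume that $\kappa_n^\circ$ converges to a finite signed measure $\kappa^\circ$ in the strong narrow sense. Let $(\mathbf x_n,\mathbf b_n)$ be the solution of $(P_n)$ with initial datum $(\mathbf x^\circ_n,\mathbf b^\circ_n)$, and $\kappa_n(t):=\frac1n\sum_{i=1}^nb_{n,i}(t)\delta_{x_{n,i}(t)}$. Then there is a family $\{\kappa(t)\}_{t\in[0,T]}$ of finite signed measures on $\mathbb R$, characterized by the property that $u(t,x)=\kappa(t,(-\infty,x])$ is the unique viscosity solution of (HJ) with initial datum $u^\circ(x)=\kappa^\circ((-\infty,x])$, such that for any $t\in[0,T]$ and any sequence $t_n\to t$ in $[0,T]$, $\kappa_n(t_n)$ converges to $\kappa(t)$ in the strong narrow sense. Moreover the sequence $(s_n)_n$ and the modulus of continuity $\omega$ in this convergence can be chosen independent of the sequence $t_n\to t$. In addition, the map $t\mapsto\kappa(t)$ is narrowly continuous on $[0,T]$.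
   Context: Narrow convergence of finite signed measures $\mu_n\to\mu$ on $\mathbb R$ means $\int\varphi\,d\mu_n\to\int\varphi\,d\mu$ for every bounded continuous $\varphi$. "Convergence in the strong narrow sense" of $\mu_n$ to $\mu$ means: $(\mu_n)$ is bounded in total variation and tight (for every $\varepsilon>0$ there is $R$ with $|\mu_n|(\mathbb R\setminus[-R,R])<\varepsilon$ for all $n$), and (a) $\mu_n\to\mu$ narrowly, (b) $\mu$ has no atoms, (c) there are a sequence $s_n\to0$ and a modulus of continuity $\omega$ (nondecreasing, $\omega(0)=0$, $\omega(r)\to0$ as $r\to0$) such that $|\mu_n((x,y])|\le s_n+\omega(|x-y|)$ for all $n$ and $-\infty<x\le y<\infty$. Equivalently, $x\mapsto\mu_n((-\infty,x])$ converges (locally) uniformly to the continuous function $x\mapsto\mu((-\infty,x])$. Particle system. $\mathcal Z_n:=\{(\mathbf x,\mathbf b)\in\mathbb R^n\times\{-1,0,+1\}^n:\ i>j,\ b_ib_j\ne0\Rightarrow x_i>x_j\}$. A solution of $(P_n)$ on $[0,T]$ with initial datum $(\mathbf x^\circ,\mathbf b^\circ)\in\mathcal Z_n$ is a map $(\mathbf x,\mathbf b):[0,T]\to\mathcal Z_n$ for which there is a finite set $S\subset(0,T]$ such that: each $x_i\in C([0,T])\cap C^1([0,T]\setminus S)$ and each $b_i:[0,T]\to\{-1,0,1\}$ is right-continuous; $(\mathbf x(0),\mathbf b(0))=(\mathbf x^\circ,\mathbf b^\circ)$; each $b_i$ jumps at most once; if $b_i$ jumps at $t$ then $t\in S$,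 $|b_i(t-)|=1$ and $b_i(t)=0$; for all $(\tau,y)\in S\times\mathbb R$, $\sum_{i:x_i(\tau)=y}(b_i(\tau)-b_i(\tau-))=0$; and on $(0,T)\setminus S$, $\frac{dx_i}{dt}=\frac1n\sum_{j\ne i}\frac{b_ib_j}{x_i-x_j}$ (terms with $b_ib_j=0$ are read as $0$). Such solutions exist and are unique up to relabeling of particles (which does not affect $\kappa_n$). Limiting equation (HJ): formally $u_t=\mathcal I[u]\,|u_x|$ with $\mathcal I[w](x)=\int_{\mathbb R}(w(x+z)-w(x)-zw'(x))\frac{dz}{z^2}$. Let $Q=(0,\infty)\times\mathbb R$, $B_\rho=(-\rho,\rho)$. For $\rho>0$, $u$ bounded and $\phi\in C^2(Q)$, put $$H_\rho[\phi,u](t,x)=|\phi_x(t,x)|\Big(\int_{B_\rho}\big(\phi(t,x+z)-\phi(t,x)-\phi_x(t,x)z\big)\tfrac{dz}{z^2}+\int_{\mathbb R\setminus B_\rho}\big(u(t,x+z)-u(t,x)\big)\tfrac{dz}{z^2}\Big).$$ A bounded upper semicontinuous $u:Q\to\mathbb R$ is a subsolution of (HJ) if whenever $\phi\in C^2(Q)$ and $u-\phi$ has a global maximum at $(\bar t,\bar x)\in Q$: if $\phi_x(\bar t,\bar x)\ne0$ then $\phi_t(\bar t,\bar x)\le H_\rho[\phi,u](\bar t,\bar x)$; if $\phi(t,x)=c|x-\bar x|^4+g(t)$ then $\phi_t(\bar t,\bar x)\le0$; otherwise no condition. A bounded lower semicontinuous $v:Q\to\mathbb R$ is a supersolution if whenever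 $\psi\in C^2(Q)$ and $v-\psi$ has a global minimum at $(\bar t,\bar x)$: if $\psi_x(\bar t,\bar x)\neq0$ then $\psi_t(\bar t,\bar x)\ge H_\rho[\psi,v](\bar t,\bar x)$; if $\psi(t,x)=c|x-\bar x|^4+g(t)$ then $\psi_t(\bar t,\bar x)\ge0$; otherwise no condition. These notions do not depend on $\rho>0$. With $u^*,u_*$ the upper/lower semicontinuous envelopes (extended to $t=0$ by limsup/liminf from $Q$), $u$ is a viscosity solution if $u^*$ is a subsolution and $u_*$ a supersolution; it has initial datum $u^\circ$ if $u^*(0,\cdot)=u_*(0,\cdot)=u^\circ$. *)

theory Defs
  imports "HOL-Analysis.Analysis"
begin

section \<open>Finite signed Borel measures on the real line\<close>

text \<open>
  A finite signed measure is a countably additive real-valued set function on the Borel sets.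
  As for \<^const>\<open>emeasure\<close>, the value on non-measurable sets is fixed to be 0, so that two
  signed measures are equal as soon as they agree on the Borel sets.
\<close>

definition finite_signed_measure :: "(real set \<Rightarrow> real) \<Rightarrow> bool" where
  "finite_signed_measure \<mu> \<longleftrightarrow>
     (\<forall>A. A \<notin> sets borel \<longrightarrow> \<mu> A = 0) \<and> \<mu> {} = 0 \<and>
     (\<forall>A :: nat \<Rightarrow> real set. range A \<subseteq> sets borel \<and> disjoint_family A \<longrightarrow>
        (\<lambda>i. \<mu> (A i)) sums \<mu> (\<Union>i. A i))"

text \<open>
  Jordan decomposition: the positive part of \<open>\<mu>\<close> is the supremum of \<open>\<mu> B\<close> over Borel subsets
  \<open>B\<close> of \<open>A\<close>. Since \<^const>\<open>ennreal\<close> truncates negative numbers to 0 and \<open>B = {}\<close> is admissible,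
  taking the supremum in \<^typ>\<open>ennreal\<close> does not change it.
\<close>

definition pos_variation :: "(real set \<Rightarrow> real) \<Rightarrow> real measure" where
  "pos_variation \<mu> =
     measure_of UNIV (sets borel) (\<lambda>A. SUP B\<in>{B \<in> sets borel. B \<subseteq> A}. ennreal (\<mu> B))"

definition neg_variation :: "(real set \<Rightarrow> real) \<Rightarrow> real measure" where
  "neg_variation \<mu> = pos_variation (\<lambda>A. - \<mu> A)"

definition total_variation :: "(real set \<Rightarrow> real) \<Rightarrow> real set \<Rightarrow> ennreal" where
  "total_variation \<mu> A = emeasure (pos_variation \<mu>) A + emeasure (neg_variation \<mu>) A"

definition signed_integral :: "(real set \<Rightarrow> real) \<Rightarrow> (real \<Rightarrow> real) \<Rightarrow> real" where
  "signed_integral \<mu> \<phi> =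
     integral\<^sup>L (pos_variation \<mu>) \<phi> - integral\<^sup>L (neg_variation \<mu>) \<phi>"

lemma sets_pos_variation [simp]: "sets (pos_variation \<mu>) = sets borel"
  using sets.sigma_sets_eq[of "borel :: real measure"] by (simp add: pos_variation_def)

lemma finite_signed_measure_uminus:
  assumes "finite_signed_measure \<mu>"
  shows "finite_signed_measure (\<lambda>A. - \<mu> A)"
  using assms unfolding finite_signed_measure_def by (auto intro: sums_minus)

lemma emeasure_pos_variation:
  assumes \<mu>: "finite_signed_measure \<mu>" and A: "A \<in> sets borel"
  shows "emeasure (pos_variation \<mu>) A = (SUP B\<in>{B \<in> sets borel. B \<subseteq> A}. ennreal (\<mu> B))"
proof -
  let ?f = "\<lambda>A. SUP B\<in>{B \<in> sets borel. B \<subseteq> A}. ennreal (\<mu> B)"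
  have empty: "\<mu> {} = 0" and
    sums: "\<And>A :: nat \<Rightarrow> real set. range A \<subseteq> sets borel \<Longrightarrow> disjoint_family A \<Longrightarrow>
             (\<lambda>i. \<mu> (A i)) sums \<mu> (\<Union>i. A i)"
    using \<mu> by (auto simp: finite_signed_measure_def)
  have add2: "\<mu> (A \<union> B) = \<mu> A + \<mu> B"
    if "A \<in> sets borel" "B \<in> sets borel" "A \<inter> B = {}" for A B
  proof -
    have "(\<lambda>i. \<mu> (binaryset A B i)) sums \<mu> (\<Union>i. binaryset A B i)"
      using that by (intro sums) (auto simp: binaryset_def disjoint_family_on_def)
    moreover have "(\<lambda>i. \<mu> (binaryset A B i)) sums (\<mu> A + \<mu> B)"
      using binaryset_sums[of \<mu> A B] empty by simp
    ultimately show ?thesis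
      by (simp add: UN_binaryset_eq sums_unique2)
  qed
  have mono: "?f A \<le> ?f B" if "A \<subseteq> B" for A B
    using that by (intro SUP_subset_mono) auto
  have upper: "ennreal (\<mu> B) \<le> ?f A" if "B \<in> sets borel" "B \<subseteq> A" for A B
    using that by (intro SUP_upper) auto
  have nonneg_subset: "\<exists>B'\<in>sets borel. B' \<subseteq> A \<and> 0 \<le> \<mu> B' \<and> ennreal (\<mu> B) = ennreal (\<mu> B')"
    if "B \<in> sets borel" "B \<subseteq> A" for A B
  proof (cases "0 \<le> \<mu> B")
    case True
    then show ?thesis using that by blast
  next
    case False
    then show ?thesis using empty by (intro bexI[of _ "{}"]) (auto simp: ennreal_neg)
  qed
  have super: "?f A + ?f B \<le> ?f (A \<union> B)"
    if AB: "A \<inter> B = {}" for A B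
  proof -
    have "ennreal (\<mu> C) + ennreal (\<mu> D) \<le> ?f (A \<union> B)"
      if CD: "C \<in> sets borel" "C \<subseteq> A" "D \<in> sets borel" "D \<subseteq> B" for C D
    proof -
      obtain C' where C': "C' \<in> sets borel" "C' \<subseteq> A" "0 \<le> \<mu> C'" "ennreal (\<mu> C) = ennreal (\<mu> C')"
        using nonneg_subset[OF CD(1,2)] by blast
      obtain D' where D': "D' \<in> sets borel" "D' \<subseteq> B" "0 \<le> \<mu> D'" "ennreal (\<mu> D) = ennreal (\<mu> D')"
        using nonneg_subset[OF CD(3,4)] by blast
      have "ennreal (\<mu> C) + ennreal (\<mu> D) = ennreal (\<mu> (C' \<union> D'))"
        using C' D' AB by (subst add2) auto
      also have "\<dots> \<le> ?f (A \<union> B)"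
        using C' D' by (intro upper) auto
      finally show ?thesis .
    qed
    then have "?f A + ennreal (\<mu> D) \<le> ?f (A \<union> B)" if "D \<in> sets borel" "D \<subseteq> B" for D
      using that by (subst ennreal_SUP_add_left[symmetric]) (auto intro!: SUP_least)
    then show ?thesis
      by (subst ennreal_SUP_add_right) (auto intro!: SUP_least)
  qed
  have "countably_additive (sets borel) ?f"
  proof (rule countably_additiveI)
    fix A :: "nat \<Rightarrow> real set"
    assume A: "range A \<subseteq> sets borel" "disjoint_family A" "\<Union> (range A) \<in> sets borel"
    show "(\<Sum>i. ?f (A i)) = ?f (\<Union> (range A))"
    proof (rule antisym)
      have fin: "(\<Sum>i<n. ?f (A i)) \<le> ?f (\<Union>i<n. A i)" for n
      proof (induction n)
        case 0
        then show ?case by simp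
      next
        case (Suc n)
        have "A i \<inter> A n = {}" if "i < n" for i
          using A(2) that by (intro disjoint_family_onD) auto
        then have disj: "(\<Union>i<n. A i) \<inter> A n = {}" by blast
        have "(\<Sum>i<Suc n. ?f (A i)) = (\<Sum>i<n. ?f (A i)) + ?f (A n)"
          by (rule sum.lessThan_Suc)
        also have "\<dots> \<le> ?f (\<Union>i<n. A i) + ?f (A n)"
          by (rule add_right_mono[OF Suc.IH])
        also have "\<dots> \<le> ?f ((\<Union>i<n. A i) \<union> A n)"
          by (rule super[OF disj])
        also have "\<dots> \<le> ?f (\<Union>i<Suc n. A i)"
          by (rule mono) (auto simp: lessThan_Suc)
        finally show ?case .
      qed
      show "(\<Sum>i. ?f (A i)) \<le> ?f (\<Union> (range A))"
        unfolding suminf_eq_SUP by (rule SUP_least, rule order_trans[OF fin], rule mono) auto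
    next
      show "?f (\<Union> (range A)) \<le> (\<Sum>i. ?f (A i))"
      proof (rule SUP_least)
        fix B assume "B \<in> {B \<in> sets borel. B \<subseteq> \<Union> (range A)}"
        then have B: "B \<in> sets borel" "B \<subseteq> \<Union> (range A)" by auto
        have "(\<lambda>i. \<mu> (B \<inter> A i)) sums \<mu> (\<Union>i. B \<inter> A i)"
          using A B by (intro sums) (auto simp: disjoint_family_on_def)
        also have "(\<Union>i. B \<inter> A i) = B" using B by auto
        finally have s: "(\<lambda>n. \<Sum>i<n. \<mu> (B \<inter> A i)) \<longlonglongrightarrow> \<mu> B" by (simp add: sums_def)
        have le: "ennreal (\<Sum>i<n. \<mu> (B \<inter> A i)) \<le> (\<Sum>i. ?f (A i))" for n
        proof -
          have "ennreal (\<Sum>i<n. \<mu> (B \<inter> A i)) \<le> ennreal (\<Sum>i<n. max 0 (\<mu> (B \<inter> A i)))"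
            by (intro ennreal_leI sum_mono) auto
          also have "\<dots> = (\<Sum>i<n. ennreal (max 0 (\<mu> (B \<inter> A i))))"
            by (rule sum_ennreal[symmetric]) auto
          also have "\<dots> = (\<Sum>i<n. ennreal (\<mu> (B \<inter> A i)))"
            by (intro sum.cong refl) (auto simp: max_def ennreal_neg)
          also have "\<dots> \<le> (\<Sum>i<n. ?f (A i))"
            using A B by (intro sum_mono upper) auto
          also have "\<dots> \<le> (\<Sum>i. ?f (A i))"
            by (intro sum_le_suminf) auto
          finally show ?thesis .
        qed
        show "ennreal (\<mu> B) \<le> (\<Sum>i. ?f (A i))"
          by (rule LIMSEQ_le_const2[OF tendsto_ennrealI[OF s]]) (use le in auto)
      qed
    qed
  qed
  moreover have "positive (sets borel) ?f"
    using empty by (auto simp: positive_def)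
  moreover have "sigma_algebra UNIV (sets (borel :: real measure))"
    using sets.sigma_algebra_axioms[of "borel :: real measure"] by simp
  ultimately show ?thesis
    unfolding pos_variation_def using A by (intro emeasure_measure_of_sigma) auto
qed

section \<open>Narrow and strong narrow convergence\<close>

text \<open>All sequences of measures below are indexed by \<open>n \<ge> 2\<close>.\<close>

definition narrow_conv :: "(nat \<Rightarrow> real set \<Rightarrow> real) \<Rightarrow> (real set \<Rightarrow> real) \<Rightarrow> bool" where
  "narrow_conv \<mu>s \<mu> \<longleftrightarrow>
     (\<forall>\<phi>. continuous_on UNIV \<phi> \<and> bounded (range \<phi>) \<longrightarrow>
        (\<lambda>n. signed_integral (\<mu>s n) \<phi>) \<longlonglongrightarrow> signed_integral \<mu> \<phi>)"

definition narrowly_continuous_on :: "real set \<Rightarrow> (real \<Rightarrow> real set \<Rightarrow> real) \<Rightarrow> bool" where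
  "narrowly_continuous_on I \<kappa> \<longleftrightarrow>
     (\<forall>\<phi>. continuous_on UNIV \<phi> \<and> bounded (range \<phi>) \<longrightarrow>
        continuous_on I (\<lambda>t. signed_integral (\<kappa> t) \<phi>))"

definition bounded_variation_seq :: "(nat \<Rightarrow> real set \<Rightarrow> real) \<Rightarrow> bool" where
  "bounded_variation_seq \<mu>s \<longleftrightarrow>
     (\<exists>C :: real. \<forall>n\<ge>2. total_variation (\<mu>s n) UNIV \<le> ennreal C)"

definition tight_seq :: "(nat \<Rightarrow> real set \<Rightarrow> real) \<Rightarrow> bool" where
  "tight_seq \<mu>s \<longleftrightarrow>
     (\<forall>\<epsilon> :: real. \<epsilon> > 0 \<longrightarrow>
        (\<exists>R. \<forall>n\<ge>2. total_variation (\<mu>s n) (UNIV - {-R..R}) < ennreal \<epsilon>))"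

definition modulus_of_continuity :: "(real \<Rightarrow> real) \<Rightarrow> bool" where
  "modulus_of_continuity \<omega> \<longleftrightarrow> mono_on {0..} \<omega> \<and> \<omega> 0 = 0 \<and> (\<omega> \<longlongrightarrow> 0) (at_right 0)"

definition strong_narrow_conv_with ::
  "(nat \<Rightarrow> real) \<Rightarrow> (real \<Rightarrow> real) \<Rightarrow> (nat \<Rightarrow> real set \<Rightarrow> real) \<Rightarrow> (real set \<Rightarrow> real) \<Rightarrow> bool" where
  "strong_narrow_conv_with s \<omega> \<mu>s \<mu> \<longleftrightarrow>
     bounded_variation_seq \<mu>s \<and> tight_seq \<mu>s \<and>
     narrow_conv \<mu>s \<mu> \<and>
     (\<forall>x. \<mu> {x} = 0) \<and>
     s \<longlonglongrightarrow> 0 \<and> modulus_of_continuity \<omega> \<and>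
     (\<forall>n\<ge>2. \<forall>x y. x \<le> y \<longrightarrow> \<bar>\<mu>s n {x<..y}\<bar> \<le> s n + \<omega> \<bar>x - y\<bar>)"

definition strong_narrow_conv ::
  "(nat \<Rightarrow> real set \<Rightarrow> real) \<Rightarrow> (real set \<Rightarrow> real) \<Rightarrow> bool" where
  "strong_narrow_conv \<mu>s \<mu> \<longleftrightarrow> (\<exists>s \<omega>. strong_narrow_conv_with s \<omega> \<mu>s \<mu>)"

section \<open>The particle system\<close>

text \<open>
  Positions and charges of \<open>n\<close> particles are functions on \<^typ>\<open>nat\<close> of which only the values at
  the indices \<open>1, \<dots>, n\<close> matter. A trajectory takes the time first and the particle index second.
\<close>

definition Zn :: "nat \<Rightarrow> ((nat \<Rightarrow> real) \<times> (nat \<Rightarrow> int)) set" where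
  "Zn n = {(x, b). (\<forall>i\<in>{1..n}. b i \<in> {-1, 0, 1}) \<and>
                   (\<forall>i\<in>{1..n}. \<forall>j\<in>{1..n}. i > j \<and> b i * b j \<noteq> 0 \<longrightarrow> x i > x j)}"

definition charge_measure :: "nat \<Rightarrow> (nat \<Rightarrow> real) \<Rightarrow> (nat \<Rightarrow> int) \<Rightarrow> real set \<Rightarrow> real" where
  "charge_measure n x b A =
     (if A \<in> sets borel then (1 / real n) * (\<Sum>i=1..n. real_of_int (b i) * indicator A (x i)) else 0)"

lemma finite_signed_measure_charge_measure: "finite_signed_measure (charge_measure n x b)"
proof -
  have "(\<lambda>k. charge_measure n x b (A k)) sums charge_measure n x b (\<Union>k. A k)"
    if A: "range A \<subseteq> sets borel" "disjoint_family A" for A :: "nat \<Rightarrow> real set"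
  proof -
    have "(\<lambda>k. indicator (A k) y :: real) sums indicator (\<Union>k. A k) y" for y
      by (rule indicator_sums) (use A(2) in \<open>auto simp: disjoint_family_on_def\<close>)
    then have "(\<lambda>k. (1 / real n) * (\<Sum>i=1..n. real_of_int (b i) * indicator (A k) (x i))) sums
               ((1 / real n) * (\<Sum>i=1..n. real_of_int (b i) * indicator (\<Union>k. A k) (x i)))"
      by (intro sums_mult sums_sum)
    moreover have "A k \<in> sets borel" for k using A(1) by auto
    moreover from this have "(\<Union>k. A k) \<in> sets borel" by auto
    ultimately show ?thesis by (simp add: charge_measure_def)
  qed
  then show ?thesis
    by (auto simp: finite_signed_measure_def charge_measure_def)
qed

definition left_limit :: "(real \<Rightarrow> 'a :: t2_space) \<Rightarrow> real \<Rightarrow> 'a" where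
  "left_limit f t = Lim (at_left t) f"

definition jumps_at :: "real \<Rightarrow> (real \<Rightarrow> 'a :: t2_space) \<Rightarrow> real \<Rightarrow> bool" where
  "jumps_at T f t \<longleftrightarrow> t \<in> {0..T} \<and> \<not> continuous (at t within {0..T}) f"

text \<open>
  In the equation of motion, the terms with \<open>b\<^sub>i b\<^sub>j = 0\<close> vanish because \<open>0 / y = 0\<close> for all
  \<open>y\<close>, including \<open>y = 0\<close>.
\<close>

definition solves_Pn ::
  "nat \<Rightarrow> real \<Rightarrow> (nat \<Rightarrow> real) \<Rightarrow> (nat \<Rightarrow> int) \<Rightarrow>
   (real \<Rightarrow> nat \<Rightarrow> real) \<Rightarrow> (real \<Rightarrow> nat \<Rightarrow> int) \<Rightarrow> bool" where
  "solves_Pn n T x0 b0 x b \<longleftrightarrow>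
     (\<forall>t\<in>{0..T}. (x t, b t) \<in> Zn n) \<and>
     (\<exists>S. finite S \<and> S \<subseteq> {0<..T} \<and>
       (\<forall>i\<in>{1..n}. continuous_on {0..T} (\<lambda>t. x t i)) \<and>
       (\<forall>i\<in>{1..n}. \<exists>v. continuous_on ({0..T} - S) v \<and>
          (\<forall>t\<in>{0..T} - S. ((\<lambda>t. x t i) has_real_derivative v t) (at t within {0..T}))) \<and>
       (\<forall>i\<in>{1..n}. \<forall>t\<in>{0..<T}. continuous (at_right t) (\<lambda>t. b t i)) \<and>
       (\<forall>i\<in>{1..n}. x 0 i = x0 i \<and> b 0 i = b0 i) \<and>
       (\<forall>i\<in>{1..n}. \<forall>t t'. jumps_at T (\<lambda>t. b t i) t \<and> jumps_at T (\<lambda>t. b t i) t' \<longrightarrow> t = t') \<and>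
       (\<forall>i\<in>{1..n}. \<forall>t. jumps_at T (\<lambda>t. b t i) t \<longrightarrow>
          t \<in> S \<and> \<bar>left_limit (\<lambda>t. b t i) t\<bar> = 1 \<and> b t i = 0) \<and>
       (\<forall>\<tau>\<in>S. \<forall>y. (\<Sum>i\<in>{i\<in>{1..n}. x \<tau> i = y}. b \<tau> i - left_limit (\<lambda>t. b t i) \<tau>) = 0) \<and>
       (\<forall>i\<in>{1..n}. \<forall>t\<in>{0<..<T} - S.
          ((\<lambda>t. x t i) has_real_derivative
             (1 / real n) * (\<Sum>j\<in>{1..n} - {i}. real_of_int (b t i * b t j) / (x t i - x t j)))
          (at t)))"

section \<open>Viscosity solutions of the limiting equation\<close>

text \<open>Points of space-time are pairs \<open>(t, x)\<close>.\<close>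

definition HJ_dom :: "(real \<times> real) set" where
  "HJ_dom = {0<..} \<times> UNIV"

definition pd_t :: "(real \<times> real \<Rightarrow> real) \<Rightarrow> real \<times> real \<Rightarrow> real" where
  "pd_t \<phi> = (\<lambda>(t, x). deriv (\<lambda>s. \<phi> (s, x)) t)"

definition pd_x :: "(real \<times> real \<Rightarrow> real) \<Rightarrow> real \<times> real \<Rightarrow> real" where
  "pd_x \<phi> = (\<lambda>(t, x). deriv (\<lambda>y. \<phi> (t, y)) x)"

definition C1_on_dom :: "(real \<times> real \<Rightarrow> real) \<Rightarrow> bool" where
  "C1_on_dom \<phi> \<longleftrightarrow>
     (\<forall>(t, x)\<in>HJ_dom. (\<lambda>s. \<phi> (s, x)) differentiable (at t) \<and> (\<lambda>y. \<phi> (t, y)) differentiable (at x)) \<and>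
     continuous_on HJ_dom (pd_t \<phi>) \<and> continuous_on HJ_dom (pd_x \<phi>)"

definition C2_on_dom :: "(real \<times> real \<Rightarrow> real) \<Rightarrow> bool" where
  "C2_on_dom \<phi> \<longleftrightarrow> C1_on_dom \<phi> \<and> C1_on_dom (pd_t \<phi>) \<and> C1_on_dom (pd_x \<phi>)"

definition HJ_H :: "real \<Rightarrow> (real \<times> real \<Rightarrow> real) \<Rightarrow> (real \<times> real \<Rightarrow> real) \<Rightarrow> real \<times> real \<Rightarrow> real" where
  "HJ_H \<rho> \<phi> u = (\<lambda>(t, x). \<bar>pd_x \<phi> (t, x)\<bar> *
     ((LINT z:{-\<rho><..<\<rho>}|lborel. (\<phi> (t, x + z) - \<phi> (t, x) - pd_x \<phi> (t, x) * z) / z\<^sup>2) +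
      (LINT z:UNIV - {-\<rho><..<\<rho>}|lborel. (u (t, x + z) - u (t, x)) / z\<^sup>2)))"

definition usc_on_dom :: "(real \<times> real \<Rightarrow> real) \<Rightarrow> bool" where
  "usc_on_dom u \<longleftrightarrow> (\<forall>a. openin (top_of_set HJ_dom) {p \<in> HJ_dom. u p < a})"

definition lsc_on_dom :: "(real \<times> real \<Rightarrow> real) \<Rightarrow> bool" where
  "lsc_on_dom u \<longleftrightarrow> (\<forall>a. openin (top_of_set HJ_dom) {p \<in> HJ_dom. u p > a})"

definition HJ_subsolution :: "real \<Rightarrow> (real \<times> real \<Rightarrow> real) \<Rightarrow> bool" where
  "HJ_subsolution \<rho> u \<longleftrightarrow>
     bounded (u ` HJ_dom) \<and> usc_on_dom u \<and>
     (\<forall>\<phi> t' x'. C2_on_dom \<phi> \<and> (t', x') \<in> HJ_dom \<and>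
        (\<forall>p\<in>HJ_dom. u p - \<phi> p \<le> u (t', x') - \<phi> (t', x')) \<longrightarrow>
        (pd_x \<phi> (t', x') \<noteq> 0 \<longrightarrow> pd_t \<phi> (t', x') \<le> HJ_H \<rho> \<phi> u (t', x')) \<and>
        ((\<exists>c g. \<forall>(t, x)\<in>HJ_dom. \<phi> (t, x) = c * \<bar>x - x'\<bar> ^ 4 + g t) \<longrightarrow> pd_t \<phi> (t', x') \<le> 0))"

definition HJ_supersolution :: "real \<Rightarrow> (real \<times> real \<Rightarrow> real) \<Rightarrow> bool" where
  "HJ_supersolution \<rho> v \<longleftrightarrow>
     bounded (v ` HJ_dom) \<and> lsc_on_dom v \<and>
     (\<forall>\<psi> t' x'. C2_on_dom \<psi> \<and> (t', x') \<in> HJ_dom \<and>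
        (\<forall>p\<in>HJ_dom. v p - \<psi> p \<ge> v (t', x') - \<psi> (t', x')) \<longrightarrow>
        (pd_x \<psi> (t', x') \<noteq> 0 \<longrightarrow> pd_t \<psi> (t', x') \<ge> HJ_H \<rho> \<psi> v (t', x')) \<and>
        ((\<exists>c g. \<forall>(t, x)\<in>HJ_dom. \<psi> (t, x) = c * \<bar>x - x'\<bar> ^ 4 + g t) \<longrightarrow> pd_t \<psi> (t', x') \<ge> 0))"

text \<open>
  The semicontinuous envelopes are defined at all points of the closure of \<^const>\<open>HJ_dom\<close>, using only
  values in \<^const>\<open>HJ_dom\<close>. They are meaningful for functions that are bounded on \<^const>\<open>HJ_dom\<close>.
\<close>

definition usc_env :: "(real \<times> real \<Rightarrow> real) \<Rightarrow> real \<times> real \<Rightarrow> real" where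
  "usc_env u p = (INF r\<in>{0<..}. SUP q\<in>HJ_dom \<inter> ball p r. u q)"

definition lsc_env :: "(real \<times> real \<Rightarrow> real) \<Rightarrow> real \<times> real \<Rightarrow> real" where
  "lsc_env u p = (SUP r\<in>{0<..}. INF q\<in>HJ_dom \<inter> ball p r. u q)"

text \<open>
  Boundedness of \<open>u\<close> is equivalent to that of its two envelopes; it is stated explicitly because
  suprema and infima of unbounded sets of reals are not meaningful.
\<close>

definition HJ_viscosity_solution :: "real \<Rightarrow> (real \<times> real \<Rightarrow> real) \<Rightarrow> bool" where
  "HJ_viscosity_solution \<rho> u \<longleftrightarrow>
     bounded (u ` HJ_dom) \<and> HJ_subsolution \<rho> (usc_env u) \<and> HJ_supersolution \<rho> (lsc_env u)"

definition has_initial_datum :: "(real \<times> real \<Rightarrow> real) \<Rightarrow> (real \<Rightarrow> real) \<Rightarrow> bool" where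
  "has_initial_datum u u0 \<longleftrightarrow> (\<forall>x. usc_env u (0, x) = u0 x \<and> lsc_env u (0, x) = u0 x)"

definition unique_HJ_solution ::
  "real \<Rightarrow> (real \<Rightarrow> real) \<Rightarrow> (real \<times> real \<Rightarrow> real) \<Rightarrow> bool" where
  "unique_HJ_solution \<rho> u0 u \<longleftrightarrow>
     HJ_viscosity_solution \<rho> u \<and> has_initial_datum u u0 \<and>
     (\<forall>v. HJ_viscosity_solution \<rho> v \<and> has_initial_datum v u0 \<longrightarrow> (\<forall>p\<in>HJ_dom. v p = u p))"

text \<open>
  The equation is posed for all times \<open>t > 0\<close>, whereas the family \<open>\<kappa>\<close> is only considered on
  \<open>[0, T]\<close>: the distribution functions of \<open>\<kappa> t\<close> are given by the unique solution for
  \<open>0 < t \<le> T\<close> and by the initial datum for \<open>t = 0\<close>.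
\<close>

definition HJ_measure_family ::
  "real \<Rightarrow> real \<Rightarrow> (real set \<Rightarrow> real) \<Rightarrow> (real \<Rightarrow> real set \<Rightarrow> real) \<Rightarrow> bool" where
  "HJ_measure_family \<rho> T \<kappa>0 \<kappa> \<longleftrightarrow>
     (\<forall>t\<in>{0..T}. finite_signed_measure (\<kappa> t)) \<and>
     (\<exists>u. unique_HJ_solution \<rho> (\<lambda>x. \<kappa>0 {..x}) u \<and>
          (\<forall>t\<in>{0<..T}. \<forall>x. u (t, x) = \<kappa> t {..x})) \<and>
     (\<forall>x. \<kappa> 0 {..x} = \<kappa>0 {..x})"

end

theory Submission
 imports Defs "HOL-Probability.Helly_Selection"
begin

abbreviation (input) limseq :: "(nat => 'a::topological_space) => 'a => bool" (infixr "---->" 60)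
 where "X ----> L == (X \<longlonglongrightarrow> L)"

text \<open>
 Between collision times the charges are constant. If a quartic \<open>c (x - y)^4 + g t\<close> touches the
 distribution function of \<open>kappa_n t\<close> from above at a particle, the equation of motion of that
 particle turns into the subsolution inequality of the limiting equation, with an error of order
 \<open>1 / n\<close>. At a collision, neutrality lets upper bounds by continuous functions pass to the
 annihilated configuration. Hence the distribution functions are approximate subsolutions for
 quartic test functions, and so are their negatives, because charges may be reversed.

 Quartic test functions suffice for comparison by doubling of variables with the penalty
 \<open>c (x - y)^4 + c (t - s)^2\<close>. Explicit quartic barriers control the initial layer and the behaviour
 at infinity. With the solution obtained by Perron's method, this gives convergence of the
 distribution functions, uniformly on \<open>[0, T]\<close> times the line. Total variations are at most 1, and tightness
 is propagated since the antisymmetry of the interaction bounds the growth of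
 \<open>sum |b_i| x_i^2 / (R^2 + x_i^2)\<close> by a multiple of \<open>1 / R^2\<close>; so uniform convergence upgrades to
 strong narrow convergence, and the limit measures exist by Helly's theorem.
\<close>

section \<open>Calculus on the open half plane\<close>

text \<open>The slope factor makes the equation degenerate: where the slope of a test function
  vanishes, the definition speaks only of quartics centred at the contact point. The penalty
  \<open>c (x - y)^4\<close> is such a quartic in each variable, so a maximum with
  \<open>x = y\<close> still yields information. Its strength \<open>c\<close> is fixed once, large
  in terms of the tolerated error, and is not sent to infinity. Instead the near integrals cost a
  bounded multiple of their radius \<open>r\<close>, the far integrals of the two functions cancel,
  and a small slope \<open>eta\<close> in time beats the rest. Hence the inequality is needed for
  every small \<open>r\<close>, although the definition fixes \<open>rho\<close>. For particles, the
  jump of the touched particle itself adds \<open>1 / (n z^2)\<close> to the integrand, which is not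
  integrable at 0. That counts of charges are integers removes this term near 0. The remaining error
  contains \<open>1 / (n r)\<close>, so \<open>r\<close> is chosen before \<open>n\<close>. Time
  windows between collisions are open on the right, and a pole in time at that end restores
  compactness.\<close>

lemma open_HJ_dom: "open HJ_dom"
 unfolding HJ_dom_def by (intro open_Times) auto

lemma mem_HJ_dom [simp]: "(t, x) : HJ_dom \<longleftrightarrow> t > 0"
 by (auto simp: HJ_dom_def)

lemma C1_on_domI:
 assumes ft: "!!t x. t > 0 ==> ((%s. f (s, x)) has_real_derivative ft (t, x)) (at t)"
  and fx: "!!t x. t > 0 ==> ((%y. f (t, y)) has_real_derivative fx (t, x)) (at x)"
  and ct: "continuous_on HJ_dom ft" and cx: "continuous_on HJ_dom fx"
 shows "C1_on_dom f"
  and "!!t x. t > 0 ==> pd_t f (t, x) = ft (t, x)"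
  and "!!t x. t > 0 ==> pd_x f (t, x) = fx (t, x)"
proof -
 show t: "pd_t f (t, x) = ft (t, x)" if "t > 0" for t x
  using DERIV_imp_deriv[OF ft[OF that]] by (simp add: pd_t_def)
 show x: "pd_x f (t, x) = fx (t, x)" if "t > 0" for t x
  using DERIV_imp_deriv[OF fx[OF that]] by (simp add: pd_x_def)
 have "continuous_on HJ_dom (pd_t f)"
  by (rule continuous_on_eq[OF ct]) (auto simp: t)
 moreover have "continuous_on HJ_dom (pd_x f)"
  by (rule continuous_on_eq[OF cx]) (auto simp: x)
 ultimately show "C1_on_dom f"
  unfolding C1_on_dom_def using ft fx
  by (auto simp: real_differentiable_def) (metis)+
qed

lemma C1_on_domD:
 assumes "C1_on_dom f"
 shows "!!t x. t > 0 ==> ((%s. f (s, x)) has_real_derivative pd_t f (t, x)) (at t)"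
  and "!!t x. t > 0 ==> ((%y. f (t, y)) has_real_derivative pd_x f (t, x)) (at x)"
  and "continuous_on HJ_dom (pd_t f)" and "continuous_on HJ_dom (pd_x f)"
 using assms by (auto simp: C1_on_dom_def pd_t_def pd_x_def DERIV_deriv_iff_real_differentiable)

lemma C1_on_dom_cong:
 assumes g: "C1_on_dom g" and eq: "!!t x. t > 0 ==> f (t, x) = g (t, x)"
 shows "C1_on_dom f"
proof (rule C1_on_domI(1))
 show "((%s. f (s, x)) has_real_derivative pd_t g (t, x)) (at t)" if "t > 0" for t x
  using C1_on_domD(1)[OF g that]
  by (rule has_field_derivative_transform_within_open[where S = "{0<..}"]) (use that eq in auto)
 show "((%y. f (t, y)) has_real_derivative pd_x g (t, x)) (at x)" if "t > 0" for t x
  using C1_on_domD(2)[OF g that] by (simp add: eq that)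
qed (use C1_on_domD[OF g] in auto)

lemma C1_on_dom_lin:
 assumes f: "C1_on_dom f" and g: "C1_on_dom g"
 shows "C1_on_dom (%p. a * f p + b * g p)"
  and "!!t x. t > 0 ==> pd_t (%p. a * f p + b * g p) (t, x) = a * pd_t f (t, x) + b * pd_t g (t, x)"
  and "!!t x. t > 0 ==> pd_x (%p. a * f p + b * g p) (t, x) = a * pd_x f (t, x) + b * pd_x g (t, x)"
proof -
 note I = C1_on_domI[where f = "%p. a * f p + b * g p"
   and ft = "%p. a * pd_t f p + b * pd_t g p" and fx = "%p. a * pd_x f p + b * pd_x g p"]
 have d: "((%s. a * f (s, x) + b * g (s, x)) has_real_derivative a * pd_t f (t, x) + b * pd_t g (t, x)) (at t)"
   "((%y. a * f (t, y) + b * g (t, y)) has_real_derivative a * pd_x f (t, x) + b * pd_x g (t, x)) (at x)"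
  if "t > 0" for t x
  using C1_on_domD(1,2)[OF f that] C1_on_domD(1,2)[OF g that] by (auto intro!: derivative_eq_intros)
 have c: "continuous_on HJ_dom (%p. a * pd_t f p + b * pd_t g p)"
   "continuous_on HJ_dom (%p. a * pd_x f p + b * pd_x g p)"
  using C1_on_domD(3,4)[OF f] C1_on_domD(3,4)[OF g] by (auto intro!: continuous_intros)
 show "C1_on_dom (%p. a * f p + b * g p)" using d c by (intro I(1)) auto
 show "pd_t (%p. a * f p + b * g p) (t, x) = a * pd_t f (t, x) + b * pd_t g (t, x)" if "t > 0" for t x
  by (rule I(2)[OF d c that])
 show "pd_x (%p. a * f p + b * g p) (t, x) = a * pd_x f (t, x) + b * pd_x g (t, x)" if "t > 0" for t x
  by (rule I(3)[OF d c that])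
qed

lemma C2_on_dom_lin:
 assumes f: "C2_on_dom f" and g: "C2_on_dom g"
 shows "C2_on_dom (%p. a * f p + b * g p)"
proof -
 have *: "C1_on_dom f" "C1_on_dom (pd_t f)" "C1_on_dom (pd_x f)"
  "C1_on_dom g" "C1_on_dom (pd_t g)" "C1_on_dom (pd_x g)"
  using f g by (auto simp: C2_on_dom_def)
 show ?thesis
  unfolding C2_on_dom_def
  by (intro conjI C1_on_dom_lin(1)[OF *(1,4)]
   C1_on_dom_cong[OF C1_on_dom_lin(1)[OF *(2,5), of a b]]
   C1_on_dom_cong[OF C1_on_dom_lin(1)[OF *(3,6), of a b]] C1_on_dom_lin(2,3)[OF *(1,4)])
qed

text \<open>The first derivative is a parameter because its value at the contact time enters the
  viscosity inequalities; the second one matters only for regularity.\<close>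

definition C2fun :: "real set => (real => real) => (real => real) => bool" where
 "C2fun I g g' \<longleftrightarrow> (\<exists>g''. (\<forall>t\<in>I. (g has_real_derivative g' t) (at t) &
   (g' has_real_derivative g'' t) (at t)) & continuous_on I g'')"

lemma C2fun_const: "C2fun I (%_. c) (%_. 0)"
 unfolding C2fun_def by (intro exI[of _ "%_. 0"]) auto

lemma C2fun_add:
 assumes "C2fun I f f'" "C2fun I g g'"
 shows "C2fun I (%t. f t + g t) (%t. f' t + g' t)"
proof -
 obtain f'' g'' where "\<forall>t\<in>I. (f has_real_derivative f' t) (at t) & (f' has_real_derivative f'' t) (at t)"
  "continuous_on I f''"
  "\<forall>t\<in>I. (g has_real_derivative g' t) (at t) & (g' has_real_derivative g'' t) (at t)"
  "continuous_on I g''" using assms unfolding C2fun_def by blast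
 then show ?thesis unfolding C2fun_def
  by (intro exI[of _ "%t. f'' t + g'' t"]) (auto intro!: derivative_eq_intros continuous_intros)
qed

lemma C2fun_mult:
 assumes "C2fun I f f'" "C2fun I g g'"
 shows "C2fun I (%t. f t * g t) (%t. f' t * g t + f t * g' t)"
proof -
 obtain f'' g'' where *: "\<forall>t\<in>I. (f has_real_derivative f' t) (at t) & (f' has_real_derivative f'' t) (at t)"
  "continuous_on I f''"
  "\<forall>t\<in>I. (g has_real_derivative g' t) (at t) & (g' has_real_derivative g'' t) (at t)"
  "continuous_on I g''" using assms unfolding C2fun_def by blast
 then have c: "continuous_on I f" "continuous_on I f'" "continuous_on I g" "continuous_on I g'"
  by (meson DERIV_continuous continuous_at_imp_continuous_at_within continuous_on_eq_continuous_within)+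
 show ?thesis unfolding C2fun_def
  using * c by (intro exI[of _ "%t. f'' t * g t + f' t * g' t + (f' t * g' t + f t * g'' t)"])
   (auto intro!: derivative_eq_intros continuous_intros)
qed

lemma C2fun_cmult: "C2fun I g g' ==> C2fun I (%t. c * g t) (%t. c * g' t)"
 using C2fun_mult[OF C2fun_const[of I c]] by simp

lemma C2fun_pow4: "C2fun I (%x. (x - y) ^ 4) (%x. 4 * (x - y) ^ 3)"
 unfolding C2fun_def by (intro exI[of _ "%x. 12 * (x - y)^2"])
  (auto intro!: derivative_eq_intros continuous_intros simp: power2_eq_square)

lemma C2fun_pow2: "C2fun I (%x. (x - y) ^ 2) (%x. 2 * (x - y))"
 unfolding C2fun_def by (intro exI[of _ "%x. 2"])
  (auto intro!: derivative_eq_intros continuous_intros simp: power2_eq_square)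

lemma C2fun_id: "C2fun I (%x. x) (%x. 1)"
 unfolding C2fun_def by (intro exI[of _ "%x. 0"]) (auto intro!: derivative_eq_intros)

lemma C2fun_imp_cont: "C2fun I g g' ==> continuous_on I g & continuous_on I g'"
 unfolding C2fun_def
 by (meson DERIV_continuous continuous_at_imp_continuous_at_within continuous_on_eq_continuous_within)

text \<open>The explicit test functions below are sums of products of a function of time and a
  function of space. Partial derivatives of such a product are again products, so regularity in one
  variable suffices.\<close>

lemma C2_on_dom_sep:
 assumes a: "C2fun {0<..} a a'" and b: "C2fun UNIV b b'"
 shows "C2_on_dom (%(t, x). a t * b x)"
  and "!!t x. t > 0 ==> pd_t (%(t, x). a t * b x) (t, x) = a' t * b x"
  and "!!t x. t > 0 ==> pd_x (%(t, x). a t * b x) (t, x) = a t * b' x"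
proof -
 obtain a'' b'' where *: "!!t. t > 0 ==> (a has_real_derivative a' t) (at t)"
  "!!t. t > 0 ==> (a' has_real_derivative a'' t) (at t)" "continuous_on {0<..} a''"
  "!!x. (b has_real_derivative b' x) (at x)" "!!x. (b' has_real_derivative b'' x) (at x)"
  "continuous_on UNIV b''"
  using a b unfolding C2fun_def by auto
 have ca: "continuous_on {0<..} a" "continuous_on {0<..} a'" "continuous_on UNIV b" "continuous_on UNIV b'"
  using C2fun_imp_cont[OF a] C2fun_imp_cont[OF b] by auto
 have cont: "continuous_on HJ_dom (%(t, x). f t * g x)"
  if "continuous_on {0<..} f" "continuous_on UNIV g" for f g :: "real => real"
 proof -
  have "continuous_on HJ_dom (%p. f (fst p))"
   by (rule continuous_on_compose2[OF that(1)]) (auto intro!: continuous_intros)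
  moreover have "continuous_on HJ_dom (%p. g (snd p))"
   by (rule continuous_on_compose2[OF that(2)]) (auto intro!: continuous_intros)
  ultimately show ?thesis
   unfolding split_beta by (rule continuous_on_mult)
 qed
 note base = C1_on_domI[where f = "%(t, x). a t * b x" and ft = "%(t, x). a' t * b x" and fx = "%(t, x). a t * b' x"]
 have d: "((%s. case (s, x) of (t, x) => a t * b x) has_real_derivative (case (t, x) of (t, x) => a' t * b x)) (at t)"
  "((%y. case (t, y) of (t, x) => a t * b x) has_real_derivative (case (t, x) of (t, x) => a t * b' x)) (at x)"
  if "t > 0" for t x using *(1,2)[OF that] *(4,5) by (auto intro!: derivative_eq_intros)
 have b0: "C1_on_dom (%(t, x). a t * b x)"
  using d cont ca by (intro base(1)) auto
 show pt: "pd_t (%(t, x). a t * b x) (t, x) = a' t * b x" if "t > 0" for t x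
  using base(2)[OF d, of t x] cont ca that by auto
 show px: "pd_x (%(t, x). a t * b x) (t, x) = a t * b' x" if "t > 0" for t x
  using base(3)[OF d, of t x] cont ca that by auto
 have "C1_on_dom (%(t, x). a' t * b x)"
  using * cont ca
  by (intro C1_on_domI(1)[where ft = "%(t, x). a'' t * b x" and fx = "%(t, x). a' t * b' x"])
    (auto intro!: derivative_eq_intros)
 then have 1: "C1_on_dom (pd_t (%(t, x). a t * b x))"
  by (rule C1_on_dom_cong) (simp add: pt)
 have "C1_on_dom (%(t, x). a t * b' x)"
  using * cont ca
  by (intro C1_on_domI(1)[where ft = "%(t, x). a' t * b' x" and fx = "%(t, x). a t * b'' x"])
    (auto intro!: derivative_eq_intros)
 then have 2: "C1_on_dom (pd_x (%(t, x). a t * b x))"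
  by (rule C1_on_dom_cong) (simp add: px)
 show "C2_on_dom (%(t, x). a t * b x)"
  unfolding C2_on_dom_def using b0 1 2 by blast
qed

section \<open>The nonlocal operator\<close>

lemma nn_integral_inverse_square_Ici:
 assumes "r > (0::real)"
 shows "(\<integral>\<^sup>+ z. ennreal (1 / z^2) * indicator {r..} z \<partial>lborel) = ennreal (1 / r)"
proof -
 have "(\<integral>\<^sup>+ z. ennreal (1 / z^2) * indicator {r..} z \<partial>lborel) = ennreal (0 - (- 1 / r))"
 proof (intro nn_integral_FTC_atLeast[where F = "%z. - 1 / z"])
  show "((%z::real. - 1 / z) \<longlongrightarrow> 0) at_top"
   by (rule tendsto_divide_0[OF tendsto_const filterlim_at_top_imp_at_infinity[OF filterlim_ident]])
  show "((%z. - 1 / z) has_real_derivative 1 / z^2) (at z)" if "r <= z" for z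
   using that assms by (auto intro!: derivative_eq_intros simp: power2_eq_square)
 qed auto
 then show ?thesis by simp
qed

lemma inverse_square_Ici:
 assumes "r > (0::real)"
 shows "set_integrable lborel {r..} (%z. 1 / z^2)" and "(LINT z:{r..}|lborel. 1 / z^2) = 1 / r"
proof -
 have 1: "(\<integral>\<^sup>+ z. ennreal (indicator {r..} z * (1 / z^2)) \<partial>lborel) = ennreal (1 / r)"
  by (subst nn_integral_inverse_square_Ici[OF assms, symmetric])
    (auto intro!: nn_integral_cong split: split_indicator)
 show "set_integrable lborel {r..} (%z. 1 / z^2)"
  unfolding set_integrable_def
  by (rule integrableI_nn_integral_finite[where x = "1/r"]) (use assms 1 in auto)
 show "(LINT z:{r..}|lborel. 1 / z^2) = 1 / r"
  unfolding set_lebesgue_integral_def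
  by (rule integral_eq_nn_integral[THEN trans]) (use assms 1 in \<open>auto simp: enn2real_ennreal\<close>)
qed

lemma set_integrable_reflect:
 fixes f :: "real => real"
 assumes "set_integrable lborel {r..} f"
 shows "set_integrable lborel {..-r} (%z. f (- z))"
  and "(LINT z:{..-r}|lborel. f (- z)) = (LINT z:{r..}|lborel. f z)"
proof -
 have eq: "indicator {..- r} z *\<^sub>R f (- z) = indicator {r..} (0 + (-1) * z) *\<^sub>R f (0 + (-1) * z)" for z :: real
  by (auto split: split_indicator)
 show "set_integrable lborel {..-r} (%z. f (- z))"
  unfolding set_integrable_def eq
  by (rule lborel_integrable_real_affine) (use assms in \<open>auto simp: set_integrable_def\<close>)
 show "(LINT z:{..-r}|lborel. f (- z)) = (LINT z:{r..}|lborel. f z)"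
  unfolding set_lebesgue_integral_def eq
  using lborel_integral_real_affine[of "-1" "%z. indicator {r..} z *\<^sub>R f z" 0] by simp
qed

abbreviation far :: "real => real set" where "far r \<equiv> UNIV - {-r<..<r}"

lemma far_split:
 fixes f :: "real => real"
 assumes r: "r > 0" and f: "set_integrable lborel {r..} f" and g: "set_integrable lborel {r..} (%z. f (- z))"
 shows "set_integrable lborel (far r) f"
  and "(LINT z:far r|lborel. f z) = (LINT z:{r..}|lborel. f z + f (- z))"
proof -
 have far: "far r = {..-r} \<union> {r..}" using r by auto
 have g': "set_integrable lborel {..-r} f" "(LINT z:{..-r}|lborel. f z) = (LINT z:{r..}|lborel. f (- z))"
  using set_integrable_reflect[OF g] by simp_all
 show "set_integrable lborel (far r) f"
  unfolding far by (rule set_integrable_Un[OF g'(1) f]) auto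
 have "(LINT z:far r|lborel. f z) = (LINT z:{..-r}|lborel. f z) + (LINT z:{r..}|lborel. f z)"
  unfolding far using r by (intro set_integral_Un g' f) auto
 also have "... = (LINT z:{r..}|lborel. f z + f (- z))"
  unfolding g'(2) by (subst set_integral_add(2)[OF f g]) simp
 finally show "(LINT z:far r|lborel. f z) = (LINT z:{r..}|lborel. f z + f (- z))" .
qed

lemma inverse_square_far:
 assumes "r > (0::real)"
 shows "set_integrable lborel (far r) (%z. 1 / z^2)" and "(LINT z:far r|lborel. 1 / z^2) = 2 / r"
proof -
 note i = inverse_square_Ici[OF assms]
 show "set_integrable lborel (far r) (%z. 1 / z^2)"
  by (rule far_split(1)[OF assms]) (use i in auto)
 have "(LINT z:far r|lborel. 1 / z^2) = (LINT z:{r..}|lborel. 1 / z^2 + 1 / z^2)"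
  by (subst far_split(2)[OF assms]) (use i in auto)
 also have "... = 2 / r"
  by (subst set_integral_add(2)[OF i(1) i(1)]) (simp add: i)
 finally show "(LINT z:far r|lborel. 1 / z^2) = 2 / r" .
qed

text \<open>The two integrals of \<open>HJ_H\<close>, with the slope \<open>p\<close> as a separate argument.\<close>

definition inn :: "real => (real => real) => real => real => real" where
 "inn r f x p = (LINT z:{-r<..<r}|lborel. (f (x + z) - f x - p * z) / z^2)"

definition outr :: "real => (real => real) => real => real" where
 "outr r f x = (LINT z:far r|lborel. (f (x + z) - f x) / z^2)"

lemma HJ_H_eq: "HJ_H rho phi u (t, x) = \<bar>pd_x phi (t, x)\<bar> *
  (inn rho (%y. phi (t, y)) x (pd_x phi (t, x)) + outr rho (%y. u (t, y)) x)"
 by (simp add: HJ_H_def inn_def outr_def)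

lemma far_integrable_bound:
 fixes f :: "real => real"
 assumes r: "r > 0" and [measurable]: "f : borel_measurable borel" and B: "!!z. r <= \<bar>z\<bar> ==> \<bar>f z\<bar> <= B"
 shows "set_integrable lborel (far r) (%z. f z / z^2)"
  and "\<bar>LINT z:far r|lborel. f z / z^2\<bar> <= 2 * B / r"
proof -
 have bi: "set_integrable lborel (far r) (%z. B / z^2)"
  using set_integrable_mult_right[OF inverse_square_far(1)[OF r], of B] by simp
 show 1: "set_integrable lborel (far r) (%z. f z / z^2)"
  using B by (intro set_integrable_bound[OF bi])
   (auto simp: set_borel_measurable_def abs_mult divide_right_mono intro!: AE_I2 divide_right_mono order_trans[OF _ abs_ge_self])
 have "\<bar>LINT z:far r|lborel. f z / z^2\<bar> <= (LINT z:far r|lborel. \<bar>f z / z^2\<bar>)"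
  using set_integral_norm_bound[OF 1] by simp
 also have "... <= (LINT z:far r|lborel. B / z^2)"
  by (intro set_integral_mono bi) (use set_integrable_abs[OF 1] B in \<open>auto intro!: divide_right_mono\<close>)
 also have "... = B * (LINT z:far r|lborel. 1 / z^2)"
  by (subst set_integral_mult_right[symmetric]) simp
 also have "... = 2 * B / r" by (simp add: inverse_square_far[OF r])
 finally show "\<bar>LINT z:far r|lborel. f z / z^2\<bar> <= 2 * B / r" .
qed

lemma outr_integrable:
 assumes "r > 0" "f : borel_measurable borel" "!!x. \<bar>f x\<bar> <= B"
 shows "set_integrable lborel (far r) (%z. (f (x + z) - f x) / z^2)"
proof -
 have [measurable]: "f : borel_measurable borel" by fact
 have "\<bar>f (x + z) - f x\<bar> <= 2 * B" for z using assms(3)[of "x+z"] assms(3)[of x] by linarith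
 then show ?thesis
  using far_integrable_bound(1)[OF assms(1), of "%z. f (x + z) - f x" "2 * B"] by simp
qed

lemma outr_bound:
 assumes "r > 0" "f : borel_measurable borel" "!!x. \<bar>f x\<bar> <= B"
 shows "\<bar>outr r f x\<bar> <= 4 * B / r"
proof -
 have [measurable]: "f : borel_measurable borel" by fact
 have "\<bar>f (x + z) - f x\<bar> <= 2 * B" for z using assms(3)[of "x+z"] assms(3)[of x] by linarith
 then show ?thesis
  unfolding outr_def using far_integrable_bound(2)[OF assms(1), of "%z. f (x + z) - f x" "2 * B"] by simp
qed

lemma outr_mono:
 assumes r: "r > 0" and f: "f : borel_measurable borel" "!!x. \<bar>f x\<bar> <= B"
  and g: "g : borel_measurable borel" "!!x. \<bar>g x\<bar> <= B'"
  and le: "!!z. r <= \<bar>z\<bar> ==> f (x + z) - f x <= g (y + z) - g y"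
 shows "outr r f x <= outr r g y"
 unfolding outr_def
 by (intro set_integral_mono outr_integrable[OF r f] outr_integrable[OF r g]) (auto intro!: divide_right_mono le)

lemma quad_integrable:
 fixes f :: "real => real"
 assumes r: "r > 0" and [measurable]: "f : borel_measurable borel" and K: "!!z. \<bar>z\<bar> < r ==> \<bar>f z\<bar> <= K * z^2" 
 shows "set_integrable lborel {-r<..<r} (%z. f z / z^2)"
  and "\<bar>LINT z:{-r<..<r}|lborel. f z / z^2\<bar> <= 2 * K * r"
proof -
 have "0 <= K * (r/2)^2" using r by (intro order_trans[OF abs_ge_zero K]) auto
 then have K0: "0 <= K" using r by (simp add: zero_le_mult_iff)
 have bd: "\<bar>f z / z^2\<bar> <= K" if "\<bar>z\<bar> < r" for z
  using K[OF that] K0 by (cases "z = 0") (auto simp: field_simps)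
 have ki: "set_integrable lborel {-r<..<r} (%z. K)"
  unfolding set_integrable_def using r by (auto intro!: integrable_mult_left integrable_real_indicator simp: emeasure_lborel_Ioo)
 show 1: "set_integrable lborel {-r<..<r} (%z. f z / z^2)"
  using bd K0 by (intro set_integrable_bound[OF ki]) (auto simp: set_borel_measurable_def abs_less_iff intro!: AE_I2)
 have "\<bar>LINT z:{-r<..<r}|lborel. f z / z^2\<bar> <= (LINT z:{-r<..<r}|lborel. \<bar>f z / z^2\<bar>)"
  using set_integral_norm_bound[OF 1] by simp
 also have "... <= (LINT z:{-r<..<r}|lborel. K)"
  by (intro set_integral_mono ki) (use set_integrable_abs[OF 1] bd in \<open>auto simp: abs_less_iff\<close>)
 also have "... = 2 * K * r" using r by (simp add: set_lebesgue_integral_def)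
 finally show "\<bar>LINT z:{-r<..<r}|lborel. f z / z^2\<bar> <= 2 * K * r" .
qed

lemma inn_integrable:
 fixes f :: "real => real"
 assumes "r > 0" "f : borel_measurable borel" "!!z. \<bar>z\<bar> < r ==> \<bar>f (x + z) - f x - p * z\<bar> <= K * z^2"
 shows "set_integrable lborel {-r<..<r} (%z. (f (x + z) - f x - p * z) / z^2)"
proof -
 have [measurable]: "f : borel_measurable borel" by fact
 have "(%z. f (x + z) - f x - p * z) : borel_measurable borel" by measurable
 from quad_integrable(1)[OF assms(1) this assms(3)] show ?thesis by simp
qed

lemma inn_bound:
 assumes "r > 0" "f : borel_measurable borel" "!!z. \<bar>z\<bar> < r ==> \<bar>f (x + z) - f x - p * z\<bar> <= K * z^2"
 shows "\<bar>inn r f x p\<bar> <= 2 * K * r"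
proof -
 have [measurable]: "f : borel_measurable borel" by fact
 have "(%z. f (x + z) - f x - p * z) : borel_measurable borel" by measurable
 from quad_integrable(2)[OF assms(1) this assms(3)] show ?thesis by (simp add: inn_def)
qed

lemma inn_mono:
 assumes "r > 0" "f : borel_measurable borel" "!!z. \<bar>z\<bar> < r ==> \<bar>f (x + z) - f x - p * z\<bar> <= K * z^2"
  and "g : borel_measurable borel" "!!z. \<bar>z\<bar> < r ==> \<bar>g (y + z) - g y - q * z\<bar> <= K' * z^2"
  and le: "!!z. \<bar>z\<bar> < r ==> f (x + z) - f x - p * z <= g (y + z) - g y - q * z"
 shows "inn r f x p <= inn r g y q"
 unfolding inn_def
 by (intro set_integral_mono inn_integrable[OF assms(1-3)] inn_integrable[OF assms(1,4,5)])
   (auto intro!: divide_right_mono le)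

section \<open>Second order bounds and limits of the near integral\<close>

text \<open>The mean value inequality is applied to \<open>f'\<close> and then to \<open>f\<close>
  minus its tangent. Compared with Taylor's formula this loses a factor 1/2, hence \<open>K\<close>
  and not \<open>K / 2\<close>.\<close>

lemma second_order_bound:
 fixes f :: "real => real"
 assumes f: "!!y. \<bar>y - x\<bar> <= R ==> (f has_real_derivative f' y) (at y)"
  and f': "!!y. \<bar>y - x\<bar> <= R ==> (f' has_real_derivative f'' y) (at y)"
  and K: "!!y. \<bar>y - x\<bar> <= R ==> \<bar>f'' y\<bar> <= K" and z: "\<bar>z\<bar> <= R"
 shows "\<bar>f (x + z) - f x - f' x * z\<bar> <= K * z^2"
proof -
 have K0: "K >= 0" using K[of x] z by (auto intro: order_trans[OF abs_ge_zero])
 have *: "\<bar>f' y - f' x\<bar> <= K * \<bar>z\<bar>" if "\<bar>y - x\<bar> <= \<bar>z\<bar>" for y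
 proof -
  have "norm (f' y - f' x) <= K * norm (y - x)"
  proof (rule field_differentiable_bound[where S = "{x - \<bar>z\<bar>..x + \<bar>z\<bar>}" and f' = f''])
   fix w assume "w : {x - \<bar>z\<bar>..x + \<bar>z\<bar>}"
   then have w: "\<bar>w - x\<bar> <= R" using z by auto
   show "(f' has_field_derivative f'' w) (at w within {x - \<bar>z\<bar>..x + \<bar>z\<bar>})"
    by (rule DERIV_subset[OF f'[OF w]]) auto
   show "norm (f'' w) <= K" using K[OF w] by simp
  qed (use that in auto)
  also have "... <= K * \<bar>z\<bar>" using that K0 by (auto intro!: mult_left_mono)
  finally show ?thesis by simp
 qed
 have "norm ((%y. f y - f' x * y) (x + z) - (%y. f y - f' x * y) x) <= (K * \<bar>z\<bar>) * norm (x + z - x)"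
 proof (rule field_differentiable_bound[where S = "{x - \<bar>z\<bar>..x + \<bar>z\<bar>}" and f' = "%y. f' y - f' x"])
  fix y assume "y : {x - \<bar>z\<bar>..x + \<bar>z\<bar>}"
  then have y: "\<bar>y - x\<bar> <= \<bar>z\<bar>" by auto
  show "((%y. f y - f' x * y) has_field_derivative f' y - f' x) (at y within {x - \<bar>z\<bar>..x + \<bar>z\<bar>})"
   using y z by (auto intro!: derivative_eq_intros DERIV_subset[OF f])
  show "norm (f' y - f' x) <= K * \<bar>z\<bar>" using *[OF y] by simp
 qed auto
 then show ?thesis by (simp add: algebra_simps power2_eq_square)
qed

text \<open>\<open>C1_on_dom\<close> only asks for partial derivatives and their continuity. Joint
  continuity follows from continuity in time on the line \<open>x = x0\<close> and the mean value
  inequality in space, with \<open>pd_x f\<close> bounded on a compact box.\<close>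

lemma C1_on_dom_imp_continuous:
 assumes "C1_on_dom f" shows "continuous_on HJ_dom f"
proof -
 have "isCont f (t0, x0)" if t0: "t0 > 0" for t0 x0
 proof -
  define K where "K = {t0/2..2*t0} \<times> {x0-1..x0+1}"
  have KH: "K \<subseteq> HJ_dom" using t0 by (auto simp: K_def HJ_dom_def)
  have "compact K" by (auto simp: K_def intro!: compact_Times)
  then have "bounded (pd_x f ` K)"
   using C1_on_domD(4)[OF assms] KH by (meson compact_continuous_image compact_imp_bounded continuous_on_subset)
  then obtain B where B: "!!p. p : K ==> \<bar>pd_x f p\<bar> <= B"
   unfolding bounded_iff by auto
  have "((%p. \<bar>f (fst p, x0) - f (t0, x0)\<bar> + B * \<bar>snd p - x0\<bar>) \<longlongrightarrow> \<bar>f (t0, x0) - f (t0, x0)\<bar> + B * \<bar>x0 - x0\<bar>) (nhds (t0, x0))"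
  proof (intro tendsto_intros)
   have "isCont (%s. f (s, x0)) t0" using C1_on_domD(1)[OF assms t0] DERIV_isCont by blast
   moreover have "(fst \<longlongrightarrow> t0) (nhds (t0, x0))" using tendsto_fst[OF tendsto_ident_at] by (simp add: nhds_prod filterlim_fst)
   ultimately show "((%p. f (fst p, x0)) \<longlongrightarrow> f (t0, x0)) (nhds (t0, x0))"
    by (rule isCont_tendsto_compose)
   show "(snd \<longlongrightarrow> x0) (nhds (t0, x0))" by (simp add: nhds_prod filterlim_snd)
  qed
  then have z: "((%p. \<bar>f (fst p, x0) - f (t0, x0)\<bar> + B * \<bar>snd p - x0\<bar>) \<longlongrightarrow> 0) (at (t0, x0))"
   by (auto elim: tendsto_mono[rotated] simp: at_within_le_nhds)
  have "eventually (%p. p : {t0/2<..<2*t0} \<times> {x0-1<..<x0+1}) (nhds (t0, x0))"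
   using t0 by (intro eventually_nhds_in_open open_Times) auto
  then have "eventually (%p. p : {t0/2<..<2*t0} \<times> {x0-1<..<x0+1}) (at (t0, x0))"
   by (auto simp: eventually_at_filter elim: eventually_mono)
  then have "eventually (%p. norm (f p - f (t0, x0)) <= \<bar>f (fst p, x0) - f (t0, x0)\<bar> + B * \<bar>snd p - x0\<bar>) (at (t0, x0))"
  proof (rule eventually_mono)
   fix p assume p: "p : {t0/2<..<2*t0} \<times> {x0-1<..<x0+1}"
   obtain t x where tx: "p = (t, x)" by (cases p)
   have t: "t > 0" using p t0 tx by auto
   have "norm (f (t, x) - f (t, x0)) <= B * norm (x - x0)"
    by (rule field_differentiable_bound[where S = "{x0-1..x0+1}" and f' = "%y. pd_x f (t, y)"])
      (use p tx in \<open>auto intro!: B DERIV_subset[OF C1_on_domD(2)[OF assms t]] simp: K_def\<close>)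
   then show "norm (f p - f (t0, x0)) <= \<bar>f (fst p, x0) - f (t0, x0)\<bar> + B * \<bar>snd p - x0\<bar>"
    using tx by simp
  qed
  then show ?thesis unfolding isCont_def using Lim_null_comparison[OF _ z] by (subst LIM_zero_iff[symmetric])
 qed
 then show ?thesis by (auto intro!: continuous_at_imp_continuous_on)
qed

text \<open>One constant serves all base points near \<open>(t0, x0)\<close>; it provides the
  dominating function when the base point of the near integral moves.\<close>

lemma C2_on_dom_x_bound:
 assumes f: "C2_on_dom f" and t0: "t0 > 0"
 obtains K where "!!t x z. \<bar>t - t0\<bar> <= t0/2 ==> \<bar>x - x0\<bar> <= 1 ==> \<bar>z\<bar> <= R ==>
   \<bar>f (t, x + z) - f (t, x) - pd_x f (t, x) * z\<bar> <= K * z^2"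
proof -
 have f1: "C1_on_dom f" "C1_on_dom (pd_x f)" using f by (auto simp: C2_on_dom_def)
 define Q where "Q = {t0/2..2*t0} \<times> {x0-1-R..x0+1+R}"
 have "Q \<subseteq> HJ_dom" "compact Q" using t0 by (auto simp: Q_def HJ_dom_def intro!: compact_Times)
 then have "bounded (pd_x (pd_x f) ` Q)"
  using C1_on_domD(4)[OF f1(2)] by (meson compact_continuous_image compact_imp_bounded continuous_on_subset)
 then obtain K where K: "!!p. p : Q ==> \<bar>pd_x (pd_x f) p\<bar> <= K"
  unfolding bounded_iff by auto
 show ?thesis
 proof (rule that[of K])
  fix t x z :: real assume *: "\<bar>t - t0\<bar> <= t0/2" "\<bar>x - x0\<bar> <= 1" "\<bar>z\<bar> <= R"
  have t: "t > 0" using * t0 by linarith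
  show "\<bar>f (t, x + z) - f (t, x) - pd_x f (t, x) * z\<bar> <= K * z^2"
  proof (rule second_order_bound[where R = R and f' = "%y. pd_x f (t, y)" and f'' = "%y. pd_x (pd_x f) (t, y)"])
   fix y assume y: "\<bar>y - x\<bar> <= R"
   show "((%y. f (t, y)) has_real_derivative pd_x f (t, y)) (at y)" by (rule C1_on_domD(2)[OF f1(1) t])
   show "((%y. pd_x f (t, y)) has_real_derivative pd_x (pd_x f) (t, y)) (at y)" by (rule C1_on_domD(2)[OF f1(2) t])
   have "t : {t0/2..2*t0}" using *(1) t0 unfolding abs_le_iff by auto
   then show "\<bar>pd_x (pd_x f) (t, y)\<bar> <= K" using y *(2) t0 by (intro K) (auto simp: Q_def)
  qed (use * in auto)
 qed
qed

lemma C1_on_dom_slice_measurable: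
 assumes "C1_on_dom f" "t > 0" shows "(%y. f (t, y)) : borel_measurable borel"
proof -
 have "continuous_on UNIV (%y. f (t, y))"
  by (rule continuous_on_compose2[OF C1_on_dom_imp_continuous[OF assms(1)], of _ "%y. (t, y)"])
    (use assms in \<open>auto intro!: continuous_intros\<close>)
 then show ?thesis by (rule borel_measurable_continuous_onI)
qed

lemma C1_on_dom_seq:
 assumes "C1_on_dom f" "t > 0" "s ----> t" "y ----> x"
 shows "(%k. f (s k, y k)) ----> f (t, x)"
proof -
 have "isCont f (t, x)"
  using C1_on_dom_imp_continuous[OF assms(1)] assms(2) open_HJ_dom by (simp add: continuous_on_eq_continuous_at)
 then show ?thesis by (rule isCont_tendsto_compose) (intro tendsto_intros assms)
qed

text \<open>Dominated convergence: the integrands are bounded by one \<open>K\<close> as soon as the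
  base points are close to \<open>(t, x)\<close>, hence the shift of the index by
  \<open>N\<close>.\<close>

lemma inn_tendsto:
 assumes f: "C2_on_dom f" and t: "t > 0" and r: "r > 0" and s: "s ----> t" and y: "y ----> x"
 shows "(%k. inn r (%w. f (s k, w)) (y k) (pd_x f (s k, y k))) ----> inn r (%w. f (t, w)) x (pd_x f (t, x))"
proof -
 have f1: "C1_on_dom f" "C1_on_dom (pd_x f)" using f by (auto simp: C2_on_dom_def)
 obtain K where K: "!!t' x' z. \<bar>t' - t\<bar> <= t/2 ==> \<bar>x' - x\<bar> <= 1 ==> \<bar>z\<bar> <= r ==>
   \<bar>f (t', x' + z) - f (t', x') - pd_x f (t', x') * z\<bar> <= K * z^2"
  using C2_on_dom_x_bound[OF f t] by metis
 have "eventually (%k. dist (s k) t < t/2) sequentially" using s t unfolding tendsto_iff by (metis half_gt_zero)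
 moreover have "eventually (%k. dist (y k) x < 1) sequentially" using y by (auto simp: tendsto_iff)
 ultimately have "eventually (%k. \<bar>s k - t\<bar> < t/2 & \<bar>y k - x\<bar> < 1) sequentially"
  by eventually_elim (auto simp: dist_real_def)
 then obtain N where N: "!!k. k >= N ==> \<bar>s k - t\<bar> < t/2 & \<bar>y k - x\<bar> < 1"
  by (auto simp: eventually_sequentially)
 have K0: "K >= 0" using K[of t x r] r t by (auto intro: order_trans[OF abs_ge_zero] simp: zero_le_mult_iff dest!: order_trans[OF abs_ge_zero])
 let ?g = "%k z. indicator {-r<..<r} z *\<^sub>R ((f (s (k+N), y (k+N) + z) - f (s (k+N), y (k+N)) - pd_x f (s (k+N), y (k+N)) * z) / z^2)"
 let ?h = "%z. indicator {-r<..<r} z *\<^sub>R ((f (t, x + z) - f (t, x) - pd_x f (t, x) * z) / z^2)"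
 have pos: "s (k+N) > 0" for k using N[of "k+N"] t by linarith
 have s': "(%k. s (k+N)) ----> t" and y': "(%k. y (k+N)) ----> x"
  using s y by (auto intro: LIMSEQ_ignore_initial_segment)
 have "(%k. integral\<^sup>L lborel (?g k)) ----> integral\<^sup>L lborel ?h"
 proof (rule integral_dominated_convergence[where w = "%z. K * indicator {-r<..<r} z"])
  show "?h : borel_measurable lborel"
   using C1_on_dom_slice_measurable[OF f1(1) t] by measurable
  show "?g k : borel_measurable lborel" for k
   using C1_on_dom_slice_measurable[OF f1(1) pos[of k]] by measurable
  show "integrable lborel (%z. K * indicator {-r<..<r} z :: real)"
   using r by (auto intro!: integrable_mult_right integrable_real_indicator simp: emeasure_lborel_Ioo)
  show "AE z in lborel. (%k. ?g k z) ----> ?h z"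
  proof (rule AE_I2)
   fix z :: real
   have "(%k. f (s (k+N), y (k+N) + z) - f (s (k+N), y (k+N)) - pd_x f (s (k+N), y (k+N)) * z)
     ----> f (t, x + z) - f (t, x) - pd_x f (t, x) * z"
    by (intro tendsto_diff tendsto_mult tendsto_const C1_on_dom_seq[OF f1(1) t s'] C1_on_dom_seq[OF f1(2) t s']
      tendsto_add y')
   then show "(%k. ?g k z) ----> ?h z"
    unfolding divide_inverse by (intro tendsto_scaleR tendsto_mult tendsto_const)
  qed
  show "AE z in lborel. norm (?g k z) <= K * indicator {-r<..<r} z" for k
  proof (rule AE_I2)
   fix z :: real
   show "norm (?g k z) <= K * indicator {-r<..<r} z"
   proof (cases "z : {-r<..<r} & z ~= 0")
    case True
    then have "\<bar>f (s (k+N), y (k+N) + z) - f (s (k+N), y (k+N)) - pd_x f (s (k+N), y (k+N)) * z\<bar> <= K * z^2"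
     using N[of "k+N"] by (intro K) auto
    then show ?thesis using True by (auto simp: field_simps)
   qed (use K0 in \<open>auto split: split_indicator\<close>)
  qed
 qed
 then have "(%k. inn r (%w. f (s (k+N), w)) (y (k+N)) (pd_x f (s (k+N), y (k+N)))) ----> inn r (%w. f (t, w)) x (pd_x f (t, x))"
  by (simp add: inn_def set_lebesgue_integral_def)
 then show ?thesis by (rule LIMSEQ_offset)
qed

section \<open>Negation, envelopes and semicontinuity\<close>

lemma C2_on_dom_uminus:
 assumes "C2_on_dom f"
 shows "C2_on_dom (%p. - f p)"
  and "!!t x. t > 0 ==> pd_t (%p. - f p) (t, x) = - pd_t f (t, x)"
  and "!!t x. t > 0 ==> pd_x (%p. - f p) (t, x) = - pd_x f (t, x)"
proof -
 have f1: "C1_on_dom f" using assms by (simp add: C2_on_dom_def)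
 show "C2_on_dom (%p. - f p)" using C2_on_dom_lin[OF assms assms, of "-1" 0] by simp
 show "pd_t (%p. - f p) (t, x) = - pd_t f (t, x)" if "t > 0" for t x
  using C1_on_dom_lin(2)[OF f1 f1 that, of "-1" 0] by simp
 show "pd_x (%p. - f p) (t, x) = - pd_x f (t, x)" if "t > 0" for t x
  using C1_on_dom_lin(3)[OF f1 f1 that, of "-1" 0] by simp
qed

lemma outr_uminus: "outr r (%y. - f y) x = - outr r f x"
proof -
 have "(%z. indicator (far r) z *\<^sub>R ((- f (x + z) - - f x) / z^2)) =
   (%z. - (indicator (far r) z *\<^sub>R ((f (x + z) - f x) / z^2)))"
  by (auto simp: fun_eq_iff diff_divide_distrib split: split_indicator)
 then show ?thesis unfolding outr_def set_lebesgue_integral_def by (simp only: integral_minus)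
qed

lemma inn_uminus: "inn r (%y. - f y) x (- p) = - inn r f x p"
proof -
 have "(%z. indicator {-r<..<r} z *\<^sub>R ((- f (x + z) - - f x - - p * z) / z^2)) =
   (%z. - (indicator {-r<..<r} z *\<^sub>R ((f (x + z) - f x - p * z) / z^2)))"
  by (auto simp: fun_eq_iff diff_divide_distrib add_divide_distrib split: split_indicator)
 then show ?thesis unfolding inn_def set_lebesgue_integral_def by (simp only: integral_minus)
qed

lemma HJ_H_uminus:
 assumes "C2_on_dom f" "t > 0"
 shows "HJ_H rho (%p. - f p) (%p. - u p) (t, x) = - HJ_H rho f u (t, x)"
 using C2_on_dom_uminus(3)[OF assms] outr_uminus[of rho "%y. u (t, y)"] inn_uminus[of rho "%y. f (t, y)"]
 by (simp add: HJ_H_eq) (simp add: algebra_simps)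

text \<open>\<open>HJ_H\<close> is odd in the pair of test function and solution, because the slope
  enters as a factor only through its absolute value, and the quartics of the definitions have
  coefficients of either sign. So negation exchanges the two notions.\<close>

lemma supersolution_iff: "HJ_supersolution rho v \<longleftrightarrow> HJ_subsolution rho (%p. - v p)"
proof -
 define quart where "quart phi x \<longleftrightarrow> (\<exists>c g. \<forall>(s, y)\<in>HJ_dom. phi (s, y) = c * \<bar>y - x\<bar> ^ 4 + g s)" for phi :: "real \<times> real => real" and x
 define sup where "sup phi t x \<longleftrightarrow> C2_on_dom phi & (t, x) : HJ_dom & (\<forall>p\<in>HJ_dom. v p - phi p >= v (t, x) - phi (t, x)) -->
  (pd_x phi (t, x) ~= 0 --> pd_t phi (t, x) >= HJ_H rho phi v (t, x)) & (quart phi x --> pd_t phi (t, x) >= 0)" for phi t x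
 define sub where "sub phi t x \<longleftrightarrow> C2_on_dom phi & (t, x) : HJ_dom & (\<forall>p\<in>HJ_dom. - v p - phi p <= - v (t, x) - phi (t, x)) -->
  (pd_x phi (t, x) ~= 0 --> pd_t phi (t, x) <= HJ_H rho phi (%p. - v p) (t, x)) & (quart phi x --> pd_t phi (t, x) <= 0)" for phi t x
 have q: "quart (%p. - phi p) x" if h: "quart phi x" for phi x
 proof -
  obtain c g where "\<forall>(s, y)\<in>HJ_dom. phi (s, y) = c * \<bar>y - x\<bar> ^ 4 + g s" using h unfolding quart_def by (elim exE) (rule that)
  then have "\<forall>(s, y)\<in>HJ_dom. - phi (s, y) = (- c) * \<bar>y - x\<bar> ^ 4 + (%s. - g s) s" by auto
  then show ?thesis unfolding quart_def by (intro exI[of _ "- c"] exI[of _ "%s. - g s"])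
 qed
 have quart: "quart (%p. - phi p) x = quart phi x" for phi x using q[of phi x] q[of "%p. - phi p" x] by auto
 have le: "- v p - - a <= - v p' - - a' \<longleftrightarrow> v p - a >= v p' - a'" for p p' a a' by linarith
 have eq: "sub (%p. - phi p) t x = sup phi t x" for phi t x
 proof (cases "C2_on_dom phi & t > 0")
  case True
  then show ?thesis unfolding sub_def sup_def quart le
   using C2_on_dom_uminus[of phi] HJ_H_uminus[of phi t rho v x] by simp
 next
  case False
  have "C2_on_dom phi" if "C2_on_dom (%p. - phi p)" using C2_on_dom_uminus(1)[OF that] by simp
  then show ?thesis using False unfolding sub_def sup_def by auto
 qed
 have "(\<forall>phi t x. sup phi t x) \<longleftrightarrow> (\<forall>phi t x. sub phi t x)"
 proof
  assume "\<forall>phi t x. sup phi t x"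
  then have "sub (%p. - (- phi p)) t x" for phi t x unfolding eq by blast
  then show "\<forall>phi t x. sub phi t x" by simp
 qed (simp add: eq[symmetric])
 moreover have "bounded ((%p. - v p) ` HJ_dom) = bounded (v ` HJ_dom)" by (auto simp: bounded_iff)
 moreover have "usc_on_dom (%p. - v p) = lsc_on_dom v"
 proof -
  have s: "{p : HJ_dom. a < v p} = {p : HJ_dom. - v p < - a}" for a by auto
  show ?thesis unfolding usc_on_dom_def lsc_on_dom_def s by (metis minus_minus)
 qed
 ultimately show ?thesis
  unfolding HJ_supersolution_def HJ_subsolution_def sup_def sub_def quart_def by (simp only:)
qed

text \<open>\<open>Inf\<close> on the reals is by definition the negated \<open>Sup\<close> of the
  negated set. Lower envelopes are handled through this equation.\<close>

lemma lsc_env_eq: "lsc_env u p = - usc_env (%q. - u q) p"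
 by (simp add: lsc_env_def usc_env_def Inf_real_def image_image)

section \<open>Semicontinuous envelopes on the closed half plane\<close>

definition HJ_cl :: "(real \<times> real) set" where "HJ_cl = {0..} \<times> UNIV"

lemma mem_HJ_cl [simp]: "(t, x) : HJ_cl \<longleftrightarrow> t >= 0"
 by (auto simp: HJ_cl_def)

lemma HJ_dom_ball_nonempty:
 assumes "p : HJ_cl" "r > 0" shows "HJ_dom \<inter> ball p r ~= {}"
proof -
 obtain t x where p: "p = (t, x)" by (cases p)
 have "(t + r/2, x) : HJ_dom \<inter> ball p r"
  using assms by (auto simp: p dist_Pair_Pair dist_real_def)
 then show ?thesis by blast
qed

context
 fixes u :: "real \<times> real => real" and M :: real
 assumes M: "!!p. p : HJ_dom ==> \<bar>u p\<bar> <= M"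
begin

private lemma bdds: "bdd_above (u ` (HJ_dom \<inter> A))" "p : HJ_dom \<inter> A ==> u p <= (SUP q\<in>HJ_dom \<inter> A. u q)"
proof -
 show *: "bdd_above (u ` (HJ_dom \<inter> A))" using M by (intro bdd_aboveI[of _ M]) (auto simp: abs_le_iff)
 show "p : HJ_dom \<inter> A ==> u p <= (SUP q\<in>HJ_dom \<inter> A. u q)" by (rule cSUP_upper[OF _ *])
qed

private lemma bddb:
 assumes "p : HJ_cl" shows "bdd_below ((%r. SUP q\<in>HJ_dom \<inter> ball p r. u q) ` {0<..})"
  and "r > 0 ==> - M <= (SUP q\<in>HJ_dom \<inter> ball p r. u q)"
proof -
 have *: "- M <= (SUP q\<in>HJ_dom \<inter> ball p r. u q)" if "r > 0" for r
 proof -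
  obtain q where q: "q : HJ_dom \<inter> ball p r" using HJ_dom_ball_nonempty[OF assms \<open>r > 0\<close>] by blast
  have "- M <= u q" using M[of q] q by auto
  also have "... <= (SUP q\<in>HJ_dom \<inter> ball p r. u q)" by (rule bdds(2)[OF q])
  finally show ?thesis .
 qed
 then show "bdd_below ((%r. SUP q\<in>HJ_dom \<inter> ball p r. u q) ` {0<..})" by (intro bdd_belowI[of _ "-M"]) auto
 show "r > 0 ==> - M <= (SUP q\<in>HJ_dom \<inter> ball p r. u q)" using * .
qed

lemma usc_env_lessD:
 assumes "p : HJ_cl" "usc_env u p < a"
 obtains r where "r > 0" "!!q. q : HJ_dom ==> dist p q < r ==> u q < a"
proof -
 obtain r where r: "r > 0" "(SUP q\<in>HJ_dom \<inter> ball p r. u q) < a"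
  using assms(2) unfolding usc_env_def by (subst (asm) cINF_less_iff) (auto intro: bddb assms)
 show ?thesis
  by (rule that[OF r(1)]) (use bdds(2)[of _ "ball p r"] r(2) in force)
qed

lemma usc_env_leI:
 assumes "p : HJ_cl" "r > 0" "!!q. q : HJ_dom ==> dist p q < r ==> u q <= a"
 shows "usc_env u p <= a"
proof -
 have "usc_env u p <= (SUP q\<in>HJ_dom \<inter> ball p r. u q)"
  unfolding usc_env_def by (rule cINF_lower) (use assms bddb in auto)
 also have "... <= a"
  using HJ_dom_ball_nonempty[OF assms(1,2)] assms(3) by (intro cSUP_least) auto
 finally show ?thesis .
qed

lemma usc_env_bound: assumes "p : HJ_cl" shows "\<bar>usc_env u p\<bar> <= M"
proof -
 have "usc_env u p <= M" using M by (intro usc_env_leI[OF assms zero_less_one]) (auto simp: abs_le_iff)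
 moreover have "- M <= usc_env u p"
  unfolding usc_env_def by (intro cINF_greatest) (auto intro: bddb assms)
 ultimately show ?thesis by (simp add: abs_le_iff)
qed

lemma usc_env_ge: assumes "p : HJ_dom" shows "u p <= usc_env u p"
 unfolding usc_env_def using assms by (intro cINF_greatest bdds) auto

lemma usc_env_usc:
 assumes "p : HJ_cl" "usc_env u p < a"
 obtains r where "r > 0" "!!q. q : HJ_cl ==> dist p q < r ==> usc_env u q < a"
proof -
 obtain b where b: "usc_env u p < b" "b < a" using assms(2) dense by blast
 obtain r where r: "r > 0" "!!q. q : HJ_dom ==> dist p q < r ==> u q < b"
  using usc_env_lessD[OF assms(1) b(1)] by blast
 show ?thesis
 proof (rule that[of "r/2"])
  fix q assume q: "q : HJ_cl" "dist p q < r/2"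
  have "usc_env u q <= b"
  proof (rule usc_env_leI[OF q(1), of "r/2"])
   fix q' assume "q' : HJ_dom" "dist q q' < r/2"
   moreover have "dist p q' <= dist p q + dist q q'" by (rule dist_triangle)
   ultimately show "u q' <= b" using q r(2)[of q'] by fastforce
  qed (use r in auto)
  then show "usc_env u q < a" using b by simp
 qed (use r in auto)
qed

text \<open>The points \<open>q k\<close> stay in \<open>HJ_dom\<close> even if \<open>p\<close>
  lies on the initial line, so the envelope at time 0 is realised from positive times.\<close>

lemma usc_env_seq:
 assumes "p : HJ_cl"
 obtains q where "!!k::nat. q k : HJ_dom" "q ----> p" "(%k. u (q k)) ----> usc_env u p"
proof -
 have "\<exists>q\<in>HJ_dom. dist p q < 1 / Suc k & u q > usc_env u p - 1 / Suc k" for k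
 proof (rule ccontr)
  assume "~ ?thesis"
  then have "usc_env u p <= usc_env u p - 1 / Suc k"
   by (intro usc_env_leI[OF assms, of "1 / Suc k"]) force+
  then show False by simp
 qed
 then obtain q where q: "!!k::nat. q k : HJ_dom" "!!k. dist p (q k) < 1 / Suc k" "!!k. u (q k) > usc_env u p - 1 / Suc k"
  by metis
 have z: "(%k. 1 / real (Suc k)) ----> 0" using LIMSEQ_inverse_real_of_nat by (simp add: inverse_eq_divide)
 have qp: "q ----> p"
  unfolding tendsto_dist_iff[of q]
  by (rule tendsto_sandwich[OF _ _ tendsto_const z]) (auto intro!: always_eventually less_imp_le[OF q(2), simplified dist_commute[of p]] simp del: of_nat_Suc)
 moreover have "(%k. u (q k)) ----> usc_env u p"
 proof (rule order_tendstoI)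
  fix a assume "a < usc_env u p"
  then have "(%k. usc_env u p - 1 / Suc k) ----> usc_env u p - 0 & a < usc_env u p - 0"
   by (intro conjI tendsto_intros z) auto
  then have "eventually (%k. a < usc_env u p - 1 / Suc k) sequentially" using order_tendstoD(1) by blast
  then show "eventually (%k. a < u (q k)) sequentially"
   by eventually_elim (use q(3) less_trans in blast)
 next
  fix a assume "usc_env u p < a"
  then obtain r where r: "r > 0" "!!q. q : HJ_dom ==> dist p q < r ==> u q < a"
   using usc_env_lessD[OF assms] by blast
  have "eventually (%k. dist (q k) p < r) sequentially" using qp r(1) by (simp add: tendsto_iff)
  then show "eventually (%k. u (q k) < a) sequentially"
   by eventually_elim (use r q(1) in \<open>auto simp: dist_commute\<close>)
 qed
 ultimately show ?thesis using that[of q] q(1) by blast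
qed

end

text \<open>Relative to an arbitrary set, since semicontinuity is needed not only on
  \<open>HJ_dom\<close> but also on \<open>HJ_cl\<close>, on products of a time interval with the
  line, and on compact sets of pairs of points.\<close>

definition usc_seq :: "'a::metric_space set => ('a => real) => bool" where
 "usc_seq X f \<longleftrightarrow> (\<forall>p\<in>X. \<forall>q a. (\<forall>k. q k : X) & q ----> p & f p < a --> eventually (%k. f (q k) < a) sequentially)"

lemma usc_seqD: "usc_seq X f ==> p : X ==> (!!k. q k : X) ==> q ----> p ==> f p < a ==> eventually (%k. f (q k) < a) sequentially"
 by (auto simp: usc_seq_def)

lemma usc_on_dom_imp_seq: assumes "usc_on_dom u" shows "usc_seq HJ_dom u"
 unfolding usc_seq_def
proof (intro ballI allI impI; elim conjE)
 fix p q a assume p: "p : HJ_dom" "\<forall>k. q k : HJ_dom" "q ----> p" "u p < a"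
 obtain U where U: "open U" "{p : HJ_dom. u p < a} = HJ_dom \<inter> U"
  using assms by (auto simp: usc_on_dom_def openin_open)
 have "p : U" using U p by auto
 then have "eventually (%k. q k : U) sequentially" using p(3) U(1) topological_tendstoD by blast
 then show "eventually (%k. u (q k) < a) sequentially"
  by eventually_elim (use U p in auto)
qed

lemma usc_on_domI:
 assumes "!!p a. p : HJ_dom ==> u p < a ==> \<exists>r>0. \<forall>q\<in>HJ_dom. dist p q < r --> u q < a"
 shows "usc_on_dom u"
 unfolding usc_on_dom_def
proof (intro allI)
 fix a
 have "open {p : HJ_dom. u p < a}"
  unfolding open_contains_ball
 proof safe
  fix t x :: real assume p: "(t, x) : HJ_dom" "u (t, x) < a"
  obtain r where "r > 0" "\<forall>q\<in>HJ_dom. dist (t, x) q < r --> u q < a" using assms[OF p] by blast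
  moreover obtain r' where "r' > 0" "ball (t, x) r' \<subseteq> HJ_dom"
   using open_HJ_dom[unfolded open_contains_ball] p(1) by blast
  ultimately show "\<exists>e>0. ball (t, x) e \<subseteq> {p : HJ_dom. u p < a}"
   by (intro exI[of _ "min r r'"]) (auto simp: subset_eq)
 qed
 then show "openin (top_of_set HJ_dom) {p : HJ_dom. u p < a}"
  using open_HJ_dom by (simp add: openin_open_eq)
qed

lemma usc_env_seq_usc:
 assumes M: "!!p. p : HJ_dom ==> \<bar>u p\<bar> <= M"
 shows "usc_seq HJ_cl (usc_env u)" and "usc_on_dom (usc_env u)"
proof -
 have cl: "p : HJ_dom ==> p : HJ_cl" for p by (cases p) auto
 show "usc_seq HJ_cl (usc_env u)"
  unfolding usc_seq_def
 proof (intro ballI allI impI; elim conjE)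
  fix p q a assume p: "p : HJ_cl" "\<forall>k. q k : HJ_cl" "q ----> p" "usc_env u p < a"
  obtain r where r: "r > 0" "!!q. q : HJ_cl ==> dist p q < r ==> usc_env u q < a"
   using usc_env_usc[OF M p(1,4)] by blast
  have "eventually (%k. dist (q k) p < r) sequentially" using p(3) r(1) by (simp add: tendsto_iff)
  then show "eventually (%k. usc_env u (q k) < a) sequentially"
   by eventually_elim (use r p in \<open>auto simp: dist_commute\<close>)
 qed
 show "usc_on_dom (usc_env u)"
 proof (rule usc_on_domI)
  fix p a assume p: "p : HJ_dom" "usc_env u p < a"
  obtain r where "r > 0" "!!q. q : HJ_cl ==> dist p q < r ==> usc_env u q < a"
   using usc_env_usc[OF M cl[OF p(1)] p(2)] by blast
  then show "\<exists>r>0. \<forall>q\<in>HJ_dom. dist p q < r --> usc_env u q < a" using cl by blast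
 qed
qed

lemma usc_env_eq:
 assumes M: "!!p. p : HJ_dom ==> \<bar>u p\<bar> <= M" and u: "usc_on_dom u" and p: "p : HJ_dom"
 shows "usc_env u p = u p"
proof (rule antisym)
 show "u p <= usc_env u p" by (rule usc_env_ge[OF M p])
 have cl: "p : HJ_cl" using p by (cases p) auto
 obtain q where q: "!!k::nat. q k : HJ_dom" "q ----> p" "(%k. u (q k)) ----> usc_env u p"
  using usc_env_seq[of u M, OF M cl] by blast
 show "usc_env u p <= u p"
 proof (rule ccontr)
  assume "~ usc_env u p <= u p"
  then obtain a where a: "u p < a" "a < usc_env u p" using dense by (meson not_le)
  have "eventually (%k. u (q k) < a) sequentially"
   by (rule usc_seqD[OF usc_on_dom_imp_seq[OF u] p q(1,2) a(1)])
  moreover have "eventually (%k. a < u (q k)) sequentially" by (rule order_tendstoD(1)[OF q(3) a(2)])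
  ultimately have "eventually (%k. False) sequentially" by eventually_elim auto
  then show False by simp
 qed
qed

text \<open>Superlevel sets of a slice are closed. Measurability has to be secured because the
  integral of a function that is not integrable is 0 by default.\<close>

lemma usc_slice_measurable:
 assumes u: "usc_seq X u" and X: "!!y. (t, y) : X"
 shows "(%y::real. u (t, y)) : borel_measurable borel"
proof (rule borel_measurableI_less)
 fix a
 have "closed {y. a <= u (t, y)}"
  unfolding closed_sequential_limits
 proof (intro allI impI; elim conjE)
  fix q l assume q: "\<forall>k. q k : {y. a <= u (t, y)}" "q ----> l"
  show "l : {y. a <= u (t, y)}"
  proof (rule ccontr)
   assume "l \<notin> {y. a <= u (t, y)}"
   then have "eventually (%k. u (t, q k) < a) sequentially"
    using q by (intro usc_seqD[OF u X X]) (auto intro!: tendsto_intros)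
   then have "eventually (%k. False) sequentially" by eventually_elim (use q(1) in \<open>simp add: not_less[symmetric]\<close>)
   then show False by simp
  qed
 qed
 then have "open (- {y. a <= u (t, y)})" by (rule open_Compl)
 also have "- {y. a <= u (t, y)} = {y. u (t, y) < a}" by auto
 finally have "open {y. u (t, y) < a}" .
 then show "{y : space borel. u (t, y) < a} : sets borel" by simp
qed

section \<open>Smooth approximation of test functions\<close>

lemma C2fun_chain:
 assumes f: "C2fun UNIV f f'" and g: "C2fun UNIV g g'"
 shows "C2fun UNIV (%x. f (g x)) (%x. f' (g x) * g' x)"
proof -
 obtain f'' g'' where *: "!!t. (f has_real_derivative f' t) (at t)" "!!t. (f' has_real_derivative f'' t) (at t)"
  "continuous_on UNIV f''" "!!t. (g has_real_derivative g' t) (at t)" "!!t. (g' has_real_derivative g'' t) (at t)"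
  "continuous_on UNIV g''" using f g unfolding C2fun_def by auto
 have c: "continuous_on UNIV g" "continuous_on UNIV g'" "continuous_on UNIV f'"
  using C2fun_imp_cont[OF g] C2fun_imp_cont[OF f] by auto
 show ?thesis
  unfolding C2fun_def
 proof (intro exI[of _ "%x. f'' (g x) * g' x * g' x + f' (g x) * g'' x"] conjI ballI)
  fix t
  show "((%x. f (g x)) has_real_derivative f' (g t) * g' t) (at t)"
   by (rule DERIV_chain2[OF *(1,4)])
  have "((%x. f' (g x)) has_real_derivative f'' (g t) * g' t) (at t)"
   by (rule DERIV_chain2[OF *(2,4)])
  from DERIV_mult[OF this *(5)]
  show "((%x. f' (g x) * g' x) has_real_derivative f'' (g t) * g' t * g' t + f' (g t) * g'' t) (at t)"
   by (simp add: algebra_simps)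
  show "continuous_on UNIV (%x. f'' (g x) * g' x * g' x + f' (g x) * g'' x)"
   by (intro continuous_intros c continuous_on_compose2[OF *(3) c(1)] continuous_on_compose2[OF c(3) c(1)] *(6)) auto
 qed
qed

lemma DERIV_mult_abs: "((%w::real. w * \<bar>w\<bar>) has_real_derivative 2 * \<bar>x\<bar>) (at x)"
proof (cases "x = 0")
 case True
 have "\<exists>g. (\<forall>z. z * \<bar>z\<bar> - x * \<bar>x\<bar> = g z * (z - x)) & isCont g x & g x = 2 * \<bar>x\<bar>"
  using True by (intro exI[of _ abs]) (auto intro!: continuous_intros)
 then show ?thesis by (simp only: CARAT_DERIV)
next
 case False
 consider "x > 0" | "x < 0" using False by linarith
 then show ?thesis
 proof cases
  case 1
  have "((%w. w * w) has_real_derivative 2 * \<bar>x\<bar>) (at x)"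
   using 1 by (auto intro!: derivative_eq_intros)
  then show ?thesis
   by (rule has_field_derivative_transform_within_open[where S = "{0<..}"]) (use 1 in auto)
 next
  case 2
  have "((%w. - (w * w)) has_real_derivative 2 * \<bar>x\<bar>) (at x)"
   using 2 by (auto intro!: derivative_eq_intros)
  then show ?thesis
   by (rule has_field_derivative_transform_within_open[where S = "{..<0}"]) (use 2 in auto)
 qed
qed

text \<open>Writing the truncation with \<open>|w|\<close> puts both sides of 0 under one formula,
  so that the junction needs no separate treatment.\<close>

lemma C2fun_max0_cube: "C2fun UNIV (%w. (max 0 w) ^ 3) (%w. 3 * (max 0 w)^2)"
proof -
 have 1: "(max 0 w) ^ 3 = (w ^ 3 + w * (w * \<bar>w\<bar>)) / 2" for w :: real
  by (cases "w >= 0") (auto simp: power3_eq_cube)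
 have 2: "3 * (max 0 w)^2 = 3 * (w^2 + w * \<bar>w\<bar>) / 2" for w :: real
  by (cases "w >= 0") (auto simp: power2_eq_square)
 show ?thesis
  unfolding C2fun_def 1 2
 proof (intro exI[of _ "%w. 3 * (2 * w + 2 * \<bar>w\<bar>) / 2"] conjI ballI)
  fix x :: real
  have A: "((%w. w * (w * \<bar>w\<bar>)) has_real_derivative 3 * x * \<bar>x\<bar>) (at x)"
   by (rule DERIV_cong[OF DERIV_mult[OF DERIV_ident DERIV_mult_abs]]) simp
  have B: "((%w. w ^ 3) has_real_derivative 3 * x^2) (at x)" "((%w. w^2) has_real_derivative 2 * x) (at x)"
   by (auto intro!: derivative_eq_intros simp: power2_eq_square)
  show "((%w. (w ^ 3 + w * (w * \<bar>w\<bar>)) / 2) has_real_derivative 3 * (x^2 + x * \<bar>x\<bar>) / 2) (at x)"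
   by (rule DERIV_cong[OF DERIV_cdivide[OF DERIV_add[OF B(1) A]]]) (simp add: algebra_simps)
  show "((%w. 3 * (w^2 + w * \<bar>w\<bar>) / 2) has_real_derivative 3 * (2 * x + 2 * \<bar>x\<bar>) / 2) (at x)"
   by (rule DERIV_cong[OF DERIV_cdivide[OF DERIV_cmult[OF DERIV_add[OF B(2) DERIV_mult_abs]]]]) simp
  show "continuous_on UNIV (%w::real. 3 * (2 * w + 2 * \<bar>w\<bar>) / 2)"
   by (intro continuous_intros) auto
 qed
qed

text \<open>The cube makes the junction at \<open>|z| = r\<close> twice continuously differentiable.
  The deficit \<open>1 - cutoff r z\<close> is quadratic at 0 and so absorbs the kernel
  \<open>1 / z^2\<close>.\<close>

definition cutoff :: "real => real => real" where
 "cutoff r z = (max 0 (1 - z^2 / r^2)) ^ 3"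

lemma cutoff_simps:
 assumes "r > 0"
 shows "cutoff r 0 = 1" "0 <= cutoff r z" "cutoff r z <= 1" "cutoff r (- z) = cutoff r z"
  "r <= \<bar>z\<bar> ==> cutoff r z = 0" "1 - cutoff r z <= 3 * z^2 / r^2"
proof -
 show "cutoff r 0 = 1" "0 <= cutoff r z" "cutoff r (- z) = cutoff r z" by (auto simp: cutoff_def)
 show "cutoff r z <= 1" unfolding cutoff_def by (intro power_le_one) auto
 show "cutoff r z = 0" if "r <= \<bar>z\<bar>"
 proof -
  have "r^2 <= z^2" using power_mono[OF that, of 2] assms by simp
  then have "1 - z^2 / r^2 <= 0" using assms by (simp add: field_simps)
  then show ?thesis by (simp add: cutoff_def)
 qed
 have b: "1 - 3 * w <= (max 0 (1 - w)) ^ 3" if "w >= 0" for w :: real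
 proof (cases "w <= 1")
  case True
  have "(1 - w) ^ 3 - (1 - 3 * w) = w^2 * (3 - w)" by (simp add: power2_eq_square power3_eq_cube algebra_simps)
  moreover have "w^2 * (3 - w) >= 0" using True by (intro mult_nonneg_nonneg) auto
  moreover have "max 0 (1 - w) = 1 - w" using True by simp
  ultimately show ?thesis by linarith
 qed auto
 show "1 - cutoff r z <= 3 * z^2 / r^2"
  using b[of "z^2 / r^2"] by (simp add: cutoff_def)
qed

lemma C2fun_cutoff:
 assumes "r > 0"
 obtains d where "C2fun UNIV (%y. cutoff r (y - x)) d" "d x = 0"
proof -
 have "C2fun UNIV (%y. 1 + (- 1 / r^2) * (y - x)^2) (%y. 0 + (- 1 / r^2) * (2 * (y - x)))"
  by (intro C2fun_add C2fun_const C2fun_cmult C2fun_pow2)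
 note C = C2fun_chain[OF C2fun_max0_cube this]
 have eq: "(%y. cutoff r (y - x)) = (%y. (max 0 (1 + (- 1 / r^2) * (y - x)^2)) ^ 3)"
  by (auto simp: cutoff_def)
 show ?thesis by (rule that[unfolded eq, OF C]) simp
qed

text \<open>A second difference quotient of a second antiderivative (a twofold Steklov average) is \<open>C2\<close>.\<close>

lemma lipschitz_C2_approx:
 fixes f :: "real => real"
 assumes L: "!!x y. \<bar>f x - f y\<bar> <= L * \<bar>x - y\<bar>" and e: "e > 0"
 obtains q q' where "C2fun UNIV q q'" "!!x. f x <= q x" "!!x. q x <= f x + e"
proof -
 \<comment> \<open>\<open>q0\<close> will be a value of \<open>f\<close> at distance less than
   \<open>2 * h\<close>; this \<open>h\<close> keeps the resulting error below
   \<open>e / 2\<close>.\<close>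
 define h where "h = e / (4 * (\<bar>L\<bar> + 1))"
 have h: "h > 0" "2 * h * \<bar>L\<bar> <= e / 2" using e by (auto simp: h_def field_simps)
 have contf: "isCont f x" for x
 proof (rule continuous_at_sequentiallyI)
  fix s assume "s ----> x"
  then have "(%n. L * \<bar>s n - x\<bar>) ----> L * \<bar>x - x\<bar>" by (intro tendsto_intros)
  then show "(%n. f (s n)) ----> f x"
   using Lim_null_comparison[of "%n. f (s n) - f x" "%n. L * \<bar>s n - x\<bar>"] L LIM_zero_iff by fastforce
 qed
 have anti: "\<exists>G. \<forall>x. (G has_real_derivative g x) (at x)" if "!!x. isCont g x" for g :: "real => real"
  using einterval_antiderivative[of "-\<infinity>" "\<infinity>" g] that by (auto simp: has_real_derivative_iff_has_vector_derivative)
 obtain F where F: "!!x. (F has_real_derivative f x) (at x)" using anti[OF contf] by blast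
 obtain G where G: "!!x. (G has_real_derivative F x) (at x)" using anti[OF DERIV_isCont[OF F]] by blast
 define q0 where "q0 x = (G (x + 2 * h) - 2 * G (x + h) + G x) / h^2" for x
 define q1 where "q1 x = (F (x + 2 * h) - 2 * F (x + h) + F x) / h^2" for x
 have sh: "((%x. G (x + a)) has_real_derivative F (x + a)) (at x)" "((%x. F (x + a)) has_real_derivative f (x + a)) (at x)" for x a
  using G[of "x + a"] F[of "x + a"] unfolding DERIV_shift by auto
 have C2: "C2fun UNIV q0 q1"
  unfolding C2fun_def
 proof (intro exI[of _ "%x. (f (x + 2 * h) - 2 * f (x + h) + f x) / h^2"] conjI ballI)
  show "(q0 has_real_derivative q1 x) (at x)" for x
   unfolding q0_def q1_def
   using DERIV_cdivide[OF DERIV_add[OF DERIV_diff[OF sh(1) DERIV_cmult[OF sh(1)]] G]] by simp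
  show "(q1 has_real_derivative (f (x + 2 * h) - 2 * f (x + h) + f x) / h^2) (at x)" for x
   unfolding q1_def
   using DERIV_cdivide[OF DERIV_add[OF DERIV_diff[OF sh(2) DERIV_cmult[OF sh(2)]] F]] by simp
  have "continuous_on UNIV f" using contf by (simp add: continuous_at_imp_continuous_on)
  then have c: "continuous_on UNIV (%x. f (x + a))" for a
   by (rule continuous_on_compose2) (auto intro!: continuous_intros)
  show "continuous_on UNIV (%x. (f (x + 2 * h) - 2 * f (x + h) + f x) / h^2)"
   using h(1) by (intro continuous_on_divide continuous_on_add continuous_on_diff continuous_on_mult
     continuous_on_const c c[of 0, simplified]) auto
 qed
 \<comment> \<open>A second difference of \<open>G\<close> is a difference of increments over
   \<open>h\<close>. Two mean values give \<open>q0 x = f zeta\<close> for some \<open>zeta\<close>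
   between \<open>x\<close> and \<open>x + 2 * h\<close>.\<close>
 have close: "\<bar>q0 x - f x\<bar> <= e / 2" for x
 proof -
  have "\<exists>z>x. z < x + h & (G (x + h + h) - G (x + h)) - (G (x + h) - G x) = (x + h - x) * (F (z + h) - F z)"
   by (rule MVT2) (use h(1) DERIV_diff[OF sh(1) G] in auto)
  then obtain xi where xi: "x < xi" "xi < x + h"
   "(G (x + h + h) - G (x + h)) - (G (x + h) - G x) = (x + h - x) * (F (xi + h) - F xi)"
   by blast
  have "\<exists>z>xi. z < xi + h & F (xi + h) - F xi = (xi + h - xi) * f z"
   by (rule MVT2) (use h(1) F in auto)
  then obtain zeta where zeta: "xi < zeta" "zeta < xi + h" "F (xi + h) - F xi = (xi + h - xi) * f zeta"
   by blast
  have "q0 x = f zeta"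
   unfolding q0_def using xi(3) zeta(3) h(1) by (simp add: power2_eq_square field_simps)
  moreover have "\<bar>f zeta - f x\<bar> <= 2 * h * \<bar>L\<bar>"
  proof -
   have "\<bar>f zeta - f x\<bar> <= L * \<bar>zeta - x\<bar>" by (rule L)
   also have "... <= \<bar>L\<bar> * (2 * h)" using xi zeta by (intro mult_mono) auto
   finally show ?thesis by (simp add: mult_ac)
  qed
  ultimately show ?thesis using h(2) by linarith
 qed
 show ?thesis
 proof (rule that[OF C2fun_add[OF C2 C2fun_const[of _ "e/2"]]])
  show "f x <= q0 x + e / 2" "q0 x + e / 2 <= f x + e" for x using close[of x] unfolding abs_le_iff by linarith+
 qed
qed

text \<open>
 Outside a small ball, a test function may be replaced by these approximations of the subsolution
 itself; this makes the inequality with the fixed radius \<open>rho\<close> available for every smaller radius.\<close>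

lemma usc_upper_approx:
 assumes u: "usc_seq HJ_dom u" and M: "!!p. p : HJ_dom ==> \<bar>u p\<bar> <= M" and t: "t > 0"
 obtains q q' where "!!k. C2fun UNIV (q k) (q' k)" "!!k s y. s > 0 ==> u (s, y) <= q k y + real k * (s - t)^2"
  "!!k y. \<bar>q k y\<bar> <= M + 1" "!!y. (%k. q k y) ----> u (t, y)"
proof -
 \<comment> \<open>Sup-convolution. The penalty in space makes \<open>f k\<close> Lipschitz with
   constant \<open>k\<close>; the penalty in time is smooth and flat at \<open>t\<close>, so it can
   stay in the test function without changing its time derivative there.\<close>
 define f where "f k x = (SUP p\<in>HJ_dom. u p - real k * \<bar>x - snd p\<bar> - real k * (fst p - t)^2)" for k x
 have ne: "HJ_dom ~= {}" using t mem_HJ_dom[of t 0] by blast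
 have ub: "u p - real k * \<bar>x - snd p\<bar> - real k * (fst p - t)^2 <= M" if "p : HJ_dom" for p k x
 proof -
  have "real k * \<bar>x - snd p\<bar> >= 0" "real k * (fst p - t)^2 >= 0" by auto
  then show ?thesis using M[OF that] by linarith
 qed
 have bdd: "bdd_above ((%p. u p - real k * \<bar>x - snd p\<bar> - real k * (fst p - t)^2) ` HJ_dom)" for k x
  using ub by (intro bdd_aboveI[of _ M]) auto
 have up: "u p - real k * \<bar>x - snd p\<bar> - real k * (fst p - t)^2 <= f k x" if "p : HJ_dom" for p k x
  unfolding f_def by (rule cSUP_upper[OF that bdd])
 have ge: "u (s, x) <= f k x + real k * (s - t)^2" if "s > 0" for s k x
  using up[of "(s, x)" k x] that by simp
 have fb: "f k x <= M" "- M <= f k x" for k x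
 proof -
  show "f k x <= M" unfolding f_def by (rule cSUP_least[OF ne ub])
  show "- M <= f k x" using ge[OF t, of x k] M[of "(t, x)"] t by (auto simp: abs_le_iff)
 qed
 have lip1: "f k x <= f k y + real k * \<bar>x - y\<bar>" for k x y
 proof -
  have "u p - real k * \<bar>x - snd p\<bar> - real k * (fst p - t)^2 <= f k y + real k * \<bar>x - y\<bar>" if p: "p : HJ_dom" for p
  proof -
   have "real k * \<bar>y - snd p\<bar> <= real k * \<bar>x - snd p\<bar> + real k * \<bar>x - y\<bar>"
    unfolding distrib_left[symmetric] by (intro mult_left_mono) auto
   then show ?thesis using up[OF p, of k y] by linarith
  qed
  then show ?thesis by (subst f_def) (rule cSUP_least[OF ne])
 qed
 have lip: "\<bar>f k x - f k y\<bar> <= real k * \<bar>x - y\<bar>" for k x y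
  using lip1[of k x y] lip1[of k y x] by (auto simp: abs_le_iff abs_minus_commute)
 have conv: "(%k. f k x) ----> u (t, x)" for x
 proof (rule order_tendstoI)
  fix a assume "a < u (t, x)"
  then show "eventually (%k. a < f k x) sequentially"
   using ge[OF t, of x] by (intro always_eventually) (auto intro: less_le_trans)
 next
  fix a assume "u (t, x) < a"
  then obtain b where b: "u (t, x) < b" "b < a" using dense by blast
  have "\<exists>d>0. \<forall>p\<in>HJ_dom. dist p (t, x) < d --> u p < b"
  proof (rule ccontr)
   assume "~ ?thesis"
   then have "\<forall>k. \<exists>p\<in>HJ_dom. dist p (t, x) < 1 / Suc k & ~ u p < b" by (metis of_nat_0_less_iff zero_less_Suc zero_less_divide_1_iff)
   then obtain p where p: "!!k. p k : HJ_dom" "!!k. dist (p k) (t, x) < 1 / Suc k" "!!k. ~ u (p k) < b" by metis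
   have z: "(%k. 1 / real (Suc k)) ----> 0" using LIMSEQ_inverse_real_of_nat by (simp add: inverse_eq_divide)
   have "p ----> (t, x)"
    unfolding tendsto_dist_iff[of p]
    by (rule tendsto_sandwich[OF _ _ tendsto_const z]) (auto intro!: always_eventually less_imp_le[OF p(2)] simp del: of_nat_Suc)
   then have "eventually (%k. u (p k) < b) sequentially" using t p(1) b(1) by (intro usc_seqD[OF u]) auto
   then have "eventually (%k. False) sequentially" by eventually_elim (use p(3) in blast)
   then show False by simp
  qed
  then obtain d where d: "d > 0" "!!p. p : HJ_dom ==> dist p (t, x) < d ==> u p < b" by blast
  \<comment> \<open>Outside the \<open>d\<close>-ball one of the two coordinates is off by at least
    \<open>d / 2\<close>, so the penalty is at least \<open>k * e\<close> there.\<close>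
  define e where "e = min (d/2) ((d/2)^2)"
  have e: "e > 0" using d(1) by (simp add: e_def)
  obtain N where N: "real N > (M - b) / e" using reals_Archimedean2 by blast
  have "f k x <= b" if k: "k >= N" for k
   unfolding f_def
  proof (rule cSUP_least[OF ne])
   fix p assume p: "p : HJ_dom"
   have nn: "real k * \<bar>x - snd p\<bar> >= 0" "real k * (fst p - t)^2 >= 0" by auto
   show "u p - real k * \<bar>x - snd p\<bar> - real k * (fst p - t)^2 <= b"
   proof (cases "dist p (t, x) < d")
    case True
    then show ?thesis using d(2)[OF p] nn by linarith
   next
    case False
    have "d <= dist p (t, x)" using False by simp
    also have "... <= \<bar>fst p - t\<bar> + \<bar>snd p - x\<bar>"
     unfolding dist_prod_def dist_real_def using sqrt_sum_squares_le_sum_abs by fastforce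
    finally have "\<bar>fst p - t\<bar> >= d/2 \<or> \<bar>snd p - x\<bar> >= d/2" by linarith
    then have "e <= \<bar>x - snd p\<bar> + (fst p - t)^2"
    proof
     assume "\<bar>fst p - t\<bar> >= d/2"
     from power_mono[OF this, of 2] d(1) have "(d/2)^2 <= (fst p - t)^2" by simp
     then have "e <= (fst p - t)^2" by (simp add: e_def)
     then show ?thesis using abs_ge_zero[of "x - snd p"] by linarith
    next
     assume "\<bar>snd p - x\<bar> >= d/2"
     moreover have "e <= d/2" by (simp add: e_def)
     ultimately have "e <= \<bar>x - snd p\<bar>" by linarith
     then show ?thesis by (simp add: add_increasing2)
    qed
    then have "real k * e <= real k * (\<bar>x - snd p\<bar> + (fst p - t)^2)" by (intro mult_left_mono) auto
    moreover have "real N * e <= real k * e" using k e by (intro mult_right_mono) auto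
    moreover have "M - b < real N * e" using N e by (simp add: field_simps)
    ultimately show ?thesis using M[OF p] by (simp add: algebra_simps abs_le_iff)
   qed
  qed
  then show "eventually (%k. f k x < a) sequentially"
   unfolding eventually_sequentially using b(2) by (meson le_less_trans)
 qed
 have "\<exists>q q'. C2fun UNIV q q' & (\<forall>x. f k x <= q x) & (\<forall>x. q x <= f k x + 1 / Suc k)" for k
  by (rule lipschitz_C2_approx[of "f k" "real k" "1 / Suc k"]) (use lip in \<open>auto simp del: of_nat_Suc\<close>)
 then obtain q q' where q: "!!k. C2fun UNIV (q k) (q' k)" "!!k x. f k x <= q k x" "!!k x. q k x <= f k x + 1 / Suc k"
  by metis
 show ?thesis
 proof (rule that[of q q'])
  show "C2fun UNIV (q k) (q' k)" for k by (rule q)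
  show "u (s, y) <= q k y + real k * (s - t)^2" if "s > 0" for k s y using ge[OF that, of y k] q(2)[of k y] by linarith
  show "\<bar>q k y\<bar> <= M + 1" for k y
  proof -
   have "1 / real (Suc k) <= 1" by simp
   then show ?thesis using fb[of k y] q(2,3)[of k y] by linarith
  qed
  show "(%k. q k y) ----> u (t, y)" for y
  proof (rule tendsto_sandwich[OF _ _ conv])
   have "(%k. f k y + 1 / real (Suc k)) ----> u (t, y) + 0"
    using LIMSEQ_inverse_real_of_nat by (intro tendsto_add conv) (simp add: inverse_eq_divide)
   then show "(%k. f k y + 1 / real (Suc k)) ----> u (t, y)" by simp
  qed (auto intro!: always_eventually q simp del: of_nat_Suc)
 qed
qed

section \<open>Quartic test functions\<close>

lemma lborel_integral_reflect: "integral\<^sup>L lborel (%z::real. f (- z) :: real) = integral\<^sup>L lborel f"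
 using lborel_integral_real_affine[of "-1" f 0] by simp

lemma lborel_integrable_reflect: "integrable lborel f ==> integrable lborel (%z::real. f (- z) :: real)"
 using lborel_integrable_real_affine[of f "-1" 0] by simp

text \<open>The term \<open>p * z\<close> is odd and cancels when \<open>z\<close> and
  \<open>- z\<close> are paired; a second difference remains.\<close>

lemma inn_sym:
 fixes f :: "real => real"
 assumes r: "r > 0" and f: "f : borel_measurable borel"
  and K: "!!z. \<bar>z\<bar> < r ==> \<bar>f (x + z) - f x - p * z\<bar> <= K * z^2"
 shows "set_integrable lborel {0<..<r} (%z. (f (x + z) + f (x - z) - 2 * f x) / z^2)"
  and "inn r f x p = (LINT z:{0<..<r}|lborel. (f (x + z) + f (x - z) - 2 * f x) / z^2)"
proof -
 define g where "g z = (f (x + z) - f x - p * z) / z^2" for z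
 have g: "set_integrable lborel {-r<..<r} g" unfolding g_def by (rule inn_integrable[OF r f K])
 have g0: "g 0 = 0" by (simp add: g_def)
 have "set_integrable lborel {0<..<r} g" by (rule set_integrable_subset[OF g]) (use r in auto)
 then have 1: "integrable lborel (%z. indicator {0<..<r} z *\<^sub>R g z)" by (simp add: set_integrable_def)
 have "set_integrable lborel {-r<..<0} g" by (rule set_integrable_subset[OF g]) (use r in auto)
 then have "integrable lborel (%z. indicator {-r<..<0} (- z) *\<^sub>R g (- z))"
  unfolding set_integrable_def by (rule lborel_integrable_reflect)
 moreover have "indicator {-r<..<0} (- z) = (indicator {0<..<r} z :: real)" for z by (auto split: split_indicator)
 ultimately have 2: "integrable lborel (%z. indicator {0<..<r} z *\<^sub>R g (- z))" by simp
 have "inn r f x p = integral\<^sup>L lborel (%z. indicator {0<..<r} z *\<^sub>R g z + indicator {0<..<r} (- z) *\<^sub>R g (- (- z)))"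
  unfolding inn_def set_lebesgue_integral_def g_def[symmetric]
 proof (intro Bochner_Integration.integral_cong refl)
  fix z :: real
  consider "z < 0" | "z = 0" | "z > 0" by linarith
  then show "indicator {-r<..<r} z *\<^sub>R g z = indicator {0<..<r} z *\<^sub>R g z + indicator {0<..<r} (- z) *\<^sub>R g (- (- z))"
   by cases (use g0 r in \<open>auto split: split_indicator\<close>)
 qed
 also have "... = integral\<^sup>L lborel (%z. indicator {0<..<r} z *\<^sub>R g z) + integral\<^sup>L lborel (%z. indicator {0<..<r} (- z) *\<^sub>R g (- (- z)))"
  using lborel_integrable_reflect[OF 2] by (intro Bochner_Integration.integral_add 1) auto
 also have "integral\<^sup>L lborel (%z. indicator {0<..<r} (- z) *\<^sub>R g (- (- z))) = integral\<^sup>L lborel (%z. indicator {0<..<r} z *\<^sub>R g (- z))"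
  by (rule lborel_integral_reflect)
 also have "integral\<^sup>L lborel (%z. indicator {0<..<r} z *\<^sub>R g z) + ... = integral\<^sup>L lborel (%z. indicator {0<..<r} z *\<^sub>R g z + indicator {0<..<r} z *\<^sub>R g (- z))"
  by (rule Bochner_Integration.integral_add[symmetric, OF 1 2])
 finally have 3: "inn r f x p = ..." .
 have eq: "indicator {0<..<r} z *\<^sub>R g z + indicator {0<..<r} z *\<^sub>R g (- z) = indicator {0<..<r} z *\<^sub>R ((f (x + z) + f (x - z) - 2 * f x) / z^2)" for z
  by (auto simp: g_def add_divide_distrib[symmetric] split: split_indicator)
 show "inn r f x p = (LINT z:{0<..<r}|lborel. (f (x + z) + f (x - z) - 2 * f x) / z^2)"
  unfolding 3 eq set_lebesgue_integral_def ..
 show "set_integrable lborel {0<..<r} (%z. (f (x + z) + f (x - z) - 2 * f x) / z^2)"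
  using Bochner_Integration.integrable_add[OF 1 2] unfolding eq set_integrable_def .
qed

lemma outr_sym:
 fixes f :: "real => real"
 assumes r: "r > 0" and f: "f : borel_measurable borel" and B: "!!x. \<bar>f x\<bar> <= B"
 shows "set_integrable lborel {r..} (%z. (f (x + z) + f (x - z) - 2 * f x) / z^2)"
  and "outr r f x = (LINT z:{r..}|lborel. (f (x + z) + f (x - z) - 2 * f x) / z^2)"
proof -
 define g where "g z = (f (x + z) - f x) / z^2" for z
 have g: "set_integrable lborel (far r) g" unfolding g_def by (rule outr_integrable[OF r f B])
 have 1: "set_integrable lborel {r..} g" by (rule set_integrable_subset[OF g]) (use r in auto)
 have "set_integrable lborel {..-r} g" by (rule set_integrable_subset[OF g]) (use r in auto)
 then have "integrable lborel (%z. indicator {..-r} (- z) *\<^sub>R g (- z))"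
  unfolding set_integrable_def by (rule lborel_integrable_reflect)
 moreover have "indicator {..-r} (- z) = (indicator {r..} z :: real)" for z by (auto split: split_indicator)
 ultimately have 2: "set_integrable lborel {r..} (%z. g (- z))" by (simp add: set_integrable_def)
 have eq: "g z + g (- z) = (f (x + z) + f (x - z) - 2 * f x) / z^2" for z
  by (auto simp: g_def add_divide_distrib[symmetric])
 show "set_integrable lborel {r..} (%z. (f (x + z) + f (x - z) - 2 * f x) / z^2)"
  using set_integral_add(1)[OF 1 2] unfolding eq .
 show "outr r f x = (LINT z:{r..}|lborel. (f (x + z) + f (x - z) - 2 * f x) / z^2)"
  using far_split(2)[OF r 1 2] unfolding eq by (simp add: outr_def g_def)
qed

text \<open>With the near and the far part in one integrand, operators with different radii can be
  compared pointwise.\<close>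

lemma inn_outr_sym:
 fixes f phi :: "real => real"
 assumes r: "r > 0" and f: "f : borel_measurable borel" "!!x. \<bar>f x\<bar> <= B" and phi: "phi : borel_measurable borel"
  and K: "!!z. \<bar>z\<bar> < r ==> \<bar>phi (x + z) - phi x - p * z\<bar> <= K * z^2"
 defines "P \<equiv> (%z. (if z < r then phi (x + z) + phi (x - z) - 2 * phi x else f (x + z) + f (x - z) - 2 * f x) / z^2)"
 shows "set_integrable lborel {0<..} P" and "inn r phi x p + outr r f x = (LINT z:{0<..}|lborel. P z)"
proof -
 have U: "{0<..} = {0<..<r} \<union> {r..}" using r by auto
 have 1: "set_integrable lborel {0<..<r} P"
  using inn_sym(1)[OF r phi K] by (rule set_integrable_cong[THEN iffD1, rotated -1]) (auto simp: P_def)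
 have 2: "set_integrable lborel {r..} P"
  using outr_sym(1)[OF r f] by (rule set_integrable_cong[THEN iffD1, rotated -1]) (auto simp: P_def)
 show "set_integrable lborel {0<..} P" unfolding U by (rule set_integrable_Un[OF 1 2]) auto
 have "(LINT z:{0<..}|lborel. P z) = (LINT z:{0<..<r}|lborel. P z) + (LINT z:{r..}|lborel. P z)"
  unfolding U by (rule set_integral_Un[OF _ 1 2]) auto
 also have "(LINT z:{0<..<r}|lborel. P z) = inn r phi x p"
  by (subst inn_sym(2)[where f = phi and K = K, OF r phi K]) (auto intro!: set_lebesgue_integral_cong simp: P_def)
 also have "(LINT z:{r..}|lborel. P z) = outr r f x"
  unfolding outr_sym(2)[OF r f] by (rule set_lebesgue_integral_cong) (auto simp: P_def)
 finally show "inn r phi x p + outr r f x = (LINT z:{0<..}|lborel. P z)" by simp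
qed

text \<open>Bounds the second order Taylor remainder of \<open>c (x - y)^4\<close> at distance \<open>d = x - y\<close> for increments up to \<open>r\<close>.\<close>

definition qC :: "real => real => real => real" where
 "qC c d r = c * (6 * d^2 + 4 * \<bar>d\<bar> * r + r^2)"

lemma quartic_taylor:
 fixes x y z c r :: real
 assumes "c >= 0" "\<bar>z\<bar> <= r"
 shows "\<bar>c * (x + z - y) ^ 4 - c * (x - y) ^ 4 - 4 * c * (x - y) ^ 3 * z\<bar> <= qC c (x - y) r * z^2"
proof -
 define d where "d = x - y"
 have "c * (x + z - y) ^ 4 - c * (x - y) ^ 4 - 4 * c * (x - y) ^ 3 * z = c * (6 * d^2 + 4 * d * z + z^2) * z^2"
  unfolding d_def by algebra
 moreover have "\<bar>6 * d^2 + 4 * d * z + z^2\<bar> <= 6 * d^2 + 4 * \<bar>d\<bar> * r + r^2"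
 proof -
  have "\<bar>4 * d * z\<bar> <= 4 * \<bar>d\<bar> * r" using assms(2) by (auto simp: abs_mult intro!: mult_left_mono)
  moreover have "z^2 <= r^2" using power_mono[OF assms(2), of 2] by simp
  moreover have "d^2 >= 0" "z^2 >= 0" by auto
  ultimately show ?thesis by linarith
 qed
 then have "c * \<bar>6 * d^2 + 4 * d * z + z^2\<bar> * z^2 <= c * (6 * d^2 + 4 * \<bar>d\<bar> * r + r^2) * z^2"
  using assms(1) by (intro mult_right_mono mult_left_mono) auto
 ultimately show ?thesis using assms(1) by (simp add: abs_mult qC_def d_def)
qed

text \<open>
 The subsolution inequality for quartic test functions on a set \<open>I\<close> of times. Viscosity subsolutions
 satisfy it with \<open>nu = 0\<close>, systems of \<open>n\<close> particles with \<open>nu = 1 / n\<close>; the factor 10 leaves room for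
 the discreteness of particle systems.\<close>

definition qsub :: "real => real set => (real \<times> real => real) => bool" where
 "qsub nu I u \<longleftrightarrow> (\<forall>c y g g' t x r. c > 0 --> r > 0 --> t : I --> C2fun I g g' -->
   (\<forall>s\<in>I. \<forall>z. u (s, z) - c * (z - y) ^ 4 - g s <= u (t, x) - c * (x - y) ^ 4 - g t) -->
   (x = y --> g' t <= 0) &
   (x ~= y --> g' t <= \<bar>4 * c * (x - y) ^ 3\<bar> * (10 * qC c (x - y) r * r + outr r (%z. u (t, z)) x)
    + nu * (\<bar>4 * c * (x - y) ^ 3\<bar> / r + 8 * qC c (x - y) r)))"

lemma C2_on_dom_quartic:
 assumes "C2fun {0<..} g g'"
 shows "C2_on_dom (%(s, z). c * (z - y) ^ 4 + g s)"
  and "t > 0 ==> pd_t (%(s, z). c * (z - y) ^ 4 + g s) (t, x) = g' t"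
  and "t > 0 ==> pd_x (%(s, z). c * (z - y) ^ 4 + g s) (t, x) = 4 * c * (x - y) ^ 3"
proof -
 note A = C2_on_dom_sep[OF C2fun_const[of _ 1] C2fun_cmult[OF C2fun_pow4[of _ y], where c = c]]
 note B = C2_on_dom_sep[OF assms C2fun_const[of _ 1]]
 note A1 = A(1)[unfolded C2_on_dom_def, THEN conjunct1] and B1 = B(1)[unfolded C2_on_dom_def, THEN conjunct1]
 have eq: "(%(s, z). c * (z - y) ^ 4 + g s) = (%p. 1 * (case p of (t, x) => 1 * (c * (x - y) ^ 4)) + 1 * (case p of (t, x) => g t * 1))"
  by auto
 show "C2_on_dom (%(s, z). c * (z - y) ^ 4 + g s)"
  unfolding eq by (rule C2_on_dom_lin[OF A(1) B(1)])
 show "pd_t (%(s, z). c * (z - y) ^ 4 + g s) (t, x) = g' t" if "t > 0"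
  unfolding eq C1_on_dom_lin(2)[OF A1 B1 that] A(2)[OF that] B(2)[OF that] by simp
 show "pd_x (%(s, z). c * (z - y) ^ 4 + g s) (t, x) = 4 * c * (x - y) ^ 3" if "t > 0"
  unfolding eq C1_on_dom_lin(3)[OF A1 B1 that] A(3)[OF that] B(3)[OF that] by simp
qed

text \<open>Enlarging the radius only raises the right-hand side, because at a contact point second
  differences of \<open>u\<close> lie below those of the quartic. For a radius \<open>r\<close>
  below \<open>rho\<close>, the quartic is blended, through \<open>cutoff r\<close>, into smooth
  majorants of \<open>u\<close>, which then tend to \<open>u\<close>.\<close>

lemma subsolution_imp_qsub:
 assumes u: "HJ_subsolution rho u" and rho: "rho > 0"
 shows "qsub 0 {0<..} u"
 unfolding qsub_def
proof (intro allI impI)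
 fix c y t x r :: real and g g' :: "real => real"
 assume c: "c > 0" and r: "r > 0" and t': "t : {0<..}" and g: "C2fun {0<..} g g'"
  and contact: "\<forall>s\<in>{0<..}. \<forall>z. u (s, z) - c * (z - y) ^ 4 - g s <= u (t, x) - c * (x - y) ^ 4 - g t"
 define d where "d = x - y"
 define p where "p = 4 * c * d ^ 3"
 have t: "t > 0" using t' by simp
 have uscd: "usc_on_dom u" using u by (simp add: HJ_subsolution_def)
 note usc = usc_on_dom_imp_seq[OF uscd]
 obtain M where M: "!!q. q : HJ_dom ==> \<bar>u q\<bar> <= M"
  using u by (auto simp: HJ_subsolution_def bounded_iff)
 define f where "f = (%z. u (t, z))"
 have fm: "f : borel_measurable borel" unfolding f_def by (rule usc_slice_measurable[OF usc]) (use t in simp)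
 have fM: "\<bar>f z\<bar> <= M" for z unfolding f_def using M t by simp
 have M0: "M >= 0" using order_trans[OF abs_ge_zero fM] .
 define phi where "phi = (%z. c * (z - y) ^ 4)"
 have phim: "phi : borel_measurable borel" unfolding phi_def by measurable
 have tay: "\<bar>phi (x + z) - phi x - p * z\<bar> <= qC c d R * z^2" if "\<bar>z\<bar> <= R" for z R
  using quartic_taylor[of c z R x y] c that by (simp add: phi_def p_def d_def)
 have fphi: "f (x + z) - f x <= phi (x + z) - phi x" for z
  using contact[rule_format, of t "x + z"] t by (simp add: f_def phi_def)
 have test: "(pd_x psi (t, x) ~= 0 --> pd_t psi (t, x) <= HJ_H rho psi u (t, x)) &
  ((\<exists>c g. \<forall>(s, z)\<in>HJ_dom. psi (s, z) = c * \<bar>z - x\<bar> ^ 4 + g s) --> pd_t psi (t, x) <= 0)"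
  if "C2_on_dom psi" "\<forall>q\<in>HJ_dom. u q - psi q <= u (t, x) - psi (t, x)" for psi
 proof -
  have "(t, x) : HJ_dom" using t by simp
  then show ?thesis using u that unfolding HJ_subsolution_def by blast
 qed
 note C2q = C2_on_dom_quartic[OF g, where c = c and y = y]
 have con: "\<forall>q\<in>HJ_dom. u q - (%(s, z). c * (z - y) ^ 4 + g s) q <= u (t, x) - (%(s, z). c * (z - y) ^ 4 + g s) (t, x)"
 proof
  fix q assume "q : HJ_dom"
  then obtain s z where q: "q = (s, z)" "s > 0" by (cases q) auto
  show "u q - (%(s, z). c * (z - y) ^ 4 + g s) q <= u (t, x) - (%(s, z). c * (z - y) ^ 4 + g s) (t, x)"
   using contact[rule_format, of s z] q by simp
 qed
 \<comment> \<open>The second order bound yields the factor 2, well within the 10 of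
   \<open>qsub\<close>.\<close>
 have fin: "inn r phi x p <= 10 * qC c d r * r"
 proof -
  have "\<bar>inn r phi x p\<bar> <= 2 * qC c d r * r" by (rule inn_bound[OF r phim]) (use tay[of _ r] in auto)
  moreover have "0 <= qC c d r * r" using c r by (auto simp: qC_def)
  ultimately show ?thesis by linarith
 qed
 define P where "P = (%z. (if z < r then phi (x + z) + phi (x - z) - 2 * phi x else f (x + z) + f (x - z) - 2 * f x) / z^2)"
 have P: "set_integrable lborel {0<..} P" "inn r phi x p + outr r f x = (LINT z:{0<..}|lborel. P z)"
  unfolding P_def
  by (rule inn_outr_sym[where K = "qC c d r" and p = p and phi = phi, OF r fm fM phim tay[OF less_imp_le]]; assumption)+
 have main: "g' t <= \<bar>p\<bar> * (inn r phi x p + outr r f x)" if xy: "x ~= y"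
 proof (cases "rho <= r")
  case True
  have p0: "p ~= 0" using xy c by (simp add: p_def d_def)
  define P' where "P' = (%z. (if z < rho then phi (x + z) + phi (x - z) - 2 * phi x else f (x + z) + f (x - z) - 2 * f x) / z^2)"
  have P': "set_integrable lborel {0<..} P'" "inn rho phi x p + outr rho f x = (LINT z:{0<..}|lborel. P' z)"
   unfolding P'_def
   by (rule inn_outr_sym[where K = "qC c d rho" and p = p and phi = phi, OF rho fm fM phim tay[OF less_imp_le]]; assumption)+
  have "inn rho (%z. (case (t, z) of (s, z) => c * (z - y) ^ 4 + g s)) x p = inn rho phi x p"
   by (simp add: inn_def phi_def)
  moreover have "pd_x (%(s, z). c * (z - y) ^ 4 + g s) (t, x) = p" using C2q(3)[OF t] by (simp add: p_def d_def)
  ultimately have "g' t <= \<bar>p\<bar> * (inn rho phi x p + outr rho f x)"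
   using test[OF C2q(1) con, THEN conjunct1] p0 C2q(2)[OF t] by (simp add: HJ_H_eq f_def)
  also have "... <= \<bar>p\<bar> * (inn r phi x p + outr r f x)"
   unfolding P(2) P'(2)
  proof (intro mult_left_mono set_integral_mono P P')
   fix z :: real
   have "f (x + z) + f (x - z) - 2 * f x <= phi (x + z) + phi (x - z) - 2 * phi x"
    using fphi[of z] fphi[of "- z"] by simp
   then show "P' z <= P z" using True by (auto simp: P_def P'_def intro!: divide_right_mono)
  qed auto
  finally show ?thesis .
 next
  case False
  then have rrho: "r < rho" by simp
  have p0: "p ~= 0" using xy c by (simp add: p_def d_def)
  obtain q q' where q: "!!k. C2fun UNIV (q k) (q' k)" "!!k s y. s > 0 ==> u (s, y) <= q k y + real k * (s - t)^2"
   "!!k y. \<bar>q k y\<bar> <= M + 1" "!!y. (%k. q k y) ----> f y"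
   using usc_upper_approx[OF usc M t] unfolding f_def by metis
  obtain e where e: "C2fun UNIV (%y. cutoff r (y - x)) e" "e x = 0" using C2fun_cutoff[OF r] by blast
  note cs = cutoff_simps[OF r]
  have e': "C2fun UNIV (%y. 1 + (-1) * cutoff r (y - x)) (%y. 0 + (-1) * e y)"
   by (intro C2fun_add C2fun_const C2fun_cmult e)
  \<comment> \<open>\<open>kappa\<close> lifts the quartic test function so that its value at the
    contact point is that of \<open>u\<close>.\<close>
  define kappa where "kappa = f x - phi x - g t"
  define A where "A k z = cutoff r (z - x) * (phi z + kappa) + (1 + (-1) * cutoff r (z - x)) * q k z" for k z
  define A' where "A' k z = e z * (phi z + kappa) + cutoff r (z - x) * (c * (4 * (z - y) ^ 3) + 0) +
    ((0 + (-1) * e z) * q k z + (1 + (-1) * cutoff r (z - x)) * q' k z)" for k z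
  have A: "C2fun UNIV (A k) (A' k)" for k
   unfolding A_def A'_def phi_def by (intro C2fun_add C2fun_mult e e' q C2fun_cmult C2fun_pow4 C2fun_const)
  \<comment> \<open>A convex combination of two majorants of \<open>u\<close>, written as nested
    linear combinations of products so that the differentiation rules apply; \<open>psi_eq\<close>
    is the readable form.\<close>
  define psi where "psi k = (%p. 1 * (1 * (case p of (s, z) => (%_. 1) s * A k z) + 1 * (case p of (s, z) => g s * cutoff r (z - x)))
    + 1 * (case p of (s, z) => (real k * (s - t)^2) * (1 + (-1) * cutoff r (z - x))))" for k :: nat
  have psi_eq: "psi k (s, z) = cutoff r (z - x) * (phi z + kappa + g s) + (1 - cutoff r (z - x)) * (q k z + real k * (s - t)^2)" for k s z
   by (simp add: psi_def A_def algebra_simps)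
  note S1 = C2_on_dom_sep[OF C2fun_const[of _ 1] A] and S2 = C2_on_dom_sep[OF g e(1)]
   and S3 = C2_on_dom_sep[OF C2fun_cmult[OF C2fun_pow2[of _ t]] e']
  note C21 = C2_on_dom_lin[OF S1(1) S2(1), where a = 1 and b = 1]
  have C2psi: "C2_on_dom (psi k)" for k unfolding psi_def by (rule C2_on_dom_lin[OF C21 S3(1)])
  note C1 = S1(1)[unfolded C2_on_dom_def, THEN conjunct1] S2(1)[unfolded C2_on_dom_def, THEN conjunct1]
   S3(1)[unfolded C2_on_dom_def, THEN conjunct1] C21[unfolded C2_on_dom_def, THEN conjunct1]
  \<comment> \<open>At \<open>x\<close> the cutoff has value 1 and derivative 0, so the first
    derivatives of \<open>psi k\<close> are those of the quartic test function.\<close>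
  have psit: "pd_t (psi k) (t, x) = g' t" for k
   unfolding psi_def C1_on_dom_lin(2)[OF C1(4) C1(3) t] C1_on_dom_lin(2)[OF C1(1) C1(2) t] S1(2)[OF t] S2(2)[OF t] S3(2)[OF t]
   by (simp add: cs)
  have psix: "pd_x (psi k) (t, x) = p" for k
   unfolding psi_def C1_on_dom_lin(3)[OF C1(4) C1(3) t] C1_on_dom_lin(3)[OF C1(1) C1(2) t] S1(3)[OF t] S2(3)[OF t] S3(3)[OF t]
   by (simp add: cs A'_def e p_def d_def)
  have psi0: "psi k (t, x) = f x" for k by (simp add: psi_eq cs kappa_def)
  have conpsi: "\<forall>q\<in>HJ_dom. u q - psi k q <= u (t, x) - psi k (t, x)" for k
  proof
   fix pp assume "pp : HJ_dom"
   then obtain s z where pp: "pp = (s, z)" "s > 0" by (cases pp) auto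
   define X where "X = cutoff r (z - x)"
   have X: "0 <= X" "0 <= 1 - X" using cs by (auto simp: X_def)
   have "u (s, z) <= phi z + kappa + g s" using contact[rule_format, of s z] pp by (simp add: kappa_def phi_def f_def)
   from mult_left_mono[OF this X(1)] mult_left_mono[OF q(2)[OF pp(2), of z k] X(2)]
   have "u (s, z) <= psi k (s, z)" unfolding psi_eq X_def[symmetric] by (simp add: algebra_simps)
   then show "u pp - psi k pp <= u (t, x) - psi k (t, x)" unfolding psi0 by (simp add: pp f_def)
  qed
  have ineq: "g' t <= \<bar>p\<bar> * (inn rho (%z. psi k (t, z)) x p + outr rho f x)" for k
   using test[OF C2psi[of k] conpsi[of k], THEN conjunct1] p0 by (simp add: HJ_H_eq psit psix f_def)
  define Q where "Q k = (%z. (if z < rho then psi k (t, x + z) + psi k (t, x - z) - 2 * psi k (t, x) else f (x + z) + f (x - z) - 2 * f x) / z^2)" for k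
  have Q: "set_integrable lborel {0<..} (Q k)" "inn rho (%z. psi k (t, z)) x p + outr rho f x = (LINT z:{0<..}|lborel. Q k z)" for k
  proof -
   have C: "C1_on_dom (psi k)" using C2psi[of k] by (simp add: C2_on_dom_def)
   obtain K where "!!t' x' z. \<bar>t' - t\<bar> <= t/2 ==> \<bar>x' - x\<bar> <= 1 ==> \<bar>z\<bar> <= rho ==>
     \<bar>psi k (t', x' + z) - psi k (t', x') - pd_x (psi k) (t', x') * z\<bar> <= K * z^2"
    using C2_on_dom_x_bound[OF C2psi[of k] t] by metis
   from this[of t x] t have K: "\<bar>psi k (t, x + z) - psi k (t, x) - p * z\<bar> <= K * z^2" if "\<bar>z\<bar> < rho" for z
    using that by (simp add: psix)
   show "set_integrable lborel {0<..} (Q k)" "inn rho (%z. psi k (t, z)) x p + outr rho f x = (LINT z:{0<..}|lborel. Q k z)"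
    unfolding Q_def using inn_outr_sym[OF rho fm fM C1_on_dom_slice_measurable[OF C t] K] by auto
  qed
  define Qi where "Qi = (%z. (if z < rho then cutoff r z * (phi (x + z) + phi (x - z) - 2 * phi x) + (1 - cutoff r z) * (f (x + z) + f (x - z) - 2 * f x)
    else f (x + z) + f (x - z) - 2 * f x) / z^2)"
  have Spsi: "psi k (t, x + z) + psi k (t, x - z) - 2 * psi k (t, x) =
    cutoff r z * (phi (x + z) + phi (x - z) - 2 * phi x) + (1 - cutoff r z) * (q k (x + z) + q k (x - z) - 2 * f x)" for k z
   unfolding psi0 unfolding psi_eq by (simp add: cs kappa_def algebra_simps)
  \<comment> \<open>For the dominating function: below \<open>rho\<close>, the first summand bounds
    the quartic part, and the second one bounds the majorants, since the deficit of the cutoff is at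
    most \<open>3 * z^2 / r^2\<close>.\<close>
  define W where "W = 2 * qC c d rho + 3 / r^2 * (4 * M + 2)"
  have W0: "W >= 0" using c rho M0 by (simp add: W_def qC_def)
  define w where "w z = W * indicator {0<..<rho} z + 4 * M * (indicator {rho..} z *\<^sub>R (1 / z^2))" for z
  have wi: "integrable lborel w"
   unfolding w_def using inverse_square_Ici(1)[OF rho] rho
   by (intro Bochner_Integration.integrable_add integrable_mult_right)
     (auto intro!: integrable_real_indicator simp: emeasure_lborel_Ioo set_integrable_def)
  have w0: "0 <= w z" for z using W0 M0 by (auto simp: w_def)
  have dom: "\<bar>Q k z\<bar> <= w z" if z: "z > 0" for k z
  proof (cases "z < rho")
   case True
   have 1: "\<bar>phi (x + z) + phi (x - z) - 2 * phi x\<bar> <= 2 * qC c d rho * z^2"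
    using tay[of z rho] tay[of "- z" rho] True z by (simp add: abs_le_iff algebra_simps) 
   have 2: "\<bar>q k (x + z) + q k (x - z) - 2 * f x\<bar> <= 4 * M + 2"
    using q(3)[of k "x + z"] q(3)[of k "x - z"] fM[of x] by linarith
   have "\<bar>cutoff r z * (phi (x + z) + phi (x - z) - 2 * phi x)\<bar> <= 1 * (2 * qC c d rho * z^2)"
    unfolding abs_mult using cs 1 by (intro mult_mono) auto
   moreover have "\<bar>(1 - cutoff r z) * (q k (x + z) + q k (x - z) - 2 * f x)\<bar> <= (3 * z^2 / r^2) * (4 * M + 2)"
    unfolding abs_mult using cs(3,6)[of z] 2 by (intro mult_mono) auto
   ultimately have "\<bar>psi k (t, x + z) + psi k (t, x - z) - 2 * psi k (t, x)\<bar> <= W * z^2"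
    unfolding Spsi W_def distrib_right
    by (intro order_trans[OF abs_triangle_ineq] add_mono) (simp_all add: algebra_simps add_divide_distrib)
   then show ?thesis using True z by (simp add: Q_def w_def field_simps)
  next
   case False
   have "\<bar>f (x + z) + f (x - z) - 2 * f x\<bar> <= 4 * M" using fM[of "x+z"] fM[of "x-z"] fM[of x] by linarith
   then show ?thesis using False z rho by (simp add: Q_def w_def divide_right_mono)
  qed
  have lim: "(%k. LINT z:{0<..}|lborel. Q k z) ----> (LINT z:{0<..}|lborel. Qi z)"
   unfolding set_lebesgue_integral_def
  proof (rule integral_dominated_convergence[OF _ _ wi])
   show "(%z. indicator {0<..} z *\<^sub>R Q k z) : borel_measurable lborel" for k
    using Q(1)[of k] by (auto simp: set_integrable_def)
   show ptw: "AE z in lborel. (%k. indicator {0<..} z *\<^sub>R Q k z) ----> indicator {0<..} z *\<^sub>R Qi z"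
   proof (rule AE_I2)
    fix z :: real
    have "(%k. Q k z) ----> Qi z"
    proof (cases "z < rho")
     case True
     show ?thesis unfolding Q_def Qi_def Spsi divide_inverse using True
      by (auto intro!: tendsto_intros q)
    qed (simp add: Q_def Qi_def)
    then show "(%k. indicator {0<..} z *\<^sub>R Q k z) ----> indicator {0<..} z *\<^sub>R Qi z" by (intro tendsto_intros)
   qed
   have [measurable]: "f : borel_measurable borel" "phi : borel_measurable borel" by fact+
   show "(%z. indicator {0<..} z *\<^sub>R Qi z) : borel_measurable lborel"
    unfolding Qi_def cutoff_def by measurable
   show "AE z in lborel. norm (indicator {0<..} z *\<^sub>R Q k z) <= w z" for k
    using dom[of _ k] w0 by (auto intro!: AE_I2 split: split_indicator)
  qed
  \<comment> \<open>A convex combination of the two second differences is at most that of the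
    quartic, and for \<open>z >= r\<close> the cutoff has vanished.\<close>
  have le: "Qi z <= P z" if "z > 0" for z
  proof -
   have S: "f (x + z) + f (x - z) - 2 * f x <= phi (x + z) + phi (x - z) - 2 * phi x"
    using fphi[of z] fphi[of "- z"] by simp
   have "cutoff r z * (phi (x + z) + phi (x - z) - 2 * phi x) + (1 - cutoff r z) * (f (x + z) + f (x - z) - 2 * f x)
    <= cutoff r z * (phi (x + z) + phi (x - z) - 2 * phi x) + (1 - cutoff r z) * (phi (x + z) + phi (x - z) - 2 * phi x)"
    using cs(3)[of z] by (intro add_left_mono mult_left_mono S) auto
   also have "... = phi (x + z) + phi (x - z) - 2 * phi x" by (simp add: algebra_simps)
   finally have "z < r ==> Qi z <= P z" using rrho by (auto simp: Qi_def P_def intro!: divide_right_mono)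
   moreover have "~ z < r ==> Qi z <= P z" using that by (simp add: Qi_def P_def cs(5))
   ultimately show ?thesis by blast
  qed
  have [measurable]: "f : borel_measurable borel" "phi : borel_measurable borel" by fact+
  have Qii: "set_integrable lborel {0<..} Qi"
   unfolding set_integrable_def
  proof (rule Bochner_Integration.integrable_bound[OF wi])
   show "(%z. indicator {0<..} z *\<^sub>R Qi z) : borel_measurable lborel" unfolding Qi_def cutoff_def by measurable
   have "\<bar>Qi z\<bar> <= w z" if "z > 0" for z
   proof (rule LIMSEQ_le_const2)
    show "(%k. \<bar>Q k z\<bar>) ----> \<bar>Qi z\<bar>"
    proof (intro tendsto_intros, cases "z < rho")
     case True
     show "(%k. Q k z) ----> Qi z" unfolding Q_def Qi_def Spsi divide_inverse using True
      by (auto intro!: tendsto_intros q)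
    qed (simp add: Q_def Qi_def)
   qed (use dom[OF that] in auto)
   then show "AE z in lborel. norm (indicator {0<..} z *\<^sub>R Qi z) <= norm (w z)"
    using w0 by (auto intro!: AE_I2 order_trans[OF _ abs_ge_self] split: split_indicator)
  qed
  have "(%k. \<bar>p\<bar> * (inn rho (%z. psi k (t, z)) x p + outr rho f x)) ----> \<bar>p\<bar> * (LINT z:{0<..}|lborel. Qi z)"
   unfolding Q(2) by (intro tendsto_intros lim)
  then have "g' t <= \<bar>p\<bar> * (LINT z:{0<..}|lborel. Qi z)"
   by (rule LIMSEQ_le_const) (use ineq in auto)
  also have "... <= \<bar>p\<bar> * (inn r phi x p + outr r f x)"
   unfolding P(2) by (intro mult_left_mono set_integral_mono Qii P) (auto intro: le)
  finally show ?thesis .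
 qed
 show "(x = y --> g' t <= 0) &
   (x ~= y --> g' t <= \<bar>4 * c * (x - y) ^ 3\<bar> * (10 * qC c (x - y) r * r + outr r (%z. u (t, z)) x)
    + 0 * (\<bar>4 * c * (x - y) ^ 3\<bar> / r + 8 * qC c (x - y) r))"
 proof (intro conjI impI)
  assume xy: "x = y"
  have "\<forall>(s, z)\<in>HJ_dom. (%(s, z). c * (z - y) ^ 4 + g s) (s, z) = c * \<bar>z - x\<bar> ^ 4 + g s"
   using xy by (auto simp: power_even_abs)
  then have "pd_t (%(s, z). c * (z - y) ^ 4 + g s) (t, x) <= 0"
   by (intro test[OF C2q(1) con, THEN conjunct2, THEN mp]) blast
  then show "g' t <= 0" using C2q(2)[OF t] by simp
 next
  assume xy: "x ~= y"
  have "g' t <= \<bar>p\<bar> * (inn r phi x p + outr r f x)" by (rule main[OF xy])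
  also have "... <= \<bar>p\<bar> * (10 * qC c d r * r + outr r f x)" using fin by (intro mult_left_mono) auto
  finally show "g' t <= \<bar>4 * c * (x - y) ^ 3\<bar> * (10 * qC c (x - y) r * r + outr r (%z. u (t, z)) x)
    + 0 * (\<bar>4 * c * (x - y) ^ 3\<bar> / r + 8 * qC c (x - y) r)"
   by (simp add: p_def d_def f_def)
 qed
qed

section \<open>Barriers and doubling of variables\<close>

lemma usc_seq_mono: "usc_seq X f ==> Y \<subseteq> X ==> usc_seq Y f"
 unfolding usc_seq_def by (meson subset_iff)

lemma usc_seq_add:
 assumes f: "usc_seq X f" and g: "usc_seq X g"
 shows "usc_seq X (%p. f p + g p)"
 unfolding usc_seq_def
proof (intro ballI allI impI; elim conjE)
 fix p q a assume p: "p : X" "\<forall>k. q k : X" "q ----> p" "f p + g p < a"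
 define e where "e = (a - f p - g p) / 2"
 have "f p < f p + e" "g p < g p + e" using p by (auto simp: e_def)
 then have "eventually (%k. f (q k) < f p + e) sequentially" "eventually (%k. g (q k) < g p + e) sequentially"
  using p by (auto intro!: usc_seqD[OF f] usc_seqD[OF g])
 then show "eventually (%k. f (q k) + g (q k) < a) sequentially"
  by eventually_elim (simp add: e_def field_simps)
qed

lemma usc_seq_compose:
 assumes f: "usc_seq Y f" and c: "continuous_on X h" and h: "!!p. p : X ==> h p : Y"
 shows "usc_seq X (%p. f (h p))"
 unfolding usc_seq_def
proof (intro ballI allI impI; elim conjE)
 fix p q a assume p: "p : X" "\<forall>k. q k : X" "q ----> p" "f (h p) < a"
 have "(%k. h (q k)) ----> h p"
  using c p by (auto simp: continuous_on_sequentially o_def)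
 then show "eventually (%k. f (h (q k)) < a) sequentially"
  using p h by (intro usc_seqD[OF f]) auto
qed

lemma continuous_imp_usc_seq: assumes "continuous_on X f" shows "usc_seq X f"
 unfolding usc_seq_def
proof (intro ballI allI impI; elim conjE)
 fix p q a assume p: "p : X" "\<forall>k. q k : X" "q ----> p" "f p < a"
 then have "(%k. f (q k)) ----> f p"
  using assms by (auto simp: continuous_on_sequentially o_def)
 then show "eventually (%k. f (q k) < a) sequentially" using p(4) by (rule order_tendstoD)
qed

lemma usc_seq_attains_max:
 fixes f :: "'a::metric_space => real"
 assumes f: "usc_seq K f" and K: "compact K" "K ~= {}" and b: "bdd_above (f ` K)"
 obtains p where "p : K" "!!q. q : K ==> f q <= f p"
proof -
 define S where "S = (SUP p\<in>K. f p)"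
 have "\<exists>p\<in>K. S - 1 / Suc k < f p" for k
  using less_cSUP_iff[OF K(2) b, of "S - 1 / Suc k"] by (simp add: S_def)
 then obtain p where p: "!!k. p k : K" "!!k. S - 1 / Suc k < f (p k)" by metis
 obtain l s where ls: "l : K" "strict_mono s" "(p \<circ> s) ----> l"
  using K(1) p(1) unfolding compact_def by blast
 have "S <= f l"
 proof (rule ccontr)
  assume "~ S <= f l"
  then obtain a where a: "f l < a" "a < S" using dense not_le by blast
  have 1: "eventually (%k. f ((p \<circ> s) k) < a) sequentially"
   by (rule usc_seqD[OF f ls(1) _ ls(3) a(1)]) (simp add: p)
  have "(%k. S - 1 / real (Suc k)) ----> S - 0"
   using LIMSEQ_inverse_real_of_nat by (intro tendsto_intros) (simp add: inverse_eq_divide)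
  then have "eventually (%k. a < S - 1 / real (Suc k)) sequentially" using a(2) by (intro order_tendstoD) auto
  then have "eventually (%k. a < S - 1 / real (Suc (s k))) sequentially"
   using filterlim_subseq[OF ls(2)] by (rule eventually_compose_filterlim)
  with 1 have "eventually (%k::nat. False) sequentially"
  proof eventually_elim
   case (elim k)
   then show False using p(2)[of "s k"] by (simp add: o_def)
  qed
  then show False by simp
 qed
 then show ?thesis using cSUP_upper[OF _ b] ls(1) by (intro that[of l]) (auto simp: S_def intro: order_trans)
qed

lemma qC_mono: "0 <= c ==> 0 <= r ==> \<bar>d\<bar> <= D ==> qC c d r <= qC c D r"
proof -
 assume *: "0 <= c" "0 <= r" "\<bar>d\<bar> <= D"
 then have "d^2 <= D^2" using power_mono[of "\<bar>d\<bar>" D 2] by simp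
 moreover have "\<bar>d\<bar> * r <= \<bar>D\<bar> * r" using * by (intro mult_right_mono) auto
 ultimately show ?thesis unfolding qC_def using * by (intro mult_left_mono) auto
qed

text \<open>
 The penalty \<open>h\<close> is 0 for functions defined for all times; on an interval \<open>[a, c)\<close> between collisions
 it is a pole at \<open>c\<close>, where nothing is known beforehand.\<close>

lemma barrier:
 fixes u :: "real \<times> real => real"
 assumes q: "qsub nu I u" and usc: "usc_seq (J \<times> UNIV) u"
  and M: "!!t x. t : J ==> \<bar>u (t, x)\<bar> <= M" and M0: "M > 0" and nu: "nu >= 0" and D: "D > 0"
  and IJ: "I \<subseteq> J" "J \<subseteq> {0..}"
  and h: "continuous_on J h" "!!t. t : J ==> 0 <= h t" "C2fun I h h'" "!!t. t : I ==> 0 <= h' t"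
  and A: "- M <= A"
  and K: "K > (1792 * M^2 + 184 * nu * M) / D^2"
  and cpt: "!!C. compact {t : J. K * t + h t <= C}"
  and start: "!!t x. t : J - I ==> u (t, x) <= A + 2 * M * ((x - y) / D) ^ 4 + K * t"
  and t: "t : J"
 shows "u (t, x) <= A + 2 * M * ((x - y) / D) ^ 4 + K * t + h t"
proof (rule ccontr)
 assume neg: "~ ?thesis"
 \<comment> \<open>The quartic reaches \<open>2 * M\<close> at distance \<open>D\<close>. Since
   \<open>A >= - M\<close>, a value of \<open>Phi\<close> above \<open>A\<close> confines the point
   to distance \<open>D\<close> from \<open>y\<close>.\<close>
 define c where "c = 2 * M / D ^ 4"
 have c: "c > 0" using M0 D by (simp add: c_def)
 have ceq: "2 * M * ((z - y) / D) ^ 4 = c * (z - y) ^ 4" for z by (simp add: c_def power_divide)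
 define Phi where "Phi p = u p + (- c * (snd p - y) ^ 4 - K * fst p - h (fst p))" for p
 define C where "C = {t : J. K * t + h t <= 2 * M} \<times> {y - D..y + D}"
 have K0: "K > 0" using K M0 nu D by (smt (verit, best) divide_nonneg_pos mult_nonneg_nonneg zero_le_power2 zero_less_power)
 have inC: "p : C" if "fst p : J" "Phi p > A" for p
 proof -
  obtain s z where p: "p = (s, z)" by (cases p)
  have "u (s, z) <= M" using M[of s z] that p by (auto simp: abs_le_iff)
  moreover have "0 <= K * s" "0 <= h s" using that p K0 IJ h(2) by auto
  moreover have "0 <= c * (z - y) ^ 4" using c by simp
  ultimately have 1: "K * s + h s <= 2 * M" and 2: "c * (z - y) ^ 4 <= 2 * M"
   using that(2) A unfolding Phi_def p by (auto simp: algebra_simps) 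
  have "\<bar>z - y\<bar> ^ 4 <= D ^ 4" using 2 M0 D by (simp add: c_def field_simps power_even_abs)
  then have "\<bar>z - y\<bar> <= D" using D by (subst (asm) power_mono_iff) auto
  then show ?thesis using 1 that p by (auto simp: C_def)
 qed
 have tx: "Phi (t, x) > A" using neg by (simp add: Phi_def ceq)
 have C1: "compact C" unfolding C_def by (intro compact_Times cpt) auto
 have C2: "C ~= {}" using inC[of "(t, x)"] tx t by auto
 have "continuous_on C (%p. - c * (snd p - y) ^ 4 - K * fst p - h (fst p))"
  by (intro continuous_intros continuous_on_compose2[OF h(1)]) (auto simp: C_def)
 moreover have "usc_seq C u" by (rule usc_seq_mono[OF usc]) (auto simp: C_def)
 ultimately have C3: "usc_seq C Phi" unfolding Phi_def using usc_seq_add continuous_imp_usc_seq by blast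
 have C4: "bdd_above (Phi ` C)"
 proof (rule bdd_aboveI2[of _ _ M])
  fix p assume "p : C"
  then obtain s z where p: "p = (s, z)" "s : J" by (auto simp: C_def)
  have "0 <= K * s" "0 <= h s" "0 <= c * (z - y) ^ 4" using p K0 IJ h(2) c by auto
  then show "Phi p <= M" using M[OF p(2), of z] by (simp add: Phi_def p(1))
 qed
 obtain p where p: "p : C" "!!q. q : C ==> Phi q <= Phi p" using usc_seq_attains_max[OF C3 C1 C2 C4] by blast
 obtain s z where sz: "p = (s, z)" "s : J" using p by (auto simp: C_def)
 have max: "Phi q <= Phi p" if "fst q : J" for q
 proof (cases "Phi q > A")
  case True then show ?thesis using p(2) inC that by blast
 next
  case False
  then show ?thesis using p(2)[OF inC[OF _ tx]] t tx by auto
 qed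
 have pA: "Phi p > A" using max[of "(t, x)"] t tx by simp
 have sI: "s : I"
 proof (rule ccontr)
  assume "s \<notin> I"
  then have "u (s, z) <= A + c * (z - y) ^ 4 + K * s" using start[of s z] sz unfolding ceq by auto
  then show False using pA h(2)[OF sz(2)] by (simp add: Phi_def sz)
 qed
 define d where "d = z - y"
 have dD: "\<bar>d\<bar> <= D" using p(1) sz by (auto simp: C_def d_def)
 have g: "C2fun I (%t. K * t + h t) (%t. K * 1 + h' t)"
  by (intro C2fun_add C2fun_cmult C2fun_id h)
 have contact: "\<forall>s'\<in>I. \<forall>z'. u (s', z') - c * (z' - y) ^ 4 - (K * s' + h s') <= u (s, z) - c * (z - y) ^ 4 - (K * s + h s)"
 proof (intro ballI allI)
  fix s' z' assume "s' : I"
  then have "Phi (s', z') <= Phi p" using IJ by (intro max) auto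
  then show "u (s', z') - c * (z' - y) ^ 4 - (K * s' + h s') <= u (s, z) - c * (z - y) ^ 4 - (K * s + h s)"
   by (simp add: Phi_def sz)
 qed
 \<comment> \<open>The radius of the test is \<open>D\<close>. The slope is at most
   \<open>8 M / D\<close>, \<open>qC\<close> at most \<open>22 M / D^2\<close>, the far integral at
   most \<open>4 M / D\<close>. The product contributes 8 times (220 + 4), that is 1792, times
   \<open>M^2 / D^2\<close>; the error term contributes 8 + 8 times 22, that is 184, times
   \<open>nu M / D^2\<close>.\<close>
 note Q = q[unfolded qsub_def, rule_format, OF c D sI g contact[rule_format]]
 show False
 proof (cases "z = y")
  case True
  then have "K + h' s <= 0" using Q by auto
  then show False using K0 h(4)[OF sI] by simp
 next
  case False
  then have main: "K + h' s <= \<bar>4 * c * d ^ 3\<bar> * (10 * qC c d D * D + outr D (%z. u (s, z)) z)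
    + nu * (\<bar>4 * c * d ^ 3\<bar> / D + 8 * qC c d D)" using Q unfolding d_def by auto
  have P: "\<bar>4 * c * d ^ 3\<bar> <= 8 * M / D"
  proof -
   have "\<bar>4 * c * d ^ 3\<bar> = 4 * c * \<bar>d\<bar> ^ 3" using c by (simp add: abs_mult power_abs)
   also have "... <= 4 * c * D ^ 3" using c dD by (intro mult_left_mono power_mono) auto
   also have "... = 8 * M / D" using D by (simp add: c_def field_simps eval_nat_numeral)
   finally show ?thesis .
  qed
  have C: "qC c d D <= 22 * M / D^2"
  proof -
   have "qC c d D <= qC c D D" using c D dD by (intro qC_mono) auto
   also have "... = 22 * M / D^2" using D by (simp add: qC_def c_def field_simps eval_nat_numeral)
   finally show ?thesis .
  qed
  have O: "outr D (%z. u (s, z)) z <= 4 * M / D"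
  proof -
   have "(%z. u (s, z)) : borel_measurable borel" by (rule usc_slice_measurable[OF usc]) (use sz in auto)
   then have "\<bar>outr D (%z. u (s, z)) z\<bar> <= 4 * M / D" by (intro outr_bound D M sz)
   then show ?thesis by simp
  qed
  have "10 * qC c d D * D <= 10 * (22 * M / D^2) * D" using C D by (intro mult_right_mono mult_left_mono) auto
  also have "... = 220 * M / D" using D by (simp add: power2_eq_square)
  finally have "10 * qC c d D * D + outr D (%z. u (s, z)) z <= 224 * M / D" using O by (simp add: add_divide_distrib[symmetric])
  then have "\<bar>4 * c * d ^ 3\<bar> * (10 * qC c d D * D + outr D (%z. u (s, z)) z) <= \<bar>4 * c * d ^ 3\<bar> * (224 * M / D)"
   by (intro mult_left_mono) auto
  also have "... <= (8 * M / D) * (224 * M / D)" using P M0 D by (intro mult_right_mono) auto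
  also have "... = 1792 * M^2 / D^2" by (simp add: power2_eq_square)
  finally have 1: "\<bar>4 * c * d ^ 3\<bar> * (10 * qC c d D * D + outr D (%z. u (s, z)) z) <= 1792 * M^2 / D^2" .
  have "\<bar>4 * c * d ^ 3\<bar> / D <= (8 * M / D) / D" using P D by (intro divide_right_mono) auto
  then have "\<bar>4 * c * d ^ 3\<bar> / D + 8 * qC c d D <= 8 * (M / D^2) + 8 * (22 * (M / D^2))"
   using C by (simp add: power2_eq_square)
  then have "\<bar>4 * c * d ^ 3\<bar> / D + 8 * qC c d D <= 184 * M / D^2" by simp
  then have "nu * (\<bar>4 * c * d ^ 3\<bar> / D + 8 * qC c d D) <= nu * (184 * M / D^2)" using nu by (intro mult_left_mono) auto
  then have "K <= 1792 * M^2 / D^2 + nu * (184 * M / D^2)" using main 1 h(4)[OF sI] by linarith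
  then show False using K by (simp add: add_divide_distrib mult_ac)
 qed
qed

text \<open>At a maximum of \<open>Phi\<close> each function is tested by the penalty with the other
  point frozen. Translating both space variables together leaves the penalty unchanged, so the far
  integrals cancel; so do the time derivatives of the penalty. There remains a bound for
  \<open>eta\<close> by the near integrals and the \<open>nu\<close> error, which contradicts
  \<open>small\<close>.\<close>

lemma doubling:
 fixes u w :: "real \<times> real => real"
 assumes qu: "qsub nu I u" and uscu: "usc_seq (J \<times> UNIV) u"
  and Mu: "!!t x. t : J ==> \<bar>u (t, x)\<bar> <= M" and M0: "M > 0" and nu: "nu >= 0"
  and qw: "qsub 0 {0<..} w" and uscw: "usc_seq HJ_cl w" and Mw: "!!p. p : HJ_cl ==> \<bar>w p\<bar> <= M"
  and IJ: "I \<subseteq> J" "J \<subseteq> {0..}"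
  and h: "continuous_on J h" "!!t. t : J ==> 0 <= h t" "C2fun I h h'" "!!t. t : I ==> 0 <= h' t"
  and eta: "eta > 0" and c: "c > 0" and theta: "theta >= 0"
  and cpt: "!!C. compact {t : J. eta * t + h t <= C}"
 defines "Phi \<equiv> %t x s y. u (t, x) + w (s, y) - c * (x - y) ^ 4 - c * (t - s)^2 - eta * t - h t"
 assumes start: "!!t x s y. t : J ==> s >= 0 ==> Phi t x s y > theta ==> t : I & s > 0"
  and inf: "!!t x s y. t : J ==> s >= 0 ==> Phi t x s y > theta ==> \<bar>x\<bar> <= R"
  and r: "0 < r" "r <= 1"
  and D: "D = 1 + 2 * M / c"
  and small: "80 * c * D ^ 3 * qC c D 1 * r + nu * (4 * c * D ^ 3 / r + 8 * qC c D 1) < eta"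
  and tJ: "t : J" and s0: "s >= 0"
 shows "Phi t x s y <= theta"
proof (rule ccontr)
 assume neg: "~ ?thesis"
 then have pos: "Phi t x s y > theta" by simp
 have D1: "D >= 1" using D M0 c by simp
 have close: "\<bar>x - y\<bar> <= D & \<bar>t - s\<bar> <= D & eta * t + h t <= 2 * M"
  if "t : J" "s >= 0" "Phi t x s y > theta" for t x s y
 proof -
  have "u (t, x) <= M" "w (s, y) <= M" using Mu[OF that(1), of x] Mw[of "(s, y)"] that by (auto simp: abs_le_iff)
  moreover have nn: "0 <= eta * t" "0 <= h t" "0 <= c * (x - y) ^ 4" "0 <= c * (t - s)^2"
   using that IJ h(2) c eta by auto
  ultimately have *: "c * (x - y) ^ 4 <= 2 * M" "c * (t - s)^2 <= 2 * M" "eta * t + h t <= 2 * M"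
   using that(3) theta unfolding Phi_def by linarith+
  \<comment> \<open>Either \<open>|a| <= 1\<close> or the even power dominates \<open>|a|\<close>;
    this is the origin of the form of \<open>D\<close>.\<close>
  have **: "\<bar>a\<bar> <= D" if "c * a ^ k <= 2 * M" "even k" "k > 0" for a :: real and k :: nat
  proof (cases "\<bar>a\<bar> <= 1")
   case False
   have "\<bar>a\<bar> ^ 1 <= \<bar>a\<bar> ^ k" using False that(3) by (intro power_increasing) auto
   also have "... = a ^ k" using that(2) by (simp add: power_even_abs)
   also have "... <= 2 * M / c" using that(1) c by (simp add: field_simps)
   finally show ?thesis using D by simp
  qed (use D1 in auto)
  show ?thesis using **[OF *(1)] **[OF *(2)] *(3) by auto
 qed
 define F where "F p = u (fst p) + (w (snd p) + (- c * (snd (fst p) - snd (snd p)) ^ 4 - c * (fst (fst p) - fst (snd p))^2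
   - eta * fst (fst p) - h (fst (fst p))))" for p
 have F: "F ((t, x), (s, y)) = Phi t x s y" for t x s y by (simp add: F_def Phi_def)
 define T where "T = 2 * M / eta"
 define C where "C = ({t : J. eta * t + h t <= 2 * M} \<times> {-R..R}) \<times> ({0..T + D} \<times> {-R-D..R+D})"
 have inC: "((t, x), (s, y)) : C" if *: "t : J" "s >= 0" "Phi t x s y > theta" for t x s y
 proof -
  note cl = close[OF *] and xR = inf[OF *]
  have "eta * t <= 2 * M" using cl h(2)[OF *(1)] by linarith
  then have "t <= T" using eta by (simp add: T_def field_simps)
  then show ?thesis using cl xR * by (auto simp: C_def)
 qed
 have CC: "fst p : J \<times> UNIV" "snd p : HJ_cl" if "p : C" for p using that by (auto simp: C_def HJ_cl_def)
 have C1: "compact C" unfolding C_def by (intro compact_Times cpt) auto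
 have C2: "C ~= {}" using inC[OF tJ s0 pos] by auto
 have "continuous_on C (%p. - c * (snd (fst p) - snd (snd p)) ^ 4 - c * (fst (fst p) - fst (snd p))^2
   - eta * fst (fst p) - h (fst (fst p)))"
  by (intro continuous_intros continuous_on_compose2[OF h(1)]) (auto simp: C_def)
 then have C3: "usc_seq C F" unfolding F_def
  by (intro usc_seq_add continuous_imp_usc_seq usc_seq_compose[OF uscu] usc_seq_compose[OF uscw])
    (auto intro!: continuous_intros CC)
 have ub: "Phi t x s y <= 2 * M" if "t : J" "s >= 0" for t x s y
 proof -
  have "u (t, x) <= M" "w (s, y) <= M" using Mu[OF that(1), of x] Mw[of "(s, y)"] that by (auto simp: abs_le_iff)
  moreover have nn: "0 <= eta * t" "0 <= h t" "0 <= c * (x - y) ^ 4" "0 <= c * (t - s)^2"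
   using that IJ h(2) c eta by auto
  ultimately show ?thesis unfolding Phi_def by linarith
 qed
 have C4: "bdd_above (F ` C)"
  by (rule bdd_aboveI2[of _ _ "2 * M"]) (auto simp: C_def F intro!: ub)
 obtain p where p: "p : C" "!!q. q : C ==> F q <= F p" using usc_seq_attains_max[OF C3 C1 C2 C4] by blast
 obtain t1 x1 s1 y1 where p1: "p = ((t1, x1), (s1, y1))" "t1 : J" "s1 >= 0" using p by (auto simp: C_def)
 have max: "Phi t x s y <= Phi t1 x1 s1 y1" if "t : J" "s >= 0" for t x s y
 proof (cases "Phi t x s y > theta")
  case True then show ?thesis using p(2)[OF inC[OF that True]] p1 by (simp add: F)
 next
  case False
  then show ?thesis using p(2)[OF inC[OF tJ s0 pos]] p1 pos by (simp add: F)
 qed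
 have pos1: "Phi t1 x1 s1 y1 > theta" using max[OF tJ s0, of x y] pos by simp
 have I1: "t1 : I" "s1 > 0" using start[OF p1(2,3) pos1] by auto
 define d where "d = x1 - y1"
 have dD: "\<bar>d\<bar> <= D" using close[OF p1(2,3) pos1] by (simp add: d_def)
 have gu: "C2fun I (%t. c * (t - s1)^2 + (eta * t + h t)) (%t. c * (2 * (t - s1)) + (eta * 1 + h' t))"
  by (intro C2fun_add C2fun_cmult C2fun_id C2fun_pow2 h)
 have cu: "\<forall>s'\<in>I. \<forall>z'. u (s', z') - c * (z' - y1) ^ 4 - (c * (s' - s1)^2 + (eta * s' + h s')) <= u (t1, x1) - c * (x1 - y1) ^ 4 - (c * (t1 - s1)^2 + (eta * t1 + h t1))"
 proof (intro ballI allI)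
  fix s' z' assume "s' : I"
  then have "Phi s' z' s1 y1 <= Phi t1 x1 s1 y1" using IJ p1 by (intro max) auto
  then show "u (s', z') - c * (z' - y1) ^ 4 - (c * (s' - s1)^2 + (eta * s' + h s')) <= u (t1, x1) - c * (x1 - y1) ^ 4 - (c * (t1 - s1)^2 + (eta * t1 + h t1))"
   by (simp add: Phi_def)
 qed
 have gw: "C2fun {0<..} (%s. c * (s - t1)^2) (%s. c * (2 * (s - t1)))"
  by (intro C2fun_cmult C2fun_pow2)
 have cw: "\<forall>s'\<in>{0<..}. \<forall>z'. w (s', z') - c * (z' - x1) ^ 4 - c * (s' - t1)^2 <= w (s1, y1) - c * (y1 - x1) ^ 4 - c * (s1 - t1)^2"
 proof (intro ballI allI)
  fix s' z' :: real assume s': "s' : {0<..}"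
  then have "Phi t1 x1 s' z' <= Phi t1 x1 s1 y1" using p1 by (intro max) auto
  moreover have "(z' - x1) ^ 4 = (x1 - z') ^ 4" "(y1 - x1) ^ 4 = (x1 - y1) ^ 4" by algebra+
  ultimately show "w (s', z') - c * (z' - x1) ^ 4 - c * (s' - t1)^2 <= w (s1, y1) - c * (y1 - x1) ^ 4 - c * (s1 - t1)^2"
   by (simp add: Phi_def power2_commute)
 qed
 have s1': "s1 : {0<..}" using I1 by simp
 note Qu = qu[unfolded qsub_def, rule_format, OF c r(1) I1(1) gu cu[rule_format]]
 note Qw = qw[unfolded qsub_def, rule_format, OF c r(1) s1' gw cw[rule_format]]
 have h1: "h' t1 >= 0" by (rule h(4)[OF I1(1)])
 show False
 proof (cases "x1 = y1")
  case True
  then have "c * (2 * (t1 - s1)) + (eta * 1 + h' t1) <= 0" "c * (2 * (s1 - t1)) <= 0" using Qu Qw by auto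
  then show False using h1 eta by (simp add: algebra_simps)
 next
  case False
  define P where "P = \<bar>4 * c * d ^ 3\<bar>"
  have P': "\<bar>4 * c * (y1 - x1) ^ 3\<bar> = P"
  proof -
   have "4 * c * (y1 - x1) ^ 3 = - (4 * c * d ^ 3)" unfolding d_def by algebra
   then show ?thesis by (simp add: P_def)
  qed
  have C': "qC c (y1 - x1) r = qC c d r" by (simp add: qC_def d_def power2_commute abs_minus_commute)
  have 1: "c * (2 * (t1 - s1)) + (eta * 1 + h' t1) <= P * (10 * qC c d r * r + outr r (%z. u (t1, z)) x1)
    + nu * (P / r + 8 * qC c d r)" using Qu False by (simp add: P_def d_def)
  have 2: "c * (2 * (s1 - t1)) <= P * (10 * qC c d r * r + outr r (%z. w (s1, z)) y1)"
   using Qw False unfolding P' C' by simp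
  have um: "(%z. u (t1, z)) : borel_measurable borel" by (rule usc_slice_measurable[OF uscu]) (use p1 in auto)
  have wm: "(%z. w (s1, z)) : borel_measurable borel" by (rule usc_slice_measurable[OF uscw]) (use p1 in auto)
  \<comment> \<open>The maximum is compared with the point at which both space variables are shifted
    by \<open>z\<close>.\<close>
  have 3: "outr r (%z. u (t1, z)) x1 <= outr r (%z. - w (s1, z)) y1"
  proof (rule outr_mono[OF r(1) um Mu[OF p1(2)]])
   show "(%z. - w (s1, z)) : borel_measurable borel" using wm by measurable
   show "\<bar>- w (s1, x)\<bar> <= M" for x using Mw[of "(s1, x)"] p1 by simp
   show "u (t1, x1 + z) - u (t1, x1) <= - w (s1, y1 + z) - - w (s1, y1)" for z
    using max[OF p1(2,3), of "x1 + z" "y1 + z"] by (simp add: Phi_def)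
  qed
  have P0: "P >= 0" by (simp add: P_def)
  have P3: "P * outr r (%z. u (t1, z)) x1 + P * outr r (%z. w (s1, z)) y1 <= 0"
   using mult_left_mono[OF 3 P0] outr_uminus[of r "%z. w (s1, z)" y1] by simp
  have le: "eta <= P * (20 * qC c d r * r) + nu * (P / r + 8 * qC c d r)"
   using 1 2 P3 h1 by (simp add: algebra_simps)
  have PD: "P <= 4 * c * D ^ 3"
  proof -
   have "P = 4 * c * \<bar>d\<bar> ^ 3" using c by (simp add: P_def abs_mult power_abs)
   also have "... <= 4 * c * D ^ 3" using c dD by (intro mult_left_mono power_mono) auto
   finally show ?thesis .
  qed
  have CD: "qC c d r <= qC c D 1" "0 <= qC c d r"
  proof -
   have "qC c d r <= qC c D r" using c r dD by (intro qC_mono) auto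
   also have "... <= qC c D 1" unfolding qC_def using c r D1
    by (intro mult_left_mono add_mono power_mono) (auto simp: power_le_one)
   finally show "qC c d r <= qC c D 1" .
   show "0 <= qC c d r" using c r by (simp add: qC_def)
  qed
  \<comment> \<open>Two near integrals with factor 10 and a slope of at most
    \<open>4 * c * D ^ 3\<close> account for the 80 in \<open>small\<close>.\<close>
  have "P * (20 * qC c d r * r) <= (4 * c * D ^ 3) * (20 * qC c D 1 * r)"
   using PD CD r c D1 by (intro mult_mono) auto
  moreover have "nu * (P / r + 8 * qC c d r) <= nu * (4 * c * D ^ 3 / r + 8 * qC c D 1)"
   using PD CD r nu by (intro mult_left_mono add_mono divide_right_mono) auto
  ultimately show False using le small by (simp add: mult_ac)
 qed
qed

section \<open>The comparison principle\<close>

text \<open>These are the properties of the distribution function of an atomless finite signed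
  measure that are used; \<open>M\<close> is any bound, not the least one.\<close>

definition datum :: "real => (real => real) => bool" where
 "datum M u0 \<longleftrightarrow> continuous_on UNIV u0 & (\<exists>l. (u0 \<longlongrightarrow> l) at_bot) & (\<exists>l. (u0 \<longlongrightarrow> l) at_top) &
   (\<forall>x. \<bar>u0 x\<bar> <= M) & M > 0"

lemma datum_uminus: "datum M u0 ==> datum M (%x. - u0 x)"
 unfolding datum_def by (auto intro!: continuous_intros tendsto_minus)

lemma datum_ends:
 assumes "datum M u0"
 obtains l0 l1 where "!!e. e > 0 ==> \<exists>R>0. (\<forall>x\<le>-R. \<bar>u0 x - l0\<bar> <= e) & (\<forall>x\<ge>R. \<bar>u0 x - l1\<bar> <= e)"
proof -
 obtain l0 l1 where l: "(u0 \<longlongrightarrow> l0) at_bot" "(u0 \<longlongrightarrow> l1) at_top"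
  using assms by (auto simp: datum_def)
 show ?thesis
 proof (rule that[of l0 l1])
  fix e :: real assume e: "e > 0"
  have "eventually (%x. dist (u0 x) l0 < e) at_bot" "eventually (%x. dist (u0 x) l1 < e) at_top"
   using l e by (auto simp: tendsto_iff)
  then obtain a b where a: "!!x. x <= a ==> dist (u0 x) l0 < e" and b: "!!x. x >= b ==> dist (u0 x) l1 < e"
   by (auto simp: eventually_at_bot_linorder eventually_at_top_linorder)
  have "\<forall>x\<le>-(\<bar>a\<bar> + \<bar>b\<bar> + 1). \<bar>u0 x - l0\<bar> <= e"
  proof (intro allI impI)
   fix x assume "x <= -(\<bar>a\<bar> + \<bar>b\<bar> + 1)"
   then have "x <= a" by linarith
   then show "\<bar>u0 x - l0\<bar> <= e" using a[of x] by (simp add: dist_real_def)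
  qed
  moreover have "\<forall>x\<ge>\<bar>a\<bar> + \<bar>b\<bar> + 1. \<bar>u0 x - l1\<bar> <= e"
  proof (intro allI impI)
   fix x assume "x >= \<bar>a\<bar> + \<bar>b\<bar> + 1"
   then have "x >= b" by linarith
   then show "\<bar>u0 x - l1\<bar> <= e" using b[of x] by (simp add: dist_real_def)
  qed
  ultimately show "\<exists>R>0. (\<forall>x\<le>-R. \<bar>u0 x - l0\<bar> <= e) & (\<forall>x\<ge>R. \<bar>u0 x - l1\<bar> <= e)"
   by (intro exI[of _ "\<bar>a\<bar> + \<bar>b\<bar> + 1"]) auto
 qed
qed

text \<open>Compactness treats \<open>{-R-1..R+1}\<close>; farther out the values are close to the
  limits. The margin 1 together with a distance of at most 1 puts both points into one of the three
  regions.\<close>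

lemma datum_uniform:
 assumes u0: "datum M u0" and e: "e > 0"
 obtains delta where "delta > 0" "!!x y. \<bar>x - y\<bar> <= delta ==> \<bar>u0 x - u0 y\<bar> <= e"
proof -
 obtain l0 l1 R where R: "R > 0" "!!x. x <= -R ==> \<bar>u0 x - l0\<bar> <= e/2" "!!x. x >= R ==> \<bar>u0 x - l1\<bar> <= e/2"
  using datum_ends[OF u0] e by (metis half_gt_zero)
 have "uniformly_continuous_on {-R-1..R+1} u0"
  using u0 by (intro compact_uniformly_continuous) (auto simp: datum_def intro: continuous_on_subset)
 then obtain d where d: "d > 0" "!!x y. x : {-R-1..R+1} ==> y : {-R-1..R+1} ==> dist y x < d ==> dist (u0 y) (u0 x) < e"
  using e unfolding uniformly_continuous_on_def by metis
 show ?thesis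
 proof (rule that[of "min 1 (d/2)"])
  show "min 1 (d/2) > 0" using d by simp
  fix x y :: real assume xy: "\<bar>x - y\<bar> <= min 1 (d/2)"
  consider "x : {-R-1..R+1}" "y : {-R-1..R+1}" | "x <= -R" "y <= -R" | "x >= R" "y >= R"
   using xy R(1) by fastforce
  then show "\<bar>u0 x - u0 y\<bar> <= e"
  proof cases
   case 1
   then show ?thesis using d(2)[of y x] xy d(1) by (auto simp: dist_real_def)
  next
   case 2
   then show ?thesis using R(2)[of x] R(2)[of y] by linarith
  next
   case 3
   then show ?thesis using R(3)[of x] R(3)[of y] by linarith
  qed
 qed
qed

text \<open>
 Local control by the initial datum. Small \<open>t\<close> gives attainment of the initial datum, large \<open>D\<close>
 gives the limits at infinity; \<open>sig\<close> is the initial error of a particle system.\<close>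

definition local_bound :: "real => real => real => (real => real) => real => (real \<times> real => real) => bool" where
 "local_bound B sig M u0 T U \<longleftrightarrow> (\<forall>t\<in>{0..T}. \<forall>x. \<bar>U (t, x)\<bar> <= M) &
   (\<forall>t\<in>{0..T}. \<forall>y D A. D > 0 --> A >= - M --> (\<forall>x. \<bar>x - y\<bar> <= D --> u0 x <= A) --> U (t, y) <= A + sig + B * t / D^2)"

text \<open>\<open>t0\<close> depends on the datum, \<open>B\<close> and \<open>e\<close> alone, so
  it serves all particle systems, and all subsolutions in Perron's method, at once.\<close>

lemma local_bound_initial:
 assumes u0: "datum M u0" and B: "B >= 0" and e: "e > 0"
 obtains t0 where "t0 > 0" "!!U sig T t x. local_bound B sig M u0 T U ==> t : {0..T} ==> t <= t0 ==> U (t, x) <= u0 x + sig + e"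
proof -
 obtain D where D: "D > 0" "!!x y. \<bar>x - y\<bar> <= D ==> \<bar>u0 x - u0 y\<bar> <= e/2" using datum_uniform[OF u0, of "e/2"] e by auto
 show ?thesis
 proof (rule that[of "e / 2 * D^2 / (B + 1)"])
  show "0 < e / 2 * D^2 / (B + 1)" using e D B by auto
  fix U sig T t x assume U: "local_bound B sig M u0 T U" and t: "t : {0..T}" "t <= e / 2 * D^2 / (B + 1)"
  have "\<bar>u0 x\<bar> <= M" using u0 by (simp add: datum_def)
  then have "- M <= u0 x + e/2" using e by linarith
  moreover have "u0 z <= u0 x + e/2" if "\<bar>z - x\<bar> <= D" for z using D(2)[OF that] by linarith
  ultimately have "U (t, x) <= (u0 x + e/2) + sig + B * t / D^2"
   using U t(1) D(1) unfolding local_bound_def by blast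
  moreover have "B * t / D^2 <= e / 2"
  proof -
   have "B * t <= (B + 1) * t" using t by (auto simp: algebra_simps)
   also have "... <= e / 2 * D^2" using t(2) B by (simp add: field_simps)
   finally show ?thesis using D(1) by (simp add: field_simps)
  qed
  ultimately show "U (t, x) <= u0 x + sig + e" by linarith
 qed
qed

text \<open>\<open>R\<close> is uniform in \<open>U\<close>, \<open>sig\<close> and
  \<open>T\<close>. Far out the datum is almost constant within distance \<open>D\<close>, and
  \<open>D\<close> is so large that the growth \<open>B * t / D^2\<close> stays small up to time
  \<open>T0\<close>.\<close>

lemma local_bound_infinity:
 assumes u0: "datum M u0" and B: "B >= 0" and e: "e > 0"
  and ends: "!!e. e > 0 ==> \<exists>R>0. (\<forall>x\<le>-R. \<bar>u0 x - l0\<bar> <= e) & (\<forall>x\<ge>R. \<bar>u0 x - l1\<bar> <= e)"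
 obtains R where "R > 0"
  "!!U sig T t x. local_bound B sig M u0 T U ==> t : {0..T} ==> t <= T0 ==> x <= - R ==> U (t, x) <= l0 + sig + e"
  "!!U sig T t x. local_bound B sig M u0 T U ==> t : {0..T} ==> t <= T0 ==> x >= R ==> U (t, x) <= l1 + sig + e"
proof -
 obtain R0 where R0: "R0 > 0" "!!x. x <= -R0 ==> \<bar>u0 x - l0\<bar> <= e/4" "!!x. x >= R0 ==> \<bar>u0 x - l1\<bar> <= e/4"
  using ends[of "e/4"] e by auto
 define D where "D = 1 + B * \<bar>T0\<bar> / (e/2)"
 have D1: "D >= 1" using B e by (auto simp: D_def)
 have small: "B * t / D^2 <= e/2" if "t >= 0" "t <= T0" for t
 proof -
  have "B * t <= B * \<bar>T0\<bar>" using that B by (intro mult_left_mono) auto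
  also have "... <= e/2 * D" using e by (simp add: D_def field_simps)
  also have "... <= e/2 * D^2" using D1 e by (intro mult_left_mono) (auto simp: power2_eq_square)
  finally show ?thesis using D1 by (simp add: field_simps)
 qed
 have bd: "\<bar>u0 x\<bar> <= M" for x using u0 by (simp add: datum_def)
 have l0: "- M <= l0 + e/4" using R0(2)[of "-R0"] bd[of "-R0"] by linarith
 have l1: "- M <= l1 + e/4" using R0(3)[of "R0"] bd[of "R0"] by linarith
 show ?thesis
 proof (rule that[of "R0 + D"])
  show "R0 + D > 0" using R0 D1 by simp
  fix U sig T t x assume U: "local_bound B sig M u0 T U" and t: "t : {0..T}" "t <= T0"
  note U' = U[unfolded local_bound_def, THEN conjunct2, rule_format, OF t(1)]
  have sm: "B * t / D^2 <= e/2" using small t by auto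
  show "U (t, x) <= l0 + sig + e" if x: "x <= - (R0 + D)"
  proof -
   have "u0 z <= l0 + e/4" if "\<bar>z - x\<bar> <= D" for z using R0(2)[of z] that x by (smt (verit))
   then have "U (t, x) <= (l0 + e/4) + sig + B * t / D^2" using D1 by (intro U' l0) auto
   then show ?thesis using sm e by linarith
  qed
  show "U (t, x) <= l1 + sig + e" if x: "x >= R0 + D"
  proof -
   have "u0 z <= l1 + e/4" if "\<bar>z - x\<bar> <= D" for z using R0(3)[of z] that x by (smt (verit))
   then have "U (t, x) <= (l1 + e/4) + sig + B * t / D^2" using D1 by (intro U' l1) auto
   then show ?thesis using sm e by linarith
  qed
 qed
qed

section \<open>Confinement of the maximum in the doubling argument\<close>

lemma pen_close:
 fixes a c :: real
 assumes "c * a ^ k <= 2 * M" "even k" "k > 0" "c >= 2 * M / delta ^ k" "delta > 0" "M > 0"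
 shows "\<bar>a\<bar> <= delta"
proof -
 have c: "c > 0" using assms by (smt (verit) divide_pos_pos zero_less_power)
 have "\<bar>a\<bar> ^ k = a ^ k" using assms(2) by (simp add: power_even_abs)
 also have "... <= 2 * M / c" using assms(1) c by (simp add: field_simps)
 also have "... <= delta ^ k" using assms(4,5) c by (simp add: field_simps)
 finally show ?thesis using assms(3,5) by (subst (asm) power_mono_iff) auto
qed

text \<open>Near time 0 the two functions are at most slightly above \<open>u0\<close> and
  \<open>- u0\<close>, near infinity slightly above opposite constants, so their sum cannot exceed
  \<open>theta\<close> there. \<open>c\<close> and \<open>R\<close> are chosen before
  \<open>U\<close>, \<open>W\<close> and \<open>sig\<close>; particle systems of all sizes share
  them.\<close>

lemma penalty_confines:
 assumes u0: "datum M u0" and B: "B >= 0" and eta: "eta > 0" and theta: "theta > 0"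
 obtains c R where "c > 0"
  "!!U W sig T t x s y. sig <= theta / 2 ==> local_bound B sig M u0 T U ==> (!!S. local_bound B 0 M (%x. - u0 x) S W) ==> t : {0..T} ==> s >= 0 ==>
   U (t, x) + W (s, y) - c * (x - y) ^ 4 - c * (t - s)^2 - eta * t > theta ==> t > 0 & s > 0 & \<bar>x\<bar> <= R"
proof -
 have M: "M > 0" using u0 by (simp add: datum_def)
 \<comment> \<open>Of the eight parts of \<open>theta\<close>, \<open>sig\<close> takes up to four;
   the two one-sided errors and the oscillation of \<open>u0\<close> take one each.\<close>
 define e where "e = theta / 8"
 have e: "e > 0" using theta by (simp add: e_def)
 note v0 = datum_uminus[OF u0]
 obtain t1 where t1: "t1 > 0" "!!U sig T t x. local_bound B sig M u0 T U ==> t : {0..T} ==> t <= t1 ==> U (t, x) <= u0 x + sig + e"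
  using local_bound_initial[OF u0 B e] by metis
 obtain t2 where t2: "t2 > 0" "!!U sig T t x. local_bound B sig M (%x. - u0 x) T U ==> t : {0..T} ==> t <= t2 ==> U (t, x) <= - u0 x + sig + e"
  using local_bound_initial[OF v0 B e] by metis
 obtain delta where delta: "delta > 0" "!!x y. \<bar>x - y\<bar> <= delta ==> \<bar>u0 x - u0 y\<bar> <= e" using datum_uniform[OF u0 e] by auto
 obtain l0 l1 where l: "!!e. e > 0 ==> \<exists>R>0. (\<forall>x\<le>-R. \<bar>u0 x - l0\<bar> <= e) & (\<forall>x\<ge>R. \<bar>u0 x - l1\<bar> <= e)"
  using datum_ends[OF u0] by blast
 have l': "\<exists>R>0. (\<forall>x\<le>-R. \<bar>- u0 x - - l0\<bar> <= e) & (\<forall>x\<ge>R. \<bar>- u0 x - - l1\<bar> <= e)" if "e > 0" for e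
  using l[OF that] by (simp add: abs_minus_commute)
 \<comment> \<open>\<open>eta * t <= 2 * M\<close> bounds \<open>t\<close>, and the summand 1
   accounts for \<open>|t - s| <= d <= 1\<close>.\<close>
 define T0 where "T0 = 2 * M / eta + 1"
 obtain R1 where R1: "R1 > 0"
  "!!U sig T t x. local_bound B sig M u0 T U ==> t : {0..T} ==> t <= T0 ==> x <= - R1 ==> U (t, x) <= l0 + sig + e"
  "!!U sig T t x. local_bound B sig M u0 T U ==> t : {0..T} ==> t <= T0 ==> x >= R1 ==> U (t, x) <= l1 + sig + e"
  using local_bound_infinity[OF u0 B e l, where ?T0.0 = T0] by metis
 obtain R2 where R2: "R2 > 0"
  "!!U sig T t x. local_bound B sig M (%x. - u0 x) T U ==> t : {0..T} ==> t <= T0 ==> x <= - R2 ==> U (t, x) <= - l0 + sig + e"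
  "!!U sig T t x. local_bound B sig M (%x. - u0 x) T U ==> t : {0..T} ==> t <= T0 ==> x >= R2 ==> U (t, x) <= - l1 + sig + e"
  using local_bound_infinity[OF v0 B e l', where ?T0.0 = T0] by metis
 define d where "d = min 1 (min delta (min t1 t2))"
 have d: "d > 0" "d <= 1" "d <= delta" "d <= t1" "d <= t2" using delta t1 t2 by (auto simp: d_def)
 \<comment> \<open>One strength for both powers of the penalty, since \<open>d <= 1\<close> gives
   \<open>d ^ 4 <= d ^ 2\<close>.\<close>
 define c where "c = 2 * M / d ^ 4"
 have c: "c > 0" "c >= 2 * M / d ^ 4" "c >= 2 * M / d ^ 2"
 proof -
  have "d ^ 4 <= d ^ 2" using d by (intro power_decreasing) auto
  then show "c >= 2 * M / d ^ 2" unfolding c_def using M d by (intro divide_left_mono) auto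
 qed (use M d in \<open>auto simp: c_def\<close>)
 show ?thesis
 proof (rule that[of c "R1 + R2 + 1"])
  show "c > 0" by fact
  fix U W sig T t x s y
  assume sig: "sig <= theta / 2" and U: "local_bound B sig M u0 T U" and W: "!!S. local_bound B 0 M (%x. - u0 x) S W"
   and t: "t : {0..T}" and s: "s >= 0"
   and Phi: "U (t, x) + W (s, y) - c * (x - y) ^ 4 - c * (t - s)^2 - eta * t > theta"
  have Ws: "local_bound B 0 M (%x. - u0 x) s W" "s : {0..s}" using W s by auto
  have "U (t, x) <= M" "W (s, y) <= M" using U Ws t unfolding local_bound_def by (auto simp: abs_le_iff)
  moreover have nn: "0 <= eta * t" "0 <= c * (x - y) ^ 4" "0 <= c * (t - s)^2" using t eta c by auto
  ultimately have 1: "c * (x - y) ^ 4 <= 2 * M" "c * (t - s)^2 <= 2 * M" "eta * t <= 2 * M" using Phi theta by linarith+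
  have xy: "\<bar>x - y\<bar> <= d" by (rule pen_close[OF 1(1) _ _ c(2) d(1) M]) auto
  have ts: "\<bar>t - s\<bar> <= d" by (rule pen_close[OF 1(2) _ _ c(3) d(1) M]) auto
  have UW: "U (t, x) + W (s, y) > theta" using Phi nn by linarith
  have pos: "t > 0 & s > 0"
  proof (rule ccontr)
   assume "~ (t > 0 & s > 0)"
   then have "t <= d" "s <= d" using ts t s by auto
   then have "U (t, x) <= u0 x + sig + e" "W (s, y) <= - u0 y + 0 + e"
    using t1(2)[OF U t] t2(2)[OF Ws] d by auto
   moreover have "\<bar>u0 x - u0 y\<bar> <= e" using delta(2) xy d by auto
   ultimately show False using UW sig e unfolding e_def by linarith
  qed
  moreover have "\<bar>x\<bar> <= R1 + R2 + 1"
  proof (rule ccontr)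
   assume x: "~ \<bar>x\<bar> <= R1 + R2 + 1"
   have "t <= 2 * M / eta" using 1(3) eta by (simp add: field_simps)
   then have tT: "t <= T0" "s <= T0" using ts d(2) unfolding T0_def by linarith+
   consider "x <= - R1" "y <= - R2" | "x >= R1" "y >= R2" using x xy d(2) R1(1) R2(1) by linarith
   then show False
   proof cases
    case 1
    then show False using R1(2)[OF U t tT(1), of x] R2(2)[OF Ws tT(2), of y] UW sig e unfolding e_def by linarith
   next
    case 2
    then show False using R1(3)[OF U t tT(1), of x] R2(3)[OF Ws tT(2), of y] UW sig e unfolding e_def by linarith
   qed
  qed
  ultimately show "t > 0 & s > 0 & \<bar>x\<bar> <= R1 + R2 + 1" by blast
 qed
qed

section \<open>Subsolutions up to the initial time and their comparison\<close>

text \<open>Semicontinuity on \<open>HJ_cl\<close> includes the initial line, so that maxima may be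
  attained at time 0, where only the inequality with the datum is known.\<close>

definition ext_sub :: "real => (real => real) => (real \<times> real => real) => bool" where
 "ext_sub M u0 U \<longleftrightarrow> usc_seq HJ_cl U & (\<forall>p\<in>HJ_cl. \<bar>U p\<bar> <= M) & qsub 0 {0<..} U & (\<forall>x. U (0, x) <= u0 x)"

lemma qsub_cong:
 assumes "qsub nu I u" "!!t x. t : I ==> v (t, x) = u (t, x)"
 shows "qsub nu I v"
proof -
 have "(%z. v (t, z)) = (%z. u (t, z))" if "t : I" for t using assms(2)[OF that] by auto
 then show ?thesis using assms unfolding qsub_def by simp
qed

lemma subsolution_ext_sub:
 assumes w: "HJ_subsolution rho w" and rho: "rho > 0" and M: "!!p. p : HJ_dom ==> \<bar>w p\<bar> <= M"
  and u0: "!!x. usc_env w (0, x) <= u0 x"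
 shows "ext_sub M u0 (usc_env w)"
proof -
 have "usc_on_dom w" using w by (simp add: HJ_subsolution_def)
 then have "usc_env w (t, x) = w (t, x)" if "t : {0<..}" for t x
  using that by (intro usc_env_eq[OF M]) auto
 then have "qsub 0 {0<..} (usc_env w)" by (rule qsub_cong[OF subsolution_imp_qsub[OF w rho]])
 then show ?thesis using usc_env_seq_usc(1)[of w M, OF M] usc_env_bound[of w M, OF M] u0
  by (auto simp: ext_sub_def)
qed

text \<open>\<open>barrier\<close> with \<open>nu = 0\<close> and \<open>h = 0\<close>; 1800 exceeds
  its 1792. At time 0, points farther than \<open>D\<close> from \<open>y\<close> are covered
  because the quartic is at least \<open>2 * M\<close> there and \<open>A >= - M\<close>.\<close>

lemma ext_sub_local_bound:
 assumes U: "ext_sub M u0 U" and M: "M > 0"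
 shows "local_bound (1800 * M^2) 0 M u0 T U"
 unfolding local_bound_def
proof (intro conjI ballI allI impI)
 show "\<bar>U (t, x)\<bar> <= M" if "t : {0..T}" for t x using U that by (auto simp: ext_sub_def)
 fix t y D A assume t: "t : {0..T}" and D: "D > 0" and A: "- M <= A" and loc: "\<forall>x. \<bar>x - y\<bar> <= D --> u0 x <= A"
 have cl: "HJ_cl = {0..} \<times> UNIV" by (simp add: HJ_cl_def)
 define K where "K = 1800 * M^2 / D^2"
 have K: "K > 0" using M D by (simp add: K_def)
 have "U (t, y) <= A + 2 * M * ((y - y) / D) ^ 4 + K * t + 0"
 proof (rule barrier[where nu = 0 and I = "{0<..}" and J = "{0..}" and h' = "%_. 0" and h = "%_. 0" and M = M and D = D])
  show "qsub 0 {0<..} U" "usc_seq ({0..} \<times> UNIV) U" using U by (auto simp: ext_sub_def cl)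
  show "\<bar>U (t, x)\<bar> <= M" if "t : {0..}" for t x using U that by (auto simp: ext_sub_def)
  show "(1792 * M^2 + 184 * 0 * M) / D^2 < K" using M D unfolding K_def by (intro divide_strict_right_mono) auto
  show "compact {t : {0..}. K * t + 0 <= C}" for C
  proof -
   have "{t : {0..}. K * t + 0 <= C} = {0..C/K}" using K by (auto simp: field_simps)
   then show ?thesis by simp
  qed
  show "U (s, x) <= A + 2 * M * ((x - y) / D) ^ 4 + K * s" if "s : {0..} - {0<..}" for s x
  proof -
   have s: "s = 0" using that by auto
   show ?thesis
   proof (cases "\<bar>x - y\<bar> <= D")
    case True
    have "U (0, x) <= u0 x" using U by (auto simp: ext_sub_def)
    also have "... <= A" using True loc by blast
    also have "... <= A + 2 * M * ((x - y) / D) ^ 4" using M by simp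
    finally show ?thesis using s by simp
   next
    case False
    have "1 <= \<bar>(x - y) / D\<bar> ^ 4" using False D by (intro one_le_power) (auto simp: field_simps)
    also have "\<bar>(x - y) / D\<bar> ^ 4 = ((x - y) / D) ^ 4" by (rule power_even_abs) simp
    finally have "1 <= ((x - y) / D) ^ 4" .
    then have "2 * M * 1 <= 2 * M * ((x - y) / D) ^ 4" using M by (intro mult_left_mono) auto
    moreover have "U (0, x) <= M" using U by (auto simp: ext_sub_def abs_le_iff)
    ultimately show ?thesis using s A by simp
   qed
  qed
 qed (use M D A t C2fun_const in auto)
 then show "U (t, y) <= A + 0 + 1800 * M^2 * t / D^2" by (simp add: K_def)
qed

lemma small_choice:
 fixes K1 eta :: real
 assumes "K1 >= 0" "eta > 0"
 obtains r where "0 < r" "r <= 1" "K1 * r < eta"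
proof (rule that[of "min 1 (eta / (K1 + 1) / 2)"])
 have "K1 * min 1 (eta / (K1 + 1) / 2) <= K1 * (eta / (K1 + 1) / 2)" using assms by (intro mult_left_mono) auto
 also have "... < eta" using assms by (simp add: field_simps add_nonneg_pos)
 finally show "K1 * min 1 (eta / (K1 + 1) / 2) < eta" .
qed (use assms in auto)

text \<open>On the diagonal the penalty of \<open>doubling\<close> vanishes, which leaves
  \<open>theta + eta * t\<close> with arbitrary positive \<open>theta\<close> and
  \<open>eta\<close>.\<close>

lemma comparison:
 assumes u0: "datum M u0" and U: "ext_sub M u0 U" and W: "ext_sub M (%x. - u0 x) W" and t: "t >= 0"
 shows "U (t, x) + W (t, x) <= 0"
proof -
 have M: "M > 0" using u0 by (simp add: datum_def)
 have cl: "HJ_cl = {0..} \<times> UNIV" by (simp add: HJ_cl_def)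
 have main: "U (t, x) + W (t, x) <= theta + eta * t" if theta: "theta > 0" and eta: "eta > 0" for theta eta
 proof -
  have B: "1800 * M^2 >= 0" by simp
  obtain c R where c: "c > 0" and conf:
   "!!U W sig T t x s y. sig <= theta / 2 ==> local_bound (1800 * M^2) sig M u0 T U ==> (!!S. local_bound (1800 * M^2) 0 M (%x. - u0 x) S W) ==> t : {0..T} ==> s >= 0 ==>
   U (t, x) + W (s, y) - c * (x - y) ^ 4 - c * (t - s)^2 - eta * t > theta ==> t > 0 & s > 0 & \<bar>x\<bar> <= R"
   using penalty_confines[OF u0 B eta theta] by metis
  have conf': "t > 0 & s > 0 & \<bar>x\<bar> <= R" if "t : {0..}" "s >= 0"
   "U (t, x) + W (s, y) - c * (x - y) ^ 4 - c * (t - s)^2 - eta * t - 0 > theta" for t x s y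
   by (rule conf[OF _ ext_sub_local_bound[OF U M, of t] ext_sub_local_bound[OF W M]]) (use that theta in auto)
  define D where "D = 1 + 2 * M / c"
  have D1: "D >= 1" using M c by (simp add: D_def)
  obtain r where r: "0 < r" "r <= 1" "80 * c * D ^ 3 * qC c D 1 * r < eta"
   using small_choice[of "80 * c * D ^ 3 * qC c D 1" eta] eta c D1 by (auto simp: qC_def)
  have "U (t, x) + W (t, x) - c * (x - x) ^ 4 - c * (t - t)^2 - eta * t - 0 <= theta"
  proof (rule doubling[where nu = 0 and I = "{0<..}" and J = "{0..}" and h' = "%_. 0" and h = "%_. 0" and M = M and D = D and R = R and r = r])
   show "qsub 0 {0<..} U" "usc_seq ({0..} \<times> UNIV) U" "qsub 0 {0<..} W" "usc_seq HJ_cl W"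
    using U W by (auto simp: ext_sub_def cl)
   show "\<bar>U (t, x)\<bar> <= M" if "t : {0..}" for t x using U that by (auto simp: ext_sub_def)
   show "\<bar>W p\<bar> <= M" if "p : HJ_cl" for p using W that by (auto simp: ext_sub_def)
   show "compact {t : {0..}. eta * t + 0 <= C}" for C
   proof -
    have "{t : {0..}. eta * t + 0 <= C} = {0..C/eta}" using eta by (auto simp: field_simps)
    then show ?thesis by simp
   qed
   show "80 * c * D ^ 3 * qC c D 1 * r + 0 * (4 * c * D ^ 3 / r + 8 * qC c D 1) < eta" using r by simp
  qed (use M c theta eta r t C2fun_const conf' D_def in auto)
  then show ?thesis by simp
 qed
 show ?thesis
 proof (rule field_le_epsilon)
  fix e :: real assume e: "e > 0"
  have "e / 2 / (t + 1) * t <= e / 2" using e t by (simp add: field_simps)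
  moreover have "U (t, x) + W (t, x) <= e/2 + e/2/(t+1) * t" using e t by (intro main) auto
  ultimately show "U (t, x) + W (t, x) <= 0 + e" by linarith
 qed
qed

section \<open>Perron's method\<close>

lemma C2_linD:
 assumes f: "C2_on_dom f" and g: "C2_on_dom g"
 shows "C2_on_dom (%p. a * f p + b * g p)"
  and "!!t x. t > 0 ==> pd_t (%p. a * f p + b * g p) (t, x) = a * pd_t f (t, x) + b * pd_t g (t, x)"
  and "!!t x. t > 0 ==> pd_x (%p. a * f p + b * g p) (t, x) = a * pd_x f (t, x) + b * pd_x g (t, x)"
 using C2_on_dom_lin[OF f g] f g by (auto simp: C2_on_dom_def intro!: C1_on_dom_lin)

text \<open>Subtracting a multiple of this function makes a maximum strict.\<close>

definition bowl :: "real => real => real \<times> real => real" where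
 "bowl t0 x0 = (%(t, x). 1 * (x - x0) ^ 4 + (t - t0)^2)"

lemma C2_bowl:
 shows "C2_on_dom (bowl t0 x0)"
  and "t > 0 ==> pd_t (bowl t0 x0) (t, x) = 2 * (t - t0)"
  and "t > 0 ==> pd_x (bowl t0 x0) (t, x) = 4 * (x - x0) ^ 3"
 unfolding bowl_def using C2_on_dom_quartic[OF C2fun_pow2[of _ t0], where c = 1 and y = x0] by auto

lemma bowl_self: "bowl t0 x0 (t0, x0) = 0" by (simp add: bowl_def)

lemma bowl_far:
 assumes r: "r > 0"
 obtains mu where "mu > 0" "!!p. dist p (t0, x0) >= r ==> bowl t0 x0 p >= mu"
proof (rule that[of "min ((r/2)^2) ((r/2) ^ 4)"])
 show "min ((r/2)^2) ((r/2) ^ 4) > 0" using r by simp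
 fix p :: "real \<times> real" assume p: "dist p (t0, x0) >= r"
 obtain t x where tx: "p = (t, x)" by (cases p)
 note p
 also have "dist p (t0, x0) <= \<bar>t - t0\<bar> + \<bar>x - x0\<bar>"
  unfolding dist_prod_def dist_real_def tx using sqrt_sum_squares_le_sum_abs by fastforce
 finally have "\<bar>t - t0\<bar> >= r/2 \<or> \<bar>x - x0\<bar> >= r/2" by linarith
 then show "bowl t0 x0 p >= min ((r/2)^2) ((r/2) ^ 4)"
 proof
  assume "\<bar>t - t0\<bar> >= r/2"
  from power_mono[OF this, of 2] r have "(r/2)^2 <= (t - t0)^2" by simp
  moreover have "0 <= (x - x0) ^ 4" by simp
  ultimately show ?thesis
   using min.cobounded1[of "(r/2)^2" "(r/2) ^ 4"] unfolding tx bowl_def prod.case mult_1_left by linarith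
 next
  assume "\<bar>x - x0\<bar> >= r/2"
  from power_mono[OF this, of 4] r have "(r/2) ^ 4 <= (x - x0) ^ 4" by (simp add: power_even_abs)
  moreover have "0 <= (t - t0)^2" by simp
  ultimately show ?thesis
   using min.cobounded2[of "(r/2)^2" "(r/2) ^ 4"] unfolding tx bowl_def prod.case mult_1_left by linarith
 qed
qed

text \<open>The bowl adds \<open>gamma * z^4 / z^2\<close> to the integrand, and
  \<open>z^4 <= r^2 * z^2\<close> for \<open>|z| < r\<close>. Making a maximum strict thus costs an
  amount that disappears with \<open>gamma\<close>.\<close>

lemma inn_bowl:
 assumes f: "C2_on_dom f" and t: "t > 0" and r: "r > 0" and p: "p = pd_x f (t, x)"
 shows "\<bar>inn r (%y. 1 * f (t, y) + gamma * bowl t x (t, y)) x p - inn r (%y. f (t, y)) x p\<bar> <= \<bar>gamma\<bar> * (2 * r ^ 3)"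
proof -
 obtain K where K': "!!t' x' z. \<bar>t' - t\<bar> <= t/2 ==> \<bar>x' - x\<bar> <= 1 ==> \<bar>z\<bar> <= r ==>
   \<bar>f (t', x' + z) - f (t', x') - pd_x f (t', x') * z\<bar> <= K * z^2"
  using C2_on_dom_x_bound[OF f t] by metis
 have K: "\<bar>f (t, x + z) - f (t, x) - p * z\<bar> <= K * z^2" if "\<bar>z\<bar> < r" for z
  using K'[of t x z] that t p by auto
 have fm: "(%y. f (t, y)) : borel_measurable borel"
  using f t by (intro C1_on_dom_slice_measurable) (auto simp: C2_on_dom_def)
 have z4: "\<bar>z ^ 4\<bar> <= r^2 * z^2" if "\<bar>z\<bar> < r" for z
 proof -
  have "z^2 <= r^2" using power_mono[of "\<bar>z\<bar>" r 2] that by simp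
  then have "z^2 * z^2 <= r^2 * z^2" by (intro mult_right_mono) auto
  then show ?thesis by (simp add: power_add[symmetric])
 qed
 note i1 = inn_integrable[OF r fm K]
 note i2 = quad_integrable[OF r _ z4]
 have i2': "set_integrable lborel {-r<..<r} (%z. z ^ 4 / z^2)" "\<bar>LINT z:{-r<..<r}|lborel. z ^ 4 / z^2\<bar> <= 2 * r^2 * r"
  by (rule i2; measurable)+
 have eq: "(1 * f (t, x + z) + gamma * bowl t x (t, x + z) - (1 * f (t, x) + gamma * bowl t x (t, x)) - p * z) / z^2
   = (f (t, x + z) - f (t, x) - p * z) / z^2 + gamma * (z ^ 4 / z^2)" for z
  by (simp add: bowl_def add_divide_distrib diff_divide_distrib)
 have "inn r (%y. 1 * f (t, y) + gamma * bowl t x (t, y)) x p = inn r (%y. f (t, y)) x p + gamma * (LINT z:{-r<..<r}|lborel. z ^ 4 / z^2)"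
  unfolding inn_def eq
  by (subst set_integral_add(2)[OF i1 set_integrable_mult_right]) (use i2' in \<open>simp_all only: set_integral_mult_right simp_thms\<close>)
 then have "\<bar>inn r (%y. 1 * f (t, y) + gamma * bowl t x (t, y)) x p - inn r (%y. f (t, y)) x p\<bar> = \<bar>gamma\<bar> * \<bar>LINT z:{-r<..<r}|lborel. z ^ 4 / z^2\<bar>"
  by (simp add: abs_mult)
 also have "... <= \<bar>gamma\<bar> * (2 * r^2 * r)" by (intro mult_left_mono i2') auto
 finally show ?thesis by (simp add: power3_eq_cube power2_eq_square mult_ac)
qed

lemma touch:
 assumes f: "C1_on_dom f" and g: "C1_on_dom g" and p: "(t, x) : HJ_dom" and r: "r > 0"
  and le: "!!q. q : HJ_dom ==> dist q (t, x) < r ==> f (t, x) - g (t, x) <= f q - g q"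
 shows "pd_t f (t, x) = pd_t g (t, x)" and "pd_x f (t, x) = pd_x g (t, x)"
proof -
 have t: "t > 0" using p by simp
 have "pd_t f (t, x) - pd_t g (t, x) = 0"
 proof (rule DERIV_local_min[where d = "min r t"])
  show "((%s. f (s, x) - g (s, x)) has_real_derivative pd_t f (t, x) - pd_t g (t, x)) (at t)"
   by (intro DERIV_diff C1_on_domD f g t)
  show "\<forall>y. \<bar>t - y\<bar> < min r t --> f (t, x) - g (t, x) <= f (y, x) - g (y, x)"
   using t by (auto intro!: le simp: dist_Pair_Pair dist_real_def)
 qed (use r t in auto)
 then show "pd_t f (t, x) = pd_t g (t, x)" by simp
 have "pd_x f (t, x) - pd_x g (t, x) = 0"
 proof (rule DERIV_local_min[where d = r])
  show "((%y. f (t, y) - g (t, y)) has_real_derivative pd_x f (t, x) - pd_x g (t, x)) (at x)"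
   by (intro DERIV_diff C1_on_domD f g t)
  show "\<forall>y. \<bar>x - y\<bar> < r --> f (t, x) - g (t, x) <= f (t, y) - g (t, y)"
   using t by (auto intro!: le simp: dist_Pair_Pair dist_real_def)
 qed (use r in auto)
 then show "pd_x f (t, x) = pd_x g (t, x)" by simp
qed

text \<open>Semicontinuity gives an upper limit of \<open>Gk\<close> but no convergence. The
  functions \<open>max (Gk k z) (G z)\<close> do converge to \<open>G z\<close>, and their integrals
  are the majorants \<open>O'\<close>; this is a reverse Fatou lemma in a form convenient for limits
  of inequalities.\<close>

lemma far_upper_limit:
 fixes G :: "real => real" and Gk :: "nat => real => real"
 assumes r: "r > 0" and [measurable]: "!!k. Gk k : borel_measurable borel" "G : borel_measurable borel"
  and B: "!!k z. \<bar>Gk k z\<bar> <= B" "!!z. \<bar>G z\<bar> <= B"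
  and lim: "!!z a. G z < a ==> eventually (%k. Gk k z < a) sequentially"
 obtains O' where "!!k. (LINT z:far r|lborel. Gk k z / z^2) <= O' k" "O' ----> (LINT z:far r|lborel. G z / z^2)"
proof (rule that[of "%k. LINT z:far r|lborel. max (Gk k z) (G z) / z^2"])
 have Bm: "\<bar>max (Gk k z) (G z)\<bar> <= B" for k z using B(1)[of k z] B(2)[of z] by (auto simp: max_def)
 have B0: "B >= 0" using order_trans[OF abs_ge_zero B(2)] .
 have im: "set_integrable lborel (far r) (%z. max (Gk k z) (G z) / z^2)" for k
  by (rule far_integrable_bound(1)[OF r _ Bm]) measurable
 have ik: "set_integrable lborel (far r) (%z. Gk k z / z^2)" for k
  by (rule far_integrable_bound(1)[OF r _ B(1)]) measurable
 show "(LINT z:far r|lborel. Gk k z / z^2) <= (LINT z:far r|lborel. max (Gk k z) (G z) / z^2)" for k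
  by (intro set_integral_mono ik im) (auto intro!: divide_right_mono)
 show "(%k. LINT z:far r|lborel. max (Gk k z) (G z) / z^2) ----> (LINT z:far r|lborel. G z / z^2)"
  unfolding set_lebesgue_integral_def
 proof (rule integral_dominated_convergence[where w = "%z. B * (indicator (far r) z *\<^sub>R (1 / z^2))"])
  show "(%z. indicator (far r) z *\<^sub>R (G z / z^2)) : borel_measurable lborel" by measurable
  show "(%z. indicator (far r) z *\<^sub>R (max (Gk k z) (G z) / z^2)) : borel_measurable lborel" for k by measurable
  show "integrable lborel (%z. B * (indicator (far r) z *\<^sub>R (1 / z^2)))"
   using inverse_square_far(1)[OF r] unfolding set_integrable_def by (rule integrable_mult_right)
  show "AE z in lborel. (%k. indicator (far r) z *\<^sub>R (max (Gk k z) (G z) / z^2)) ----> indicator (far r) z *\<^sub>R (G z / z^2)"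
  proof (rule AE_I2)
   fix z
   have "(%k. max (Gk k z) (G z)) ----> G z"
   proof (rule order_tendstoI)
    show "eventually (%k. a < max (Gk k z) (G z)) sequentially" if "a < G z" for a
     using that by (intro always_eventually) auto
    show "eventually (%k. max (Gk k z) (G z) < a) sequentially" if "G z < a" for a
     using lim[OF that] by eventually_elim (use that in auto)
   qed
   then show "(%k. indicator (far r) z *\<^sub>R (max (Gk k z) (G z) / z^2)) ----> indicator (far r) z *\<^sub>R (G z / z^2)"
    unfolding divide_inverse by (intro tendsto_intros)
  qed
  show "AE z in lborel. norm (indicator (far r) z *\<^sub>R (max (Gk k z) (G z) / z^2)) <= B * (indicator (far r) z *\<^sub>R (1 / z^2))" for k
   using Bm B0 by (auto intro!: AE_I2 divide_right_mono split: split_indicator)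
 qed
qed

section \<open>Explicit subsolutions below a datum\<close>

text \<open>Where the quartic branch is active, the point lies within \<open>D\<close> of
  \<open>y\<close>: the slope is at most \<open>8 M / D\<close>, and the operator is at least minus
  the second factor of \<open>K\<close>. So descending with speed \<open>K\<close> suffices.
  Elsewhere the function is locally the constant \<open>- M\<close>.\<close>

lemma barrier_subsolution:
 fixes M A D rho y :: real
 assumes M: "M > 0" and A: "- M <= A" "A <= M" and D: "D > 0" and rho: "rho > 0"
 defines "c \<equiv> 2 * M / D ^ 4"
 defines "K \<equiv> (8 * M / D) * (2 * qC c D rho * rho + 4 * M / rho)"
 defines "w \<equiv> %(t, x). max (- M) (A - c * (x - y) ^ 4 - K * t)"
 shows "HJ_subsolution rho w"
proof -
 have c: "c > 0" using M D by (simp add: c_def)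
 have qC0: "qC c D rho >= 0" using c D rho by (simp add: qC_def)
 have K0: "K >= 0" unfolding K_def using M D rho qC0 by simp
 have wb: "\<bar>w (t, x)\<bar> <= M" if "t > 0" for t x
 proof -
  have "0 <= c * (x - y) ^ 4" "0 <= K * t" using c K0 that by auto
  then show ?thesis using A M by (auto simp: w_def abs_le_iff)
 qed
 have contw: "continuous_on UNIV w" unfolding w_def split_beta by (intro continuous_intros)
 define q where "q = (%(t, x). (- c) * (x - y) ^ 4 + (A + (- K) * t))"
 have gq: "C2fun {0<..} (%t. A + (- K) * t) (%t. 0 + (- K) * 1)"
  by (intro C2fun_add C2fun_const C2fun_cmult C2fun_id)
 note q = C2_on_dom_quartic[OF gq, where c = "- c" and y = y, folded q_def]
 have q1: "C1_on_dom q" using q(1) by (simp add: C2_on_dom_def)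
 have wq: "w p = max (- M) (q p)" for p by (cases p) (simp add: w_def q_def)
 \<comment> \<open>A touching test function has time derivative \<open>- K\<close> or 0, which
   settles the quartic clause whatever the shape of \<open>phi\<close>.\<close>
 have key: "(pd_x phi (t, x) ~= 0 --> pd_t phi (t, x) <= HJ_H rho phi w (t, x)) & pd_t phi (t, x) <= 0"
  if phi: "C2_on_dom phi" and t: "t > 0" and con: "!!p. p : HJ_dom ==> w p - phi p <= w (t, x) - phi (t, x)" for phi t x
 proof (cases "q (t, x) >= - M")
  case True
  have phi1: "C1_on_dom phi" using phi by (simp add: C2_on_dom_def)
  have le: "phi (t, x) - q (t, x) <= phi p - q p" if "p : HJ_dom" for p
   using con[OF that] True by (simp add: wq max_def split: if_splits)
  have pt: "pd_t phi (t, x) = - K" and px: "pd_x phi (t, x) = 4 * (- c) * (x - y) ^ 3"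
   using touch[OF phi1 q1 _ zero_less_one le] t q(2,3)[OF t] by auto
  define p where "p = 4 * (- c) * (x - y) ^ 3"
  have "q (t, x) = A - c * (x - y) ^ 4 - K * t" by (simp add: q_def)
  then have "c * (x - y) ^ 4 <= 2 * M" using True A(2) mult_nonneg_nonneg[OF K0 less_imp_le[OF t]] by linarith
  then have xy: "\<bar>x - y\<bar> <= D" by (rule pen_close[OF _ _ _ _ D M]) (auto simp: c_def)
  have Ptop: "\<bar>p\<bar> <= 8 * M / D"
  proof -
   have "\<bar>p\<bar> = 4 * c * \<bar>x - y\<bar> ^ 3" using c by (simp add: p_def abs_mult power_abs)
   also have "... <= 4 * c * D ^ 3" using c xy by (intro mult_left_mono power_mono) auto
   also have "... = 8 * M / D" using D by (simp add: c_def field_simps eval_nat_numeral)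
   finally show ?thesis .
  qed
  obtain K' where K': "!!t' x' z. \<bar>t' - t\<bar> <= t/2 ==> \<bar>x' - x\<bar> <= 1 ==> \<bar>z\<bar> <= rho ==>
    \<bar>phi (t', x' + z) - phi (t', x') - pd_x phi (t', x') * z\<bar> <= K' * z^2"
   using C2_on_dom_x_bound[OF phi t] by metis
  have kphi: "\<bar>phi (t, x + z) - phi (t, x) - p * z\<bar> <= K' * z^2" if "\<bar>z\<bar> < rho" for z
   using K'[of t x z] that t px by (auto simp: p_def)
  have kq: "\<bar>q (t, x + z) - q (t, x) - p * z\<bar> <= qC c (x - y) rho * z^2" if "\<bar>z\<bar> < rho" for z
  proof -
   have "q (t, x + z) - q (t, x) - p * z = - (c * (x + z - y) ^ 4 - c * (x - y) ^ 4 - 4 * c * (x - y) ^ 3 * z)"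
    by (simp add: q_def p_def)
   then show ?thesis using quartic_taylor[of c z rho x y] that c by (simp only: abs_minus_cancel)
  qed
  have qm: "(%x. q (t, x)) : borel_measurable borel" by (rule C1_on_dom_slice_measurable[OF q1 t])
  have lez: "q (t, x + z) - q (t, x) - p * z <= phi (t, x + z) - phi (t, x) - p * z" for z
   using le[of "(t, x + z)"] t by simp
  have "inn rho (%z. q (t, z)) x p <= inn rho (%z. phi (t, z)) x p"
   by (rule inn_mono[OF rho qm kq C1_on_dom_slice_measurable[OF phi1 t] kphi lez])
  moreover have "\<bar>inn rho (%z. q (t, z)) x p\<bar> <= 2 * qC c (x - y) rho * rho"
   by (rule inn_bound[OF rho qm kq])
  moreover have "2 * qC c (x - y) rho * rho <= 2 * qC c D rho * rho"
   using qC_mono[of c rho "x - y" D] c rho xy by (intro mult_right_mono) auto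
  ultimately have i: "inn rho (%z. phi (t, z)) x p >= - (2 * qC c D rho * rho)" by linarith
  have "(%z. w (t, z)) : borel_measurable borel"
   by (rule borel_measurable_continuous_onI, rule continuous_on_compose2[OF contw]) (auto intro!: continuous_intros)
  then have "\<bar>outr rho (%z. w (t, z)) x\<bar> <= 4 * M / rho" by (rule outr_bound[OF rho]) (rule wb[OF t])
  with i have "- (2 * qC c D rho * rho + 4 * M / rho) <= inn rho (%z. phi (t, z)) x p + outr rho (%z. w (t, z)) x" by linarith
  then have "\<bar>p\<bar> * (- (2 * qC c D rho * rho + 4 * M / rho)) <= HJ_H rho phi w (t, x)"
   unfolding HJ_H_eq px p_def[symmetric] by (intro mult_left_mono) auto
  moreover have "\<bar>p\<bar> * (2 * qC c D rho * rho + 4 * M / rho) <= K"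
   unfolding K_def using Ptop qC0 rho M by (intro mult_right_mono) auto
  ultimately have "- K <= HJ_H rho phi w (t, x)" by (simp only: mult_minus_right)
  then show ?thesis using pt K0 by simp
 next
  case False
  have phi1: "C1_on_dom phi" using phi by (simp add: C2_on_dom_def)
  have "isCont q (t, x)" using C1_on_dom_imp_continuous[OF q1] t open_HJ_dom by (simp add: continuous_on_eq_continuous_at)
  then have "eventually (%p. q p < - M) (at (t, x))" unfolding isCont_def using False by (intro order_tendstoD) auto
  then obtain r where r: "r > 0" "!!p. p ~= (t, x) ==> dist p (t, x) < r ==> q p < - M"
   unfolding eventually_at by auto
  have C0: "C1_on_dom (%_. 0)" using C2_linD(1)[OF phi phi, of 0 0] by (simp add: C2_on_dom_def)
  have pd0: "pd_t (%_. 0) (t, x) = 0" "pd_x (%_. 0) (t, x) = 0" by (auto simp: pd_t_def pd_x_def)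
  have "phi (t, x) - 0 <= phi p - 0" if p: "p : HJ_dom" "dist p (t, x) < r" for p
  proof -
   have "w p = - M" using r(2)[OF _ p(2)] False by (cases "p = (t, x)") (auto simp: wq)
   moreover have "w (t, x) = - M" using False by (simp add: wq)
   ultimately show ?thesis using con[OF p(1)] by simp
  qed
  then have "pd_t phi (t, x) = 0" "pd_x phi (t, x) = 0"
   using touch[OF phi1 C0 _ r(1), where t = t and x = x] t pd0 by auto
  then show ?thesis by simp
 qed
 show ?thesis
  unfolding HJ_subsolution_def
 proof (intro conjI allI impI; (elim conjE)?)
  show "bounded (w ` HJ_dom)" using wb by (auto simp: bounded_iff HJ_dom_def)
  show "usc_on_dom w"
  proof (rule usc_on_domI)
   fix p a assume "w p < a"
   moreover have "isCont w p" using contw by (cases p) (simp add: continuous_on_eq_continuous_at)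
   ultimately have "eventually (%q. w q < a) (at p)" unfolding isCont_def by (intro order_tendstoD) auto
   then show "\<exists>r>0. \<forall>q\<in>HJ_dom. dist p q < r --> w q < a"
    unfolding eventually_at using \<open>w p < a\<close> by (auto simp: dist_commute) (metis dist_commute surj_pair)
  qed
 qed (use key in auto)
qed

lemma usc_env_mono:
 assumes M: "!!p. p : HJ_dom ==> \<bar>u p\<bar> <= M" "!!p. p : HJ_dom ==> \<bar>v p\<bar> <= M'"
  and le: "!!q. q : HJ_dom ==> dist p q < r ==> u q <= v q" and r: "r > 0" and p: "p : HJ_cl"
 shows "usc_env u p <= usc_env v p"
proof (rule dense_ge)
 fix a assume a: "usc_env v p < a"
 obtain r' where r': "r' > 0" "!!q. q : HJ_dom ==> dist p q < r' ==> v q < a"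
  using usc_env_lessD[of v M', OF M(2) p a] by blast
 show "usc_env u p <= a"
  by (rule usc_env_leI[of u M "p" "min r r'", OF M(1) p]) (use r r' le in \<open>force intro: order_trans less_imp_le\<close>)+
qed

lemma usc_env_idem:
 assumes M: "!!p. p : HJ_dom ==> \<bar>u p\<bar> <= M" and p: "p : HJ_cl"
 shows "usc_env (usc_env u) p = usc_env u p"
proof (rule antisym)
 have cl: "q : HJ_dom ==> q : HJ_cl" for q by (cases q) auto
 have M': "\<bar>usc_env u q\<bar> <= M" if "q : HJ_dom" for q using usc_env_bound[of u M, OF M cl[OF that]] .
 show "usc_env (usc_env u) p <= usc_env u p"
 proof (rule dense_ge)
  fix a assume a: "usc_env u p < a"
  obtain r' where r': "r' > 0" "!!q. q : HJ_cl ==> dist p q < r' ==> usc_env u q < a"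
   using usc_env_usc[of u M, OF M p a] by blast
  show "usc_env (usc_env u) p <= a"
   by (rule usc_env_leI[of "usc_env u" M p r', OF M' p r'(1)]) (use r' cl in \<open>auto intro: less_imp_le\<close>)
 qed
 show "usc_env u p <= usc_env (usc_env u) p"
  by (rule usc_env_mono[OF M M' _ zero_less_one p]) (use usc_env_ge[of u M, OF M] in auto)
qed

section \<open>Suprema of subsolutions\<close>

definition subs :: "real => real => (real \<times> real => real) set" where
 "subs rho M = {w. HJ_subsolution rho w & (\<forall>p\<in>HJ_dom. \<bar>w p\<bar> <= M)}"

text \<open>A bowl added to the test function makes the maximum strict. Members of \<open>S\<close>
  that nearly reach \<open>N\<close> are then touched at points converging to \<open>(t, x)\<close>,
  and their inequalities pass to the limit, the far integrals being controlled from above.\<close>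

lemma sup_subsolution:
 assumes S: "S \<subseteq> subs rho M" "S ~= {}" and rho: "rho > 0"
 defines "u \<equiv> (%p. SUP w\<in>S. w p)"
 shows "HJ_subsolution rho (usc_env u)" and "!!p. p : HJ_dom ==> \<bar>u p\<bar> <= M"
  and "!!w p. w : S ==> p : HJ_dom ==> w p <= u p"
proof -
 have Sw: "HJ_subsolution rho w" "p : HJ_dom ==> \<bar>w p\<bar> <= M" if "w : S" for w p using S that by (auto simp: subs_def)
 have bdd: "bdd_above ((%w. w p) ` S)" if "p : HJ_dom" for p
  using Sw(2)[OF _ that] by (intro bdd_aboveI2[of _ _ M]) (auto simp: abs_le_iff)
 show wu: "w p <= u p" if "w : S" "p : HJ_dom" for w p
  unfolding u_def by (rule cSUP_upper[OF that(1) bdd[OF that(2)]])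
 show uM: "\<bar>u p\<bar> <= M" if p: "p : HJ_dom" for p
 proof -
  obtain w where w: "w : S" using S by blast
  have "u p <= M" unfolding u_def by (rule cSUP_least[OF S(2)]) (use Sw(2)[OF _ p] in \<open>auto simp: abs_le_iff\<close>)
  moreover have "- M <= u p" using wu[OF w p] Sw(2)[OF w p] by (simp add: abs_le_iff)
  ultimately show ?thesis by (simp add: abs_le_iff)
 qed
 define N where "N = usc_env u"
 have cl: "q : HJ_dom ==> q : HJ_cl" for q by (cases q) auto
 have NM: "\<bar>N p\<bar> <= M" if "p : HJ_dom" for p unfolding N_def using usc_env_bound[of u M, OF uM cl[OF that]] .
 have uN: "u p <= N p" if "p : HJ_dom" for p unfolding N_def using usc_env_ge[of u M, OF uM that] .
 have Nusc: "usc_on_dom N" unfolding N_def by (rule usc_env_seq_usc(2)[OF uM])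
 note Nseq = usc_on_dom_imp_seq[OF Nusc]
 have near: "\<exists>w\<in>S. \<exists>p\<in>HJ_dom. dist p (t, x) < epsilon & w p > N (t, x) - epsilon & (\<forall>p'\<in>HJ_dom. w p' - f p' <= w p - f p)"
  if f: "C1_on_dom f" and t: "t > 0" and epsilon: "epsilon > 0" and gamma: "gamma > 0"
  and con: "!!p. p : HJ_dom ==> N p - f p <= N (t, x) - f (t, x) - gamma * bowl t x p" for f t x epsilon gamma
 proof -
  have tx: "(t, x) : HJ_dom" using t by simp
  have fc: "isCont f (t, x)" using C1_on_dom_imp_continuous[OF f] tx open_HJ_dom by (simp add: continuous_on_eq_continuous_at)
  then have "eventually (%p. dist (f p) (f (t, x)) < epsilon / 2) (at (t, x))"
   unfolding isCont_def tendsto_iff using half_gt_zero[OF epsilon] by blast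
  then obtain r1 where r1: "r1 > 0" "!!p. dist p (t, x) < r1 ==> \<bar>f p - f (t, x)\<bar> < epsilon / 2"
   unfolding eventually_at dist_real_def using epsilon by (metis UNIV_I abs_zero cancel_comm_monoid_add_class.diff_cancel half_gt_zero)
  define r where "r = Min {epsilon, t/2, r1} / 2"
  have r: "r > 0" "r < epsilon" "r < t/2" "r < r1" using epsilon t r1 by (auto simp: r_def)
  obtain mu where mu: "mu > 0" "!!p. dist p (t, x) >= r ==> bowl t x p >= mu" using bowl_far[OF r(1)] by blast
  \<comment> \<open>A deficit of at most \<open>gamma * mu\<close> cannot be made up outside the
    \<open>r\<close>-ball. One half of \<open>epsilon\<close> is granted to the value of
    \<open>w\<close>, the other half to the oscillation of \<open>f\<close>.\<close>
  define g where "g = min (gamma * mu) (epsilon / 2)"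
  have g: "g > 0" "g <= gamma * mu" "g <= epsilon / 2" using gamma mu epsilon by (auto simp: g_def)
  obtain q where q: "!!k::nat. q k : HJ_dom" "q ----> (t, x)" "(%k. u (q k)) ----> N (t, x)"
   using usc_env_seq[of u M, OF uM cl[OF tx]] unfolding N_def by blast
  have "(%k. f (q k)) ----> f (t, x)" by (rule isCont_tendsto_compose[OF fc q(2)])
  then have "(%k. u (q k) - f (q k)) ----> N (t, x) - f (t, x)" by (intro tendsto_diff q)
  then have "eventually (%k. N (t, x) - f (t, x) - g < u (q k) - f (q k)) sequentially"
   using g by (intro order_tendstoD) auto
  then obtain k where k: "N (t, x) - f (t, x) - g < u (q k) - f (q k)" by (auto simp: eventually_sequentially)
  then have "N (t, x) - f (t, x) - g + f (q k) < (SUP w\<in>S. w (q k))" by (simp add: u_def)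
  then obtain w where w: "w : S" "N (t, x) - f (t, x) - g + f (q k) < w (q k)"
   using less_cSUP_iff[OF S(2) bdd[OF q(1)]] by blast
  have out: "w p - f p < w (q k) - f (q k)" if p: "p : HJ_dom" "dist p (t, x) >= r" for p
  proof -
   have "w p - f p <= N p - f p" using wu[OF w(1) p(1)] uN[OF p(1)] by simp
   also have "... <= N (t, x) - f (t, x) - gamma * bowl t x p" by (rule con[OF p(1)])
   also have "... <= N (t, x) - f (t, x) - gamma * mu" using mu(2)[OF p(2)] gamma by simp
   also have "... < w (q k) - f (q k)" using w(2) g by linarith
   finally show ?thesis .
  qed
  define C where "C = cball (t, x) r"
  have CH: "C \<subseteq> HJ_dom"
  proof
   fix p assume p: "p : C"
   obtain s y where sy: "p = (s, y)" by (cases p)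
   have "\<bar>t - s\<bar> <= dist (t, x) p" unfolding sy dist_Pair_Pair dist_real_def by (rule real_le_rsqrt) simp
   then show "p : HJ_dom" using p r(3) t by (auto simp: C_def sy)
  qed
  have wusc: "usc_seq C (%p. w p + - f p)"
   using Sw(1)[OF w(1)] CH
   by (intro usc_seq_add usc_seq_mono[OF usc_on_dom_imp_seq] continuous_imp_usc_seq continuous_on_minus
     continuous_on_subset[OF C1_on_dom_imp_continuous[OF f]]) (auto simp: HJ_subsolution_def)
  have C1: "compact C" "C ~= {}" using r by (auto simp: C_def)
  have "bdd_above ((%p. w p + - f p) ` C)"
  proof -
   have "bounded (f ` C)" using C1(1) CH C1_on_dom_imp_continuous[OF f]
    by (meson compact_continuous_image compact_imp_bounded continuous_on_subset)
   then obtain b where "!!p. p : C ==> \<bar>f p\<bar> <= b" by (auto simp: bounded_iff)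
   then show ?thesis using Sw(2)[OF w(1)] CH
    by (intro bdd_aboveI2[of _ _ "M + b"]) (smt (verit, best) subsetD)
  qed
  then obtain p where p: "p : C" "!!p'. p' : C ==> w p' + - f p' <= w p + - f p"
   using usc_seq_attains_max[OF wusc C1] by blast
  have qC: "q k : C" using out[OF q(1)[of k]] by (fastforce simp: C_def dist_commute)
  have glob: "w p' - f p' <= w p - f p" if "p' : HJ_dom" for p'
   using p(2)[of p'] p(2)[OF qC] out[OF that] by (cases "p' : C") (auto simp: C_def dist_commute)
  have pd: "dist p (t, x) < r1" "dist p (t, x) < epsilon" using p(1) r by (auto simp: C_def dist_commute)
  have "w p > N (t, x) - epsilon"
   using p(2)[OF qC] w(2) g(3) r1(2)[OF pd(1)] unfolding abs_less_iff by linarith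
  then show ?thesis using w(1) p(1) CH pd glob by blast
 qed
 have test: "(pd_x f (s, y) ~= 0 --> pd_t f (s, y) <= HJ_H rho f w (s, y)) &
   ((\<exists>c g. \<forall>(s', y')\<in>HJ_dom. f (s', y') = c * \<bar>y' - y\<bar> ^ 4 + g s') --> pd_t f (s, y) <= 0)"
  if "w : S" "C2_on_dom f" "(s, y) : HJ_dom" "\<forall>p'\<in>HJ_dom. w p' - f p' <= w (s, y) - f (s, y)" for w f s y
  using Sw(1)[OF that(1)] that unfolding HJ_subsolution_def by blast
 show "HJ_subsolution rho (usc_env u)"
  unfolding HJ_subsolution_def N_def[symmetric]
 proof (intro conjI allI impI; (elim conjE)?)
  show "bounded (N ` HJ_dom)" by (auto simp: bounded_iff intro!: exI[of _ M] NM)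
  show "usc_on_dom N" by (rule Nusc)
  fix phi t x assume phi: "C2_on_dom phi" and tx: "(t, x) : HJ_dom" and con: "\<forall>p\<in>HJ_dom. N p - phi p <= N (t, x) - phi (t, x)"
  have t: "t > 0" using tx by simp
  define F where "F gamma = (%p. 1 * phi p + gamma * bowl t x p)" for gamma
  note FL = C2_linD[OF phi C2_bowl(1)[of t x], where a = 1]
  have F2: "C2_on_dom (F gamma)" for gamma unfolding F_def by (rule FL(1))
  have F1: "C1_on_dom (F gamma)" "C1_on_dom (pd_t (F gamma))" "C1_on_dom (pd_x (F gamma))" for gamma using F2[of gamma] by (auto simp: C2_on_dom_def)
  have Fpd: "pd_t (F gamma) (t, x) = pd_t phi (t, x)" "pd_x (F gamma) (t, x) = pd_x phi (t, x)" for gamma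
   unfolding F_def FL(2)[OF t] FL(3)[OF t] C2_bowl(2)[OF t] C2_bowl(3)[OF t] by auto
  have Nsm: "(%y. N (s, y)) : borel_measurable borel" if "s > 0" for s by (rule usc_slice_measurable[OF Nseq]) (use that in simp)
  have lim: "\<exists>w p O'. (\<forall>k::nat. w k : S & p k : HJ_dom & (\<forall>p'\<in>HJ_dom. w k p' - F gamma p' <= w k (p k) - F gamma (p k))
    & outr rho (%y. w k (fst (p k), y)) (snd (p k)) <= O' k) & p ----> (t, x) & O' ----> outr rho (%y. N (t, y)) x"
   if gamma: "gamma > 0" for gamma
  proof -
   have "\<exists>w\<in>S. \<exists>p\<in>HJ_dom. dist p (t, x) < 1 / Suc k & w p > N (t, x) - 1 / Suc k & (\<forall>p'\<in>HJ_dom. w p' - F gamma p' <= w p - F gamma p)" for k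
   proof (rule near[OF F1(1) t _ gamma])
    fix p assume "p : HJ_dom"
    then show "N p - F gamma p <= N (t, x) - F gamma (t, x) - gamma * bowl t x p" using con by (auto simp: F_def bowl_self)
   qed simp
   then obtain w p where wp: "!!k. w k : S" "!!k. p k : HJ_dom" "!!k. dist (p k) (t, x) < 1 / Suc k" "!!k. w k (p k) > N (t, x) - 1 / Suc k"
    "!!k. \<forall>p'\<in>HJ_dom. w k p' - F gamma p' <= w k (p k) - F gamma (p k)" by metis
   have z: "(%k. 1 / real (Suc k)) ----> 0" using LIMSEQ_inverse_real_of_nat by (simp add: inverse_eq_divide)
   have plim: "p ----> (t, x)"
    unfolding tendsto_dist_iff[of p]
    by (rule tendsto_sandwich[OF _ _ tendsto_const z]) (auto intro!: always_eventually less_imp_le[OF wp(3)] simp del: of_nat_Suc)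
   define P1 where "P1 k = fst (p k)" for k
   define P2 where "P2 k = snd (p k)" for k
   have pP: "p k = (P1 k, P2 k)" for k by (simp add: P1_def P2_def)
   have P1: "P1 k > 0" for k using wp(2)[of k] by (simp add: pP)
   have P1l: "P1 ----> t" and P2l: "P2 ----> x" using tendsto_fst[OF plim] tendsto_snd[OF plim] by (auto simp: P1_def[abs_def] P2_def[abs_def])
   have wk: "\<bar>w k (P1 k, P2 k)\<bar> <= M" for k using Sw(2)[OF wp(1) wp(2)[of k]] by (simp add: pP)
   have wN: "w k (P1 k, y) <= N (P1 k, y)" for k y using wu[OF wp(1), of "(P1 k, y)"] uN[of "(P1 k, y)"] P1 by (auto intro: order_trans)
   have wsm: "(%y. w k (P1 k, y)) : borel_measurable borel" for k
    using Sw(1)[OF wp(1)] P1 by (intro usc_slice_measurable[OF usc_on_dom_imp_seq]) (auto simp: HJ_subsolution_def)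
   \<comment> \<open>At the shifted points \<open>w k\<close> is replaced by the larger
     \<open>N\<close>, which is upper semicontinuous; at the contact points \<open>w k\<close> stays
     above \<open>N (t, x) - 1 / Suc k\<close>.\<close>
   have "\<exists>O'. (\<forall>k. (LINT z:far rho|lborel. (N (P1 k, P2 k + z) - w k (P1 k, P2 k)) / z^2) <= O' k) &
     O' ----> (LINT z:far rho|lborel. (N (t, x + z) - N (t, x)) / z^2)"
   proof (rule far_upper_limit[OF rho, where B = "2 * M" and Gk = "%k z. N (P1 k, P2 k + z) - w k (P1 k, P2 k)" and G = "%z. N (t, x + z) - N (t, x)"])
    show "(%z. N (P1 k, P2 k + z) - w k (P1 k, P2 k)) : borel_measurable borel" for k using Nsm[OF P1[of k]] by measurable
    show "(%z. N (t, x + z) - N (t, x)) : borel_measurable borel" using Nsm[OF t] by measurable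
    show "\<bar>N (P1 k, P2 k + z) - w k (P1 k, P2 k)\<bar> <= 2 * M" for k z using NM[of "(P1 k, P2 k + z)"] wk[of k] P1[of k] by auto
    show "\<bar>N (t, x + z) - N (t, x)\<bar> <= 2 * M" for z using NM[of "(t, x + z)"] NM[of "(t, x)"] t by auto
    fix z a assume a: "N (t, x + z) - N (t, x) < a"
    define e where "e = (a - (N (t, x + z) - N (t, x))) / 2"
    have e: "e > 0" using a by (simp add: e_def)
    have "eventually (%k. N (P1 k, P2 k + z) < N (t, x + z) + e) sequentially"
     using P1 e t by (intro usc_seqD[OF Nseq]) (auto intro!: tendsto_intros P1l P2l)
    moreover have "eventually (%k. 1 / real (Suc k) < e) sequentially" using z e by (rule order_tendstoD)
    ultimately show "eventually (%k. N (P1 k, P2 k + z) - w k (P1 k, P2 k) < a) sequentially"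
    proof eventually_elim
     case (elim k)
     have "w k (P1 k, P2 k) > N (t, x) - 1 / Suc k" using wp(4)[of k] by (simp add: pP)
     moreover have "2 * e = a - (N (t, x + z) - N (t, x))" by (simp add: e_def)
     ultimately show ?case using elim by linarith
    qed
   qed blast
   then obtain O' where O': "!!k. (LINT z:far rho|lborel. (N (P1 k, P2 k + z) - w k (P1 k, P2 k)) / z^2) <= O' k"
     "O' ----> outr rho (%y. N (t, y)) x" by (auto simp: outr_def)
   have "outr rho (%y. w k (P1 k, y)) (P2 k) <= O' k" for k
   proof -
    have [measurable]: "(%y. N (P1 k, y)) : borel_measurable borel" using Nsm[OF P1[of k]] .
    have b: "\<bar>N (P1 k, P2 k + z) - w k (P1 k, P2 k)\<bar> <= 2 * M" for z using NM[of "(P1 k, P2 k + z)"] wk[of k] P1[of k] by auto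
    have "outr rho (%y. w k (P1 k, y)) (P2 k) <= (LINT z:far rho|lborel. (N (P1 k, P2 k + z) - w k (P1 k, P2 k)) / z^2)"
     unfolding outr_def
    proof (intro set_integral_mono)
     show "set_integrable lborel (far rho) (%z. (w k (P1 k, P2 k + z) - w k (P1 k, P2 k)) / z^2)"
      by (rule outr_integrable[OF rho wsm, where B = M]) (use Sw(2)[OF wp(1)] P1 in auto)
     show "set_integrable lborel (far rho) (%z. (N (P1 k, P2 k + z) - w k (P1 k, P2 k)) / z^2)"
      by (rule far_integrable_bound(1)[OF rho _ b]) measurable
    qed (use wN in \<open>auto intro!: divide_right_mono\<close>)
    then show ?thesis using O'(1)[of k] by linarith
   qed
   then show ?thesis using wp plim O'(2) by (intro exI[of _ w] exI[of _ p] exI[of _ O']) (auto simp: P1_def P2_def)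
  qed
  have innlim: "(%k. inn rho (%y. F gamma (fst (p k), y)) (snd (p k)) (pd_x (F gamma) (p k))) ----> inn rho (%y. F gamma (t, y)) x (pd_x phi (t, x))"
   if "p ----> (t, x)" for gamma p
   using inn_tendsto[OF F2[of gamma] t rho tendsto_fst[OF that, unfolded fst_conv] tendsto_snd[OF that, unfolded snd_conv]] by (simp add: Fpd)
  have plim: "(%k. pd_x (F gamma) (p k)) ----> pd_x phi (t, x)" "(%k. pd_t (F gamma) (p k)) ----> pd_t phi (t, x)"
   if "p ----> (t, x)" for gamma p
   using C1_on_dom_seq[OF F1(3)[of gamma] t tendsto_fst[OF that, unfolded fst_conv] tendsto_snd[OF that, unfolded snd_conv]]
    C1_on_dom_seq[OF F1(2)[of gamma] t tendsto_fst[OF that, unfolded fst_conv] tendsto_snd[OF that, unfolded snd_conv]] by (auto simp: Fpd)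
  {
   assume px: "pd_x phi (t, x) ~= 0"
   have ineq: "pd_t phi (t, x) <= \<bar>pd_x phi (t, x)\<bar> * (inn rho (%y. F gamma (t, y)) x (pd_x phi (t, x)) + outr rho (%y. N (t, y)) x)" if gamma: "gamma > 0" for gamma
   proof -
    obtain w p O' where wp: "!!k::nat. w k : S & p k : HJ_dom & (\<forall>p'\<in>HJ_dom. w k p' - F gamma p' <= w k (p k) - F gamma (p k))
     & outr rho (%y. w k (fst (p k), y)) (snd (p k)) <= O' k" "p ----> (t, x)" "O' ----> outr rho (%y. N (t, y)) x"
     using lim[OF gamma] by blast
    have "eventually (%k. pd_x (F gamma) (p k) ~= 0) sequentially"
     using tendsto_imp_eventually_ne[OF plim(1)[OF wp(2)] px] .
    then have "eventually (%k. pd_t (F gamma) (p k) <= \<bar>pd_x (F gamma) (p k)\<bar> * (inn rho (%y. F gamma (fst (p k), y)) (snd (p k)) (pd_x (F gamma) (p k)) + O' k)) sequentially"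
    proof eventually_elim
     case (elim k)
     have "pd_t (F gamma) (fst (p k), snd (p k)) <= HJ_H rho (F gamma) (w k) (fst (p k), snd (p k))"
      by (rule test[OF _ F2, THEN conjunct1, THEN mp]) (use wp(1)[of k] elim in simp_all)
     also have "... <= \<bar>pd_x (F gamma) (p k)\<bar> * (inn rho (%y. F gamma (fst (p k), y)) (snd (p k)) (pd_x (F gamma) (p k)) + O' k)"
      unfolding HJ_H_eq using wp(1)[of k] by (auto intro!: mult_left_mono)
     finally show ?case by simp
    qed
    moreover have rl: "(%k. \<bar>pd_x (F gamma) (p k)\<bar> * (inn rho (%y. F gamma (fst (p k), y)) (snd (p k)) (pd_x (F gamma) (p k)) + O' k))
     ----> \<bar>pd_x phi (t, x)\<bar> * (inn rho (%y. F gamma (t, y)) x (pd_x phi (t, x)) + outr rho (%y. N (t, y)) x)"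
     by (intro tendsto_intros plim(1) innlim wp)
    ultimately show ?thesis
     by (intro tendsto_le[OF trivial_limit_sequentially rl plim(2)[OF wp(2), of gamma]])
   qed
   have ineq2: "pd_t phi (t, x) <= HJ_H rho phi N (t, x) + \<bar>pd_x phi (t, x)\<bar> * (2 * rho ^ 3) * gamma" if "gamma > 0" for gamma
   proof -
    have "\<bar>inn rho (%y. 1 * phi (t, y) + gamma * bowl t x (t, y)) x (pd_x phi (t, x)) - inn rho (%y. phi (t, y)) x (pd_x phi (t, x))\<bar> <= \<bar>gamma\<bar> * (2 * rho ^ 3)"
     by (rule inn_bowl[OF phi t rho refl])
    then have "inn rho (%y. F gamma (t, y)) x (pd_x phi (t, x)) + outr rho (%y. N (t, y)) x <= inn rho (%y. phi (t, y)) x (pd_x phi (t, x)) + outr rho (%y. N (t, y)) x + 2 * rho ^ 3 * gamma"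
     unfolding F_def using that by (simp add: abs_le_iff mult_ac)
    from mult_left_mono[OF this abs_ge_zero[of "pd_x phi (t, x)"]] ineq[OF that]
    show ?thesis unfolding HJ_H_eq by (simp add: algebra_simps)
   qed
   show "pd_t phi (t, x) <= HJ_H rho phi N (t, x)"
   proof (rule tendsto_lowerbound)
    show "((%gamma. HJ_H rho phi N (t, x) + \<bar>pd_x phi (t, x)\<bar> * (2 * rho ^ 3) * gamma) \<longlongrightarrow> HJ_H rho phi N (t, x)) (at_right 0)"
     by (rule tendsto_eq_intros | simp)+
    show "eventually (%gamma. pd_t phi (t, x) <= HJ_H rho phi N (t, x) + \<bar>pd_x phi (t, x)\<bar> * (2 * rho ^ 3) * gamma) (at_right 0)"
     using eventually_at_right_less by (rule eventually_mono) (rule ineq2)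
   qed simp
  next
   assume "\<exists>c g. \<forall>(s, y)\<in>HJ_dom. phi (s, y) = c * \<bar>y - x\<bar> ^ 4 + g s"
   then obtain c g where cg: "\<forall>(s, y)\<in>HJ_dom. phi (s, y) = c * \<bar>y - x\<bar> ^ 4 + g s" by blast
   \<comment> \<open>With \<open>c + gamma > 0\<close> the slope of \<open>F gamma\<close> vanishes
     only on the line \<open>y = x\<close>. Off this line a contact gives the equation, on it the
     quartic clause applies; both lead to one inequality, whose right-hand side tends to 0.\<close>
   define gamma where "gamma = \<bar>c\<bar> + 1"
   have gamma: "gamma > 0" "c + gamma > 0" by (auto simp: gamma_def)
   have Feq: "F gamma (s, y) = (c + gamma) * \<bar>y - x\<bar> ^ 4 + (g s + gamma * (s - t)^2)" if "s > 0" for s y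
    using cg that by (auto simp: F_def bowl_def algebra_simps power_even_abs)
   have px: "pd_x (F gamma) (s, y) = (c + gamma) * (4 * (y - x) ^ 3)" if s: "s > 0" for s y
   proof (rule DERIV_unique[OF C1_on_domD(2)[OF F1(1) s]])
    have "(%y. F gamma (s, y)) = (%y. (c + gamma) * (y - x) ^ 4 + (g s + gamma * (s - t)^2))" using Feq[OF s] by (auto simp: power_even_abs)
    then show "((%y. F gamma (s, y)) has_real_derivative (c + gamma) * (4 * (y - x) ^ 3)) (at y)"
     by (auto intro!: derivative_eq_intros)
   qed
   obtain w p O' where wp: "!!k::nat. w k : S & p k : HJ_dom & (\<forall>p'\<in>HJ_dom. w k p' - F gamma p' <= w k (p k) - F gamma (p k))
     & outr rho (%y. w k (fst (p k), y)) (snd (p k)) <= O' k" "p ----> (t, x)" "O' ----> outr rho (%y. N (t, y)) x"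
    using lim[OF gamma(1)] by blast
   have "pd_t (F gamma) (p k) <= \<bar>pd_x (F gamma) (p k)\<bar> * (inn rho (%y. F gamma (fst (p k), y)) (snd (p k)) (pd_x (F gamma) (p k)) + O' k)" for k
   proof -
    obtain s y where sy: "p k = (s, y)" by (cases "p k")
    have s: "s > 0" using wp(1)[of k] sy by simp
    have "w k : S" "(s, y) : HJ_dom" "\<forall>p'\<in>HJ_dom. w k p' - F gamma p' <= w k (s, y) - F gamma (s, y)"
     using wp(1)[of k] unfolding sy by blast+
    note test = test[OF this(1) F2[of gamma] this(2,3)]
    show ?thesis
    proof (cases "y = x")
     case True
     have "\<forall>(s', y')\<in>HJ_dom. F gamma (s', y') = (c + gamma) * \<bar>y' - y\<bar> ^ 4 + (%s'. g s' + gamma * (s' - t)^2) s'"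
      using Feq True by (auto simp: HJ_dom_def)
     then have "pd_t (F gamma) (s, y) <= 0"
      by (intro test[THEN conjunct2, THEN mp] exI[of _ "c + gamma"] exI[of _ "%s'. g s' + gamma * (s' - t)^2"])
     moreover have "pd_x (F gamma) (s, y) = 0" using px[OF s, of y] True by simp
     ultimately show ?thesis by (simp add: sy)
    next
     case False
     then have "pd_x (F gamma) (s, y) ~= 0" using px[OF s, of y] gamma(2) by simp
     then have "pd_t (F gamma) (s, y) <= HJ_H rho (F gamma) (w k) (s, y)" using test by blast
     also have "... <= \<bar>pd_x (F gamma) (p k)\<bar> * (inn rho (%y. F gamma (fst (p k), y)) (snd (p k)) (pd_x (F gamma) (p k)) + O' k)"
      unfolding HJ_H_eq using wp(1)[of k] by (auto simp: sy intro!: mult_left_mono)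
     finally show ?thesis by (simp add: sy)
    qed
   qed
   moreover have rl: "(%k. \<bar>pd_x (F gamma) (p k)\<bar> * (inn rho (%y. F gamma (fst (p k), y)) (snd (p k)) (pd_x (F gamma) (p k)) + O' k))
     ----> \<bar>pd_x phi (t, x)\<bar> * (inn rho (%y. F gamma (t, y)) x (pd_x phi (t, x)) + outr rho (%y. N (t, y)) x)"
     by (intro tendsto_intros plim(1) innlim wp)
   ultimately have "pd_t phi (t, x) <= \<bar>pd_x phi (t, x)\<bar> * (inn rho (%y. F gamma (t, y)) x (pd_x phi (t, x)) + outr rho (%y. N (t, y)) x)"
    by (intro LIMSEQ_le[OF plim(2)[OF wp(2), of gamma] rl]) auto
   moreover have "pd_x phi (t, x) = 0" using px[OF t, of x] Fpd by simp
   ultimately show "pd_t phi (t, x) <= 0" by simp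
  }
 qed
qed

lemma quartic_form_pd_x:
 assumes "C1_on_dom phi" "t > 0" "\<forall>(s, z)\<in>HJ_dom. phi (s, z) = c * \<bar>z - x\<bar> ^ 4 + g s"
 shows "pd_x phi (t, x) = 0"
proof (rule DERIV_unique[OF C1_on_domD(2)[OF assms(1,2)]])
 have "(%y. phi (t, y)) = (%y. c * (y - x) ^ 4 + g t)" using assms(2,3) by (auto simp: HJ_dom_def power_even_abs)
 then show "((%y. phi (t, y)) has_real_derivative 0) (at x)"
  by (auto intro!: derivative_eq_intros)
qed

lemma usc_max:
 assumes "usc_on_dom f" "usc_on_dom g" shows "usc_on_dom (%p. max (f p) (g p))"
proof -
 have "{p : HJ_dom. max (f p) (g p) < a} = {p : HJ_dom. f p < a} \<inter> {p : HJ_dom. g p < a}" for a by auto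
 then show ?thesis using assms unfolding usc_on_dom_def by (auto intro: openin_Int)
qed

lemma continuous_imp_usc_on_dom:
 assumes "continuous_on HJ_dom f" shows "usc_on_dom f"
 unfolding usc_on_dom_def
proof
 fix a
 have "{p : HJ_dom. f p < a} = HJ_dom \<inter> f -` {..<a}" by auto
 then show "openin (top_of_set HJ_dom) {p : HJ_dom. f p < a}"
  using continuous_openin_preimage_gen[OF assms, of "{..<a}"] by simp
qed

section \<open>The lower envelope of a maximal subsolution\<close>

context
 fixes rho M :: real and u :: "real \<times> real => real"
 assumes rho: "rho > 0" and usub: "HJ_subsolution rho u" and uM: "!!p. p : HJ_dom ==> \<bar>u p\<bar> <= M"
begin

private lemma cl: "q : HJ_dom ==> q : HJ_cl" by (cases q) auto

private lemma nuM: "p : HJ_dom ==> \<bar>- u p\<bar> <= M" using uM by simp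

private lemma Vu: assumes "p : HJ_dom" shows "lsc_env u p <= u p"
proof -
 have "- u p <= usc_env (%p. - u p) p" by (rule usc_env_ge[of "%p. - u p" M, OF nuM assms])
 then show ?thesis unfolding lsc_env_eq by linarith
qed

private lemma VM: assumes "p : HJ_dom" shows "\<bar>lsc_env u p\<bar> <= M"
proof -
 have "\<bar>usc_env (%p. - u p) p\<bar> <= M" by (rule usc_env_bound[of "%p. - u p" M, OF nuM cl[OF assms]])
 then show ?thesis unfolding lsc_env_eq by linarith
qed

private lemma Vusc: "usc_on_dom (%p. - lsc_env u p)"
 using usc_env_seq_usc(2)[of "%p. - u p" M, OF nuM] unfolding lsc_env_eq minus_minus .

private lemma Vmeas: assumes "s > 0" shows "(%y. lsc_env u (s, y)) : borel_measurable borel"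
proof -
 have "(%y. - lsc_env u (s, y)) : borel_measurable borel"
  by (rule usc_slice_measurable[OF usc_on_dom_imp_seq[OF Vusc]]) (use assms in simp)
 from borel_measurable_uminus[OF this] show ?thesis by simp
qed

text \<open>Along a sequence of counterexamples the terms with \<open>f\<close> converge, while
  lower semicontinuity keeps the limit inferior of the far integrals at least at its value for
  \<open>(t, x)\<close>; this contradicts strictness. The \<open>delta\<close> anticipates the
  height by which \<open>f\<close> will be lifted.\<close>

private lemma strict_nearby:
 assumes f: "C2_on_dom f" and t: "t > 0" and fV: "f (t, x) = lsc_env u (t, x)"
  and strict: "pd_t f (t, x) < \<bar>pd_x f (t, x)\<bar> * (inn rho (%y. f (t, y)) x (pd_x f (t, x)) + outr rho (%y. lsc_env u (t, y)) x)"
 shows "\<exists>e>0. \<forall>s y delta. s > 0 --> dist (s, y) (t, x) < e --> 0 < delta --> delta < e -->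
  pd_t f (s, y) <= \<bar>pd_x f (s, y)\<bar> * (inn rho (%z. f (s, z)) y (pd_x f (s, y)) +
   (LINT z:far rho|lborel. (lsc_env u (s, y + z) - f (s, y) - delta) / z^2))"
proof (rule ccontr)
 assume neg: "~ ?thesis"
 define V where "V = lsc_env u"
 have f1: "C1_on_dom f" "C1_on_dom (pd_t f)" "C1_on_dom (pd_x f)" using f by (auto simp: C2_on_dom_def)
 have fc: "isCont f (t, x)" using C1_on_dom_imp_continuous[OF f1(1)] t open_HJ_dom by (simp add: continuous_on_eq_continuous_at)
 then have "eventually (%p. dist (f p) (f (t, x)) < 1) (at (t, x))"
  unfolding isCont_def tendsto_iff using zero_less_one by blast
 then obtain r1 where r1: "r1 > 0" "!!p. p ~= (t, x) ==> dist p (t, x) < r1 ==> dist (f p) (f (t, x)) < 1"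
  unfolding eventually_at by auto
 have r1': "\<bar>f p - f (t, x)\<bar> < 1" if "dist p (t, x) < r1" for p
  using r1(2)[OF _ that] by (cases "p = (t, x)") (auto simp: dist_real_def)
 define e where "e k = min r1 (1 / real (Suc k))" for k
 have e: "e k > 0" "e k <= r1" "e k <= 1 / real (Suc k)" for k using r1(1) by (auto simp: e_def simp del: of_nat_Suc)
 define Q where "Q k s y delta \<longleftrightarrow> s > 0 & dist (s, y) (t, x) < e k & 0 < delta & delta < e k &
   pd_t f (s, y) > \<bar>pd_x f (s, y)\<bar> * (inn rho (%z. f (s, z)) y (pd_x f (s, y)) +
   (LINT z:far rho|lborel. (V (s, y + z) - f (s, y) - delta) / z^2))" for k s y delta
 have "\<exists>s y delta. Q k s y delta" for k
  using neg e(1)[of k] unfolding V_def Q_def by (meson not_le)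
 then obtain s y delta where "!!k. Q k (s k) (y k) (delta k)" by metis
 then have sy: "!!k. s k > 0" "!!k. dist (s k, y k) (t, x) < e k" "!!k. 0 < delta k" "!!k. delta k < e k"
   "!!k. pd_t f (s k, y k) > \<bar>pd_x f (s k, y k)\<bar> * (inn rho (%z. f (s k, z)) (y k) (pd_x f (s k, y k)) +
   (LINT z:far rho|lborel. (V (s k, y k + z) - f (s k, y k) - delta k) / z^2))" unfolding Q_def by blast+
 have z: "(%k. 1 / real (Suc k)) ----> 0" using LIMSEQ_inverse_real_of_nat by (simp add: inverse_eq_divide)
 have plim: "(%k. (s k, y k)) ----> (t, x)"
  unfolding tendsto_dist_iff[of "%k. (s k, y k)"]
  by (rule tendsto_sandwich[OF _ _ tendsto_const z])
   (intro always_eventually allI less_imp_le[OF less_le_trans[OF sy(2) e(3)]] zero_le_dist)+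
 have sl: "s ----> t" and yl: "y ----> x" using tendsto_fst[OF plim] tendsto_snd[OF plim] by auto
 have deltal: "delta ----> 0"
  by (rule tendsto_sandwich[OF _ _ tendsto_const z])
   (intro always_eventually allI less_imp_le[OF less_le_trans[OF sy(4) e(3)]] less_imp_le[OF sy(3)])+
 have fl: "(%k. f (s k, y k)) ----> f (t, x)" by (rule C1_on_dom_seq[OF f1(1) t sl yl])
 have delta1: "delta k < 1" for k
 proof -
  have "1 / real (Suc k) <= 1" by simp
  then show ?thesis using sy(4)[of k] e(3)[of k] by linarith
 qed
 have fb: "\<bar>f (s k, y k)\<bar> <= M + 1" for k
  using r1'[of "(s k, y k)"] sy(2)[of k] e(2)[of k] VM[of "(t, x)"] t fV by auto
 have "\<exists>O'. (\<forall>k. (LINT z:far rho|lborel. - (V (s k, y k + z) - f (s k, y k) - delta k) / z^2) <= O' k) &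
   O' ----> (LINT z:far rho|lborel. - (V (t, x + z) - V (t, x)) / z^2)"
 proof (rule far_upper_limit[OF rho, where B = "2 * M + 2" and Gk = "%k z. - (V (s k, y k + z) - f (s k, y k) - delta k)" and G = "%z. - (V (t, x + z) - V (t, x))"])
  show "(%z. - (V (s k, y k + z) - f (s k, y k) - delta k)) : borel_measurable borel" for k
   using Vmeas[OF sy(1)[of k]] unfolding V_def by measurable
  show "(%z. - (V (t, x + z) - V (t, x))) : borel_measurable borel" using Vmeas[OF t] unfolding V_def by measurable
  show "\<bar>- (V (s k, y k + z) - f (s k, y k) - delta k)\<bar> <= 2 * M + 2" for k z
   using VM[of "(s k, y k + z)"] fb[of k] sy(1,3)[of k] delta1[of k] by (auto simp: V_def)
  show "\<bar>- (V (t, x + z) - V (t, x))\<bar> <= 2 * M + 2" for z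
   using VM[of "(t, x + z)"] VM[of "(t, x)"] t by (auto simp: V_def)
  fix z a assume a: "- (V (t, x + z) - V (t, x)) < a"
  define d where "d = (a + (V (t, x + z) - V (t, x))) / 3"
  have d: "d > 0" using a by (simp add: d_def)
  have "eventually (%k. - V (s k, y k + z) < - V (t, x + z) + d) sequentially"
   unfolding V_def using sy(1) d t by (intro usc_seqD[OF usc_on_dom_imp_seq[OF Vusc]]) (auto intro!: tendsto_intros sl yl)
  moreover have "eventually (%k. f (s k, y k) < V (t, x) + d) sequentially"
   using order_tendstoD(2)[OF fl, of "V (t, x) + d"] d fV by (simp add: V_def)
  moreover have "eventually (%k. delta k < d) sequentially" using order_tendstoD(2)[OF deltal d] .
  ultimately show "eventually (%k. - (V (s k, y k + z) - f (s k, y k) - delta k) < a) sequentially"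
  proof eventually_elim
   case (elim k)
   moreover have "3 * d = a + (V (t, x + z) - V (t, x))" by (simp add: d_def)
   ultimately show ?case by linarith
  qed
 qed blast
 moreover have neg_int: "(LINT z:far rho|lborel. - h z / z^2) = - (LINT z:far rho|lborel. h z / z^2)" for h :: "real => real"
  by (simp add: set_lebesgue_integral_def)
 ultimately obtain O' where O': "!!k. - (LINT z:far rho|lborel. (V (s k, y k + z) - f (s k, y k) - delta k) / z^2) <= O' k"
  "O' ----> - outr rho (%y. V (t, y)) x" unfolding outr_def neg_int by auto
 have "(%k. \<bar>pd_x f (s k, y k)\<bar> * (inn rho (%z. f (s k, z)) (y k) (pd_x f (s k, y k)) - O' k)) \<longlonglongrightarrow>
   \<bar>pd_x f (t, x)\<bar> * (inn rho (%y. f (t, y)) x (pd_x f (t, x)) - - outr rho (%y. V (t, y)) x)"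
  by (intro tendsto_intros C1_on_dom_seq[OF f1(3) t sl yl] inn_tendsto[OF f t rho sl yl] O')
 moreover have "(%k. pd_t f (s k, y k)) ----> pd_t f (t, x)" by (rule C1_on_dom_seq[OF f1(2) t sl yl])
 moreover have "\<bar>pd_x f (s k, y k)\<bar> * (inn rho (%z. f (s k, z)) (y k) (pd_x f (s k, y k)) - O' k) <= pd_t f (s k, y k)" for k
 proof -
  have "\<bar>pd_x f (s k, y k)\<bar> * (inn rho (%z. f (s k, z)) (y k) (pd_x f (s k, y k)) - O' k) \<le>
   \<bar>pd_x f (s k, y k)\<bar> * (inn rho (%z. f (s k, z)) (y k) (pd_x f (s k, y k)) + (LINT z:far rho|lborel. (V (s k, y k + z) - f (s k, y k) - delta k) / z^2))"
   using O'(1)[of k] by (intro mult_left_mono) auto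
  then show ?thesis using sy(5)[of k] by linarith
 qed
 ultimately have "\<bar>pd_x f (t, x)\<bar> * (inn rho (%y. f (t, y)) x (pd_x f (t, x)) - - outr rho (%y. V (t, y)) x) <= pd_t f (t, x)"
  by (intro LIMSEQ_le) auto
 then show False using strict by (simp add: V_def)
qed

text \<open>Perron's argument: if the supersolution inequality fails, lifting the test function a
  little yields the subsolution \<open>max (u p) (f p + delta)\<close>. By maximality it lies below
  \<open>u\<close>, whereas \<open>u\<close> has values close to \<open>f (t, x)\<close> arbitrarily
  near \<open>(t, x)\<close>.\<close>

private lemma bump:
 assumes maximal: "!!w p. HJ_subsolution rho w ==> (!!p. p : HJ_dom ==> \<bar>w p\<bar> <= M) ==> (!!x. usc_env w (0, x) <= usc_env u (0, x)) ==> p : HJ_dom ==> w p <= u p"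
  and f: "C2_on_dom f" and t: "t > 0" and gamma: "gamma > 0" and fV: "f (t, x) = lsc_env u (t, x)"
  and below: "!!p. p : HJ_dom ==> f p + gamma * bowl t x p <= lsc_env u p" and VltM: "lsc_env u (t, x) < M"
  and strict: "pd_t f (t, x) < \<bar>pd_x f (t, x)\<bar> * (inn rho (%y. f (t, y)) x (pd_x f (t, x)) + outr rho (%y. lsc_env u (t, y)) x)"
 shows False
proof -
 define V where "V = lsc_env u"
 have f1: "C1_on_dom f" "C1_on_dom (pd_t f)" "C1_on_dom (pd_x f)" using f by (auto simp: C2_on_dom_def)
 obtain e where e: "e > 0" "!!s y delta. s > 0 ==> dist (s, y) (t, x) < e ==> 0 < delta ==> delta < e ==>
  pd_t f (s, y) <= \<bar>pd_x f (s, y)\<bar> * (inn rho (%z. f (s, z)) y (pd_x f (s, y)) +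
   (LINT z:far rho|lborel. (V (s, y + z) - f (s, y) - delta) / z^2))"
  using strict_nearby[OF f t fV strict] unfolding V_def by blast
 have fc: "isCont f (t, x)" using C1_on_dom_imp_continuous[OF f1(1)] t open_HJ_dom by (simp add: continuous_on_eq_continuous_at)
 define m where "m = (V (t, x) + M) / 2"
 have m: "V (t, x) < m" "m < M" using VltM by (auto simp: m_def V_def)
 have "eventually (%p. f p < m) (at (t, x))" using fc m fV unfolding isCont_def V_def by (intro order_tendstoD) auto
 then obtain r1 where r1: "r1 > 0" "!!p. p ~= (t, x) ==> dist p (t, x) < r1 ==> f p < m"
  unfolding eventually_at by auto
 have r1': "f p < m" if "dist p (t, x) < r1" for p using r1(2)[OF _ that] m fV by (cases "p = (t, x)") (auto simp: V_def)
 \<comment> \<open>\<open>e\<close> keeps the inequality of \<open>strict_nearby\<close>,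
   \<open>r1\<close> leaves room below \<open>M\<close>, and \<open>t/2\<close> keeps away from the
   initial line, so that the initial envelope does not change.\<close>
 define r where "r = min (min e r1) (t/2)"
 have r: "r > 0" "r <= e" "r <= r1" "r <= t/2" using e(1) r1(1) t by (auto simp: r_def)
 obtain mu where mu: "mu > 0" "!!p. dist p (t, x) >= r ==> bowl t x p >= mu" using bowl_far[OF r(1)] by blast
 \<comment> \<open>The bound \<open>gamma * mu\<close> hides the lifted function below
   \<open>lsc_env u\<close> outside the \<open>r\<close>-ball; \<open>M - m\<close> keeps it below
   \<open>M\<close> inside.\<close>
 define delta where "delta = min (min (e/2) (M - m)) (gamma * mu)"
 have delta: "delta > 0" "delta < e" "delta <= M - m" "delta <= gamma * mu" using e(1) m gamma mu(1) by (auto simp: delta_def)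
 define w where "w p = max (u p) (f p + delta)" for p
 have outside: "f p + delta <= V p" if "p : HJ_dom" "dist p (t, x) >= r" for p
 proof -
  have "gamma * mu <= gamma * bowl t x p" using mu(2)[OF that(2)] gamma by (intro mult_left_mono) auto
  then show ?thesis using below[OF that(1)] delta(4) by (simp add: V_def)
 qed
 have wu: "w p = u p" if "p : HJ_dom" "dist p (t, x) >= r" for p
  using outside[OF that] Vu[OF that(1)] by (simp add: w_def V_def)
 have wM: "\<bar>w p\<bar> <= M" if p: "p : HJ_dom" for p
 proof (cases "dist p (t, x) < r")
  case True
  then have "f p + delta <= M" using r1'[of p] r delta by auto
  then show ?thesis using uM[OF p] by (auto simp: w_def abs_le_iff)
 next
  case False
  then show ?thesis using wu[OF p] uM[OF p] by simp
 qed
 have fcont: "continuous_on HJ_dom (%p. f p + delta)" using C1_on_dom_imp_continuous[OF f1(1)] by (intro continuous_intros)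
 have wusc: "usc_on_dom w"
  unfolding w_def using usub by (intro usc_max continuous_imp_usc_on_dom[OF fcont]) (simp add: HJ_subsolution_def)
 have wmeas: "(%y. w (s, y)) : borel_measurable borel" if "s > 0" for s
  by (rule usc_slice_measurable[OF usc_on_dom_imp_seq[OF wusc]]) (use that in simp)
 have umeas: "(%y. u (s, y)) : borel_measurable borel" if "s > 0" for s
  using usub by (intro usc_slice_measurable[OF usc_on_dom_imp_seq]) (use that in \<open>auto simp: HJ_subsolution_def\<close>)
 have wsub: "HJ_subsolution rho w"
  unfolding HJ_subsolution_def
 proof (intro conjI)
  show "bounded (w ` HJ_dom)" by (auto simp: bounded_iff intro!: exI[of _ M] wM)
  show "usc_on_dom w" by (rule wusc)
  have key: "(pd_x phi (s, y) ~= 0 --> pd_t phi (s, y) <= HJ_H rho phi w (s, y)) &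
    ((\<exists>c g. \<forall>(s', y')\<in>HJ_dom. phi (s', y') = c * \<bar>y' - y\<bar> ^ 4 + g s') --> pd_t phi (s, y) <= 0)"
   if phi: "C2_on_dom phi" and sy: "(s, y) : HJ_dom" and con: "\<forall>p\<in>HJ_dom. w p - phi p <= w (s, y) - phi (s, y)" for phi s y
  proof -
   have s: "s > 0" using sy by simp
   have phi1: "C1_on_dom phi" using phi by (simp add: C2_on_dom_def)
   show ?thesis
   proof (cases "f (s, y) + delta <= u (s, y)")
    case True
    then have w_eq: "w (s, y) = u (s, y)" by (simp add: w_def)
    have "\<forall>p\<in>HJ_dom. u p - phi p <= u (s, y) - phi (s, y)"
    proof
     fix p assume "p : HJ_dom"
     then have "w p - phi p <= w (s, y) - phi (s, y)" using con by blast
     moreover have "u p <= w p" by (simp add: w_def)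
     ultimately show "u p - phi p <= u (s, y) - phi (s, y)" using w_eq by linarith
    qed
    then have t1: "(pd_x phi (s, y) ~= 0 --> pd_t phi (s, y) <= HJ_H rho phi u (s, y)) &
     ((\<exists>c g. \<forall>(s', y')\<in>HJ_dom. phi (s', y') = c * \<bar>y' - y\<bar> ^ 4 + g s') --> pd_t phi (s, y) <= 0)"
     using usub phi sy unfolding HJ_subsolution_def by blast
    have "outr rho (%y. u (s, y)) y <= outr rho (%y. w (s, y)) y"
     by (rule outr_mono[OF rho umeas[OF s] _ wmeas[OF s]]) (use uM wM s w_eq in \<open>auto simp: w_def\<close>)
    then have "HJ_H rho phi u (s, y) <= HJ_H rho phi w (s, y)" unfolding HJ_H_eq by (intro mult_left_mono) auto
    then show ?thesis using t1 by auto
   next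
    case False
    then have w_eq: "w (s, y) = f (s, y) + delta" by (simp add: w_def)
    have d: "dist (s, y) (t, x) < e"
     using False outside[OF sy] Vu[OF sy] r(2) by (cases "dist (s, y) (t, x) < r") (auto simp: V_def)
    have le: "phi (s, y) - f (s, y) <= phi p - f p" if "p : HJ_dom" for p
     using con[rule_format, OF that] w_eq by (auto simp: w_def max_def split: if_splits)
    have pd: "pd_t phi (s, y) = pd_t f (s, y)" "pd_x phi (s, y) = pd_x f (s, y)"
     using touch[OF phi1 f1(1) sy zero_less_one le] by auto
    have E: "pd_t f (s, y) <= \<bar>pd_x f (s, y)\<bar> * (inn rho (%z. f (s, z)) y (pd_x f (s, y)) +
      (LINT z:far rho|lborel. (V (s, y + z) - f (s, y) - delta) / z^2))" by (rule e(2)[OF s d delta(1,2)])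
    obtain K where K: "!!t' x' z. \<bar>t' - s\<bar> <= s/2 ==> \<bar>x' - y\<bar> <= 1 ==> \<bar>z\<bar> <= rho ==>
      \<bar>phi (t', x' + z) - phi (t', x') - pd_x phi (t', x') * z\<bar> <= K * z^2"
     using C2_on_dom_x_bound[OF phi s] by metis
    obtain K' where K': "!!t' x' z. \<bar>t' - s\<bar> <= s/2 ==> \<bar>x' - y\<bar> <= 1 ==> \<bar>z\<bar> <= rho ==>
      \<bar>f (t', x' + z) - f (t', x') - pd_x f (t', x') * z\<bar> <= K' * z^2"
     using C2_on_dom_x_bound[OF f s] by metis
    have k1: "\<bar>phi (s, y + z) - phi (s, y) - pd_x f (s, y) * z\<bar> <= K * z^2" if "\<bar>z\<bar> < rho" for z using K[of s y z] that s pd by auto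
    have k2: "\<bar>f (s, y + z) - f (s, y) - pd_x f (s, y) * z\<bar> <= K' * z^2" if "\<bar>z\<bar> < rho" for z using K'[of s y z] that s by auto
    have lez: "f (s, y + z) - f (s, y) - pd_x f (s, y) * z <= phi (s, y + z) - phi (s, y) - pd_x f (s, y) * z" for z
     using le[of "(s, y + z)"] s by simp
    have i: "inn rho (%z. f (s, z)) y (pd_x f (s, y)) <= inn rho (%z. phi (s, z)) y (pd_x f (s, y))"
     by (rule inn_mono[OF rho C1_on_dom_slice_measurable[OF f1(1) s] k2 C1_on_dom_slice_measurable[OF phi1 s] k1 lez])
    have Vm: "(%z. V (s, y + z) - f (s, y) - delta) : borel_measurable borel" using Vmeas[OF s] unfolding V_def by measurable
    have Vb: "\<bar>V (s, y + z) - f (s, y) - delta\<bar> <= M + \<bar>f (s, y)\<bar> + delta" for z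
     using VM[of "(s, y + z)"] s delta(1) by (auto simp: V_def)
    have wb: "\<bar>w (s, z)\<bar> <= M" for z using wM s by simp
    \<comment> \<open>At the shifted points \<open>lsc_env u <= u <= w\<close>, while at the contact
      point \<open>w\<close> equals \<open>f + delta\<close>.\<close>
    have o: "(LINT z:far rho|lborel. (V (s, y + z) - f (s, y) - delta) / z^2) <= outr rho (%z. w (s, z)) y"
     unfolding outr_def
    proof (intro set_integral_mono far_integrable_bound(1)[OF rho Vm Vb] outr_integrable[OF rho wmeas[OF s] wb])
     fix z
     have "V (s, y + z) <= w (s, y + z)" using Vu[of "(s, y + z)"] s by (simp add: V_def w_def)
     then show "(V (s, y + z) - f (s, y) - delta) / z^2 <= (w (s, y + z) - w (s, y)) / z^2"
      unfolding w_eq by (intro divide_right_mono) auto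
    qed
    have "pd_t phi (s, y) <= HJ_H rho phi w (s, y)"
     unfolding HJ_H_eq pd using E i o by (intro order_trans[OF E] mult_left_mono) auto
    moreover have "pd_t phi (s, y) <= 0" if "\<exists>c g. \<forall>(s', y')\<in>HJ_dom. phi (s', y') = c * \<bar>y' - y\<bar> ^ 4 + g s'"
    proof -
     obtain c g where "\<forall>(s', y')\<in>HJ_dom. phi (s', y') = c * \<bar>y' - y\<bar> ^ 4 + g s'" using \<open>\<exists>c g. _\<close> by blast
     then have "pd_x phi (s, y) = 0" by (rule quartic_form_pd_x[OF phi1 s])
     then have "pd_x f (s, y) = 0" using pd by simp
     then show ?thesis using E pd by simp
    qed
    ultimately show ?thesis by blast
   qed
  qed
  then show "\<forall>phi t' x'. C2_on_dom phi & (t', x') : HJ_dom & (\<forall>p\<in>HJ_dom. w p - phi p <= w (t', x') - phi (t', x')) -->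
    (pd_x phi (t', x') ~= 0 --> pd_t phi (t', x') <= HJ_H rho phi w (t', x')) &
    ((\<exists>c g. \<forall>(t, x)\<in>HJ_dom. phi (t, x) = c * \<bar>x - x'\<bar> ^ 4 + g t) --> pd_t phi (t', x') <= 0)"
   by blast
 qed
 have winit: "usc_env w (0, y) <= usc_env u (0, y)" for y
 proof (rule usc_env_mono[of w M u M, OF wM uM])
  show "t/2 > 0" using t by simp
  fix q assume q: "q : HJ_dom" "dist (0, y) q < t/2"
  obtain s z where sz: "q = (s, z)" by (cases q)
  have 1: "\<bar>0 - s\<bar> <= dist (0, y) q" unfolding sz dist_Pair_Pair dist_real_def by (rule real_le_rsqrt) simp
  have 2: "\<bar>s - t\<bar> <= dist q (t, x)" unfolding sz dist_Pair_Pair dist_real_def by (rule real_le_rsqrt) simp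
  have "dist q (t, x) >= r" using 1 2 q(2) r(4) by linarith
  then show "w q <= u q" using wu[OF q(1)] by simp
 qed auto
 have wle: "w p <= u p" if "p : HJ_dom" for p by (rule maximal[OF wsub wM winit that])
 obtain q where q: "!!k::nat. q k : HJ_dom" "q ----> (t, x)" "(%k. - u (q k)) ----> usc_env (%p. - u p) (t, x)"
  using usc_env_seq[of "%p. - u p" M "(t, x)", OF nuM] t by auto
 have ul: "(%k. u (q k)) ----> V (t, x)"
  using tendsto_minus[OF q(3)] by (simp add: V_def lsc_env_eq)
 have "(%k. f (q k) + delta) ----> f (t, x) + delta" by (intro tendsto_intros isCont_tendsto_compose[OF fc q(2)])
 moreover have "f (q k) + delta <= u (q k)" for k using wle[OF q(1)[of k]] by (simp add: w_def)
 ultimately have "f (t, x) + delta <= V (t, x)" by (intro LIMSEQ_le[OF _ ul]) auto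
 then show False using fV delta(1) by (simp add: V_def)
qed

text \<open>Both clauses follow from \<open>~ pd_t psi (t, x) < Lambda\<close>, because
  \<open>Lambda\<close> is 0 when the slope vanishes. A violation survives the subtraction of a
  small bowl, which gives the room needed by \<open>bump\<close>.\<close>

lemma perron_supersolution:
 assumes maximal: "!!w p. HJ_subsolution rho w ==> (!!p. p : HJ_dom ==> \<bar>w p\<bar> <= M) ==> (!!x. usc_env w (0, x) <= usc_env u (0, x)) ==> p : HJ_dom ==> w p <= u p"
 shows "HJ_supersolution rho (lsc_env u)"
proof -
 define V where "V = lsc_env u"
 have key: "(pd_x psi (t, x) ~= 0 --> pd_t psi (t, x) >= HJ_H rho psi V (t, x)) &
    ((\<exists>c g. \<forall>(s, y)\<in>HJ_dom. psi (s, y) = c * \<bar>y - x\<bar> ^ 4 + g s) --> pd_t psi (t, x) >= 0)"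
  if psi: "C2_on_dom psi" and tx: "(t, x) : HJ_dom" and con: "\<forall>p\<in>HJ_dom. V p - psi p >= V (t, x) - psi (t, x)" for psi t x
 proof -
  have t: "t > 0" using tx by simp
  have psi1: "C1_on_dom psi" using psi by (simp add: C2_on_dom_def)
  define P where "P = pd_x psi (t, x)"
  define Lambda where "Lambda = \<bar>P\<bar> * (inn rho (%y. psi (t, y)) x P + outr rho (%y. V (t, y)) x)"
  have no: "~ pd_t psi (t, x) < Lambda" if nz: "P ~= 0 \<or> pd_t psi (t, x) < 0"
  proof
   assume lt: "pd_t psi (t, x) < Lambda"
   define gap where "gap = Lambda - pd_t psi (t, x)"
   \<comment> \<open>At most half of the gap pays for the change of the near integral caused by the
     bowl; the summand 1 keeps the denominator positive when \<open>P = 0\<close>.\<close>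
   define gamma where "gamma = gap / (2 * (\<bar>P\<bar> * (2 * rho ^ 3) + 1))"
   have gap: "gap > 0" using lt by (simp add: gap_def)
   have gamma: "gamma > 0" unfolding gamma_def using gap rho by (intro divide_pos_pos) (auto simp: add_nonneg_pos)
   have gammas: "\<bar>P\<bar> * (gamma * (2 * rho ^ 3)) < gap"
   proof -
    have "\<bar>P\<bar> * (gamma * (2 * rho ^ 3)) <= gamma * (\<bar>P\<bar> * (2 * rho ^ 3) + 1)" using gamma by (simp add: algebra_simps)
    also have "... = gap / 2"
    proof -
     have "\<bar>P\<bar> * (2 * rho ^ 3) + 1 > 0" using rho by (auto simp: add_nonneg_pos)
     then show ?thesis unfolding gamma_def by (metis divide_divide_eq_left mult.commute nonzero_eq_divide_eq less_irrefl)
    qed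
    finally show ?thesis using gap by simp
   qed
   define kappa where "kappa = V (t, x) - psi (t, x)"
   define g where "g = (%(s, y). (- gamma) * (y - x) ^ 4 + (kappa + (- gamma) * (s - t)^2))"
   have gg: "C2fun {0<..} (%s. kappa + (- gamma) * (s - t)^2) (%s. 0 + (- gamma) * (2 * (s - t)))"
    by (intro C2fun_add C2fun_const C2fun_cmult C2fun_pow2)
   note g = C2_on_dom_quartic[OF gg, where c = "- gamma" and y = x, folded g_def]
   define f where "f = (%p. 1 * psi p + 1 * g p)"
   have f2: "C2_on_dom f" unfolding f_def by (rule C2_linD(1)[OF psi g(1)])
   have fpd: "pd_t f (t, x) = pd_t psi (t, x)" "pd_x f (t, x) = P"
    unfolding f_def C2_linD(2)[OF psi g(1) t] C2_linD(3)[OF psi g(1) t] g(2)[OF t] g(3)[OF t] by (auto simp: P_def)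
   have fbowl: "f p = psi p + kappa - gamma * bowl t x p" for p by (cases p) (simp add: f_def g_def bowl_def algebra_simps)
   \<comment> \<open>If \<open>V\<close> had the value \<open>M\<close> there, \<open>psi\<close>
     would have a maximum at \<open>(t, x)\<close> and both derivatives would vanish, contrary to
     \<open>nz\<close>.\<close>
   have VltM: "V (t, x) < M"
   proof (rule ccontr)
    assume "~ V (t, x) < M"
    then have VM': "V (t, x) = M" using VM[OF tx] by (simp add: V_def)
    have C0: "C1_on_dom (%_. 0)" using C2_linD(1)[OF psi psi, of 0 0] by (simp add: C2_on_dom_def)
    have "0 - psi (t, x) <= 0 - psi q" if "q : HJ_dom" for q
     using con[rule_format, OF that] VM[OF that] VM' by (auto simp: V_def abs_le_iff)
    then have "pd_t (%_. 0) (t, x) = pd_t psi (t, x)" "pd_x (%_. 0) (t, x) = pd_x psi (t, x)"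
     using touch[OF C0 psi1 tx zero_less_one] by auto
    then show False using nz by (auto simp: P_def pd_t_def pd_x_def)
   qed
   have "inn rho (%y. f (t, y)) x P = inn rho (%y. 1 * psi (t, y) + (- gamma) * bowl t x (t, y)) x P"
    unfolding inn_def fbowl by (simp add: algebra_simps)
   moreover have "\<bar>inn rho (%y. 1 * psi (t, y) + (- gamma) * bowl t x (t, y)) x P - inn rho (%y. psi (t, y)) x P\<bar> <= \<bar>- gamma\<bar> * (2 * rho ^ 3)"
    by (rule inn_bowl[OF psi t rho P_def])
   ultimately have "inn rho (%y. psi (t, y)) x P <= inn rho (%y. f (t, y)) x P + gamma * (2 * rho ^ 3)" using gamma by (simp add: abs_le_iff)
   then have "\<bar>P\<bar> * (inn rho (%y. psi (t, y)) x P + outr rho (%y. V (t, y)) x) \<le>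
    \<bar>P\<bar> * (inn rho (%y. f (t, y)) x P + gamma * (2 * rho ^ 3) + outr rho (%y. V (t, y)) x)" by (intro mult_left_mono) auto
   then have Lambdale: "Lambda <= \<bar>P\<bar> * (inn rho (%y. f (t, y)) x P + outr rho (%y. V (t, y)) x) + \<bar>P\<bar> * (gamma * (2 * rho ^ 3))"
    unfolding Lambda_def by (simp add: algebra_simps)
   show False
   proof (rule bump[where f = f and t = t and x = x and gamma = gamma])
    show "w p <= u p" if "HJ_subsolution rho w" "!!p. p : HJ_dom ==> \<bar>w p\<bar> <= M"
     "!!x. usc_env w (0, x) <= usc_env u (0, x)" "p : HJ_dom" for w p by (rule maximal[OF that])
    show "C2_on_dom f" "t > 0" "gamma > 0" by fact+
    show "f (t, x) = lsc_env u (t, x)" by (simp add: fbowl bowl_self kappa_def V_def)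
    show "f p + gamma * bowl t x p <= lsc_env u p" if "p : HJ_dom" for p
     using con[rule_format, OF that] by (simp add: fbowl kappa_def V_def)
    show "lsc_env u (t, x) < M" using VltM by (simp add: V_def)
    show "pd_t f (t, x) < \<bar>pd_x f (t, x)\<bar> * (inn rho (%y. f (t, y)) x (pd_x f (t, x)) + outr rho (%y. lsc_env u (t, y)) x)"
     unfolding fpd V_def[symmetric] using Lambdale gammas unfolding gap_def by linarith
   qed
  qed
  show ?thesis
  proof (intro conjI impI)
   assume "pd_x psi (t, x) ~= 0"
   then show "pd_t psi (t, x) >= HJ_H rho psi V (t, x)" using no by (simp add: HJ_H_eq Lambda_def P_def)
  next
   assume "\<exists>c g. \<forall>(s, y)\<in>HJ_dom. psi (s, y) = c * \<bar>y - x\<bar> ^ 4 + g s"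
   then obtain c g where "\<forall>(s, y)\<in>HJ_dom. psi (s, y) = c * \<bar>y - x\<bar> ^ 4 + g s" by blast
   then have "P = 0" unfolding P_def by (rule quartic_form_pd_x[OF psi1 t])
   then show "pd_t psi (t, x) >= 0" using no unfolding Lambda_def by (cases "pd_t psi (t, x) < 0") auto
  qed
 qed
 have lsc: "lsc_on_dom V"
 proof -
  have eq: "{p : HJ_dom. a < V p} = {p : HJ_dom. - V p < - a}" for a by auto
  show ?thesis using Vusc unfolding usc_on_dom_def lsc_on_dom_def V_def[symmetric] eq by blast
 qed
 show ?thesis
  unfolding HJ_supersolution_def V_def[symmetric]
 proof (intro conjI)
  show "bounded (V ` HJ_dom)" unfolding V_def by (auto simp: bounded_iff intro!: exI[of _ M] VM)
  show "lsc_on_dom V" by (rule lsc)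
  show "\<forall>psi t' x'. C2_on_dom psi & (t', x') : HJ_dom & (\<forall>p\<in>HJ_dom. V (t', x') - psi (t', x') <= V p - psi p) -->
   (pd_x psi (t', x') ~= 0 --> HJ_H rho psi V (t', x') <= pd_t psi (t', x')) &
   ((\<exists>c g. \<forall>(t, x)\<in>HJ_dom. psi (t, x) = c * \<bar>x - x'\<bar> ^ 4 + g t) --> 0 <= pd_t psi (t', x'))"
   using key by blast
 qed
qed

end

section \<open>Existence, uniqueness and continuity of the solution\<close>

lemma lsc_env_le_usc_env:
 assumes M: "!!p. p : HJ_dom ==> \<bar>u p\<bar> <= M" and p: "p : HJ_cl"
 shows "lsc_env u p <= usc_env u p"
proof (rule ccontr)
 assume "~ lsc_env u p <= usc_env u p"
 then obtain a where a: "usc_env u p < a" "a < lsc_env u p" using dense not_le by blast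
 then have a': "usc_env (%p. - u p) p < - a" unfolding lsc_env_eq by linarith
 have M': "!!p. p : HJ_dom ==> \<bar>- u p\<bar> <= M" using M by simp
 obtain r1 where r1: "r1 > 0" "!!q. q : HJ_dom ==> dist p q < r1 ==> u q < a"
  using usc_env_lessD[of u M, OF M p a(1)] by blast
 obtain r2 where r2: "r2 > 0" "!!q. q : HJ_dom ==> dist p q < r2 ==> - u q < - a"
  using usc_env_lessD[of "%p. - u p" M, OF M' p a'] by blast
 have "HJ_dom \<inter> ball p (min r1 r2) ~= {}" using r1(1) r2(1) by (intro HJ_dom_ball_nonempty[OF p]) simp
 then obtain q where "q : HJ_dom \<inter> ball p (min r1 r2)" by blast
 then have "q : HJ_dom" "dist p q < r1" "dist p q < r2" by auto
 then show False using r1(2)[of q] r2(2)[of q] by linarith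
qed

lemma ext_sub_cong:
 assumes "ext_sub M u0 U" "!!p. p : HJ_cl ==> U' p = U p"
 shows "ext_sub M u0 U'"
proof -
 have U: "usc_seq HJ_cl U" "!!p. p : HJ_cl ==> \<bar>U p\<bar> <= M" "qsub 0 {0<..} U" "!!x. U (0, x) <= u0 x"
  using assms(1) by (auto simp: ext_sub_def)
 have eq: "U' p = U p" if "p : HJ_cl" for p by (rule assms(2)[OF that])
 have "usc_seq HJ_cl U'"
  using U(1) unfolding usc_seq_def by (simp add: eq)
 moreover have "qsub 0 {0<..} U'" by (rule qsub_cong[OF U(3)]) (rule eq, simp)
 ultimately show ?thesis using U(2,4) unfolding ext_sub_def by (simp add: eq)
qed

lemma ext_sub_mono: "ext_sub M u0 U ==> M <= M' ==> ext_sub M' u0 U"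
 unfolding ext_sub_def by force

lemma usc_both_continuous:
 fixes f :: "'a::metric_space => real"
 assumes "usc_seq X f" "usc_seq X (%p. - f p)"
 shows "continuous_on X f"
 unfolding continuous_on_sequentially o_def
proof (intro allI ballI impI; elim conjE)
 fix q p assume q: "\<forall>n. q n : X" "q ----> p" "p : X"
 show "(%n. f (q n)) ----> f p"
 proof (rule order_tendstoI)
  show "eventually (%n. f (q n) < a) sequentially" if "f p < a" for a
   using usc_seqD[OF assms(1) q(3) _ q(2) that] q(1) by blast
  show "eventually (%n. a < f (q n)) sequentially" if "a < f p" for a
   using usc_seqD[OF assms(2) q(3) _ q(2), of "- a"] q(1) that by simp
 qed
qed

text \<open>\<open>N\<close> is the envelope of the supremum of all subsolutions starting below
  \<open>u0\<close>. A uniform initial bound keeps \<open>N\<close> below the datum at time 0,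
  explicit subsolutions keep its lower envelope \<open>V\<close> above it, and comparison identifies
  \<open>N\<close> with \<open>V\<close>. This gives continuity and the initial values at one
  stroke.\<close>

theorem HJ_well_posed:
 assumes u0: "datum M u0" and rho: "rho > 0"
 obtains U where "unique_HJ_solution rho u0 U" "continuous_on HJ_cl U" "!!x. U (0, x) = u0 x"
  "ext_sub M u0 U" "ext_sub M (%x. - u0 x) (%p. - U p)"
proof -
 have M: "M > 0" and u0M: "\<bar>u0 x\<bar> <= M" for x using u0 by (auto simp: datum_def)
 have cl: "q : HJ_dom ==> q : HJ_cl" for q by (cases q) auto
 define S where "S = {w : subs rho M. \<forall>x. usc_env w (0, x) <= u0 x}"
 have SM: "\<bar>w p\<bar> <= M" if "w : S" "p : HJ_dom" for w p using that by (auto simp: S_def subs_def)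
 \<comment> \<open>One \<open>e\<close> covers the oscillation of the datum within \<open>D\<close>,
   the other the decay of the barrier near \<open>(0, y)\<close>.\<close>
 have lower: "\<exists>w\<in>S. \<exists>r>0. \<forall>q\<in>HJ_dom. dist (0, y) q < r --> u0 y - 2 * e <= w q" if e: "e > 0" for e y
 proof -
  obtain D where D: "D > 0" "!!x y. \<bar>x - y\<bar> <= D ==> \<bar>u0 x - u0 y\<bar> <= e" using datum_uniform[OF u0 e] by auto
  define A where "A = max (- M) (u0 y - e)"
  have A: "- M <= A" "A <= M" using u0M[of y] e M by (auto simp: A_def abs_le_iff)
  define c where "c = 2 * M / D ^ 4"
  define K where "K = (8 * M / D) * (2 * qC c D rho * rho + 4 * M / rho)"
  have c: "c > 0" using M D by (simp add: c_def)
  have K: "K >= 0" unfolding K_def using M D(1) rho c by (auto simp: qC_def)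
  define w where "w = (%(t, x). max (- M) (A - c * (x - y) ^ 4 - K * t))"
  have wsub: "HJ_subsolution rho w"
   using barrier_subsolution[OF M A D(1) rho, of y] unfolding w_def K_def c_def .
  have wb: "\<bar>w (t, x)\<bar> <= M" if "t > 0" for t x
  proof -
   have "0 <= c * (x - y) ^ 4" "0 <= K * t" using c K that by auto
   then show ?thesis using A M by (auto simp: w_def abs_le_iff)
  qed
  have wu0: "w (t, x) <= u0 x" if "t > 0" for t x
  proof -
   have 1: "A - c * (x - y) ^ 4 - K * t <= A - c * (x - y) ^ 4" using K that by simp
   have "A - c * (x - y) ^ 4 <= u0 x"
   proof (cases "\<bar>x - y\<bar> <= D")
    case True
    have "A <= u0 x" using D(2)[OF True] u0M[of x] unfolding A_def by (auto simp: abs_le_iff)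
    moreover have "0 <= c * (x - y) ^ 4" using c by simp
    ultimately show ?thesis by linarith
   next
    case False
    have "D ^ 4 <= \<bar>x - y\<bar> ^ 4" using False D(1) by (intro power_mono) auto
    then have "c * D ^ 4 <= c * (x - y) ^ 4" using c by (intro mult_left_mono) (auto simp: power_even_abs)
    moreover have "c * D ^ 4 = 2 * M" using D(1) by (simp add: c_def)
    ultimately show ?thesis using A(2) u0M[of x] by (simp add: abs_le_iff)
   qed
   then show ?thesis using 1 u0M[of x] by (simp add: w_def abs_le_iff)
  qed
  have winit: "usc_env w (0, x) <= u0 x" for x
  proof (rule field_le_epsilon)
   fix e' :: real assume e': "e' > 0"
   obtain d where d: "d > 0" "!!x y. \<bar>x - y\<bar> <= d ==> \<bar>u0 x - u0 y\<bar> <= e'" using datum_uniform[OF u0 e'] by auto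
   show "usc_env w (0, x) <= u0 x + e'"
   proof (rule usc_env_leI[of w M _ d])
    show "\<bar>w p\<bar> <= M" if "p : HJ_dom" for p using wb that by (cases p) auto
    fix q assume q: "q : HJ_dom" "dist (0, x) q < d"
    obtain s z where sz: "q = (s, z)" by (cases q)
    have "\<bar>x - z\<bar> <= dist (0, x) q" unfolding sz dist_Pair_Pair dist_real_def by (rule real_le_rsqrt) simp
    then have "\<bar>z - x\<bar> <= d" using q(2) by linarith
    then have "u0 z <= u0 x + e'" using d(2)[of z x] by linarith
    moreover have "w q <= u0 z" using wu0[of s z] q(1) sz by simp
    ultimately show "w q <= u0 x + e'" by linarith
   qed (use d in auto)
  qed
  have wS: "w : S" using wsub wb winit by (auto simp: S_def subs_def HJ_dom_def)
  define r where "r = min 1 (e / (c + K + 1))"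
  have r: "r > 0" "r <= 1" "(c + K) * r <= e"
  proof -
   show "r > 0" "r <= 1" using e c K by (auto simp: r_def)
   have "(c + K) * r <= (c + K) * (e / (c + K + 1))" using c K by (intro mult_left_mono) (auto simp: r_def)
   also have "... <= e" using c K e by (simp add: field_simps)
   finally show "(c + K) * r <= e" .
  qed
  have "u0 y - 2 * e <= w q" if q: "q : HJ_dom" "dist (0, y) q < r" for q
  proof -
   obtain s z where sz: "q = (s, z)" by (cases q)
   have 1: "\<bar>y - z\<bar> <= dist (0, y) q" "\<bar>0 - s\<bar> <= dist (0, y) q"
    unfolding sz dist_Pair_Pair dist_real_def by (rule real_le_rsqrt, simp)+
   have zy: "\<bar>z - y\<bar> <= r" and s: "0 < s" "s <= r" using 1 q sz by auto
   have "\<bar>z - y\<bar> ^ 4 <= r ^ 4" using zy by (intro power_mono) auto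
   also have "r ^ 4 <= r ^ 1" using r by (intro power_decreasing) auto
   finally have "c * (z - y) ^ 4 <= c * r" using c by (intro mult_left_mono) (auto simp: power_even_abs)
   moreover have "K * s <= K * r" using K s by (intro mult_left_mono) auto
   ultimately have "A - e <= A - c * (z - y) ^ 4 - K * s" using r(3) by (simp add: algebra_simps)
   moreover have "A >= u0 y - e" by (simp add: A_def)
   ultimately show ?thesis by (simp add: w_def sz)
  qed
  then show ?thesis using wS r(1) by blast
 qed
 have Sne: "S ~= {}" using lower[OF zero_less_one] by blast
 define v where "v = (%p. SUP w\<in>S. w p)"
 have Ssub: "S \<subseteq> subs rho M" by (auto simp: S_def)
 have sup: "HJ_subsolution rho (usc_env v)" "!!p. p : HJ_dom ==> \<bar>v p\<bar> <= M"
  "!!w p. w : S ==> p : HJ_dom ==> w p <= v p"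
  using sup_subsolution[OF Ssub Sne rho] unfolding v_def by blast+
 note vM = sup(2)
 define N where "N = usc_env v"
 have Nsub: "HJ_subsolution rho N" unfolding N_def by (rule sup(1))
 have NMcl: "\<bar>N p\<bar> <= M" if "p : HJ_cl" for p unfolding N_def using usc_env_bound[of v M, OF vM that] .
 have NM: "\<bar>N p\<bar> <= M" if "p : HJ_dom" for p using NMcl[OF cl[OF that]] .
 have vN: "v p <= N p" if "p : HJ_dom" for p unfolding N_def using usc_env_ge[of v M, OF vM that] .
 have Nidem: "usc_env N p = N p" if "p : HJ_cl" for p unfolding N_def by (rule usc_env_idem[of v M, OF vM that])
 have N0: "N (0, x) <= u0 x" for x
 proof (rule field_le_epsilon)
  fix e :: real assume e: "e > 0"
  have B: "0 <= 1800 * M^2" by simp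
  \<comment> \<open>The time \<open>t0\<close> is common to all members of \<open>S\<close>, so the
    bound passes to their supremum.\<close>
  obtain t0 where t0: "t0 > 0" "!!U sig T t x. local_bound (1800 * M^2) sig M u0 T U ==> t : {0..T} ==> t <= t0 ==> U (t, x) <= u0 x + sig + e/2"
   using local_bound_initial[OF u0 B, of "e/2"] e by (metis half_gt_zero)
  obtain d where d: "d > 0" "!!x y. \<bar>x - y\<bar> <= d ==> \<bar>u0 x - u0 y\<bar> <= e/2" using datum_uniform[OF u0, of "e/2"] e by auto
  show "N (0, x) <= u0 x + e"
   unfolding N_def
  proof (rule usc_env_leI[of v M _ "min t0 d", OF vM])
   fix q assume q: "q : HJ_dom" "dist (0, x) q < min t0 d"
   obtain s z where sz: "q = (s, z)" by (cases q)
   have 1: "\<bar>x - z\<bar> <= dist (0, x) q" "\<bar>0 - s\<bar> <= dist (0, x) q"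
    unfolding sz dist_Pair_Pair dist_real_def by (rule real_le_rsqrt, simp)+
   have s: "s > 0" using q sz by simp
   have st: "s <= t0" and zx: "\<bar>z - x\<bar> <= d" using 1 q(2) by auto
   have "w (s, z) <= u0 z + e/2" if w: "w : S" for w
   proof -
    have "ext_sub M u0 (usc_env w)" using w by (intro subsolution_ext_sub[OF _ rho SM[OF w]]) (auto simp: S_def subs_def)
    from t0(2)[OF ext_sub_local_bound[OF this M, of s], of s z] s st
    have "usc_env w (s, z) <= u0 z + e/2" by simp
    moreover have "w (s, z) <= usc_env w (s, z)" by (rule usc_env_ge[of w M, OF SM[OF w]]) (use s in auto)
    ultimately show ?thesis by linarith
   qed
   then have "v (s, z) <= u0 z + e/2" unfolding v_def by (intro cSUP_least Sne)
   moreover have "u0 z <= u0 x + e/2" using d(2)[OF zx] by linarith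
   ultimately show "v q <= u0 x + e" using sz by simp
  qed (use t0 d in auto)
 qed
 define V where "V = lsc_env N"
 have nNM: "\<bar>- N p\<bar> <= M" if "p : HJ_dom" for p using NM[OF that] by simp
 have Vsup: "HJ_supersolution rho V"
  unfolding V_def
 proof (rule perron_supersolution[OF rho Nsub NM])
  fix w p assume w: "HJ_subsolution rho w" "!!p. p : HJ_dom ==> \<bar>w p\<bar> <= M" "!!x. usc_env w (0, x) <= usc_env N (0, x)" and p: "p : HJ_dom"
  have "usc_env w (0, x) <= u0 x" for x using w(3)[of x] Nidem[of "(0, x)"] N0[of x] by simp
  then have "w : S" using w(1,2) by (simp add: S_def subs_def)
  then show "w p <= N p" using sup(3)[OF _ p] vN[OF p] by (meson order_trans)
 qed
 have negV: "(%p. - V p) = usc_env (%p. - N p)" by (simp add: V_def lsc_env_eq fun_eq_iff)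
 have V0: "- V (0, y) <= - u0 y" for y
 proof (rule field_le_epsilon)
  fix e :: real assume e: "e > 0"
  obtain w r where w: "w : S" "r > 0" "!!q. q : HJ_dom ==> dist (0, y) q < r ==> u0 y - 2 * (e/2) <= w q"
   using lower[of "e/2" y] e by auto
  have "usc_env (%p. - N p) (0, y) <= - u0 y + e"
  proof (rule usc_env_leI[of "%p. - N p" M _ r, OF nNM])
   fix q assume q: "q : HJ_dom" "dist (0, y) q < r"
   show "- N q <= - u0 y + e" using w(3)[OF q] sup(3)[OF w(1) q(1)] vN[OF q(1)] by simp
  qed (use w in auto)
  then show "- V (0, y) <= - u0 y + e" by (simp add: V_def lsc_env_eq)
 qed
 have VM: "\<bar>- V p\<bar> <= M" if "p : HJ_dom" for p
  using usc_env_bound[of "%p. - N p" M, OF nNM cl[OF that]] by (simp add: V_def lsc_env_eq)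
 have Videm: "usc_env (%p. - V p) p = - V p" if "p : HJ_cl" for p
  unfolding negV using usc_env_idem[of "%p. - N p" M, OF nNM that] by (simp add: V_def lsc_env_eq)
 have extN: "ext_sub M u0 N"
  by (rule ext_sub_cong[OF subsolution_ext_sub[OF Nsub rho NM]]) (use Nidem N0 in auto)
 have extV: "ext_sub M (%x. - u0 x) (%p. - V p)"
  by (rule ext_sub_cong[OF subsolution_ext_sub[OF Vsup[unfolded supersolution_iff] rho VM]]) (use Videm V0 in auto)
 have NV: "N p = V p" if "p : HJ_cl" for p
 proof (rule antisym)
  obtain t x where tx: "p = (t, x)" by (cases p)
  show "N p <= V p" using comparison[OF u0 extN extV, of t x] that tx by simp
  show "V p <= N p" using lsc_env_le_usc_env[of N M, OF NM that] Nidem[OF that] by (simp add: V_def)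
 qed
 have extN': "ext_sub M (%x. - u0 x) (%p. - N p)" by (rule ext_sub_cong[OF extV]) (simp add: NV)
 have N0eq: "N (0, x) = u0 x" for x using N0[of x] V0[of x] NV[of "(0, x)"] by simp
 have usc_lsc: "usc_env N p = N p" "lsc_env N p = N p" if "p : HJ_cl" for p
  using Nidem[OF that] NV[OF that] by (auto simp: V_def)
 have sol: "unique_HJ_solution rho u0 N"
  unfolding unique_HJ_solution_def
 proof (intro conjI allI impI ballI; (elim conjE)?)
  have "HJ_subsolution rho (usc_env N)"
  proof -
   have wS: "N : subs rho M" using Nsub NM by (simp add: subs_def)
   have "(%p. SUP w\<in>{N}. w p) = N" by simp
   then show ?thesis using sup_subsolution(1)[OF _ _ rho, of "{N}" M] wS by simp
  qed
  then show "HJ_viscosity_solution rho N"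
   using Vsup by (auto simp: HJ_viscosity_solution_def V_def bounded_iff intro!: exI[of _ M] NM)
  show "has_initial_datum N u0" using usc_lsc N0eq by (simp add: has_initial_datum_def)
  fix v' p assume v': "HJ_viscosity_solution rho v'" "has_initial_datum v' u0" and p: "p : HJ_dom"
  obtain t x where tx: "p = (t, x)" by (cases p)
  have t: "t > 0" using p tx by simp
  obtain M' where M': "!!q. q : HJ_dom ==> \<bar>v' q\<bar> <= M'" using v'(1) by (auto simp: HJ_viscosity_solution_def bounded_iff)
  \<comment> \<open>A competing solution may have a larger bound than \<open>M\<close>; comparison
    takes place with the common bound \<open>M2\<close>.\<close>
  define M2 where "M2 = max M M'"
  have v'M: "\<bar>v' q\<bar> <= M2" if "q : HJ_dom" for q using M'[OF that] by (simp add: M2_def)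
  have nv'M: "\<bar>- v' q\<bar> <= M2" if "q : HJ_dom" for q using v'M[OF that] by simp
  have d2: "datum M2 u0" using u0 M by (auto simp: datum_def M2_def max.coboundedI1)
  have MM2: "M <= M2" by (simp add: M2_def)
  have b1: "\<bar>usc_env v' q\<bar> <= M2" if "q : HJ_dom" for q using usc_env_bound[of v' M2, OF v'M cl[OF that]] .
  have b2: "\<bar>- lsc_env v' q\<bar> <= M2" if "q : HJ_dom" for q
   using usc_env_bound[of "%p. - v' p" M2, OF nv'M cl[OF that]] by (simp add: lsc_env_eq)
  have i1: "usc_env (usc_env v') q = usc_env v' q" if "q : HJ_cl" for q by (rule usc_env_idem[of v' M2, OF v'M that])
  have eqn: "(%q. - lsc_env v' q) = usc_env (%q. - v' q)" by (simp add: lsc_env_eq fun_eq_iff)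
  have i2: "usc_env (%q. - lsc_env v' q) q = - lsc_env v' q" if "q : HJ_cl" for q
   unfolding eqn using usc_env_idem[of "%q. - v' q" M2, OF nv'M that] by (simp add: lsc_env_eq)
  have e1: "ext_sub M2 u0 (usc_env v')"
   by (rule ext_sub_cong[OF subsolution_ext_sub[OF _ rho b1]])
     (use v' i1 in \<open>auto simp: HJ_viscosity_solution_def has_initial_datum_def\<close>)
  have e2: "ext_sub M2 (%x. - u0 x) (%q. - lsc_env v' q)"
   by (rule ext_sub_cong[OF subsolution_ext_sub[OF _ rho b2]])
     (use v' i2 in \<open>auto simp: HJ_viscosity_solution_def has_initial_datum_def supersolution_iff\<close>)
  have "usc_env v' (t, x) <= N (t, x)" using comparison[OF d2 e1 ext_sub_mono[OF extN' MM2], of t x] t by simp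
  moreover have "N (t, x) <= lsc_env v' (t, x)" using comparison[OF d2 ext_sub_mono[OF extN MM2] e2, of t x] t by simp
  moreover have "v' (t, x) <= usc_env v' (t, x)" by (rule usc_env_ge[of v' M2, OF v'M]) (use t in auto)
  moreover have "lsc_env v' (t, x) <= v' (t, x)"
  proof -
   have "- v' (t, x) <= usc_env (%q. - v' q) (t, x)" by (rule usc_env_ge[of "%q. - v' q" M2, OF nv'M]) (use t in auto)
   then show ?thesis by (simp add: lsc_env_eq)
  qed
  ultimately show "v' p = N p" using tx by simp
 qed
 have cont: "continuous_on HJ_cl N"
  by (rule usc_both_continuous) (use extN extN' in \<open>auto simp: ext_sub_def\<close>)
 show ?thesis by (rule that[OF sol cont N0eq extN extN'])
qed

section \<open>Distribution functions of particle configurations\<close>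

text \<open>
 \<open>FI\<close> and \<open>FM\<close> are \<open>n\<close> times the distribution function and its left limit; \<open>UU\<close> is the upper
 semicontinuous envelope of the distribution function.\<close>

definition FI :: "nat => (nat => real) => (nat => int) => real => int" where
 "FI n x b y = (\<Sum>i=1..n. if x i <= y then b i else 0)"

definition FM :: "nat => (nat => real) => (nat => int) => real => int" where
 "FM n x b y = (\<Sum>i=1..n. if x i < y then b i else 0)"

definition UU :: "nat => (nat => real) => (nat => int) => real => real" where
 "UU n x b y = real_of_int (max (FI n x b y) (FM n x b y)) / real n"

lemma charge_measure_atMost: "charge_measure n x b {..y} = real_of_int (FI n x b y) / real n"
proof -
 have "(\<Sum>i=1..n. real_of_int (b i) * indicator {..y} (x i)) = real_of_int (FI n x b y)"
  unfolding FI_def of_int_sum by (intro sum.cong refl) (auto simp: indicator_def)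
 then show ?thesis by (simp add: charge_measure_def)
qed

lemma Zn_distinct:
 assumes "(x, b) : Zn n" "i : {1..n}" "j : {1..n}" "b i ~= 0" "b j ~= 0" "x i = x j"
 shows "i = j"
proof (rule ccontr)
 assume "i ~= j"
 then consider "i > j" | "j > i" by linarith
 moreover have "x i > x j" if "i : {1..n}" "j : {1..n}" "i > j" "b i * b j ~= 0" for i j
  using assms(1) that unfolding Zn_def by blast
 ultimately show False using assms by cases force+
qed

lemma Zn_charge: assumes "(x, b) : Zn n" "i : {1..n}" shows "b i = -1 \<or> b i = 0 \<or> b i = 1"
 using assms unfolding Zn_def by blast

lemma FI_bound:
 assumes "(x, b) : Zn n"
 shows "\<bar>FI n x b y\<bar> <= int n" "\<bar>FM n x b y\<bar> <= int n"
proof -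
 have b: "\<bar>b i\<bar> <= 1" if "i : {1..n}" for i using Zn_charge[OF assms that] by auto
 have "\<bar>FI n x b y\<bar> <= (\<Sum>i=1..n. \<bar>if x i <= y then b i else 0\<bar>)" unfolding FI_def by (rule sum_abs)
 also have "... <= (\<Sum>i=1..n. 1)" by (rule sum_mono) (use b in auto)
 finally show "\<bar>FI n x b y\<bar> <= int n" by simp
 have "\<bar>FM n x b y\<bar> <= (\<Sum>i=1..n. \<bar>if x i < y then b i else 0\<bar>)" unfolding FM_def by (rule sum_abs)
 also have "... <= (\<Sum>i=1..n. 1)" by (rule sum_mono) (use b in auto)
 finally show "\<bar>FM n x b y\<bar> <= int n" by simp
qed

lemma UU_bound:
 assumes "(x, b) : Zn n" "n >= 1" shows "\<bar>UU n x b y\<bar> <= 1"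
proof -
 have "\<bar>max (FI n x b y) (FM n x b y)\<bar> <= int n" using FI_bound[OF assms(1), of y] by (auto simp: max_def)
 then have "\<bar>real_of_int (max (FI n x b y) (FM n x b y))\<bar> <= real n" by linarith
 then show ?thesis using assms(2) by (simp add: UU_def abs_divide)
qed

lemma FI_le_UU: "real_of_int (FI n x b y) / real n <= UU n x b y"
 unfolding UU_def by (intro divide_right_mono) auto

text \<open>At most one charged particle sits at \<open>y\<close>. Particles elsewhere keep their
  side of \<open>y\<close> when positions and \<open>y\<close> move by less than half of the gap
  \<open>D\<close>, so only the term of that one charge can change.\<close>

lemma cdf_perturb:
 assumes Z: "(x, b) : Zn n"
 obtains d where "d > 0"
  "!!x' y'. (!!i. i : {1..n} ==> \<bar>x' i - x i\<bar> < d) ==> \<bar>y' - y\<bar> < d ==>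
    (!!i. i : {1..n} ==> b i ~= 0 ==> x i ~= y) ==> FI n x' b y' = FI n x b y & FM n x' b y' = FI n x b y & FM n x b y = FI n x b y"
  "!!x' y' i0. (!!i. i : {1..n} ==> \<bar>x' i - x i\<bar> < d) ==> \<bar>y' - y\<bar> < d ==>
    i0 : {1..n} ==> b i0 ~= 0 ==> x i0 = y ==>
    FI n x' b y' = FM n x b y + (if x' i0 <= y' then b i0 else 0) &
    FM n x' b y' = FM n x b y + (if x' i0 < y' then b i0 else 0) & FI n x b y = FM n x b y + b i0"
proof -
 define D where "D = Min (insert 1 ((%i. \<bar>x i - y\<bar>) ` {i\<in>{1..n}. x i ~= y}))"
 have D: "D > 0" unfolding D_def by (subst Min_gr_iff) auto
 have Dle: "D <= \<bar>x i - y\<bar>" if "i : {1..n}" "x i ~= y" for i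
  unfolding D_def by (rule Min_le) (use that in auto)
 have side: "(x' i <= y') = (x i < y)" "(x' i < y') = (x i < y)" "(x i <= y) = (x i < y)"
  if "i : {1..n}" "x i ~= y" "!!i. i : {1..n} ==> \<bar>x' i - x i\<bar> < D/2" "\<bar>y' - y\<bar> < D/2" for x' y' i
  using Dle[OF that(1,2)] that(3)[OF that(1)] that(4) that(2) by linarith+
 show ?thesis
 proof (rule that[of "D/2"])
  show "D/2 > 0" using D by simp
  fix x' :: "nat => real" and y' assume near: "!!i. i : {1..n} ==> \<bar>x' i - x i\<bar> < D/2" "\<bar>y' - y\<bar> < D/2"
  {
   assume no: "!!i. i : {1..n} ==> b i ~= 0 ==> x i ~= y"
   have "FI n x' b y' = FM n x b y" "FM n x' b y' = FM n x b y" "FI n x b y = FM n x b y"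
    unfolding FI_def FM_def
    by (intro sum.cong refl; metis no side near)+
   then show "FI n x' b y' = FI n x b y & FM n x' b y' = FI n x b y & FM n x b y = FI n x b y" by simp
  next
   fix i0 assume i0: "i0 : {1..n}" "b i0 ~= 0" "x i0 = y"
   have no: "b i = 0 \<or> x i ~= y" if "i : {1..n} - {i0}" for i using Zn_distinct[OF Z, of i i0] that i0 by auto
   have "FI n x' b y' = (if x' i0 <= y' then b i0 else 0) + (\<Sum>i\<in>{1..n} - {i0}. if x' i <= y' then b i else 0)"
    unfolding FI_def using i0 by (subst sum.remove[of _ i0]) auto
   moreover have "FM n x' b y' = (if x' i0 < y' then b i0 else 0) + (\<Sum>i\<in>{1..n} - {i0}. if x' i < y' then b i else 0)"
    unfolding FM_def using i0 by (subst sum.remove[of _ i0]) auto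
   moreover have "FI n x b y = b i0 + (\<Sum>i\<in>{1..n} - {i0}. if x i <= y then b i else 0)"
    unfolding FI_def using i0 by (subst sum.remove[of _ i0]) auto
   moreover have "FM n x b y = (\<Sum>i\<in>{1..n} - {i0}. if x i < y then b i else 0)"
    unfolding FM_def using i0 by (subst sum.remove[of _ i0]) auto
   moreover have "(\<Sum>i\<in>{1..n} - {i0}. if x' i <= y' then b i else 0) = (\<Sum>i\<in>{1..n} - {i0}. if x i < y then b i else 0)"
    "(\<Sum>i\<in>{1..n} - {i0}. if x' i < y' then b i else 0) = (\<Sum>i\<in>{1..n} - {i0}. if x i < y then b i else 0)"
    "(\<Sum>i\<in>{1..n} - {i0}. if x i <= y then b i else 0) = (\<Sum>i\<in>{1..n} - {i0}. if x i < y then b i else 0)"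
    by (intro sum.cong refl; metis no side near DiffD1)+
   ultimately show "FI n x' b y' = FM n x b y + (if x' i0 <= y' then b i0 else 0) &
     FM n x' b y' = FM n x b y + (if x' i0 < y' then b i0 else 0) & FI n x b y = FM n x b y + b i0" by simp
  }
 qed
qed

text \<open>\<open>UU\<close> takes the larger one-sided value at a jump, so small motions can only
  lower it. It is unchanged if the observer stays on the higher side of the particle: to the right
  of a positive charge, to the left of a negative one.\<close>

lemma UU_perturb:
 assumes Z: "(x, b) : Zn n"
 obtains d where "d > 0"
  "!!x' y'. (!!i. i : {1..n} ==> \<bar>x' i - x i\<bar> < d) ==> \<bar>y' - y\<bar> < d ==> UU n x' b y' <= UU n x b y"
  "!!x' y'. (!!i. i : {1..n} ==> \<bar>x' i - x i\<bar> < d) ==> \<bar>y' - y\<bar> < d ==>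
    (!!i. i : {1..n} ==> b i ~= 0 ==> x i ~= y) ==> UU n x' b y' = UU n x b y"
  "!!x' y' i0. (!!i. i : {1..n} ==> \<bar>x' i - x i\<bar> < d) ==> \<bar>y' - y\<bar> < d ==>
    i0 : {1..n} ==> b i0 ~= 0 ==> x i0 = y ==> (if b i0 > 0 then x' i0 <= y' else y' <= x' i0) ==> UU n x' b y' = UU n x b y"
proof -
 obtain d where d: "d > 0"
  "!!x' y'. (!!i. i : {1..n} ==> \<bar>x' i - x i\<bar> < d) ==> \<bar>y' - y\<bar> < d ==>
    (!!i. i : {1..n} ==> b i ~= 0 ==> x i ~= y) ==> FI n x' b y' = FI n x b y & FM n x' b y' = FI n x b y & FM n x b y = FI n x b y"
  "!!x' y' i0. (!!i. i : {1..n} ==> \<bar>x' i - x i\<bar> < d) ==> \<bar>y' - y\<bar> < d ==>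
    i0 : {1..n} ==> b i0 ~= 0 ==> x i0 = y ==>
    FI n x' b y' = FM n x b y + (if x' i0 <= y' then b i0 else 0) &
    FM n x' b y' = FM n x b y + (if x' i0 < y' then b i0 else 0) & FI n x b y = FM n x b y + b i0"
  using cdf_perturb[OF Z, where y = y] by blast
 have a: "UU n x' b y' = UU n x b y" if "!!i. i : {1..n} ==> \<bar>x' i - x i\<bar> < d" "\<bar>y' - y\<bar> < d"
  "!!i. i : {1..n} ==> b i ~= 0 ==> x i ~= y" for x' y'
  using d(2)[OF that] by (simp add: UU_def)
 have m: "max (FI n x' b y') (FM n x' b y') <= max (FI n x b y) (FM n x b y)"
  if "!!i. i : {1..n} ==> \<bar>x' i - x i\<bar> < d" "\<bar>y' - y\<bar> < d" "i0 : {1..n}" "b i0 ~= 0" "x i0 = y" for x' y' i0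
  using d(3)[OF that] by (simp add: max_def)
 show ?thesis
 proof (rule that[OF d(1)])
  fix x' :: "nat => real" and y' assume near: "!!i. i : {1..n} ==> \<bar>x' i - x i\<bar> < d" "\<bar>y' - y\<bar> < d"
  show "UU n x' b y' <= UU n x b y"
  proof (cases "\<exists>i0\<in>{1..n}. b i0 ~= 0 & x i0 = y")
   case True
   then obtain i0 where i0: "i0 : {1..n}" "b i0 ~= 0" "x i0 = y" by blast
   show ?thesis unfolding UU_def
    by (intro divide_right_mono of_int_le_iff[THEN iffD2] m[OF near i0]) auto
  next
   case False
   then show ?thesis using a[OF near] by fastforce
  qed
  show "UU n x' b y' = UU n x b y" if "!!i. i : {1..n} ==> b i ~= 0 ==> x i ~= y" by (rule a[OF near that])
  show "UU n x' b y' = UU n x b y" if i0: "i0 : {1..n}" "b i0 ~= 0" "x i0 = y" and s: "if b i0 > 0 then x' i0 <= y' else y' <= x' i0" for i0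
  proof -
   have "max (FI n x' b y') (FM n x' b y') = max (FI n x b y) (FM n x b y)"
    using d(3)[OF near i0] s i0(2) by (auto simp: max_def split: if_splits)
   then show ?thesis by (simp add: UU_def)
  qed
 qed
qed

text \<open>
 At a contact point, an integer-valued quantity lies below \<open>N (P z + C z^2)\<close> on the right and below
 \<open>N (- P z + C z^2)\<close> on the left. The sum of the floors is \<open>- 1\<close> unless \<open>z\<close> is within \<open>O(z^2)\<close> of
 a multiple of \<open>1 / (N P)\<close>, so the exceptional set has small measure.\<close>

lemma floor_gap_count:
 fixes P C N z r1 :: real
 assumes P: "P > 0" and C: "C > 0" and N: "N > 0" and r1: "r1 <= P / (8 * C)" and z: "0 < z" "z < r1"
 shows "real_of_int (\<lfloor>N * (P * z + C * z^2)\<rfloor> + \<lfloor>N * (- P * z + C * z^2)\<rfloor> + 1) / (N * z^2) \<le>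
   (\<Sum>k\<in>{1..nat \<lfloor>N * P * (9/8) * r1\<rfloor>}. 2 * (N * P)^2 / (N * (real k)^2) *
    indicator {real k / (N * P) - C / P * (real k / (N * P))^2 .. real k / (N * P) + 2 * (C / P) * (real k / (N * P))^2} z)"
  (is "?lhs <= (\<Sum>k\<in>?Ks. ?f k)")
proof -
 define kappa where "kappa = C / P"
 have kappa: "kappa > 0" using C P by (simp add: kappa_def)
 \<comment> \<open>This is the role of the bound on \<open>r1\<close>: the quadratic term stays
   below an eighth of the linear one.\<close>
 have kz: "kappa * z < 1/8"
 proof -
  have "kappa * z < kappa * (P / (8 * C))" using z r1 kappa by (intro mult_strict_left_mono) auto
  also have "... = 1/8" using C P by (simp add: kappa_def)
  finally show ?thesis .
 qed
 define a where "a = \<lfloor>N * (P * z + C * z^2)\<rfloor>"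
 define e where "e = \<lceil>N * (P * z - C * z^2)\<rceil>"
 \<comment> \<open>The second floor is minus a ceiling, so the sum plus 1 counts the integers from
   \<open>e\<close> to \<open>a\<close>, if there are any.\<close>
 have fl: "\<lfloor>N * (- P * z + C * z^2)\<rfloor> = - e"
  unfolding e_def ceiling_def by (simp add: algebra_simps)
 have NP: "N * P > 0" using N P by simp
 have CP: "C = P * kappa" using P by (simp add: kappa_def)
 have e1: "e >= 1"
 proof -
  have "P * z - C * z^2 = P * z * (1 - kappa * z)" by (simp add: CP power2_eq_square algebra_simps)
  then have "P * z - C * z^2 > 0" using P z kz by simp
  then have "N * (P * z - C * z^2) > 0" using N by simp
  then show ?thesis unfolding e_def by (simp add: le_ceiling_iff)
 qed
 have nonneg: "?f k >= 0" for k using N by (auto split: split_indicator)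
 \<comment> \<open>Each such integer \<open>k\<close> pins \<open>z\<close> to an interval around
   \<open>q = k / (N P)\<close> of length \<open>3 * kappa * q^2\<close>, on which
   \<open>1 / z^2\<close> is comparable to \<open>1 / q^2\<close>.\<close>
 have in_int: "real k / (N * P) - C / P * (real k / (N * P))^2 <= z & z <= real k / (N * P) + 2 * (C / P) * (real k / (N * P))^2 & k : ?Ks & 1 / (N * z^2) <= 2 * (N * P)^2 / (N * (real k)^2)"
  if k: "e <= int k" "int k <= a" for k
 proof -
  define q where "q = real k / (N * P)"
  have k1: "k >= 1" using k(1) e1 by linarith
  have q0: "q > 0" using k1 NP by (simp add: q_def)
  have "real k <= N * (P * z + C * z^2)" using k(2) unfolding a_def by (simp add: le_floor_iff)
  then have "real k <= (N * P) * (z + kappa * z^2)" by (simp add: CP algebra_simps)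
  then have qu: "q <= z + kappa * z^2" unfolding q_def by (simp only: pos_divide_le_eq[OF NP] mult.commute)
  have "N * (P * z - C * z^2) <= real k" using k(1) unfolding e_def by (simp add: ceiling_le_iff)
  then have "(N * P) * (z - kappa * z^2) <= real k" by (simp add: CP algebra_simps)
  then have ql: "z - kappa * z^2 <= q" unfolding q_def by (simp only: pos_le_divide_eq[OF NP] mult.commute)
  have z2: "kappa * z^2 <= z / 8" using mult_right_mono[OF less_imp_le[OF kz], of z] z by (simp add: power2_eq_square mult_ac)
  have qz: "q <= 9/8 * z" "7/8 * z <= q" using qu ql z2 by auto
  have lo: "q - kappa * q^2 <= z"
  proof (cases "z < q")
   case True
   then have "kappa * z^2 <= kappa * q^2" using kappa z by (intro mult_left_mono power_mono) auto
   then show ?thesis using qu by linarith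
  next
   case False
   moreover have "0 <= kappa * q^2" using kappa by simp
   ultimately show ?thesis by linarith
  qed
  have hi: "z <= q + 2 * kappa * q^2"
  proof -
   have "z^2 <= (8/7 * q)^2" using qz z by (intro power_mono) auto
   also have "... = 64/49 * q^2" by (simp add: power2_eq_square)
   also have "... <= 2 * q^2" by simp
   finally have "kappa * z^2 <= kappa * (2 * q^2)" using kappa by (intro mult_left_mono) auto
   then show ?thesis using ql by simp
  qed
  have "real k = N * P * q" using N P by (simp add: q_def)
  also have "... <= N * P * (9/8 * r1)" using NP qz z by (intro mult_left_mono) auto
  finally have "real k <= N * P * (9/8) * r1" by simp
  then have "int k <= \<lfloor>N * P * (9/8) * r1\<rfloor>" by (simp add: le_floor_iff)
  then have kK: "k : ?Ks" using k1 by (auto simp: le_nat_iff)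
  have "q^2 <= (9/8 * z)^2" using qz q0 by (intro power_mono) auto
  also have "... = 81/64 * z^2" by (simp add: power2_eq_square)
  also have "... <= 2 * z^2" by simp
  finally have "q^2 <= 2 * z^2" .
  then have "1 / z^2 <= 2 / q^2" using z q0 by (simp add: field_simps)
  then have "1 / z^2 / N <= 2 / q^2 / N" using N by (intro divide_right_mono) auto
  then have "1 / (N * z^2) <= 2 * (N * P)^2 / (N * (real k)^2)"
   by (simp add: q_def power_divide mult_ac)
  then show ?thesis using lo hi kK by (simp add: q_def kappa_def)
 qed
 show ?thesis
 proof (cases "a - e + 1 <= 0")
  case True
  then have "?lhs <= 0" using N z unfolding fl a_def[symmetric] by (intro divide_nonpos_pos) auto
  also have "0 <= (\<Sum>k\<in>?Ks. ?f k)" by (intro sum_nonneg nonneg)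
  finally show ?thesis .
 next
  case False
  have "?lhs = real_of_int (a - e + 1) * (1 / (N * z^2))" unfolding fl a_def[symmetric] by simp
  also have "real_of_int (a - e + 1) = real (card {nat e..nat a})" using False e1 by simp
  also have "... * (1 / (N * z^2)) = (\<Sum>k\<in>{nat e..nat a}. 1 / (N * z^2))" by simp
  also have "... <= (\<Sum>k\<in>{nat e..nat a}. ?f k)"
  proof (rule sum_mono)
   fix k assume "k : {nat e..nat a}"
   then have "e <= int k" "int k <= a" using e1 False by auto
   from in_int[OF this] show "1 / (N * z^2) <= ?f k" by simp
  qed
  also have "... <= (\<Sum>k\<in>?Ks. ?f k)"
  proof (rule sum_mono2)
   show "{nat e..nat a} \<subseteq> ?Ks"
   proof
    fix k assume "k : {nat e..nat a}"
    then have "e <= int k" "int k <= a" using e1 False by auto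
    from in_int[OF this] show "k : ?Ks" by blast
   qed
  qed (use nonneg in auto)
  finally show ?thesis .
 qed
qed

section \<open>The velocity of a charge at a contact point\<close>

lemma UU_measurable: "UU n x b : borel_measurable borel"
proof -
 have "UU n x b = (%y. max (\<Sum>i=1..n. real_of_int (b i) * indicator {x i..} y) (\<Sum>i=1..n. real_of_int (b i) * indicator {x i<..} y) / real n)"
  unfolding UU_def FI_def FM_def of_int_max of_int_sum
  by (intro ext arg_cong2[where f = "(/)"] arg_cong2[where f = max] sum.cong refl) (auto simp: indicator_def)
 also have "... : borel_measurable borel" by measurable
 finally show ?thesis .
qed

lemma FI_eq_FM:
 assumes Z: "(x, b) : Zn n" and i0: "i0 : {1..n}" "b i0 ~= 0"
 shows "FI n x b (x i0) = FM n x b (x i0) + b i0"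
proof -
 have "FI n x b (x i0) = (\<Sum>i=1..n. (if x i < x i0 then b i else 0) + (if i = i0 then b i0 else 0))"
  unfolding FI_def
 proof (intro sum.cong refl)
  fix i assume "i : {1..n}"
  then show "(if x i <= x i0 then b i else 0) = (if x i < x i0 then b i else 0) + (if i = i0 then b i0 else 0)"
   using Zn_distinct[OF Z _ i0(1) _ i0(2), of i] by (cases "i = i0"; cases "x i = x i0"; cases "b i = 0") auto
 qed
 also have "... = FM n x b (x i0) + b i0" using i0(1) by (simp add: FM_def sum.distrib)
 finally show ?thesis .
qed

text \<open>Each \<open>1 / (X j - X i0)\<close> is a signed integral of \<open>1 / z^2\<close> over
  \<open>z >= |X j - X i0|\<close>, so the sum is the integral of a second difference of integer
  counts. Below \<open>r1\<close> contact and integrality bound it by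
  \<open>floor_gap_count\<close>, from there to \<open>r\<close> the second order bound of the
  quartic does, and beyond \<open>r\<close> the far integral appears. The first range contributes at
  most 8 and the second 2 of the factor 10.\<close>

lemma velocity_bound:
 assumes Z: "(X, beta) : Zn n" and n: "n >= 1" and i0: "i0 : {1..n}" "beta i0 ~= 0" and c: "c > 0" and r: "r > 0"
  and xy: "X i0 ~= y"
  and contact: "!!z. UU n X beta z - c * (z - y) ^ 4 <= UU n X beta (X i0) - c * (X i0 - y) ^ 4"
 defines "p \<equiv> 4 * c * (X i0 - y) ^ 3" and "C \<equiv> qC c (X i0 - y) r"
 shows "(\<Sum>j\<in>{1..n} - {i0}. real_of_int (beta j) / (X j - X i0)) / real n \<le>
  10 * C * r + outr r (UU n X beta) (X i0) + (1 / real n) * (1 / r + 8 * C / \<bar>p\<bar>)"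
proof -
 define x where "x = X i0"
 define N where "N = real n"
 define P where "P = \<bar>p\<bar>"
 define U where "U = UU n X beta"
 have N: "N > 0" using n by (simp add: N_def)
 have d0: "x - y ~= 0" using xy by (simp add: x_def)
 have P: "P > 0" using d0 c by (simp add: P_def p_def x_def)
 have C: "C > 0"
  using c d0 r unfolding C_def qC_def x_def[symmetric] by (intro mult_pos_pos add_pos_nonneg) auto
 define r1 where "r1 = min r (P / (8 * C))"
 have r1: "r1 > 0" "r1 <= r" "r1 <= P / (8 * C)" using r P C by (auto simp: r1_def)
 define D where "D z = c * (x + z - y) ^ 4 - c * (x - y) ^ 4" for z
 have Dp: "D z <= p * z + C * z^2" if "\<bar>z\<bar> <= r" for z
  using quartic_taylor[of c z r x y] c that unfolding D_def p_def C_def x_def by linarith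
 define mx where "mx = max (FI n X beta x) (FM n X beta x)"
 have Ux: "U x = real_of_int mx / N" by (simp add: U_def UU_def mx_def N_def)
 define A where "A z = FI n X beta (x + z) - mx" for z
 have Ale: "real_of_int (A z) <= N * (U (x + z) - U x)" for z
 proof -
  have "real_of_int (FI n X beta (x + z)) / N <= U (x + z)" unfolding U_def N_def by (rule FI_le_UU)
  then show ?thesis using N by (simp add: A_def Ux field_simps)
 qed
 have AD: "real_of_int (A z) <= N * D z" for z
 proof -
  have "U (x + z) - U x <= D z" using contact[of "x + z"] by (simp add: D_def U_def x_def)
  then have "N * (U (x + z) - U x) <= N * D z" using N by (intro mult_left_mono) auto
  then show ?thesis using Ale[of z] by linarith
 qed
 define Js where "Js = {j : {1..n} - {i0}. beta j ~= 0}"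
 have Jfin: "finite Js" by (simp add: Js_def)
 define zeta where "zeta j = \<bar>X j - x\<bar>" for j
 have zeta: "zeta j > 0" if "j : Js" for j using Zn_distinct[OF Z, of j i0] that i0 by (auto simp: zeta_def Js_def x_def)
 define k where "k j z = (real_of_int (beta j) * sgn (X j - x) / N) * (indicator {zeta j..} z *\<^sub>R (1 / z^2))" for j z
 have ki: "integrable lborel (k j)" "integral\<^sup>L lborel (k j) = real_of_int (beta j) / (X j - x) / N" if j: "j : Js" for j
 proof -
  show "integrable lborel (k j)"
   unfolding k_def using inverse_square_Ici(1)[OF zeta[OF j]] unfolding set_integrable_def by (rule integrable_mult_right)
  have "integral\<^sup>L lborel (k j) = (real_of_int (beta j) * sgn (X j - x) / N) * (1 / zeta j)"
   unfolding k_def using inverse_square_Ici(2)[OF zeta[OF j]] unfolding set_lebesgue_integral_def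
   by (subst integral_mult_right_zero) simp
  also have "... = real_of_int (beta j) / (X j - x) / N"
  proof -
   have "sgn a * (1 / \<bar>a\<bar>) = 1 / a" if "a ~= 0" for a :: real
    using that by (cases "a > 0") (auto simp: sgn_if abs_if divide_simps)
   then have "sgn (X j - x) * (1 / zeta j) = 1 / (X j - x)" using zeta[OF j] by (simp add: zeta_def)
   then have "real_of_int (beta j) / N * (sgn (X j - x) * (1 / zeta j)) = real_of_int (beta j) / N * (1 / (X j - x))" by simp
   then show ?thesis by (simp add: mult_ac)
  qed
  finally show "integral\<^sup>L lborel (k j) = real_of_int (beta j) / (X j - x) / N" .
 qed
 have ksum: "integrable lborel (%z. \<Sum>j\<in>Js. k j z)" by (intro Bochner_Integration.integrable_sum ki)
 have J: "(\<Sum>j\<in>{1..n} - {i0}. real_of_int (beta j) / (X j - x)) / N = integral\<^sup>L lborel (%z. \<Sum>j\<in>Js. k j z)"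
 proof -
  have "(\<Sum>j\<in>{1..n} - {i0}. real_of_int (beta j) / (X j - x)) = (\<Sum>j\<in>Js. real_of_int (beta j) / (X j - x))"
   unfolding Js_def by (rule sum.mono_neutral_right) auto
  then show ?thesis by (simp add: Bochner_Integration.integral_sum ki sum_divide_distrib)
 qed
 have ksum_eq: "(\<Sum>j\<in>Js. k j z) = real_of_int (A z + A (- z) + 1) / (N * z^2)" if z: "z > 0" "!!j. j : Js ==> z ~= zeta j" for z
 proof -
  have t: "(if X i <= x + z then beta i else 0) + (if X i <= x - z then beta i else 0) - (if X i <= x then beta i else 0) - (if X i < x then beta i else 0)
    = (if i : Js then (if zeta i <= z then (if X i > x then beta i else - beta i) else 0) else 0)" if i: "i : {1..n}" for i
  proof (cases "i : Js")
   case True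
   then have "X i ~= x" "z ~= zeta i" using zeta[OF True] z(2)[OF True] by (auto simp: zeta_def)
   then show ?thesis using True z(1) by (auto simp: zeta_def)
  next
   case False
   then have "beta i = 0 \<or> X i = x" using i by (auto simp: Js_def x_def)
   then show ?thesis using False z(1) by auto
  qed
  \<comment> \<open>\<open>mx\<close> is the larger of two integers differing by 1, the values on
    both sides of the particle. Its own jump is the source of the 1 in
    \<open>A z + A (- z) + 1\<close>.\<close>
  have mx: "2 * mx - 1 = FI n X beta x + FM n X beta x"
  proof -
   have "FI n X beta x = FM n X beta x + beta i0" unfolding x_def by (rule FI_eq_FM[OF Z i0])
   then show ?thesis using Zn_charge[OF Z i0(1)] i0(2) by (auto simp: mx_def)
  qed
  have "A z + A (- z) + 1 = FI n X beta (x + z) + FI n X beta (x - z) - FI n X beta x - FM n X beta x"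
   using mx by (simp add: A_def)
  also have "... = (\<Sum>i=1..n. (if X i <= x + z then beta i else 0) + (if X i <= x - z then beta i else 0) - (if X i <= x then beta i else 0) - (if X i < x then beta i else 0))"
   by (simp add: FI_def FM_def sum.distrib sum_subtractf)
  also have "... = (\<Sum>i=1..n. (if i : Js then (if zeta i <= z then (if X i > x then beta i else - beta i) else 0) else 0))"
   by (intro sum.cong refl t)
  also have "... = (\<Sum>i\<in>Js. (if zeta i <= z then (if X i > x then beta i else - beta i) else 0))"
   by (rule sum.mono_neutral_cong_right) (auto simp: Js_def)
  finally have eq: "A z + A (- z) + 1 = (\<Sum>i\<in>Js. (if zeta i <= z then (if X i > x then beta i else - beta i) else 0))" .
  show ?thesis
   unfolding eq of_int_sum sum_divide_distrib
  proof (intro sum.cong refl)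
   fix j assume j: "j : Js"
   show "k j z = real_of_int (if zeta j <= z then (if X j > x then beta j else - beta j) else 0) / (N * z^2)"
    using zeta[OF j] by (auto simp: k_def zeta_def sgn_if indicator_def)
  qed
 qed
 define Ks where "Ks = {1..nat \<lfloor>N * P * (9/8) * r1\<rfloor>}"
 define lo where "lo k = real k / (N * P) - C / P * (real k / (N * P))^2" for k :: nat
 define hi where "hi k = real k / (N * P) + 2 * (C / P) * (real k / (N * P))^2" for k :: nat
 define G1 where "G1 z = (\<Sum>k\<in>Ks. 2 * (N * P)^2 / (N * (real k)^2) * indicator {lo k..hi k} z)" for z :: real
 define G2 where "G2 z = 2 * C * indicator {0<..<r} z" for z :: real
 define G3 where "G3 z = (1 / N) * (indicator {r1..} z *\<^sub>R (1 / z^2))" for z :: real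
 define G4 where "G4 z = indicator {r..} z *\<^sub>R ((U (x + z) + U (x - z) - 2 * U x) / z^2)" for z
 have lohi: "hi k - lo k = 3 * (C / P) * (real k / (N * P))^2" for k by (simp add: lo_def hi_def)
 have lohi0: "lo k <= hi k" for k
 proof -
  have "0 <= hi k - lo k" unfolding lohi using C P by simp
  then show ?thesis by simp
 qed
 \<comment> \<open>Each \<open>k\<close> contributes \<open>6 C / (P N)\<close>, and there are at
   most \<open>9/8 N P r1\<close> of them, which makes 27/4 times \<open>C * r1\<close>.\<close>
 have G1i: "integrable lborel G1" "integral\<^sup>L lborel G1 <= 8 * C * r1"
 proof -
  have i: "integrable lborel (%z. 2 * (N * P)^2 / (N * (real k)^2) * indicator {lo k..hi k} z :: real)" for k
   using lohi0[of k] by (intro integrable_mult_right integrable_real_indicator) auto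
  show "integrable lborel G1" unfolding G1_def by (intro Bochner_Integration.integrable_sum i)
  have "integral\<^sup>L lborel G1 = (\<Sum>k\<in>Ks. 2 * (N * P)^2 / (N * (real k)^2) * (hi k - lo k))"
   unfolding G1_def using lohi0 by (subst Bochner_Integration.integral_sum[OF i]) simp
  also have "... = (\<Sum>k\<in>Ks. 6 * (C / P) / N)"
   unfolding lohi using N P by (intro sum.cong refl) (auto simp: Ks_def power_divide)
  also have "... = real (nat \<lfloor>N * P * (9/8) * r1\<rfloor>) * (6 * (C / P) / N)" by (simp add: Ks_def)
  also have "... <= (N * P * (9/8) * r1) * (6 * (C / P) / N)"
  proof (rule mult_right_mono)
   show "real (nat \<lfloor>N * P * (9/8) * r1\<rfloor>) <= N * P * (9/8) * r1"
    by (rule of_nat_floor) (use N P r1 in simp)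
  qed (use N P C in auto)
  also have "... = 27 / 4 * C * r1" using N P by simp
  also have "... <= 8 * C * r1" using C r1 by simp
  finally show "integral\<^sup>L lborel G1 <= 8 * C * r1" .
 qed
 have G2i: "integrable lborel G2" "integral\<^sup>L lborel G2 = 2 * C * r"
  unfolding G2_def using r by (auto intro!: integrable_mult_right integrable_real_indicator simp: emeasure_lborel_Ioo)
 have G3i: "integrable lborel G3" "integral\<^sup>L lborel G3 = (1 / N) * (1 / r1)"
 proof -
  show "integrable lborel G3"
   unfolding G3_def using inverse_square_Ici(1)[OF r1(1)] unfolding set_integrable_def by (rule integrable_mult_right)
  show "integral\<^sup>L lborel G3 = (1 / N) * (1 / r1)"
   unfolding G3_def using inverse_square_Ici(2)[OF r1(1)] unfolding set_lebesgue_integral_def by (subst integral_mult_right_zero) simp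
 qed
 have Ub: "\<bar>U z\<bar> <= 1" for z unfolding U_def by (rule UU_bound[OF Z n])
 have Um: "U : borel_measurable borel" unfolding U_def by (rule UU_measurable)
 have G4i: "integrable lborel G4" "integral\<^sup>L lborel G4 = outr r U x"
  using outr_sym[OF r Um Ub, of x] unfolding G4_def set_integrable_def set_lebesgue_integral_def by auto
 have le: "(\<Sum>j\<in>Js. k j z) <= G1 z + G2 z + (G3 z + G4 z)" if nz: "!!j. j : Js ==> z ~= zeta j" "z ~= 0" for z
 proof (cases "z > 0")
  case False
  have "(\<Sum>j\<in>Js. k j z) = 0" using False zeta by (intro sum.neutral) (auto simp: k_def indicator_def dest!: zeta)
  moreover have "0 <= G1 z" unfolding G1_def using N by (intro sum_nonneg) (auto split: split_indicator)
  ultimately show ?thesis using False r r1 by (simp add: G2_def G3_def G4_def)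
 next
  case z: True
  have eq: "(\<Sum>j\<in>Js. k j z) = real_of_int (A z + A (- z) + 1) / (N * z^2)"
   using ksum_eq[OF z] nz(1) by blast
  have G10: "0 <= G1 z" unfolding G1_def using N by (intro sum_nonneg) (auto split: split_indicator)
  consider "z < r1" | "r1 <= z" "z < r" | "r <= z" by linarith
  then show ?thesis
  proof cases
   case 1
   have zr: "\<bar>z\<bar> <= r" "\<bar>- z\<bar> <= r" using 1 z r1 by auto
   have fl: "A w <= \<lfloor>N * (p * w + C * w^2)\<rfloor>" if "\<bar>w\<bar> <= r" for w
   proof -
    have "N * D w <= N * (p * w + C * w^2)" using Dp[OF that] N by (intro mult_left_mono) auto
    then show ?thesis using AD[of w] by (simp add: le_floor_iff)
   qed
   have "A z + A (- z) + 1 <= \<lfloor>N * (P * z + C * z^2)\<rfloor> + \<lfloor>N * (- P * z + C * z^2)\<rfloor> + 1"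
    using fl[OF zr(1)] fl[OF zr(2)] by (cases "p >= 0") (auto simp: P_def)
   then have "real_of_int (A z + A (- z) + 1) / (N * z^2) \<le>
     real_of_int (\<lfloor>N * (P * z + C * z^2)\<rfloor> + \<lfloor>N * (- P * z + C * z^2)\<rfloor> + 1) / (N * z^2)"
    using N by (intro divide_right_mono of_int_le_iff[THEN iffD2]) auto
   also have "... <= G1 z" unfolding G1_def lo_def hi_def Ks_def by (rule floor_gap_count[OF P C N r1(3) z 1])
   finally show ?thesis using eq 1 z C N r1 by (simp add: G2_def G3_def G4_def)
  next
   case 2
   have zr: "\<bar>z\<bar> <= r" "\<bar>- z\<bar> <= r" using 2 z by auto
   have "real_of_int (A z + A (- z) + 1) <= N * D z + N * D (- z) + 1" using AD[of z] AD[of "- z"] by simp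
   also have "N * D z <= N * (p * z + C * z^2)" using Dp[OF zr(1)] N by (intro mult_left_mono) auto
   also have "N * D (- z) <= N * (p * (- z) + C * (- z)^2)" using Dp[OF zr(2)] N by (intro mult_left_mono) auto
   finally have "real_of_int (A z + A (- z) + 1) <= N * (2 * C * z^2) + 1" by (simp add: algebra_simps)
   then have "real_of_int (A z + A (- z) + 1) / (N * z^2) <= (N * (2 * C * z^2) + 1) / (N * z^2)"
    using N by (intro divide_right_mono) auto
   also have "... = 2 * C + 1 / N * (1 / z^2)" using N z by (simp add: add_divide_distrib)
   finally show ?thesis using eq 2 z G10 by (simp add: G2_def G3_def G4_def)
  next
   case 3
   have "real_of_int (A z + A (- z) + 1) <= N * (U (x + z) + U (x - z) - 2 * U x) + 1"
    using Ale[of z] Ale[of "- z"] by (simp add: algebra_simps)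
   then have "real_of_int (A z + A (- z) + 1) / (N * z^2) <= (N * (U (x + z) + U (x - z) - 2 * U x) + 1) / (N * z^2)"
    using N by (intro divide_right_mono) auto
   also have "... = (U (x + z) + U (x - z) - 2 * U x) / z^2 + 1 / N * (1 / z^2)" using N z by (simp add: add_divide_distrib)
   finally show ?thesis using eq 3 z G10 r1 by (simp add: G2_def G3_def G4_def)
  qed
 qed
 have "AE z in lborel. z \<notin> insert 0 (zeta ` Js)"
  using Jfin by (intro AE_not_in finite_imp_null_set_lborel) auto
 then have AE: "AE z in lborel. (\<Sum>j\<in>Js. k j z) <= G1 z + G2 z + (G3 z + G4 z)"
  by (rule AE_mp) (auto intro!: AE_I2 le)
 have "integral\<^sup>L lborel (%z. \<Sum>j\<in>Js. k j z) <= integral\<^sup>L lborel (%z. G1 z + G2 z + (G3 z + G4 z))"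
  by (intro integral_mono_AE ksum AE Bochner_Integration.integrable_add G1i G2i G3i G4i)
 also have "... = integral\<^sup>L lborel G1 + integral\<^sup>L lborel G2 + (integral\<^sup>L lborel G3 + integral\<^sup>L lborel G4)"
  by (simp add: G1i G2i G3i G4i)
 also have "... <= 8 * C * r1 + 2 * C * r + ((1 / N) * (1 / r1) + outr r U x)"
  using G1i(2) by (simp add: G2i G3i G4i)
 also have "8 * C * r1 <= 8 * C * r" using C r1 by simp
 also have "(1 / N) * (1 / r1) <= (1 / N) * (1 / r + 8 * C / P)"
 proof (intro mult_left_mono)
  show "1 / r1 <= 1 / r + 8 * C / P" using r P C by (auto simp: r1_def min_def)
 qed (use N in auto)
 finally have "integral\<^sup>L lborel (%z. \<Sum>j\<in>Js. k j z) <= 10 * C * r + outr r U x + (1 / N) * (1 / r + 8 * C / P)"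
  by (simp add: algebra_simps)
 then show ?thesis unfolding J[unfolded x_def N_def, symmetric] unfolding U_def x_def N_def P_def .
qed

section \<open>Particle dynamics\<close>

text \<open>Particles with constant charges \<open>beta\<close> on \<open>[a, c)\<close>; collisions may occur at \<open>c\<close>.\<close>

definition window :: "nat => real => real => (real => nat => real) => (nat => int) => bool" where
 "window n a c x beta \<longleftrightarrow> n >= 1 & 0 <= a & a < c & (\<forall>t\<in>{a..<c}. (x t, beta) : Zn n) &
   (\<forall>i\<in>{1..n}. continuous_on {a..c} (%t. x t i)) &
   (\<forall>i\<in>{1..n}. \<forall>t\<in>{a<..<c}. ((%t. x t i) has_real_derivative
    (1 / real n) * (\<Sum>j\<in>{1..n} - {i}. real_of_int (beta i * beta j) / (x t i - x t j))) (at t))"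

text \<open>Jump conditions are restated relative to the constant charges \<open>beta\<close> of the
  preceding window, without left limits. Annihilation enters through neutrality at each point and
  \<open>|b c i| <= |beta i|\<close>, which are stable under reversal of all charges.\<close>

definition particle_flow :: "nat => real => (real => nat => real) => (real => nat => int) => bool" where
 "particle_flow n T x b \<longleftrightarrow> n >= 1 & (\<forall>t\<in>{0..T}. (x t, b t) : Zn n) & (\<exists>S. finite S &
   (\<forall>a c. 0 <= a & a < c & c <= T & S \<inter> {a<..<c} = {} -->
    (\<exists>beta. window n a c x beta & (\<forall>i\<in>{1..n}. \<forall>t\<in>{a..<c}. b t i = beta i) &
      (\<forall>y. (\<Sum>i\<in>{i\<in>{1..n}. x c i = y}. b c i - beta i) = 0) & (\<forall>i\<in>{1..n}. \<bar>b c i\<bar> <= \<bar>beta i\<bar>))))"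

lemma Zn_cong:
 assumes "(x, b) : Zn n" "!!i. i : {1..n} ==> b' i = b i" shows "(x, b') : Zn n"
 using assms unfolding Zn_def by simp

lemma Zn_uminus: "(x, b) : Zn n ==> (x, %i. - b i) : Zn n"
 unfolding Zn_def by auto

lemma UU_cong: "(!!i. i : {1..n} ==> b' i = b i) ==> UU n x b' = UU n x b"
 unfolding UU_def FI_def FM_def by (intro ext arg_cong2[where f = "(/)"] arg_cong[where f = real_of_int] arg_cong2[where f = max] sum.cong refl) simp_all

lemma window_uminus: "window n a c x beta ==> window n a c x (%i. - beta i)"
 unfolding window_def using Zn_uminus by simp

lemma particle_flow_uminus:
 assumes "particle_flow n T x b" shows "particle_flow n T x (%t i. - b t i)"
proof -
 obtain S where n: "n >= 1" and Z: "\<forall>t\<in>{0..T}. (x t, b t) : Zn n" and S: "finite S" and w: "!!a c. 0 <= a ==> a < c ==> c <= T ==> S \<inter> {a<..<c} = {} ==>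
    \<exists>beta. window n a c x beta & (\<forall>i\<in>{1..n}. \<forall>t\<in>{a..<c}. b t i = beta i) &
      (\<forall>y. (\<Sum>i\<in>{i\<in>{1..n}. x c i = y}. b c i - beta i) = 0) & (\<forall>i\<in>{1..n}. \<bar>b c i\<bar> <= \<bar>beta i\<bar>)"
  using assms unfolding particle_flow_def by blast
 have "\<exists>beta. window n a c x beta & (\<forall>i\<in>{1..n}. \<forall>t\<in>{a..<c}. - b t i = beta i) &
      (\<forall>y. (\<Sum>i\<in>{i\<in>{1..n}. x c i = y}. - b c i - beta i) = 0) & (\<forall>i\<in>{1..n}. \<bar>- b c i\<bar> <= \<bar>beta i\<bar>)"
  if h: "0 <= a" "a < c" "c <= T" "S \<inter> {a<..<c} = {}" for a c
 proof -
  obtain beta where beta: "window n a c x beta" "\<forall>i\<in>{1..n}. \<forall>t\<in>{a..<c}. b t i = beta i"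
      "\<forall>y. (\<Sum>i\<in>{i\<in>{1..n}. x c i = y}. b c i - beta i) = 0" "\<forall>i\<in>{1..n}. \<bar>b c i\<bar> <= \<bar>beta i\<bar>"
   using w[OF h] by blast
  have "(\<Sum>i\<in>{i\<in>{1..n}. x c i = y}. - b c i - - beta i) = - (\<Sum>i\<in>{i\<in>{1..n}. x c i = y}. b c i - beta i)" for y
   by (subst sum_negf[symmetric]) (rule sum.cong, auto)
  then have neut: "\<forall>y. (\<Sum>i\<in>{i\<in>{1..n}. x c i = y}. - b c i - - beta i) = 0" using beta(3) by simp
  show ?thesis
   by (rule exI[of _ "%i. - beta i"], intro conjI window_uminus[OF beta(1)] neut) (use beta(2,4) in auto)
 qed
 then show ?thesis unfolding particle_flow_def using n Z S Zn_uminus by blast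
qed

text \<open>On a window the charges are integer valued, right-continuous at \<open>a\<close> and
  continuous afterwards, hence constant. So \<open>b a\<close> serves as \<open>beta\<close> and is
  also the left limit at \<open>c\<close>.\<close>

lemma solves_imp_particle_flow:
 assumes sol: "solves_Pn n T x0 b0 x b" and n: "n >= 1"
 shows "particle_flow n T x b"
proof -
 obtain S where Z: "\<forall>t\<in>{0..T}. (x t, b t) : Zn n" and S: "finite S" "S \<subseteq> {0<..T}"
  and xc: "\<forall>i\<in>{1..n}. continuous_on {0..T} (%t. x t i)"
  and rc: "\<forall>i\<in>{1..n}. \<forall>t\<in>{0..<T}. continuous (at_right t) (%t. b t i)"
  and jump: "\<forall>i\<in>{1..n}. \<forall>t. jumps_at T (%t. b t i) t --> t : S & \<bar>left_limit (%t. b t i) t\<bar> = 1 & b t i = 0"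
  and neut: "\<forall>tau\<in>S. \<forall>y. (\<Sum>i\<in>{i\<in>{1..n}. x tau i = y}. b tau i - left_limit (%t. b t i) tau) = 0"
  and ode: "\<forall>i\<in>{1..n}. \<forall>t\<in>{0<..<T} - S. ((%t. x t i) has_real_derivative
       (1 / real n) * (\<Sum>j\<in>{1..n} - {i}. real_of_int (b t i * b t j) / (x t i - x t j))) (at t)"
  using sol unfolding solves_Pn_def by (elim conjE exE) blast
 have "\<exists>beta. window n a c x beta & (\<forall>i\<in>{1..n}. \<forall>t\<in>{a..<c}. b t i = beta i) &
      (\<forall>y. (\<Sum>i\<in>{i\<in>{1..n}. x c i = y}. b c i - beta i) = 0) & (\<forall>i\<in>{1..n}. \<bar>b c i\<bar> <= \<bar>beta i\<bar>)"
  if h: "0 <= a" "a < c" "c <= T" "S \<inter> {a<..<c} = {}" for a c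
 proof -
  have cont: "continuous (at t within {0..T}) (%t. b t i)" if "i : {1..n}" "t : {0..T}" "t \<notin> S" for i t
   using jump that unfolding jumps_at_def by blast
  have const: "b t i = b a i" if i: "i : {1..n}" and t: "t : {a..<c}" for i t
  proof -
   have ci: "continuous_on {a..<c} (%t. b t i)"
    unfolding continuous_on_eq_continuous_within
   proof
    fix s assume s: "s : {a..<c}"
    show "continuous (at s within {a..<c}) (%t. b t i)"
    proof (cases "s = a")
     case True
     have "continuous (at_right a) (%t. b t i)" using rc i h by auto
     then have "((%t. b t i) \<longlongrightarrow> b a i) (at_right a)" by (simp add: continuous_within)
     moreover have "at a within {a..<c} <= at_right a"
      unfolding at_within_def by (rule inf_mono) auto
     ultimately have "((%t. b t i) \<longlongrightarrow> b a i) (at a within {a..<c})" by (rule tendsto_mono[rotated])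
     then show ?thesis using True by (simp add: continuous_within)
    next
     case False
     then have "s : {a<..<c}" using s by auto
     then have "s \<notin> S" using h by auto
     from cont[OF i _ this] s h have "continuous (at s within {0..T}) (%t. b t i)" by auto
     then show ?thesis by (rule continuous_within_subset) (use h in auto)
    qed
   qed
   have "continuous_on {a..<c} (%t. real_of_int (b t i))" by (intro continuous_on_of_int ci)
   then have "(%t. real_of_int (b t i)) constant_on {a..<c}"
   proof (rule continuous_discrete_range_constant[rotated])
    fix s assume "s : {a..<c}"
    show "\<exists>e>0. \<forall>y. y : {a..<c} & real_of_int (b y i) ~= real_of_int (b s i) --> e <= norm (real_of_int (b y i) - real_of_int (b s i))"
    proof (intro exI[of _ 1] conjI allI impI)
     fix y assume "y : {a..<c} & real_of_int (b y i) ~= real_of_int (b s i)"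
     then have "1 <= \<bar>b y i - b s i\<bar>" by auto
     then show "1 <= norm (real_of_int (b y i) - real_of_int (b s i))" unfolding real_norm_def of_int_diff[symmetric] of_int_abs[symmetric] by (subst of_int_1_le_iff)
    qed simp
   qed simp
   then obtain k where k: "!!s. s : {a..<c} ==> real_of_int (b s i) = k" unfolding constant_on_def by blast
   have "real_of_int (b t i) = real_of_int (b a i)" using k[OF t] k[of a] h by simp
   then show ?thesis by simp
  qed
  have lim: "((%t. b t i) \<longlongrightarrow> b a i) (at_left c)" if i: "i : {1..n}" for i
  proof (rule tendsto_eventually)
   show "eventually (%t. b t i = b a i) (at_left c)"
    using eventually_at_left_real[OF h(2)] by (rule eventually_mono) (auto intro!: const[OF i])
  qed
  have ll: "left_limit (%t. b t i) c = b a i" if i: "i : {1..n}" for i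
   unfolding left_limit_def by (rule tendsto_Lim[OF _ lim[OF i]]) simp
  have nojump: "b c i = b a i" if i: "i : {1..n}" and nj: "~ jumps_at T (%t. b t i) c" for i
  proof -
   have "continuous (at c within {0..T}) (%t. b t i)" using nj h by (auto simp: jumps_at_def)
   then have "((%t. b t i) \<longlongrightarrow> b c i) (at c within {0..T})" by (simp add: continuous_within)
   then have "((%t. b t i) \<longlongrightarrow> b c i) (at c within {a<..<c})" by (rule tendsto_within_subset) (use h in auto)
   moreover have "at c within {a<..<c} = at_left c"
    by (rule at_within_nhd[where S = "{a<..}"]) (use h in auto)
   ultimately have "((%t. b t i) \<longlongrightarrow> b c i) (at_left c)" by simp
   then show ?thesis by (rule tendsto_unique[OF trivial_limit_at_left_real _ lim[OF i]])
  qed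
  have win: "window n a c x (b a)"
   unfolding window_def
  proof (intro conjI ballI)
   show "(x t, b a) : Zn n" if t: "t : {a..<c}" for t
   proof (rule Zn_cong)
    show "(x t, b t) : Zn n" using Z t h by auto
    show "!!i. i : {1..n} ==> b a i = b t i" using const t by metis
   qed
   show "continuous_on {a..c} (%t. x t i)" if "i : {1..n}" for i by (rule continuous_on_subset[OF bspec[OF xc that]]) (use h in auto)
   fix i t assume i: "i : {1..n}" and t: "t : {a<..<c}"
   have "t : {0<..<T} - S" using t h by auto
   then have "((%t. x t i) has_real_derivative (1 / real n) * (\<Sum>j\<in>{1..n} - {i}. real_of_int (b t i * b t j) / (x t i - x t j))) (at t)"
    using ode i by blast
   moreover have "(\<Sum>j\<in>{1..n} - {i}. real_of_int (b t i * b t j) / (x t i - x t j)) = (\<Sum>j\<in>{1..n} - {i}. real_of_int (b a i * b a j) / (x t i - x t j))"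
    using const[of _ t] i t by (intro sum.cong refl) auto
   ultimately show "((%t. x t i) has_real_derivative (1 / real n) * (\<Sum>j\<in>{1..n} - {i}. real_of_int (b a i * b a j) / (x t i - x t j))) (at t)"
    by simp
  qed (use n h in auto)
  have ne: "(\<Sum>i\<in>{i\<in>{1..n}. x c i = y}. b c i - b a i) = 0" for y
  proof (cases "c : S")
   case True
   have "(\<Sum>i\<in>{i\<in>{1..n}. x c i = y}. b c i - b a i) = (\<Sum>i\<in>{i\<in>{1..n}. x c i = y}. b c i - left_limit (%t. b t i) c)"
    by (intro sum.cong refl) (simp add: ll)
   then show ?thesis using neut True by simp
  next
   case False
   then have "b c i = b a i" if "i : {1..n}" for i using nojump[OF that] jump that by blast
   then show ?thesis by (intro sum.neutral) auto
  qed
  have dec: "\<bar>b c i\<bar> <= \<bar>b a i\<bar>" if i: "i : {1..n}" for i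
  proof (cases "jumps_at T (%t. b t i) c")
   case True
   then have "b c i = 0" using jump i by blast
   then show ?thesis by simp
  next
   case False
   then show ?thesis using nojump[OF i] by simp
  qed
  show ?thesis by (intro exI[of _ "b a"] conjI ballI allI win ne const dec)
 qed
 then show ?thesis unfolding particle_flow_def using n Z S by blast
qed

text \<open>Induction on the number of collision times before \<open>t\<close>: \<open>step\<close>
  propagates a property inside a window, \<open>close\<close> carries it across the right end. Later
  arguments need not mention the collision times.\<close>

lemma particle_flow_induct:
 assumes fl: "particle_flow n T x b" and Q0: "Q 0"
  and step: "!!a c beta t. 0 <= a ==> a < c ==> c <= T ==> window n a c x beta ==> (!!i t. i : {1..n} ==> t : {a..<c} ==> b t i = beta i) ==> Q a ==> t : {a..<c} ==> Q t"
  and close: "!!a c beta. 0 <= a ==> a < c ==> c <= T ==> window n a c x beta ==> (!!i t. i : {1..n} ==> t : {a..<c} ==> b t i = beta i) ==>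
    (!!y. (\<Sum>i\<in>{i\<in>{1..n}. x c i = y}. b c i - beta i) = 0) ==> (!!i. i : {1..n} ==> \<bar>b c i\<bar> <= \<bar>beta i\<bar>) ==>
    (!!t. t : {a..<c} ==> Q t) ==> Q c"
  and t: "t : {0..T}"
 shows "Q t"
proof -
 obtain S where S: "finite S" and w: "!!a c. 0 <= a ==> a < c ==> c <= T ==> S \<inter> {a<..<c} = {} ==>
    \<exists>beta. window n a c x beta & (\<forall>i\<in>{1..n}. \<forall>t\<in>{a..<c}. b t i = beta i) &
      (\<forall>y. (\<Sum>i\<in>{i\<in>{1..n}. x c i = y}. b c i - beta i) = 0) & (\<forall>i\<in>{1..n}. \<bar>b c i\<bar> <= \<bar>beta i\<bar>)"
  using fl unfolding particle_flow_def by blast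
 have adv: "Q c" if h: "0 <= a" "a < c" "c <= T" "S \<inter> {a<..<c} = {}" and Qa: "Q a" for a c
 proof -
  obtain beta where beta: "window n a c x beta" "\<forall>i\<in>{1..n}. \<forall>t\<in>{a..<c}. b t i = beta i"
      "\<forall>y. (\<Sum>i\<in>{i\<in>{1..n}. x c i = y}. b c i - beta i) = 0" "\<forall>i\<in>{1..n}. \<bar>b c i\<bar> <= \<bar>beta i\<bar>"
   using w[OF h] by blast
  have "Q t" if "t : {a..<c}" for t by (rule step[OF h(1-3) beta(1) _ Qa that]) (use beta(2) in blast)
  then show ?thesis by (intro close[OF h(1-3) beta(1)]) (use beta(2-4) in auto)
 qed
 have "Q t" if "t : {0<..T}" for t using that
 proof (induction "card (S \<inter> {0<..<t})" arbitrary: t rule: less_induct)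
  case less
  show ?case
  proof (cases "S \<inter> {0<..<t} = {}")
   case True
   then show ?thesis using less.prems by (intro adv[OF _ _ _ _ Q0]) auto
  next
   case False
   define s where "s = Max (S \<inter> {0<..<t})"
   have fin: "finite (S \<inter> {0<..<t})" using S by simp
   have s: "s : S" "0 < s" "s < t" using Max_in[OF fin False] by (auto simp: s_def)
   have "S \<inter> {0<..<s} \<subset> S \<inter> {0<..<t}" using s by auto
   then have "card (S \<inter> {0<..<s}) < card (S \<inter> {0<..<t})" by (rule psubset_card_mono[OF fin])
   then have "Q s" using less.hyps[of s] s less.prems by auto
   moreover have "S \<inter> {s<..<t} = {}"
   proof (rule ccontr)
    assume "S \<inter> {s<..<t} ~= {}"
    then obtain w where "w : S" "s < w" "w < t" by auto
    then show False using Max_ge[OF fin, of w] s by (auto simp: s_def)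
   qed
   ultimately show ?thesis using s less.prems by (intro adv[of s t]) auto
  qed
 qed
 then show ?thesis using t Q0 by (cases "t = 0") auto
qed

section \<open>Particle systems as approximate subsolutions\<close>

lemma window_near:
 assumes w: "window n a c x beta" and t: "t : {a..<c}" and d: "d > 0"
 shows "eventually (%s. \<forall>i\<in>{1..n}. \<bar>x s i - x t i\<bar> < d) (at t within {a..<c})"
proof (rule eventually_ball_finite)
 show "\<forall>i\<in>{1..n}. eventually (%s. \<bar>x s i - x t i\<bar> < d) (at t within {a..<c})"
 proof
  fix i assume i: "i : {1..n}"
  have "continuous_on {a..c} (%t. x t i)" using w i unfolding window_def by blast
  then have "continuous_on {a..<c} (%t. x t i)" by (rule continuous_on_subset) auto
  then have "((%s. x s i) \<longlongrightarrow> x t i) (at t within {a..<c})" using t by (simp add: continuous_on_def)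
  then show "eventually (%s. \<bar>x s i - x t i\<bar> < d) (at t within {a..<c})"
   using d by (auto simp: tendsto_iff dist_real_def)
 qed
qed simp

lemma window_usc:
 assumes w: "window n a c x beta"
 shows "usc_seq ({a..<c} \<times> UNIV) (%(t, y). UU n (x t) beta y)"
 unfolding usc_seq_def
proof (intro ballI allI impI; elim conjE)
 fix p q e assume p: "p : {a..<c} \<times> UNIV" "\<forall>k. q k : {a..<c} \<times> UNIV" "q ----> p" "(%(t, y). UU n (x t) beta y) p < e"
 obtain t y where ty: "p = (t, y)" "t : {a..<c}" using p(1) by auto
 have Z: "(x t, beta) : Zn n" using w ty by (auto simp: window_def)
 obtain d where d: "d > 0" "!!x' y'. (!!i. i : {1..n} ==> \<bar>x' i - x t i\<bar> < d) ==> \<bar>y' - y\<bar> < d ==> UU n x' beta y' <= UU n (x t) beta y"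
  by (rule UU_perturb[OF Z, of y]) blast
 obtain epsilon where epsilon: "epsilon > 0" "!!s. s : {a..<c} ==> dist s t < epsilon ==> s ~= t ==> \<forall>i\<in>{1..n}. \<bar>x s i - x t i\<bar> < d"
  using window_near[OF w ty(2) d(1)] unfolding eventually_at by auto
 have q1: "(%k. fst (q k)) ----> t" "(%k. snd (q k)) ----> y" using tendsto_fst[OF p(3)] tendsto_snd[OF p(3)] ty by auto
 have "eventually (%k. dist (fst (q k)) t < epsilon) sequentially" using q1(1) epsilon(1) by (simp add: tendsto_iff)
 moreover have "eventually (%k. dist (snd (q k)) y < d) sequentially" using q1(2) d(1) by (simp add: tendsto_iff)
 ultimately show "eventually (%k. (%(t, y). UU n (x t) beta y) (q k) < e) sequentially"
 proof eventually_elim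
  case (elim k)
  have "fst (q k) : {a..<c}" using p(2)[rule_format, of k] by (auto simp: mem_Times_iff)
  then have "\<bar>x (fst (q k)) i - x t i\<bar> < d" if "i : {1..n}" for i
   using epsilon(2)[of "fst (q k)"] elim(1) that d(1) by (cases "fst (q k) = t") auto
  then have "UU n (x (fst (q k))) beta (snd (q k)) <= UU n (x t) beta y"
   using elim(2) by (intro d(2)) (auto simp: dist_real_def)
  then show ?case using p(4) ty by (simp add: split_beta)
 qed
qed

text \<open>If no charge sits at the contact point, \<open>UU\<close> is locally constant in time
  and in space, and both derivatives of the test function vanish. Otherwise \<open>UU\<close> is
  constant along the trajectory of that charge, which expresses \<open>g' t\<close> by its velocity.
  The sign of the charge agrees with that of the slope \<open>p\<close>, and
  \<open>velocity_bound\<close> multiplied by \<open>|p|\<close> gives the claim.\<close>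

lemma window_qsub:
 assumes w: "window n a c x beta"
 shows "qsub (1 / real n) {a<..<c} (%(t, y). UU n (x t) beta y)"
 unfolding qsub_def
proof (intro allI impI)
 fix k y t xb r :: real and g g' :: "real => real"
 assume k: "k > 0" and r: "r > 0" and t: "t : {a<..<c}" and g: "C2fun {a<..<c} g g'"
  and con0: "\<forall>s\<in>{a<..<c}. \<forall>z. (%(t, y). UU n (x t) beta y) (s, z) - k * (z - y) ^ 4 - g s <= (%(t, y). UU n (x t) beta y) (t, xb) - k * (xb - y) ^ 4 - g t"
 have con: "UU n (x s) beta z - k * (z - y) ^ 4 - g s <= UU n (x t) beta xb - k * (xb - y) ^ 4 - g t" if "s : {a<..<c}" for s z
  using con0 that by simp
 have n: "n >= 1" using w by (simp add: window_def)
 have t': "t : {a..<c}" using t by auto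
 have Z: "(x t, beta) : Zn n" using w t' by (auto simp: window_def)
 have gd: "(g has_real_derivative g' t) (at t)" using g t unfolding C2fun_def by blast
 have qd: "((%z. k * (z - y) ^ 4) has_real_derivative 4 * k * (z - y) ^ 3) (at z)" for z
  by (auto intro!: derivative_eq_intros)
 obtain d where d: "d > 0"
  "!!x' y'. (!!i. i : {1..n} ==> \<bar>x' i - x t i\<bar> < d) ==> \<bar>y' - xb\<bar> < d ==>
    (!!i. i : {1..n} ==> beta i ~= 0 ==> x t i ~= xb) ==> UU n x' beta y' = UU n (x t) beta xb"
  "!!x' y' i0. (!!i. i : {1..n} ==> \<bar>x' i - x t i\<bar> < d) ==> \<bar>y' - xb\<bar> < d ==>
    i0 : {1..n} ==> beta i0 ~= 0 ==> x t i0 = xb ==> (if beta i0 > 0 then x' i0 <= y' else y' <= x' i0) ==> UU n x' beta y' = UU n (x t) beta xb"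
  by (rule UU_perturb[OF Z, of xb]) blast
 obtain epsilon0 where epsilon0: "epsilon0 > 0" "!!s. s : {a..<c} ==> dist s t < epsilon0 ==> s ~= t ==> \<forall>i\<in>{1..n}. \<bar>x s i - x t i\<bar> < d"
  using window_near[OF w t' d(1)] unfolding eventually_at by auto
 define epsilon where "epsilon = min epsilon0 (min (t - a) (c - t))"
 have epsilon: "epsilon > 0" using epsilon0(1) t by (auto simp: epsilon_def)
 have near: "s : {a<..<c}" "!!i. i : {1..n} ==> \<bar>x s i - x t i\<bar> < d" if "\<bar>t - s\<bar> < epsilon" for s
 proof -
  show s: "s : {a<..<c}" using that unfolding epsilon_def by auto
  show "\<bar>x s i - x t i\<bar> < d" if i: "i : {1..n}" for i
   using epsilon0(2)[of s] \<open>\<bar>t - s\<bar> < epsilon\<close> s i d(1) by (cases "s = t") (auto simp: epsilon_def dist_real_def abs_minus_commute)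
 qed
 have nt: "\<bar>t - t\<bar> < epsilon" using epsilon by simp
 define p where "p = 4 * k * (xb - y) ^ 3"
 define C where "C = qC k (xb - y) r"
 have "(xb = y --> g' t <= 0) & (xb ~= y --> g' t <= \<bar>p\<bar> * (10 * C * r + outr r (UU n (x t) beta) xb) + (1 / real n) * (\<bar>p\<bar> / r + 8 * C))"
 proof (cases "\<exists>i0\<in>{1..n}. beta i0 ~= 0 & x t i0 = xb")
  case False
  then have no: "!!i. i : {1..n} ==> beta i ~= 0 ==> x t i ~= xb" by blast
  have "g' t = 0"
  proof (rule DERIV_local_min[OF gd epsilon], intro allI impI)
   fix s assume s: "\<bar>t - s\<bar> < epsilon"
   have "UU n (x s) beta xb = UU n (x t) beta xb" using near(2)[OF s] d(1) no by (intro d(2)) auto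
   then show "g t <= g s" using con[OF near(1)[OF s], of xb] by simp
  qed
  moreover have "4 * k * (xb - y) ^ 3 = 0"
  proof (rule DERIV_local_min[OF qd d(1)], intro allI impI)
   fix z assume "\<bar>xb - z\<bar> < d"
   then have "UU n (x t) beta z = UU n (x t) beta xb" using d(1) no by (intro d(2)) auto
   then show "k * (xb - y) ^ 4 <= k * (z - y) ^ 4" using con[OF near(1)[OF nt], of z] by simp
  qed
  ultimately show ?thesis using k by simp
 next
  case True
  then obtain i0 where i0: "i0 : {1..n}" "beta i0 ~= 0" "x t i0 = xb" by blast
  define v where "v = (1 / real n) * (\<Sum>j\<in>{1..n} - {i0}. real_of_int (beta i0 * beta j) / (x t i0 - x t j))"
  have xd: "((%s. x s i0) has_real_derivative v) (at t)" using w i0(1) t unfolding window_def v_def by blast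
  have "p * v + g' t = 0"
  proof (rule DERIV_local_min[OF _ epsilon])
   have "((%s. k * (x s i0 - y) ^ 4) has_real_derivative 4 * k * (x t i0 - y) ^ 3 * v) (at t)"
    by (rule DERIV_chain2[OF qd xd])
   then show "((%s. k * (x s i0 - y) ^ 4 + g s) has_real_derivative p * v + g' t) (at t)"
    unfolding p_def i0(3) by (rule DERIV_add[OF _ gd])
   show "\<forall>s. \<bar>t - s\<bar> < epsilon --> k * (x t i0 - y) ^ 4 + g t <= k * (x s i0 - y) ^ 4 + g s"
   proof (intro allI impI)
    fix s assume s: "\<bar>t - s\<bar> < epsilon"
    have "UU n (x s) beta (x s i0) = UU n (x t) beta xb" using near(2)[OF s] i0 by (intro d(3)[of _ _ i0]) auto
    then show "k * (x t i0 - y) ^ 4 + g t <= k * (x s i0 - y) ^ 4 + g s" using con[OF near(1)[OF s], of "x s i0"] i0(3) by simp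
   qed
  qed
  then have gp: "g' t = - (p * v)" by simp
  have side: "k * (xb - y) ^ 4 <= k * (z - y) ^ 4" if "\<bar>z - xb\<bar> < d" "if beta i0 > 0 then xb <= z else z <= xb" for z
  proof -
   have "UU n (x t) beta z = UU n (x t) beta xb" using that i0 d(1) by (intro d(3)[of _ _ i0]) auto
   then show ?thesis using con[OF near(1)[OF nt], of z] by simp
  qed
  \<comment> \<open>On the higher side of the jump \<open>UU\<close> is locally constant, so the
    quartic cannot decrease in that direction.\<close>
  have sgn: "real_of_int (beta i0) * p = \<bar>p\<bar>"
  proof (cases "beta i0 > 0")
   case pos: True
   then have "beta i0 = 1" using Zn_charge[OF Z i0(1)] by auto
   moreover have "p >= 0"
   proof (rule ccontr)
    assume "~ p >= 0"
    then obtain e where e: "e > 0" "\<forall>h>0. h < e --> k * (xb + h - y) ^ 4 < k * (xb - y) ^ 4"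
     using DERIV_neg_dec_right[OF qd[of xb]] unfolding p_def by auto
    define m where "m = min d e / 2"
    have m: "0 < m" "m < d" "m < e" using d(1) e(1) by (auto simp: m_def)
    have "k * (xb + m - y) ^ 4 < k * (xb - y) ^ 4" using e(2) m by blast
    moreover have "k * (xb - y) ^ 4 <= k * (xb + m - y) ^ 4" using pos m by (intro side) auto
    ultimately show False by linarith
   qed
   ultimately show ?thesis by simp
  next
   case neg: False
   then have "beta i0 = -1" using Zn_charge[OF Z i0(1)] i0(2) by auto
   moreover have "p <= 0"
   proof (rule ccontr)
    assume "~ p <= 0"
    then obtain e where e: "e > 0" "\<forall>h>0. h < e --> k * (xb - h - y) ^ 4 < k * (xb - y) ^ 4"
     using DERIV_pos_inc_left[OF qd[of xb]] unfolding p_def by auto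
    define m where "m = min d e / 2"
    have m: "0 < m" "m < d" "m < e" using d(1) e(1) by (auto simp: m_def)
    have "k * (xb - m - y) ^ 4 < k * (xb - y) ^ 4" using e(2) m by blast
    moreover have "k * (xb - y) ^ 4 <= k * (xb - m - y) ^ 4" using neg m by (intro side) auto
    ultimately show False by linarith
   qed
   ultimately show ?thesis by simp
  qed
  \<comment> \<open>\<open>J\<close> is the field of the other charges at the particle. The velocity
    is \<open>- beta i0\<close> times \<open>J\<close>, and \<open>beta i0 * p = |p|\<close> absorbs
    the sign.\<close>
  define J where "J = (\<Sum>j\<in>{1..n} - {i0}. real_of_int (beta j) / (x t j - x t i0)) / real n"
  have vJ: "v = - (real_of_int (beta i0) * J)"
  proof -
   have "real_of_int (beta i0 * beta j) / (x t i0 - x t j) = - (real_of_int (beta i0) * (real_of_int (beta j) / (x t j - x t i0)))" for j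
    using minus_divide_right[of "real_of_int (beta i0 * beta j)" "x t j - x t i0"] by simp
   then have "v = (1 / real n) * (\<Sum>j\<in>{1..n} - {i0}. - (real_of_int (beta i0) * (real_of_int (beta j) / (x t j - x t i0))))"
    unfolding v_def by (simp only:)
   also have "... = - (real_of_int (beta i0) * J)"
    unfolding J_def sum_negf sum_distrib_left[symmetric] by simp
   finally show ?thesis .
  qed
  have gJ: "g' t = \<bar>p\<bar> * J" unfolding gp vJ sgn[symmetric] by (simp add: mult_ac)
  show ?thesis
  proof (intro conjI impI)
   assume "xb = y"
   then show "g' t <= 0" using gJ by (simp add: p_def)
  next
   assume xy: "xb ~= y"
   have p0: "\<bar>p\<bar> > 0" using xy k by (simp add: p_def)
   have "J <= 10 * C * r + outr r (UU n (x t) beta) xb + (1 / real n) * (1 / r + 8 * C / \<bar>p\<bar>)"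
    using velocity_bound[OF Z n i0(1,2) k r, of y] xy con[OF near(1)[OF nt]] unfolding J_def C_def p_def i0(3) by auto
   then have "\<bar>p\<bar> * J <= \<bar>p\<bar> * (10 * C * r + outr r (UU n (x t) beta) xb + (1 / real n) * (1 / r + 8 * C / \<bar>p\<bar>))"
    by (intro mult_left_mono) auto
   also have "... = \<bar>p\<bar> * (10 * C * r + outr r (UU n (x t) beta) xb) + (1 / real n) * (\<bar>p\<bar> * (1 / r + 8 * C / \<bar>p\<bar>))"
    by (simp add: algebra_simps)
   also have "\<bar>p\<bar> * (1 / r + 8 * C / \<bar>p\<bar>) = \<bar>p\<bar> / r + 8 * C" using p0 by (simp add: distrib_left)
   finally show "g' t <= \<bar>p\<bar> * (10 * C * r + outr r (UU n (x t) beta) xb) + (1 / real n) * (\<bar>p\<bar> / r + 8 * C)" unfolding gJ .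
  qed
 qed
 then show "(xb = y --> g' t <= 0) & (xb ~= y --> g' t <= \<bar>4 * k * (xb - y) ^ 3\<bar> * (10 * qC k (xb - y) r * r + outr r (%z. (%(t, y). UU n (x t) beta y) (t, z)) xb)
    + 1 / real n * (\<bar>4 * k * (xb - y) ^ 3\<bar> / r + 8 * qC k (xb - y) r))"
  unfolding p_def C_def by simp
qed

text \<open>Neutrality of the collisions at each point makes them invisible to the distribution function.\<close>

lemma FI_neutral:
 assumes "!!y. (\<Sum>i\<in>{i\<in>{1..n}. x i = y}. b i - beta i) = 0"
 shows "FI n x b y = FI n x beta y" "FM n x b y = FM n x beta y"
proof -
 have main: "(\<Sum>i=1..n. if P (x i) then b i else 0) = (\<Sum>i=1..n. if P (x i) then beta i else 0)" for P :: "real => bool"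
 proof -
  define S where "S = {i\<in>{1..n}. P (x i)}"
  have fin: "finite S" by (simp add: S_def)
  have fib: "{i : S. x i = v} = {i\<in>{1..n}. x i = v}" if "v : x ` S" for v using that by (auto simp: S_def)
  have "(\<Sum>i\<in>S. b i - beta i) = (\<Sum>v\<in>x ` S. \<Sum>i\<in>{i : S. x i = v}. b i - beta i)"
   by (rule sum.image_gen[OF fin])
  also have "... = 0"     proof (rule sum.neutral, rule ballI)
   fix v assume "v : x ` S"
   then show "(\<Sum>i\<in>{i : S. x i = v}. b i - beta i) = 0" using assms[of v] fib by simp
  qed
  finally have "(\<Sum>i\<in>S. b i) = (\<Sum>i\<in>S. beta i)" by (simp add: sum_subtractf)
  moreover have "(\<Sum>i=1..n. if P (x i) then f i else 0) = (\<Sum>i\<in>S. f i)" for f :: "nat => int"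
   unfolding S_def by (subst sum.inter_filter[symmetric]) auto
  ultimately show ?thesis by simp
 qed
 show "FI n x b y = FI n x beta y" unfolding FI_def by (rule main)
 show "FM n x b y = FM n x beta y" unfolding FM_def by (rule main)
qed

section \<open>Crossing a collision, and compactness on half-open windows\<close>

text \<open>Shortly before \<open>c\<close>, looking at \<open>y + delta\<close> or
  \<open>y - delta\<close> instead of \<open>y\<close> puts all particles that meet at
  \<open>y\<close> on the intended side, and neutrality replaces the new charges by the old ones.
  Continuity of \<open>G\<close> absorbs the shift.\<close>

lemma UU_left_limit:
 assumes w: "window n a c x beta" and ne: "!!y. (\<Sum>i\<in>{i\<in>{1..n}. x c i = y}. bc i - beta i) = 0"
  and le: "!!t y. t : {a..<c} ==> UU n (x t) beta y <= G (t, y)" and G: "isCont G (c, y)"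
 shows "UU n (x c) bc y <= G (c, y)"
proof (rule field_le_epsilon)
 fix e :: real assume e: "e > 0"
 have ac: "a < c" and n: "n >= 1" using w by (auto simp: window_def)
 obtain rho where rho: "rho > 0" "!!p. dist p (c, y) < rho ==> dist (G p) (G (c, y)) < e"
  using G e unfolding continuous_at_eps_delta by blast
 define d where "d = Min (insert 1 ((%i. \<bar>x c i - y\<bar>) ` {i\<in>{1..n}. x c i ~= y}))"
 have d: "d > 0" unfolding d_def by (subst Min_gr_iff) auto
 have dle: "d <= \<bar>x c i - y\<bar>" if "i : {1..n}" "x c i ~= y" for i
  unfolding d_def by (rule Min_le) (use that in auto)
 \<comment> \<open>Positions will differ by less than \<open>delta\<close> from those at
   \<open>c\<close>, and particles not at \<open>y\<close> are at least \<open>3 * delta\<close>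
   away from it.\<close>
 define delta where "delta = min (d / 3) (rho / 2)"
 have delta: "delta > 0" "3 * delta <= d" "delta <= rho / 2" using d rho(1) by (auto simp: delta_def)
 have "eventually (%s. \<forall>i\<in>{1..n}. \<bar>x s i - x c i\<bar> < delta) (at_left c)"
 proof (rule eventually_ball_finite)
  show "\<forall>i\<in>{1..n}. eventually (%s. \<bar>x s i - x c i\<bar> < delta) (at_left c)"
  proof
   fix i assume i: "i : {1..n}"
   have "continuous_on {a..c} (%t. x t i)" using w i unfolding window_def by blast
   then have "((%s. x s i) \<longlongrightarrow> x c i) (at c within {a..c})" using ac by (simp add: continuous_on_def)
   then have "((%s. x s i) \<longlongrightarrow> x c i) (at_left c)" using at_within_Icc_at_left[OF ac] by simp
   then show "eventually (%s. \<bar>x s i - x c i\<bar> < delta) (at_left c)"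
    using delta(1) by (auto simp: tendsto_iff dist_real_def)
  qed
 qed simp
 moreover have "eventually (%s. s : {max a (c - rho / 2)<..<c}) (at_left c)"
  by (rule eventually_at_left_real) (use ac rho(1) in auto)
 ultimately have "eventually (%s. (\<forall>i\<in>{1..n}. \<bar>x s i - x c i\<bar> < delta) & s : {max a (c - rho / 2)<..<c}) (at_left c)"
  by (rule eventually_conj)
 then obtain s where s: "!!i. i : {1..n} ==> \<bar>x s i - x c i\<bar> < delta" "s : {max a (c - rho / 2)<..<c}"
  using eventually_happens'[OF trivial_limit_at_left_real] by blast
 have Gs: "G (s, y') <= G (c, y) + e" if "\<bar>y' - y\<bar> <= delta" for y'
 proof -
  have "dist (s, y') (c, y) <= \<bar>s - c\<bar> + \<bar>y' - y\<bar>"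
   unfolding dist_prod_def fst_conv snd_conv dist_real_def by (rule sqrt_sum_squares_le_sum) auto
  also have "... < rho" using s(2) that delta(3) by auto
  finally show ?thesis using rho(2)[of "(s, y')"] unfolding dist_real_def by linarith
 qed
 have side: "(x c i <= y) = (x s i <= y + delta)" "(x c i < y) = (x s i <= y - delta)" if i: "i : {1..n}" for i
  using s(1)[OF i] dle[OF i] delta(1,2) by (cases "x c i = y"; linarith)+
 have "FI n (x c) bc y = FI n (x s) beta (y + delta)"
  unfolding FI_neutral(1)[where x = "x c" and b = bc and beta = beta and n = n, OF ne] unfolding FI_def
  by (intro sum.cong refl if_cong side)
 then have 1: "FI n (x c) bc y / n <= G (c, y) + e"
  using FI_le_UU[of n "x s" beta "y + delta"] le[of s "y + delta"] Gs[of "y + delta"] s(2) delta(1) by auto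
 have "FM n (x c) bc y = FI n (x s) beta (y - delta)"
  unfolding FI_neutral(2)[where x = "x c" and b = bc and beta = beta and n = n, OF ne] unfolding FI_def FM_def
  by (intro sum.cong refl if_cong side)
 then have 2: "FM n (x c) bc y / n <= G (c, y) + e"
  using FI_le_UU[of n "x s" beta "y - delta"] le[of s "y - delta"] Gs[of "y - delta"] s(2) delta(1) by auto
 show "UU n (x c) bc y <= G (c, y) + e" using 1 2 by (simp add: UU_def max_def)
qed

text \<open>The pole makes sublevel sets compact although the window is open at \<open>c\<close>,
  and its derivative has the favourable sign. It is removed afterwards by letting \<open>l\<close>
  tend to 0.\<close>

lemma pole_penalty:
 fixes a c l :: real assumes a: "0 <= a" and l: "l > 0"
 shows "continuous_on {a..<c} (%t. l / (c - t))" "!!t. t : {a..<c} ==> 0 <= l / (c - t)"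
  "C2fun {a<..<c} (%t. l / (c - t)) (%t. l / (c - t)^2)"
  "K >= 0 ==> compact {t : {a..<c}. K * t + l / (c - t) <= C}"
proof -
 show cont: "continuous_on {a..<c} (%t. l / (c - t))" by (intro continuous_intros) auto
 show "!!t. t : {a..<c} ==> 0 <= l / (c - t)" using l by auto
 show "C2fun {a<..<c} (%t. l / (c - t)) (%t. l / (c - t)^2)"
  unfolding C2fun_def
 proof (intro exI[of _ "%t. 2 * l / (c - t) ^ 3"] conjI ballI)
  fix t assume t: "t : {a<..<c}"
  then have ct: "c - t ~= 0" by auto
  show "((%t. l / (c - t)) has_real_derivative l / (c - t)^2) (at t)"
   using ct by (auto intro!: derivative_eq_intros simp: power2_eq_square)
  have "((%t. l / (c - t)^2) has_real_derivative l * (2 * (c - t)) / ((c - t)^2 * (c - t)^2)) (at t)"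
   using ct by (auto intro!: derivative_eq_intros simp: algebra_simps)
  moreover have "l * (2 * (c - t)) / ((c - t)^2 * (c - t)^2) = 2 * l / (c - t) ^ 3"
  proof -
   define q where "q = c - t"
   have "q ~= 0" using ct by (simp add: q_def)
   then show ?thesis unfolding q_def[symmetric] by (simp add: power2_eq_square power3_eq_cube mult_ac)
  qed
  ultimately show "((%t. l / (c - t)^2) has_real_derivative 2 * l / (c - t) ^ 3) (at t)" by simp
 next
  show "continuous_on {a<..<c} (%t. 2 * l / (c - t) ^ 3)" by (intro continuous_intros) auto
 qed
 show "compact {t : {a..<c}. K * t + l / (c - t) <= C}" if K: "K >= 0"
 proof (cases "C > 0")
  case False
  have "K * t + l / (c - t) > 0" if "t : {a..<c}" for t using that a l K by (intro add_nonneg_pos) auto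
  then have eq: "{t : {a..<c}. K * t + l / (c - t) <= C} = {}" using False by force
  show ?thesis unfolding eq by simp
 next
  case C: True
  have "t <= c - l / C" if t: "t : {a..<c}" "K * t + l / (c - t) <= C" for t
  proof -
   have "0 <= K * t" using K a t by simp
   then have "l / (c - t) <= C" using t(2) by linarith
   then have "l <= C * (c - t)" using t by (simp add: field_simps)
   then show ?thesis using C by (simp add: field_simps)
  qed
  moreover have "c - l / C < c" using l C by simp
  ultimately have eq: "{t : {a..<c}. K * t + l / (c - t) <= C} = {t : {a..c - l/C}. K * t + l / (c - t) <= C}"
   by fastforce
  have "continuous_on {a..c - l/C} (%t. K * t + l / (c - t))"
   using \<open>c - l / C < c\<close> by (intro continuous_intros) auto
  then have "closed ({a..c - l/C} \<inter> (%t. K * t + l / (c - t)) -` {..C})"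
   by (rule continuous_closed_preimage) auto
  moreover have "bounded ({a..c - l/C} \<inter> (%t. K * t + l / (c - t)) -` {..C})"
   by (rule bounded_subset[OF bounded_closed_interval]) auto
  moreover have "{t : {a..c - l/C}. K * t + l / (c - t) <= C} = {a..c - l/C} \<inter> (%t. K * t + l / (c - t)) -` {..C}"
   by auto
  ultimately show ?thesis unfolding eq by (simp only: compact_eq_bounded_closed)
 qed
qed

lemma pole_limit:
 fixes X theta c t :: real
 assumes "t < c" "!!l. l > 0 ==> X - l / (c - t) <= theta" shows "X <= theta"
proof (rule field_le_epsilon)
 fix e :: real assume "e > 0"
 then show "X <= theta + e" using assms(2)[of "e * (c - t)"] assms(1) by simp
qed

lemma window_bound: "window n a c x beta ==> t : {a..<c} ==> \<bar>UU n (x t) beta y\<bar> <= 1"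
 unfolding window_def by (intro UU_bound) auto

section \<open>Propagation of upper bounds by the flow\<close>

text \<open>1976 is the sum of the constants 1792 and 184 of \<open>barrier\<close>, since
  \<open>1 / n <= 1 <= M\<close>.\<close>

lemma window_barrier:
 assumes w: "window n a c x beta" and M: "M >= 1" and D: "D > 0" and A: "- M <= A" and K: "K > 1976 * M^2 / D^2"
  and start: "!!y. UU n (x a) beta y <= A + 2 * M * ((y - z) / D) ^ 4 + K * a" and t: "t : {a..<c}"
 shows "UU n (x t) beta y <= A + 2 * M * ((y - z) / D) ^ 4 + K * t"
proof (rule pole_limit[of t c])
 have a: "0 <= a" and n: "n >= 1" using w by (auto simp: window_def)
 fix l :: real assume l: "l > 0"
 have K0: "K >= 0" using K M by (smt (verit) divide_nonneg_nonneg zero_le_power2)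
 have "(%(t, y). UU n (x t) beta y) (t, y) <= A + 2 * M * ((y - z) / D) ^ 4 + K * t + l / (c - t)"
 proof (rule barrier[where h = "%t. l / (c - t)", OF window_qsub[OF w] window_usc[OF w] _ _ _ D _ _ pole_penalty(1)[OF a l] _ pole_penalty(3)[OF a l] _ A _ pole_penalty(4)[OF a l K0] _ t])
  show "\<bar>(%(t, y). UU n (x t) beta y) (t, y)\<bar> <= M" if "t : {a..<c}" for t y
   using window_bound[OF w that, of y] M by simp
  have "184 * (1 / real n) * M <= 184 * M^2"
  proof -
   have "(1 / real n) * M <= 1 * M" using n M by (intro mult_right_mono) auto
   also have "... <= M^2" using M by (simp add: power2_eq_square)
   finally show ?thesis by simp
  qed
  then have "(1792 * M^2 + 184 * (1 / real n) * M) / D^2 <= 1976 * M^2 / D^2"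
   using D by (intro divide_right_mono) auto
  then show "(1792 * M^2 + 184 * (1 / real n) * M) / D^2 < K" using K by linarith
  show "(%(t, y). UU n (x t) beta y) (s, y) <= A + 2 * M * ((y - z) / D) ^ 4 + K * s" if "s : {a..<c} - {a<..<c}" for s y
  proof -
   have "s = a" using that by auto
   then show ?thesis using start[of y] by simp
  qed
 qed (use M a l in auto)
 then show "UU n (x t) beta y - l / (c - t) <= A + 2 * M * ((y - z) / D) ^ 4 + K * t" by simp
qed (use t in auto)

lemma local_bound_mono: "local_bound B sig M u0 T U ==> B <= B' ==> local_bound B' sig M u0 T U"
 unfolding local_bound_def
proof (elim conjE, intro conjI ballI allI impI)
 fix t y D A assume B: "B <= B'" and U: "\<forall>t\<in>{0..T}. \<forall>y D A. D > 0 --> A >= - M --> (\<forall>x. \<bar>x - y\<bar> <= D --> u0 x <= A) --> U (t, y) <= A + sig + B * t / D^2"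
  and t: "t : {0..T}" and h: "0 < D" "- M <= A" "\<forall>x. \<bar>x - y\<bar> <= D --> u0 x <= A"
 have "U (t, y) <= A + sig + B * t / D^2" using U t h by blast
 also have "B * t / D^2 <= B' * t / D^2" using B t by (intro divide_right_mono mult_right_mono) auto
 finally show "U (t, y) <= A + sig + B' * t / D^2" by simp
qed blast

text \<open>One barrier is carried through all windows with the same \<open>K\<close>, so no error
  accumulates over the collisions, whose number may grow with \<open>n\<close>. The 2000 leaves
  strict room above 1976.\<close>

lemma particle_flow_local_bound:
 assumes fl: "particle_flow n T x b" and M: "M >= 1" and sig: "sig >= 0" and init: "!!y. UU n (x 0) (b 0) y <= u0 y + sig"
 shows "local_bound (2000 * M^2) sig M u0 T (%(t, y). UU n (x t) (b t) y)"
 unfolding local_bound_def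
proof (intro conjI ballI allI impI)
 have Z: "(x t, b t) : Zn n" "n >= 1" if "t : {0..T}" for t using fl that by (auto simp: particle_flow_def)
 show "\<bar>(%(t, y). UU n (x t) (b t) y) (t, y)\<bar> <= M" if "t : {0..T}" for t y
  using UU_bound[OF Z[OF that], of y] M by simp
 fix t z D A assume t: "t : {0..T}" and D: "0 < D" and A: "- M <= A" and loc: "\<forall>x. \<bar>x - z\<bar> <= D --> u0 x <= A"
 define K where "K = 2000 * M^2 / D^2"
 define A' where "A' = A + sig"
 have A': "- M <= A'" using A sig by (simp add: A'_def)
 have K: "K > 1976 * M^2 / D^2" unfolding K_def using M D by (intro divide_strict_right_mono) auto
 have "\<forall>y. UU n (x t) (b t) y <= A' + 2 * M * ((y - z) / D) ^ 4 + K * t"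
 proof (rule particle_flow_induct[OF fl _ _ _ t])
  show "\<forall>y. UU n (x 0) (b 0) y <= A' + 2 * M * ((y - z) / D) ^ 4 + K * 0"
  proof
   fix y
   show "UU n (x 0) (b 0) y <= A' + 2 * M * ((y - z) / D) ^ 4 + K * 0"
   proof (cases "\<bar>y - z\<bar> <= D")
    case True
    have "UU n (x 0) (b 0) y <= A'" using init[of y] loc True unfolding A'_def by force
    also have "... <= A' + 2 * M * ((y - z) / D) ^ 4 + K * 0" using M by simp
    finally show ?thesis .
   next
    case False
    have "1 <= \<bar>(y - z) / D\<bar> ^ 4" using False D by (intro one_le_power) (auto simp: field_simps)
    also have "\<bar>(y - z) / D\<bar> ^ 4 = ((y - z) / D) ^ 4" by (rule power_even_abs) simp
    finally have "1 <= ((y - z) / D) ^ 4" .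
    then have "2 * M * 1 <= 2 * M * ((y - z) / D) ^ 4" using M by (intro mult_left_mono) auto
    moreover have "UU n (x 0) (b 0) y <= 1" using UU_bound[OF Z(1)[of 0] Z(2)[of 0], of y] t by (auto simp: abs_le_iff)
    ultimately show ?thesis using A' M by linarith
   qed
  qed
 next
  fix a c beta t assume w: "window n a c x beta" and ac: "a < c" and b: "!!i t. i : {1..n} ==> t : {a..<c} ==> b t i = beta i"
   and Qa: "\<forall>y. UU n (x a) (b a) y <= A' + 2 * M * ((y - z) / D) ^ 4 + K * a" and t: "t : {a..<c}"
  have eq: "UU n (x s) (b t) = UU n (x s) beta" if "t : {a..<c}" for s t
   by (rule UU_cong) (rule b[OF _ that])
  have aa: "a : {a..<c}" using ac by simp
  show "\<forall>y. UU n (x t) (b t) y <= A' + 2 * M * ((y - z) / D) ^ 4 + K * t"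
   using window_barrier[OF w M D A' K _ t, of z] Qa unfolding eq[OF t] eq[OF aa] by blast
 next
  fix a c beta assume w: "window n a c x beta" and b: "!!i t. i : {1..n} ==> t : {a..<c} ==> b t i = beta i"
   and ne: "!!y. (\<Sum>i\<in>{i\<in>{1..n}. x c i = y}. b c i - beta i) = 0"
   and Q: "!!t. t : {a..<c} ==> \<forall>y. UU n (x t) (b t) y <= A' + 2 * M * ((y - z) / D) ^ 4 + K * t"
  have eq: "UU n (x s) (b t) = UU n (x s) beta" if "t : {a..<c}" for s t
   by (rule UU_cong) (rule b[OF _ that])
  show "\<forall>y. UU n (x c) (b c) y <= A' + 2 * M * ((y - z) / D) ^ 4 + K * c"
  proof
   fix y
   have "UU n (x c) (b c) y <= (%p. A' + 2 * M * ((snd p - z) / D) ^ 4 + K * fst p) (c, y)"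
   proof (rule UU_left_limit[OF w ne])
    show "UU n (x t) beta y <= A' + 2 * M * ((snd (t, y) - z) / D) ^ 4 + K * fst (t, y)" if "t : {a..<c}" for t y
     using Q[OF that] unfolding eq[OF that] by simp
    show "isCont (%p. A' + 2 * M * ((snd p - z) / D) ^ 4 + K * fst p) (c, y)"
     using D by (intro continuous_intros) auto
   qed
   then show "UU n (x c) (b c) y <= A' + 2 * M * ((y - z) / D) ^ 4 + K * c" by simp
  qed
 qed
 from spec[OF this, of z] show "(%(t, y). UU n (x t) (b t) y) (t, z) <= A + sig + 2000 * M^2 * t / D^2"
  by (simp add: A'_def K_def)
qed

lemma window_doubling:
 assumes w: "window n a c x beta" and M: "M >= 1" and W: "ext_sub M w0 W"
  and eta: "eta > 0" and k: "k > 0" and theta: "theta >= 0"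
 defines "Phi \<equiv> %t y s z. UU n (x t) beta y + W (s, z) - k * (y - z) ^ 4 - k * (t - s)^2 - eta * t"
 assumes start: "!!y s z. s >= 0 ==> Phi a y s z <= theta"
  and conf: "!!t y s z. t : {a..<c} ==> s >= 0 ==> Phi t y s z > theta ==> s > 0 & \<bar>y\<bar> <= R"
  and r: "0 < r" "r <= 1" and D: "D = 1 + 2 * M / k"
  and small: "80 * k * D ^ 3 * qC k D 1 * r + (1 / real n) * (4 * k * D ^ 3 / r + 8 * qC k D 1) < eta"
  and t: "t : {a..<c}" and s: "s >= 0"
 shows "Phi t y s z <= theta"
proof (rule pole_limit[of t c])
 have a: "0 <= a" using w by (auto simp: window_def)
 fix l :: real assume l: "l > 0"
 have h0: "!!t. t : {a..<c} ==> 0 <= l / (c - t)" by (rule pole_penalty(2)[OF a l])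
 have "(%(t, y). UU n (x t) beta y) (t, y) + W (s, z) - k * (y - z) ^ 4 - k * (t - s)^2 - eta * t - l / (c - t) <= theta"
 proof (rule doubling[where h = "%t. l / (c - t)" and M = M, OF window_qsub[OF w] window_usc[OF w] _ _ _ _ _ _ _ _ pole_penalty(1)[OF a l] h0 pole_penalty(3)[OF a l] _ eta k theta pole_penalty(4)[OF a l] _ _ r D small t s])
  show "\<bar>(%(t, y). UU n (x t) beta y) (t, y)\<bar> <= M" if "t : {a..<c}" for t y
   using window_bound[OF w that, of y] M by simp
  show "qsub 0 {0<..} W" "usc_seq HJ_cl W" using W by (auto simp: ext_sub_def)
  show "\<bar>W p\<bar> <= M" if "p : HJ_cl" for p using W that by (auto simp: ext_sub_def)
  fix t y s z assume t: "t : {a..<c}" and s: "0 <= s"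
   and gt: "(%(t, y). UU n (x t) beta y) (t, y) + W (s, z) - k * (y - z) ^ 4 - k * (t - s)^2 - eta * t - l / (c - t) > theta"
  then have gt': "Phi t y s z > theta" using h0[OF t] by (simp add: Phi_def)
  then have "t ~= a" using start[OF s, of y z] by auto
  then show "t : {a<..<c} & s > 0" using conf[OF t s gt'] t by auto
  show "\<bar>y\<bar> <= R" using conf[OF t s gt'] by blast
 qed (use M a l eta in auto)
 then show "Phi t y s z - l / (c - t) <= theta" by (simp add: Phi_def)
qed (use t in auto)

text \<open>\<open>e\<close> determines \<open>theta\<close> and \<open>eta\<close>, these determine
  \<open>k\<close> and \<open>R\<close> for all \<open>n\<close>, then \<open>r\<close> is chosen,
  and only then \<open>n\<close>, because the error contains \<open>4 * k * D ^ 3 / (n * r)\<close>.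
  The induction carries the bound for all \<open>y\<close>, \<open>s\<close>, \<open>z\<close> at
  once, since the maximum over a window may involve times \<open>s\<close> outside of it.\<close>

lemma particle_comparison:
 assumes u0: "datum M u0" and M: "M >= 1" and W: "ext_sub M (%x. - u0 x) W"
  and fl: "!!n. n >= 2 ==> particle_flow n T (x n) (b n)"
  and init: "!!n y. n >= 2 ==> UU n (x n 0) (b n 0) y <= u0 y + sig n"
  and sig: "sig ----> 0" "!!n. n >= 2 ==> sig n >= 0" and e: "e > 0" and T: "T >= 0"
 shows "\<exists>N. \<forall>n\<ge>N. \<forall>t\<in>{0..T}. \<forall>y. UU n (x n t) (b n t) y + W (t, y) <= e"
proof -
 define theta where "theta = e / 2"
 define eta where "eta = e / 2 / (T + 1)"
 have theta: "theta > 0" and eta: "eta > 0" using e T by (auto simp: theta_def eta_def)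
 have B: "2000 * M^2 >= 0" by simp
 obtain k R where k: "k > 0" and conf:
  "!!U W sig T t x s y. sig <= theta / 2 ==> local_bound (2000 * M^2) sig M u0 T U ==> (!!S. local_bound (2000 * M^2) 0 M (%x. - u0 x) S W) ==> t : {0..T} ==> s >= 0 ==>
   U (t, x) + W (s, y) - k * (x - y) ^ 4 - k * (t - s)^2 - eta * t > theta ==> t > 0 & s > 0 & \<bar>x\<bar> <= R"
  by (rule penalty_confines[OF u0 B eta theta]) blast
 have WL: "local_bound (2000 * M^2) 0 M (%x. - u0 x) S W" for S
  by (rule local_bound_mono[OF ext_sub_local_bound[OF W]]) (use M in auto)
 define D where "D = 1 + 2 * M / k"
 have D1: "D >= 1" using M k by (simp add: D_def)
 obtain r where r: "0 < r" "r <= 1" "80 * k * D ^ 3 * qC k D 1 * r < eta / 2"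
  using small_choice[of "80 * k * D ^ 3 * qC k D 1" "eta / 2"] eta k D1 by (auto simp: qC_def)
 define L where "L = 4 * k * D ^ 3 / r + 8 * qC k D 1"
 have "(%n. (1 / real n) * L) ----> 0 * L" by (intro tendsto_intros lim_1_over_n)
 then have "eventually (%n. (1 / real n) * L < eta / 2) sequentially"
  using eta by (intro order_tendstoD) auto
 moreover have "eventually (%n. sig n < theta / 2) sequentially" using sig(1) theta by (intro order_tendstoD) auto
 ultimately have "eventually (%n. (1 / real n) * L < eta / 2 & sig n < theta / 2 & n >= 2) sequentially"
  using eventually_ge_at_top[of 2] by eventually_elim auto
 then obtain N where N: "!!n. n >= N ==> (1 / real n) * L < eta / 2 & sig n < theta / 2 & n >= 2"
  unfolding eventually_sequentially by blast
 show ?thesis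
 proof (intro exI[of _ N] allI impI ballI)
  fix n t y assume n: "n >= N" and t: "t : {0..T}"
  have n2: "n >= 2" "sig n <= theta / 2" and small: "80 * k * D ^ 3 * qC k D 1 * r + (1 / real n) * (4 * k * D ^ 3 / r + 8 * qC k D 1) < eta"
  proof -
   show "n >= 2" "sig n <= theta / 2" using N[OF n] by auto
   have "(1 / real n) * L < eta / 2" using N[OF n] by blast
   then show "80 * k * D ^ 3 * qC k D 1 * r + (1 / real n) * (4 * k * D ^ 3 / r + 8 * qC k D 1) < eta"
    using r(3) unfolding L_def by linarith
  qed
  have UL: "local_bound (2000 * M^2) (sig n) M u0 T (%(t, y). UU n (x n t) (b n t) y)"
   by (rule particle_flow_local_bound[OF fl[OF n2(1)] M sig(2)[OF n2(1)] init[OF n2(1)]])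
  define Phi where "Phi t y s z = UU n (x n t) (b n t) y + W (s, z) - k * (y - z) ^ 4 - k * (t - s)^2 - eta * t" for t y s z
  have cf: "t > 0 & s > 0 & \<bar>y\<bar> <= R" if "t : {0..T}" "s >= 0" "Phi t y s z > theta" for t y s z
   using conf[OF n2(2) UL WL that(1,2), of y z] that(3) by (simp add: Phi_def)
  have "\<forall>y s z. s >= 0 --> Phi t y s z <= theta"
  proof (rule particle_flow_induct[OF fl[OF n2(1)] _ _ _ t])
   show "\<forall>y s z. s >= 0 --> Phi 0 y s z <= theta"
   proof (intro allI impI)
    fix y s z :: real assume "s >= 0"
    then show "Phi 0 y s z <= theta" using cf[of 0 s y z] T by (cases "Phi 0 y s z <= theta") auto
   qed
  next
   fix a c beta t assume a0: "0 <= a" and cT: "c <= T" and w: "window n a c (x n) beta" and ac: "a < c"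
    and b: "!!i t. i : {1..n} ==> t : {a..<c} ==> b n t i = beta i"
    and Qa: "\<forall>y s z. s >= 0 --> Phi a y s z <= theta" and t: "t : {a..<c}"
   have eq: "UU n (x n t) (b n t) = UU n (x n t) beta" if "t : {a..<c}" for t
    by (rule UU_cong) (rule b[OF _ that])
   have aa: "a : {a..<c}" using ac by simp
   show "\<forall>y s z. s >= 0 --> Phi t y s z <= theta"
    unfolding Phi_def eq[OF t]
   proof (intro allI impI, rule window_doubling[OF w M W eta k less_imp_le[OF theta] _ _ r(1,2) D_def small t])
    fix y s z :: real assume "s >= 0"
    then show "UU n (x n a) beta y + W (s, z) - k * (y - z) ^ 4 - k * (a - s)^2 - eta * a <= theta"
     using Qa unfolding Phi_def eq[OF aa] by blast
   next
    fix t y s z assume t: "t : {a..<c}" and s: "s >= 0"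
     and gt: "UU n (x n t) beta y + W (s, z) - k * (y - z) ^ 4 - k * (t - s)^2 - eta * t > theta"
    show "s > 0 & \<bar>y\<bar> <= R" using cf[of t s y z] t s gt a0 cT unfolding Phi_def eq[OF t] by auto
   qed
  next
   fix a c beta assume w: "window n a c (x n) beta" and b: "!!i t. i : {1..n} ==> t : {a..<c} ==> b n t i = beta i"
    and ne: "!!y. (\<Sum>i\<in>{i\<in>{1..n}. x n c i = y}. b n c i - beta i) = 0"
    and Q: "!!t. t : {a..<c} ==> \<forall>y s z. s >= 0 --> Phi t y s z <= theta"
   have eq: "UU n (x n t) (b n t) = UU n (x n t) beta" if "t : {a..<c}" for t
    by (rule UU_cong) (rule b[OF _ that])
   show "\<forall>y s z. s >= 0 --> Phi c y s z <= theta"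
   proof (intro allI impI)
    fix y s z :: real assume s: "s >= 0"
    \<comment> \<open>For fixed \<open>s\<close> and \<open>z\<close> the bound is a continuous
      function of the time and position of the particle system, as \<open>UU_left_limit\<close>
      demands.\<close>
    have "UU n (x n c) (b n c) y <= (%p. theta + eta * fst p + k * (fst p - s)^2 + k * (snd p - z) ^ 4 - W (s, z)) (c, y)"
    proof (rule UU_left_limit[OF w ne])
     show "UU n (x n t) beta y <= theta + eta * fst (t, y) + k * (fst (t, y) - s)^2 + k * (snd (t, y) - z) ^ 4 - W (s, z)"
      if "t : {a..<c}" for t y
      using Q[OF that, rule_format, OF s, of y z] unfolding Phi_def eq[OF that] by simp
     show "isCont (%p. theta + eta * fst p + k * (fst p - s)^2 + k * (snd p - z) ^ 4 - W (s, z)) (c, y)"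
      by (intro continuous_intros)
    qed
    then show "Phi c y s z <= theta" by (simp add: Phi_def)
   qed
  qed
  then have "Phi t y t y <= theta" using t by simp
  moreover have "eta * t <= e / 2"
  proof -
   have "eta * t <= eta * (T + 1)" using t eta by (intro mult_left_mono) auto
   also have "... = e / 2" using T unfolding eta_def by (intro nonzero_mult_div_cancel_right[of "T + 1" "e / 2", unfolded times_divide_eq_left[symmetric]]) simp
   finally show ?thesis .
  qed
  ultimately show "UU n (x n t) (b n t) y + W (t, y) <= e" by (simp add: Phi_def theta_def)
 qed
qed

section \<open>Finite signed measures\<close>

lemma signed_measure_sums:
 "finite_signed_measure mu ==> range A \<subseteq> sets borel ==> disjoint_family A ==> (%i. mu (A i)) sums mu (\<Union>i. A i)"
 for A :: "nat => real set"
 unfolding finite_signed_measure_def by blast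

lemma signed_measure_empty: "finite_signed_measure mu ==> mu {} = 0"
 unfolding finite_signed_measure_def by blast

lemma signed_measure_union:
 assumes mu: "finite_signed_measure mu" and "A : sets borel" "B : sets borel" "A \<inter> B = {}"
 shows "mu (A \<union> B) = mu A + mu B"
proof -
 have "(%i. mu (binaryset A B i)) sums mu (\<Union>i. binaryset A B i)"
  using assms(2-) by (intro signed_measure_sums[OF mu]) (auto simp: binaryset_def disjoint_family_on_def)
 moreover have "(%i. mu (binaryset A B i)) sums (mu A + mu B)"
  using binaryset_sums[of mu A B] signed_measure_empty[OF mu] by simp
 ultimately show ?thesis by (simp add: UN_binaryset_eq sums_unique2)
qed

lemma signed_measure_diff:
 assumes mu: "finite_signed_measure mu" and "A : sets borel" "B : sets borel" "B \<subseteq> A"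
 shows "mu (A - B) = mu A - mu B"
proof -
 have "mu (B \<union> (A - B)) = mu B + mu (A - B)" using assms by (intro signed_measure_union) auto
 moreover have "B \<union> (A - B) = A" using assms by auto
 ultimately show ?thesis by simp
qed

lemma signed_measure_Ioc:
 assumes "finite_signed_measure mu" "x <= y"
 shows "mu {x<..y} = mu {..y} - mu {..x}"
proof -
 have "{..y} - {..x} = {x<..y}" by auto
 moreover have "mu ({..y} - {..x}) = mu {..y} - mu {..x}" using assms by (intro signed_measure_diff) auto
 ultimately show ?thesis by simp
qed

text \<open>
 If \<open>mu\<close> is unbounded on the subsets of \<open>A\<close>, then this is also true for some \<open>B\<close> contained in \<open>A\<close> with
 \<open>|mu (A - B)|\<close> at least 1. Iteration produces disjoint sets which contradict summability.\<close>

lemma signed_measure_bounded: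
 assumes mu: "finite_signed_measure mu"
 obtains C where "C >= 0" "!!A. A : sets borel ==> \<bar>mu A\<bar> <= C"
proof -
 define bad where "bad A \<longleftrightarrow> A : sets borel & (\<forall>C. \<exists>B\<in>sets borel. B \<subseteq> A & \<bar>mu B\<bar> > C)" for A
 have split: "bad B \<or> bad (A - B)" if A: "bad A" and B: "B : sets borel" for A B
 proof (rule ccontr)
  assume "~ ?thesis"
  moreover have sA: "A : sets borel" using A by (simp add: bad_def)
  moreover have "A - B : sets borel" using sA B by auto
  ultimately obtain C1 C2 where C1: "!!E. E : sets borel ==> E \<subseteq> B ==> \<bar>mu E\<bar> <= C1"
   and C2: "!!E. E : sets borel ==> E \<subseteq> A - B ==> \<bar>mu E\<bar> <= C2"
   using B unfolding bad_def by (meson not_less)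
  obtain E where E: "E : sets borel" "E \<subseteq> A" "\<bar>mu E\<bar> > C1 + C2" using A unfolding bad_def by blast
  have "mu ((E - B) \<union> (E \<inter> B)) = mu (E - B) + mu (E \<inter> B)" using E(1) B by (intro signed_measure_union[OF mu]) auto
  then have "mu E = mu (E - B) + mu (E \<inter> B)" by (simp only: Un_Diff_Int)
  moreover have "\<bar>mu (E \<inter> B)\<bar> <= C1" using E B by (intro C1) auto
  moreover have "\<bar>mu (E - B)\<bar> <= C2" using E B by (intro C2) auto
  ultimately show False using E(3) by linarith
 qed
 have step: "\<exists>A'. bad A' & A' \<subseteq> A & \<bar>mu (A - A')\<bar> >= 1" if A: "bad A" for A
 proof -
  have sA: "A : sets borel" using A by (simp add: bad_def)
  \<comment> \<open>With more than \<open>1 + |mu A|\<close>, both \<open>B\<close> and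
    \<open>A - B\<close> have absolute measure at least 1, so either of them may be the part that is
    removed.\<close>
  obtain B where B: "B : sets borel" "B \<subseteq> A" "\<bar>mu B\<bar> > 1 + \<bar>mu A\<bar>" using A unfolding bad_def by blast
  have d: "mu (A - B) = mu A - mu B" using sA B by (intro signed_measure_diff[OF mu]) auto
  show ?thesis
  proof (cases "bad B")
   case True
   moreover have "\<bar>mu (A - B)\<bar> >= 1" using d B(3) by linarith
   ultimately show ?thesis using B(2) by blast
  next
   case False
   then have badAB: "bad (A - B)" using split[OF A B(1)] by blast
   have eq: "A - (A - B) = B" using B(2) by (simp add: double_diff)
   have "\<bar>mu (A - (A - B))\<bar> >= 1" unfolding eq using B(3) abs_ge_zero[of "mu A"] by linarith
   with badAB show ?thesis by (intro exI[of _ "A - B"] conjI Diff_subset)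
  qed
 qed
 have "~ bad UNIV"
 proof
  assume b: "bad UNIV"
  have "\<exists>A. \<forall>n. bad (A n) & (A (Suc n) \<subseteq> A n & \<bar>mu (A n - A (Suc n))\<bar> >= 1)"
  proof (rule dependent_nat_choice[of "%_. bad" "%_ A A'. A' \<subseteq> A & \<bar>mu (A - A')\<bar> >= 1"])
   show "\<exists>A. bad A" using b by (rule exI)
   show "\<exists>A'. bad A' & (A' \<subseteq> A & \<bar>mu (A - A')\<bar> >= 1)" if "bad A" for A by (rule step[OF that])
  qed
  then obtain A where AA: "\<forall>n. bad (A n) & (A (Suc n) \<subseteq> A n & \<bar>mu (A n - A (Suc n))\<bar> >= 1)" by (rule exE)
  have A: "bad (A n)" "A (Suc n) \<subseteq> A n & \<bar>mu (A n - A (Suc n))\<bar> >= 1" for n using spec[OF AA, of n] by (rule conjunct1, rule conjunct2)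
  have anti: "A m \<subseteq> A n" if "n <= m" for n m
   by (rule lift_Suc_antimono_le[of A, OF _ that]) (rule conjunct1[OF A(2)])
  have "(%i. mu (A i - A (Suc i))) sums mu (\<Union>i. A i - A (Suc i))"
  proof (rule signed_measure_sums[OF mu])
   have "A i : sets borel" for i using A(1)[of i] unfolding bad_def by (rule conjunct1)
   then show "range (%i. A i - A (Suc i)) \<subseteq> sets borel" by auto
   have "(A i - A (Suc i)) \<inter> (A j - A (Suc j)) = {}" if "i < j" for i j using anti[OF Suc_leI[OF that]] by blast
   then show "disjoint_family (%i. A i - A (Suc i))"
    unfolding disjoint_family_on_def by (metis inf_commute linorder_neqE_nat)
  qed
  then have "(%i. mu (A i - A (Suc i))) ----> 0" by (intro summable_LIMSEQ_zero) (rule sums_summable)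
  then have "eventually (%i. dist (mu (A i - A (Suc i))) 0 < 1) sequentially" by (rule tendstoD) simp
  then obtain i where "\<bar>mu (A i - A (Suc i))\<bar> < 1" by (auto simp: eventually_sequentially)
  then show False using A(2)[of i] by linarith
 qed
 then obtain C where C: "!!A. A : sets borel ==> \<bar>mu A\<bar> <= C" unfolding bad_def by (auto simp: not_less)
 show ?thesis by (rule that[of "\<bar>C\<bar>"], simp) (rule order_trans[OF C abs_ge_self])
qed

section \<open>Jordan decomposition, total variation and integrals\<close>

lemma pos_variation_upper:
 assumes mu: "finite_signed_measure mu" and A: "A : sets borel" and h: "!!B. B : sets borel ==> B \<subseteq> A ==> mu B <= c"
 shows "emeasure (pos_variation mu) A <= ennreal c"
 unfolding emeasure_pos_variation[OF mu A] using h by (intro SUP_least ennreal_leI) auto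

lemma space_pos_variation [simp]: "space (pos_variation mu) = UNIV"
 using sets_eq_imp_space_eq[OF sets_pos_variation[of mu]] by simp

lemma finite_pos_variation:
 assumes mu: "finite_signed_measure mu" shows "finite_borel_measure (pos_variation mu)"
proof -
 obtain C where C: "C >= 0" "!!A. A : sets borel ==> \<bar>mu A\<bar> <= C" using signed_measure_bounded[OF mu] by blast
 have "emeasure (pos_variation mu) UNIV <= ennreal C" using C(2) by (intro pos_variation_upper[OF mu]) (auto simp: abs_le_iff)
 then have "emeasure (pos_variation mu) (space (pos_variation mu)) ~= \<infinity>" by (auto simp: top_unique)
 then show ?thesis
  by (intro finite_borel_measure.intro finite_measureI) (auto simp: finite_borel_measure_axioms_def)
qed

lemma finite_neg_variation:
 assumes "finite_signed_measure mu" shows "finite_borel_measure (neg_variation mu)"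
 unfolding neg_variation_def by (rule finite_pos_variation[OF finite_signed_measure_uminus[OF assms]])

lemma measure_pos_variation:
 assumes mu: "finite_signed_measure mu" and A: "A : sets borel"
 shows "!!B. B : sets borel ==> B \<subseteq> A ==> mu B <= measure (pos_variation mu) A"
  "(!!B. B : sets borel ==> B \<subseteq> A ==> mu B <= c) ==> measure (pos_variation mu) A <= c"
proof -
 interpret finite_borel_measure "pos_variation mu" by (rule finite_pos_variation[OF mu])
 show "mu B <= measure (pos_variation mu) A" if "B : sets borel" "B \<subseteq> A" for B
 proof -
  have "ennreal (mu B) <= emeasure (pos_variation mu) A"
   unfolding emeasure_pos_variation[OF mu A] using that by (intro SUP_upper) auto
  then show ?thesis using measure_nonneg[of "pos_variation mu" A] by (auto simp: emeasure_eq_measure ennreal_le_iff2)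
 qed
 show "measure (pos_variation mu) A <= c" if h: "!!B. B : sets borel ==> B \<subseteq> A ==> mu B <= c"
 proof -
  have "c >= 0" using h[of "{}"] signed_measure_empty[OF mu] by simp
  moreover have "emeasure (pos_variation mu) A <= ennreal c" by (rule pos_variation_upper[OF mu A h])
  ultimately show ?thesis by (simp add: emeasure_eq_measure)
 qed
qed

text \<open>\<open>mu B = mu A - mu (A - B)\<close> turns a bound on \<open>A - B\<close> by one
  variation into a bound on \<open>B\<close> for the other, in both directions.\<close>

lemma jordan_decomposition:
 assumes mu: "finite_signed_measure mu" and A: "A : sets borel"
 shows "mu A = measure (pos_variation mu) A - measure (neg_variation mu) A"
proof -
 note nu = finite_signed_measure_uminus[OF mu]
 have "mu B <= mu A + measure (neg_variation mu) A" if B: "B : sets borel" "B \<subseteq> A" for B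
 proof -
  have "- mu (A - B) <= measure (neg_variation mu) A"
   unfolding neg_variation_def using A B by (intro measure_pos_variation(1)[OF nu]) auto
  then show ?thesis using signed_measure_diff[OF mu A B] by linarith
 qed
 then have 1: "measure (pos_variation mu) A <= mu A + measure (neg_variation mu) A"
  by (rule measure_pos_variation(2)[OF mu A])
 have "- mu B <= measure (pos_variation mu) A - mu A" if B: "B : sets borel" "B \<subseteq> A" for B
 proof -
  have "mu (A - B) <= measure (pos_variation mu) A"
   using A B by (intro measure_pos_variation(1)[OF mu]) auto
  then show ?thesis using signed_measure_diff[OF mu A B] by linarith
 qed
 then have 2: "measure (neg_variation mu) A <= measure (pos_variation mu) A - mu A"
  unfolding neg_variation_def by (rule measure_pos_variation(2)[OF nu A])
 show ?thesis using 1 2 by linarith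
qed

definition tv :: "(real set => real) => real set => real" where
 "tv mu A = measure (pos_variation mu) A + measure (neg_variation mu) A"

lemma total_variation_eq:
 assumes mu: "finite_signed_measure mu" and A: "A : sets borel"
 shows "total_variation mu A = ennreal (tv mu A)"
proof -
 interpret P: finite_borel_measure "pos_variation mu" by (rule finite_pos_variation[OF mu])
 interpret N: finite_borel_measure "neg_variation mu" by (rule finite_neg_variation[OF mu])
 show ?thesis unfolding total_variation_def tv_def P.emeasure_eq_measure N.emeasure_eq_measure by (simp add: ennreal_plus)
qed

lemma abs_le_tv:
 assumes mu: "finite_signed_measure mu" and A: "A : sets borel" and B: "B : sets borel" "B \<subseteq> A"
 shows "\<bar>mu B\<bar> <= tv mu A"
proof -
 have "mu B <= measure (pos_variation mu) A" by (rule measure_pos_variation(1)[OF mu A B])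
 moreover have "- mu B <= measure (neg_variation mu) A"
  unfolding neg_variation_def by (rule measure_pos_variation(1)[OF finite_signed_measure_uminus[OF mu] A B])
 ultimately show ?thesis unfolding tv_def using measure_nonneg[of "pos_variation mu" A] measure_nonneg[of "neg_variation mu" A] by linarith
qed

lemma sets_neg_variation [simp]: "sets (neg_variation mu) = sets borel" by (simp add: neg_variation_def)
lemma space_neg_variation [simp]: "space (neg_variation mu) = UNIV" by (simp add: neg_variation_def)

lemma finite_borel_integrable:
 fixes f :: "real => real"
 assumes "finite_borel_measure P" "f : borel_measurable borel" "!!x. \<bar>f x\<bar> <= b"
 shows "integrable P f"
proof -
 interpret finite_borel_measure P by fact
 have "f : borel_measurable P" using assms(2) M_is_borel by (simp cong: measurable_cong_sets)
 then show ?thesis using assms(3) by (intro integrable_const_bound[of _ b]) auto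
qed

lemma finite_borel_integral_bound:
 fixes f :: "real => real"
 assumes P: "finite_borel_measure P" and f: "f : borel_measurable borel" and K: "K : sets borel"
  and b: "!!x. x : K ==> \<bar>f x\<bar> <= a" "!!x. \<bar>f x\<bar> <= b" and ab: "a >= 0"
 shows "\<bar>integral\<^sup>L P f\<bar> <= a * measure P UNIV + b * measure P (UNIV - K)"
proof -
 interpret finite_borel_measure P by fact
 have b0: "b >= 0" using b(2)[of 0] by linarith
 have "\<bar>integral\<^sup>L P f\<bar> <= integral\<^sup>L P (%x. \<bar>f x\<bar>)" by (rule integral_abs_bound)
 also have "... <= integral\<^sup>L P (%x. a + b * indicator (UNIV - K) x)"
 proof (rule integral_mono)
  show "integrable P (%x. \<bar>f x\<bar>)" using finite_borel_integrable[OF P f b(2)] by simp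
  have i: "(%x. a + b * indicator (UNIV - K) x) : borel_measurable borel" using K by measurable
  show "integrable P (%x. a + b * indicator (UNIV - K) x)"
   by (rule finite_borel_integrable[OF P i, of "a + b"]) (use ab b0 in \<open>auto split: split_indicator\<close>)
  show "\<bar>f x\<bar> <= a + b * indicator (UNIV - K) x" for x
   using b(1)[of x] b(2)[of x] ab by (auto split: split_indicator)
 qed
 also have "... = a * measure P UNIV + b * measure P (UNIV - K)"
 proof -
  have "(indicator (UNIV - K) :: real => real) : borel_measurable borel" using K by measurable
  then have "integrable P (indicator (UNIV - K) :: real => real)"
   by (rule finite_borel_integrable[OF P, of _ 1]) (auto split: split_indicator)
  then show ?thesis using K M_is_borel borel_UNIV by (subst Bochner_Integration.integral_add) auto
 qed
 finally show ?thesis .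
qed

lemma signed_integral_diff:
 assumes mu: "finite_signed_measure mu" and f: "f : borel_measurable borel" "!!x. \<bar>f x\<bar> <= a"
  and g: "g : borel_measurable borel" "!!x. \<bar>g x\<bar> <= b"
 shows "signed_integral mu (%x. f x - g x) = signed_integral mu f - signed_integral mu g"
proof -
 note i = finite_borel_integrable[OF finite_pos_variation[OF mu]] finite_borel_integrable[OF finite_neg_variation[OF mu]]
 show ?thesis
  unfolding signed_integral_def using i[OF f] i[OF g] by simp
qed

lemma signed_integral_bound:
 assumes mu: "finite_signed_measure mu" and f: "f : borel_measurable borel" and K: "K : sets borel"
  and b: "!!x. x : K ==> \<bar>f x\<bar> <= a" "!!x. \<bar>f x\<bar> <= b" and a: "a >= 0"
 shows "\<bar>signed_integral mu f\<bar> <= a * tv mu UNIV + b * tv mu (UNIV - K)"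
proof -
 have "\<bar>integral\<^sup>L (pos_variation mu) f\<bar> <= a * measure (pos_variation mu) UNIV + b * measure (pos_variation mu) (UNIV - K)"
  by (rule finite_borel_integral_bound[OF finite_pos_variation[OF mu] f K b a])
 moreover have "\<bar>integral\<^sup>L (neg_variation mu) f\<bar> <= a * measure (neg_variation mu) UNIV + b * measure (neg_variation mu) (UNIV - K)"
  by (rule finite_borel_integral_bound[OF finite_neg_variation[OF mu] f K b a])
 ultimately show ?thesis unfolding signed_integral_def tv_def by (simp add: distrib_left)
qed

lemma signed_integral_step:
 assumes mu: "finite_signed_measure mu" and I: "finite I" and A: "!!i. i : I ==> A i : sets borel"
 shows "signed_integral mu (%x. \<Sum>i\<in>I. c i * indicator (A i) x) = (\<Sum>i\<in>I. c i * mu (A i))"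
proof -
 interpret P: finite_borel_measure "pos_variation mu" by (rule finite_pos_variation[OF mu])
 interpret N: finite_borel_measure "neg_variation mu" by (rule finite_neg_variation[OF mu])
 have "integral\<^sup>L (pos_variation mu) (%x. \<Sum>i\<in>I. c i * indicator (A i) x) = (\<Sum>i\<in>I. c i * measure (pos_variation mu) (A i))"
  using A by (subst Bochner_Integration.integral_sum) (auto intro!: integrable_mult_right integrable_real_indicator P.emeasure_finite[THEN less_top[THEN iffD1]] simp: less_top[symmetric])
 moreover have "integral\<^sup>L (neg_variation mu) (%x. \<Sum>i\<in>I. c i * indicator (A i) x) = (\<Sum>i\<in>I. c i * measure (neg_variation mu) (A i))"
  using A by (subst Bochner_Integration.integral_sum) (auto intro!: integrable_mult_right integrable_real_indicator simp: less_top[symmetric])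
 ultimately show ?thesis
  unfolding signed_integral_def using A by (simp add: jordan_decomposition[OF mu] sum_subtractf right_diff_distrib)
qed

text \<open>Half lines form a generator stable under intersections, but the whole line is not among
  them; equality on it comes from a partition into countably many differences of half lines. A
  Dynkin argument then covers all Borel sets.\<close>

lemma signed_measure_eqI:
 assumes mu: "finite_signed_measure mu" and nu: "finite_signed_measure nu" and eq: "!!x. mu {..x} = nu {..x}"
 shows "mu = nu"
proof
 fix A
 have UNIVeq: "mu UNIV = nu UNIV"
 proof -
  define B where "B i = (if i = 0 then {..0} else {real (i - 1)<..real i})" for i :: nat
  have U: "(\<Union>i. B i) = UNIV"
  proof -
   have "x : (\<Union>i. B i)" for x
   proof (cases "x <= 0")
    case True
    then have "x : B 0" by (simp add: B_def)
    then show ?thesis by blast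
   next
    case False
    define i where "i = nat \<lceil>x\<rceil>"
    have "x : B i" using False unfolding B_def i_def by (auto simp: of_nat_diff) linarith+
    then show ?thesis by blast
   qed
   then show ?thesis by blast
  qed
  have dis: "disjoint_family B"
  proof -
   have "B i \<inter> B j = {}" if "i < j" for i j
   proof -
    have "real i <= real (j - 1)" using that by simp
    then show ?thesis using that by (auto simp: B_def)
   qed
   then show ?thesis unfolding disjoint_family_on_def by (metis inf_commute linorder_neqE_nat)
  qed
  have rng: "range B \<subseteq> sets borel" by (auto simp: B_def)
  have "mu (B i) = nu (B i)" for i
   using eq signed_measure_Ioc[OF mu, of "real (i - 1)" "real i"] signed_measure_Ioc[OF nu, of "real (i - 1)" "real i"]
   by (cases i) (simp_all add: B_def)
  then show ?thesis
   using signed_measure_sums[OF mu rng dis] signed_measure_sums[OF nu rng dis] U by (simp add: sums_unique2)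
 qed
 show "mu A = nu A"
 proof (cases "A : sets borel")
  case False
  then show ?thesis using mu nu by (simp add: finite_signed_measure_def)
 next
  case True
  have bor: "sets (borel :: real measure) = sigma_sets UNIV (range (%x. {..x}))"
   by (subst borel_eq_atMost) simp
  have "Int_stable (range (%x :: real. {..x}))" unfolding Int_stable_def by (auto simp: image_iff min_def)
  moreover have "range (%x :: real. {..x}) \<subseteq> Pow UNIV" by simp
  moreover have "A : sigma_sets UNIV (range (%x :: real. {..x}))" using True unfolding bor .
  ultimately show ?thesis
  proof (induction rule: sigma_sets_induct_disjoint)
   case (basic A)
   then show ?case using eq by auto
  next
   case empty
   then show ?case using signed_measure_empty[OF mu] signed_measure_empty[OF nu] by simp
  next
   case (compl A)
   have "A : sets borel" using compl(1) unfolding bor .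
   then have "mu (UNIV - A) = mu UNIV - mu A" "nu (UNIV - A) = nu UNIV - nu A"
    by (intro signed_measure_diff[OF mu] signed_measure_diff[OF nu]; simp)+
   then show ?case using UNIVeq compl(2) by simp
  next
   case (union A)
   have rng: "range A \<subseteq> sets borel" using union(2) unfolding bor .
   have "(%i. mu (A i)) = (%i. nu (A i))" using union(3) by (rule ext)
   then show ?case using signed_measure_sums[OF mu rng union(1)] signed_measure_sums[OF nu rng union(1)] by (simp add: sums_unique2)
  qed
 qed
qed

section \<open>Distribution functions and narrow convergence\<close>

definition tent :: "real => real => real => real" where
 "tent y delta x = max 0 (min 1 ((y + delta - x) / delta))"

lemma tent_cont: "delta > 0 ==> continuous_on UNIV (tent y delta)"
 unfolding tent_def by (intro continuous_intros) auto

lemma tent_bound: "\<bar>tent y delta x\<bar> <= 1" unfolding tent_def by auto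

text \<open>Measured from \<open>y\<close> in units of \<open>delta / m\<close>, the point sits at
  \<open>a\<close>. The step function counts the \<open>k\<close> in \<open>{1..m}\<close> with
  \<open>a <= k\<close>, so only a rounding error of at most one unit arises.\<close>

lemma tent_step:
 assumes delta: "delta > 0" and m: "m >= (1::nat)"
 shows "\<bar>tent y delta x - (\<Sum>k=1..m. (1 / real m) * indicator {..y + real k * delta / real m} x)\<bar> <= 1 / real m"
proof -
 define a where "a = (x - y) * real m / delta"
 have m0: "real m > 0" using m by simp
 have le: "x <= y + real k * delta / real m \<longleftrightarrow> a <= real k" for k
  unfolding a_def using delta m0 by (simp add: field_simps)
 define c where "c = card {k\<in>{1..m}. a <= real k}"
 have "(\<Sum>k=1..m. (1 / real m) * indicator {..y + real k * delta / real m} x) = (\<Sum>k\<in>{k\<in>{1..m}. a <= real k}. 1 / real m)"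
  by (rule sum.mono_neutral_cong_right) (auto simp: le indicator_def)
 then have s: "(\<Sum>k=1..m. (1 / real m) * indicator {..y + real k * delta / real m} x) = real c / real m"
  by (simp add: c_def)
 have t: "tent y delta x = max 0 (min 1 ((real m - a) / real m))"
 proof -
  have "(y + delta - x) / delta = (real m - a) / real m" unfolding a_def using delta m0 by (simp add: field_simps)
  then show ?thesis by (simp add: tent_def)
 qed
 consider "a <= 0" | "a > m" | "0 < a" "a <= m" by linarith
 then show ?thesis
 proof cases
  case 1
  then have "{k\<in>{1..m}. a <= real k} = {1..m}" by auto
  moreover have "1 <= (real m - a) / real m" using 1 m0 by simp
  ultimately show ?thesis unfolding s t using m0 by (simp add: c_def)
 next
  case 2
  then have e: "{k\<in>{1..m}. a <= real k} = {}" by auto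
  have "(real m - a) / real m <= 0" using 2 m0 by (simp add: divide_nonpos_pos)
  moreover have "c = 0" unfolding c_def e by simp
  ultimately show ?thesis unfolding s t using m0 by simp
 next
  case 3
  define j where "j = nat \<lceil>a\<rceil>"
  have j: "a <= real j" "real j < a + 1" "1 <= j" "j <= m" using 3 unfolding j_def by linarith+
  have "{k\<in>{1..m}. a <= real k} = {j..m}"
  proof -
   have "a <= real k \<longleftrightarrow> j <= k" for k unfolding j_def using 3 by (simp add: nat_le_iff ceiling_le_iff)
   then have "{k\<in>{1..m}. a <= real k} = {k\<in>{1..m}. j <= k}" by (simp only:)
   also have "... = {j..m}" using j(3) by auto
   finally show ?thesis .
  qed
  then have c: "real c = real m - real j + 1" using j by (simp add: c_def)
  have "max 0 (min 1 ((real m - a) / real m)) = (real m - a) / real m" using 3 m0 by (simp add: max_def min_def)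
  then have "tent y delta x - real c / real m = (real j - a - 1) / real m" unfolding t c by (simp add: diff_divide_distrib add_divide_distrib)
  then show ?thesis unfolding s using j m0 by (simp add: divide_simps)
 qed
qed

text \<open>
 The tent is an average of indicators of half lines, so that the increments of the distribution
 function suffice here; a bound on the variation of \<open>mu\<close> near \<open>y\<close> is not available.\<close>

lemma tent_estimate:
 assumes mu: "finite_signed_measure mu" and delta: "delta > 0" and w: "!!s. s : {0..delta} ==> \<bar>mu {..y + s} - mu {..y}\<bar> <= w"
 shows "\<bar>signed_integral mu (tent y delta) - mu {..y}\<bar> <= w"
proof -
 have tm: "tent y delta : borel_measurable borel" by (rule borel_measurable_continuous_onI[OF tent_cont[OF delta]])
 have main: "\<bar>signed_integral mu (tent y delta) - mu {..y}\<bar> <= (1 / real m) * tv mu UNIV + w" if m: "m >= 1" for m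
 proof -
  have m0: "real m > 0" using m by simp
  define psi where "psi x = (\<Sum>k=1..m. (1 / real m) * indicator {..y + real k * delta / real m} x)" for x :: real
  have pm: "psi : borel_measurable borel" unfolding psi_def by measurable
  have pb: "\<bar>psi x\<bar> <= 2" for x
  proof -
   have "1 / real m <= 1" using m by simp
   then show ?thesis using tent_step[OF delta m, of y x] tent_bound[of y delta x] unfolding psi_def by linarith
  qed
  have I: "signed_integral mu psi = (\<Sum>k=1..m. (1 / real m) * mu {..y + real k * delta / real m})"
   unfolding psi_def by (rule signed_integral_step[OF mu]) auto
  have "signed_integral mu psi - mu {..y} = (\<Sum>k=1..m. (1 / real m) * (mu {..y + real k * delta / real m} - mu {..y}))"
   unfolding I using m0 by (simp add: right_diff_distrib sum_subtractf)
  also have "\<bar>...\<bar> <= (\<Sum>k=1..m. (1 / real m) * w)"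
  proof (rule order_trans[OF sum_abs sum_mono])
   fix k assume k: "k : {1..m}"
   have "real k * delta / real m : {0..delta}" using k delta m0 by (auto simp: divide_simps)
   then have "\<bar>mu {..y + real k * delta / real m} - mu {..y}\<bar> <= w" by (rule w)
   then show "\<bar>(1 / real m) * (mu {..y + real k * delta / real m} - mu {..y})\<bar> <= (1 / real m) * w"
    using m0 by (simp add: abs_mult divide_right_mono)
  qed
  also have "... = w" using m0 by simp
  finally have 1: "\<bar>signed_integral mu psi - mu {..y}\<bar> <= w" .
  have "\<bar>signed_integral mu (%x. tent y delta x - psi x)\<bar> <= (1 / real m) * tv mu UNIV + (1 / real m) * tv mu (UNIV - UNIV)"
   by (rule signed_integral_bound[OF mu]) (use tm pm tent_step[OF delta m, of y] m0 in \<open>auto simp: psi_def\<close>)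
  then have "\<bar>signed_integral mu (tent y delta) - signed_integral mu psi\<bar> <= (1 / real m) * tv mu UNIV"
   unfolding signed_integral_diff[OF mu tm tent_bound pm pb] by (simp add: tv_def)
  then show ?thesis using 1 by linarith
 qed
 \<comment> \<open>The total variation enters only with the factor \<open>1 / m\<close> and
   disappears in the limit.\<close>
 have "(%m. (1 / real m) * tv mu UNIV + w) ----> 0 * tv mu UNIV + w" by (intro tendsto_intros lim_1_over_n)
 then show ?thesis using main by (intro LIMSEQ_le_const[where X = "%m. (1 / real m) * tv mu UNIV + w"]) (auto intro!: exI[of _ 1])
qed

lemma grid_cell:
 fixes L h x :: real
 assumes h: "h > 0" and m: "real m * h = 2 * L" and x: "-L < x" "x <= L"
 obtains k where "k < m" "!!j. (- L + real j * h < x & x <= - L + real (Suc j) * h) \<longleftrightarrow> j = k"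
proof -
 define q where "q = (x + L) / h"
 have q: "0 < q" "q <= real m"
  unfolding q_def using x h m by (auto simp: field_simps)
 have eq: "(- L + real j * h < x & x <= - L + real (Suc j) * h) \<longleftrightarrow> real j < q & q <= real j + 1" for j
  unfolding q_def using h by (auto simp: field_simps)
 show ?thesis
 proof (rule that[of "nat (\<lceil>q\<rceil> - 1)"])
  show "nat (\<lceil>q\<rceil> - 1) < m" using q by linarith
  show "(- L + real j * h < x & x <= - L + real (Suc j) * h) \<longleftrightarrow> j = nat (\<lceil>q\<rceil> - 1)" for j
   unfolding eq using q by linarith
 qed
qed

section \<open>Narrow convergence from distribution functions\<close>

text \<open>Half-open cells are used because integrals of the step function are then combinations of
  increments of the distribution function.\<close>

lemma step_approx:
 fixes phi :: "real => real"
 assumes phi: "continuous_on UNIV phi" "!!x. \<bar>phi x\<bar> <= B" and L: "L > 0" and e: "e > 0"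
 obtains p :: "nat => real" and m :: nat where
  "!!j. p j <= p (Suc j)"
  "!!x. x : {-L<..L} ==> \<bar>phi x - (\<Sum>j<m. phi (p (Suc j)) * indicator {p j<..p (Suc j)} x)\<bar> <= e"
  "!!x. \<bar>phi x - (\<Sum>j<m. phi (p (Suc j)) * indicator {p j<..p (Suc j)} x)\<bar> <= B + e"
proof -
 have "uniformly_continuous_on {-L..L} phi"
  by (rule compact_uniformly_continuous[OF continuous_on_subset[OF phi(1)]]) auto
 then obtain d where d: "d > 0" "!!x y. x : {-L..L} ==> y : {-L..L} ==> dist y x < d ==> dist (phi y) (phi x) < e"
  using e unfolding uniformly_continuous_on_def by metis
 obtain m :: nat where m: "real m > 2 * L / d" using reals_Archimedean2 by blast
 have m0: "real m > 0" using m L d(1) by (smt (verit) divide_pos_pos)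
 define h where "h = 2 * L / real m"
 have h: "h > 0" "real m * h = 2 * L" "h < d" using L m0 m d(1) by (auto simp: h_def field_simps)
 define p where "p j = - L + real j * h" for j
 have in1: "\<bar>phi x - (\<Sum>j<m. phi (p (Suc j)) * indicator {p j<..p (Suc j)} x)\<bar> <= e" if x: "x : {-L<..L}" for x
 proof -
  obtain k where k: "k < m" "!!j. (- L + real j * h < x & x <= - L + real (Suc j) * h) \<longleftrightarrow> j = k"
   using grid_cell[OF h(1,2), of x] x by auto
  have ind: "indicator {p j<..p (Suc j)} x = (if j = k then 1 else (0::real))" for j
   using k(2)[of j] unfolding p_def indicator_def by auto
  have "(\<Sum>j<m. phi (p (Suc j)) * indicator {p j<..p (Suc j)} x) = phi (p (Suc k))"
   unfolding ind using k(1) by (simp add: if_distrib cong: if_cong)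
  moreover have "dist (phi x) (phi (p (Suc k))) < e"
  proof (rule d(2))
   have kx: "p k < x" "x <= p (Suc k)" using k(2)[of k] by (auto simp: p_def)
   have "real (Suc k) * h <= real m * h" using k(1) h(1) by (intro mult_right_mono) auto
   then have "p (Suc k) <= L" unfolding p_def h(2) by linarith
   then show "p (Suc k) : {-L..L}" using kx x by auto
   have "p (Suc k) = p k + h" by (simp add: p_def algebra_simps)
   then show "dist x (p (Suc k)) < d" using kx h(3) unfolding dist_real_def by linarith
   show "x : {-L..L}" using x by auto
  qed
  ultimately show ?thesis unfolding dist_real_def by linarith
 qed
 show ?thesis
 proof (rule that[of p m, OF _ in1])
  show "p j <= p (Suc j)" for j using h(1) by (simp add: p_def)
  fix x
  have B: "B >= 0" using phi(2)[of 0] by linarith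
  show "\<bar>phi x - (\<Sum>j<m. phi (p (Suc j)) * indicator {p j<..p (Suc j)} x)\<bar> <= B + e"
  proof (cases "x : {-L<..L}")
   case True
   then show ?thesis using in1[OF True] B by linarith
  next
   case False
   have "(\<Sum>j<m. phi (p (Suc j)) * indicator {p j<..p (Suc j)} x) = 0"
   proof (rule sum.neutral, rule ballI)
    fix j assume "j : {..<m}"
    then have "real (Suc j) * h <= real m * h" using h(1) by (intro mult_right_mono) auto
    then have "p (Suc j) <= L" unfolding p_def h(2) by linarith
    moreover have "p j >= - L" using h(1) by (simp add: p_def)
    ultimately have "x \<notin> {p j<..p (Suc j)}" using False by auto
    then show "phi (p (Suc j)) * indicator {p j<..p (Suc j)} x = 0" by simp
   qed
   then show ?thesis using phi(2)[of x] e by simp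
  qed
 qed
qed

lemma tv_tail:
 assumes mu: "finite_signed_measure mu" and e: "e > 0"
 shows "\<exists>R>0. tv mu (UNIV - {-R..R}) < e"
proof -
 have m: "(%n. measure P (UNIV - {- real n..real n})) ----> 0" if "finite_borel_measure P" for P
 proof -
  interpret finite_borel_measure P by fact
  have "(%n. measure P (UNIV - {- real n..real n})) ----> measure P (\<Inter>n. UNIV - {- real n..real n})"
   by (rule finite_Lim_measure_decseq) (auto simp: decseq_def)
  moreover have "(\<Inter>n. UNIV - {- real n..real n}) = {}"
  proof -
   have "\<exists>n. x : {- real n..real n}" for x
   proof -
    obtain n where "\<bar>x\<bar> <= real n" using real_arch_simple by blast
    then show ?thesis by (intro exI[of _ n]) auto
   qed
   then show ?thesis by blast
  qed
  ultimately show ?thesis by (simp only: measure_empty)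
 qed
 have "(%n. tv mu (UNIV - {- real n..real n})) ----> 0 + 0"
  unfolding tv_def by (intro tendsto_add m finite_pos_variation finite_neg_variation mu)
 then have "eventually (%n. tv mu (UNIV - {- real n..real n}) < e) sequentially"
  using e by (intro order_tendstoD) auto
 then have "eventually (%n. tv mu (UNIV - {- real n..real n}) < e & n >= 1) sequentially"
  using eventually_ge_at_top by (rule eventually_conj)
 then obtain n where "tv mu (UNIV - {- real n..real n}) < e" "n >= 1" by (auto simp: eventually_sequentially)
 then show ?thesis by (intro exI[of _ "real n"]) auto
qed

lemma tv_mono:
 assumes mu: "finite_signed_measure mu" and "A \<subseteq> B" "A : sets borel" "B : sets borel"
 shows "tv mu A <= tv mu B"
proof -
 interpret P: finite_borel_measure "pos_variation mu" by (rule finite_pos_variation[OF mu])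
 interpret N: finite_borel_measure "neg_variation mu" by (rule finite_neg_variation[OF mu])
 show ?thesis unfolding tv_def using assms(2-) by (intro add_mono P.finite_measure_mono N.finite_measure_mono) auto
qed

text \<open>Step functions reduce the integrals to finitely many values of the distribution
  functions. Of five shares of \<open>e\<close>, each of the two measures takes two, for the
  interior error and for the tail, and the values at the grid points take one.\<close>

lemma narrow_conv_from_cdf:
 assumes fs: "!!n. n >= 2 ==> finite_signed_measure (mus n)" and mu: "finite_signed_measure mu"
  and C: "!!n. n >= 2 ==> tv (mus n) UNIV <= C"
  and tight: "!!e. e > 0 ==> \<exists>R>0. \<forall>n\<ge>2. tv (mus n) (UNIV - {-R..R}) <= e"
  and cdf: "!!y. (%n. mus n {..y}) ----> mu {..y}"
 shows "narrow_conv mus mu"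
 unfolding narrow_conv_def
proof (intro allI impI)
 fix phi :: "real => real" assume phi: "continuous_on UNIV phi & bounded (range phi)"
 then obtain B where B: "!!x. \<bar>phi x\<bar> <= B" by (auto simp: bounded_iff)
 have B0: "B >= 0" using B[of 0] by linarith
 have phim: "phi : borel_measurable borel" using phi by (intro borel_measurable_continuous_onI) simp
 define C' where "C' = \<bar>C\<bar> + tv mu UNIV + 1"
 have tv0: "tv mu UNIV >= 0" by (simp add: tv_def)
 have C'0: "C' > 0" using tv0 by (simp add: C'_def)
 show "(%n. signed_integral (mus n) phi) ----> signed_integral mu phi"
 proof (rule tendstoI)
  fix e :: real assume e: "e > 0"
  define e1 where "e1 = e / (5 * C')"
  define e2 where "e2 = e / 5 / (B + e1)"
  have e1: "e1 > 0" using e C'0 by (simp add: e1_def)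
  have e2: "e2 > 0" unfolding e2_def using e e1 B0 by (intro divide_pos_pos) auto
  obtain R1 where R1: "R1 > 0" "!!n. n >= 2 ==> tv (mus n) (UNIV - {-R1..R1}) <= e2" using tight[OF e2] by blast
  obtain R2 where R2: "R2 > 0" "tv mu (UNIV - {-R2..R2}) < e2" using tv_tail[OF mu e2] by blast
  define L where "L = R1 + R2"
  have L: "L > 0" "L > R1" "L > R2" using R1 R2 by (auto simp: L_def)
  obtain p m where p: "!!j. p j <= p (Suc j)"
   "!!x. x : {-L<..L} ==> \<bar>phi x - (\<Sum>j<m. phi (p (Suc j)) * indicator {p j<..p (Suc j)} x)\<bar> <= e1"
   "!!x. \<bar>phi x - (\<Sum>j<m. phi (p (Suc j)) * indicator {p j<..p (Suc j)} x)\<bar> <= B + e1"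
   by (rule step_approx[OF conjunct1[OF phi] B L(1) e1]) (rule that)
  define psi where "psi x = (\<Sum>j<m. phi (p (Suc j)) * indicator {p j<..p (Suc j)} x)" for x
  have psim: "psi : borel_measurable borel" unfolding psi_def by measurable
  have psib: "\<bar>psi x\<bar> <= B + (B + e1)" for x using p(3)[of x] B[of x] unfolding psi_def by linarith
  have approx: "\<bar>signed_integral nu phi - signed_integral nu psi\<bar> <= 2 * e / 5"
   if nu: "finite_signed_measure nu" and tvC: "tv nu UNIV <= C'" and R: "0 < R" "R < L" "tv nu (UNIV - {-R..R}) <= e2" for nu R
  proof -
   have "\<bar>signed_integral nu (%x. phi x - psi x)\<bar> <= e1 * tv nu UNIV + (B + e1) * tv nu (UNIV - {-L<..L})"
    by (rule signed_integral_bound[OF nu borel_measurable_diff[OF phim psim] _ p(2)[folded psi_def] p(3)[folded psi_def]]) (use e1 in auto)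
   also have "e1 * tv nu UNIV <= e1 * C'" using tvC e1 by (intro mult_left_mono) auto
   also have "tv nu (UNIV - {-L<..L}) <= tv nu (UNIV - {-R..R})" by (rule tv_mono[OF nu]) (use R in auto)
   also have "... <= e2" by fact
   finally have "\<bar>signed_integral nu (%x. phi x - psi x)\<bar> <= e1 * C' + (B + e1) * e2"
    using B0 e1 by (simp add: mult_left_mono)
   moreover have "e1 * C' = e / 5" using C'0 by (simp add: e1_def)
   moreover have "(B + e1) * e2 = e / 5"
    unfolding e2_def by (subst times_divide_eq_right, rule nonzero_mult_div_cancel_left) (use B0 e1 in simp)
   ultimately show ?thesis unfolding signed_integral_diff[OF nu phim B psim psib] by linarith
  qed
  have step: "signed_integral nu psi = (\<Sum>j<m. phi (p (Suc j)) * (nu {..p (Suc j)} - nu {..p j}))" if nu: "finite_signed_measure nu" for nu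
   unfolding psi_def signed_measure_Ioc[OF nu p(1), symmetric] by (rule signed_integral_step[OF nu]) auto
  have "(%n. \<Sum>j<m. phi (p (Suc j)) * (mus n {..p (Suc j)} - mus n {..p j})) ----> signed_integral mu psi"
   unfolding step[OF mu] by (intro tendsto_intros cdf)
  then have "eventually (%n. dist (\<Sum>j<m. phi (p (Suc j)) * (mus n {..p (Suc j)} - mus n {..p j})) (signed_integral mu psi) < e / 5) sequentially"
   using e by (intro tendstoD) auto
  then show "eventually (%n. dist (signed_integral (mus n) phi) (signed_integral mu phi) < e) sequentially"
   using eventually_ge_at_top[of 2]
  proof eventually_elim
   case (elim n)
   have "\<bar>signed_integral (mus n) phi - signed_integral (mus n) psi\<bar> <= 2 * e / 5"
    by (rule approx[OF fs[OF elim(2)] _ R1(1) L(2) R1(2)[OF elim(2)]]) (use C[OF elim(2)] tv0 in \<open>simp add: C'_def\<close>)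
   moreover have "\<bar>signed_integral mu phi - signed_integral mu psi\<bar> <= 2 * e / 5"
    by (rule approx[OF mu _ R2(1) L(3)]) (use R2(2) tv0 in \<open>simp_all add: C'_def\<close>)
   moreover have "\<bar>signed_integral (mus n) psi - signed_integral mu psi\<bar> < e / 5"
    using elim(1) unfolding step[OF fs[OF elim(2)]] dist_real_def .
   ultimately show ?case unfolding dist_real_def by linarith
  qed
 qed
qed

section \<open>Distribution functions under strong narrow convergence\<close>

text \<open>One-sided limits are read off from the Jordan decomposition, and the absence of atoms
  identifies the left one. The summand 1 in \<open>tv mu UNIV + 1\<close> provides
  \<open>M >= 1\<close>.\<close>

lemma signed_measure_datum:
 assumes mu: "finite_signed_measure mu" and atom: "!!x. mu {x} = 0"
 obtains M where "M >= 1" "datum M (%x. mu {..x})" "((%x. mu {..x}) \<longlongrightarrow> 0) at_bot"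
proof -
 interpret P: finite_borel_measure "pos_variation mu" by (rule finite_pos_variation[OF mu])
 interpret N: finite_borel_measure "neg_variation mu" by (rule finite_neg_variation[OF mu])
 have eq: "mu {..x} = cdf (pos_variation mu) x - cdf (neg_variation mu) x" for x
  unfolding cdf_def2 by (rule jordan_decomposition[OF mu]) simp
 have bot: "((%x. mu {..x}) \<longlongrightarrow> 0 - 0) at_bot"
  unfolding eq by (intro tendsto_diff P.cdf_lim_at_bot N.cdf_lim_at_bot)
 have top: "\<exists>l. ((%x. mu {..x}) \<longlongrightarrow> l) at_top"
  unfolding eq using tendsto_diff[OF P.cdf_lim_at_top N.cdf_lim_at_top] by (rule exI)
 have cont: "continuous_on UNIV (%x. mu {..x})"
  unfolding continuous_on_eq_continuous_at[OF open_UNIV]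
 proof
  fix x :: real
  have "((%x. mu {..x}) \<longlongrightarrow> mu {..x}) (at_right x)"
   using tendsto_diff[OF P.cdf_is_right_cont[of x, unfolded continuous_within] N.cdf_is_right_cont[of x, unfolded continuous_within]]
   unfolding eq .
  moreover have "((%x. mu {..x}) \<longlongrightarrow> mu {..x}) (at_left x)"
  proof -
   have "((%x. mu {..x}) \<longlongrightarrow> measure (pos_variation mu) {..<x} - measure (neg_variation mu) {..<x}) (at_left x)"
    unfolding eq by (intro tendsto_diff P.cdf_at_left N.cdf_at_left)
   moreover have "measure (pos_variation mu) {..<x} - measure (neg_variation mu) {..<x} = mu {..<x}"
    by (rule jordan_decomposition[OF mu, symmetric]) simp
   moreover have "mu ({..<x} \<union> {x}) = mu {..<x} + mu {x}" by (rule signed_measure_union[OF mu]) auto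
   moreover have "{..<x} \<union> {x} = {..x}" by auto
   ultimately show ?thesis using atom[of x] by simp
  qed
  ultimately show "isCont (%x. mu {..x}) x" unfolding isCont_def by (rule filterlim_split_at[rotated])
 qed
 have bd: "\<bar>mu {..x}\<bar> <= tv mu UNIV + 1" for x using abs_le_tv[OF mu, of UNIV "{..x}"] by simp
 have "tv mu UNIV >= 0" by (simp add: tv_def)
 then show ?thesis
  using bot top cont bd by (intro that[of "tv mu UNIV + 1"]) (auto simp: datum_def)
qed

text \<open>For signed measures narrow convergence does not imply this, even at points of
  continuity: opposite masses may approach each other there. The bound \<open>s n + omega\<close> on
  increments excludes it and controls the comparison with a tent.\<close>

lemma strong_narrow_cdf:
 assumes sn: "strong_narrow_conv_with s omega mus mu" and fs: "!!n. n >= 2 ==> finite_signed_measure (mus n)"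
  and mu: "finite_signed_measure mu" and cont: "isCont (%x. mu {..x}) y"
 shows "(%n. mus n {..y}) ----> mu {..y}"
proof (rule tendstoI)
 fix e :: real assume e: "e > 0"
 have nc: "narrow_conv mus mu" and s: "s ----> 0" and omega: "mono_on {0..} omega" "(omega \<longlongrightarrow> 0) (at_right 0)" "omega 0 = 0"
  and inc: "!!n x y. n >= 2 ==> x <= y ==> \<bar>mus n {x<..y}\<bar> <= s n + omega \<bar>x - y\<bar>"
  using sn unfolding strong_narrow_conv_with_def modulus_of_continuity_def by blast+
 have "eventually (%r. omega r < e / 5) (at_right 0)" using omega(2) e by (intro order_tendstoD) auto
 then obtain d1 where d1: "d1 > 0" "!!r. 0 < r ==> r < d1 ==> omega r < e / 5"
  unfolding eventually_at_right_field by blast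
 obtain d2 where d2: "d2 > 0" "!!x. dist x y < d2 ==> dist (mu {..x}) (mu {..y}) < e / 5"
  using cont e unfolding continuous_at_eps_delta by (metis divide_pos_pos zero_less_numeral)
 define delta where "delta = min d1 d2 / 2"
 have delta: "delta > 0" "delta < d1" "delta < d2" using d1(1) d2(1) by (auto simp: delta_def)
 have tmu: "\<bar>signed_integral mu (tent y delta) - mu {..y}\<bar> <= e / 5"
 proof (rule tent_estimate[OF mu delta(1)])
  fix r assume r: "r : {0..delta}"
  then have "dist (y + r) y < d2" using delta(3) by (simp add: dist_real_def)
  then show "\<bar>mu {..y + r} - mu {..y}\<bar> <= e / 5" using d2(2)[of "y + r"] by (simp add: dist_real_def)
 qed
 have tn: "\<bar>signed_integral (mus n) (tent y delta) - mus n {..y}\<bar> <= s n + e / 5" if n: "n >= 2" for n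
 proof (rule tent_estimate[OF fs[OF n] delta(1)])
  fix r assume r: "r : {0..delta}"
  have "\<bar>mus n {y<..y + r}\<bar> <= s n + omega \<bar>y - (y + r)\<bar>" using r by (intro inc[OF n]) auto
  also have "omega \<bar>y - (y + r)\<bar> <= omega delta" using r by (intro mono_onD[OF omega(1)]) auto
  also have "omega delta <= e / 5" using d1(2)[of delta] delta by simp
  finally show "\<bar>mus n {..y + r} - mus n {..y}\<bar> <= s n + e / 5"
   using signed_measure_Ioc[OF fs[OF n], of y "y + r"] r by simp
 qed
 have "(%n. signed_integral (mus n) (tent y delta)) ----> signed_integral mu (tent y delta)"
 proof -
  have "bounded (range (tent y delta))" using tent_bound[of y delta] by (auto simp: bounded_iff)
  then show ?thesis using nc tent_cont[OF delta(1), of y] unfolding narrow_conv_def by blast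
 qed
 then have "eventually (%n. dist (signed_integral (mus n) (tent y delta)) (signed_integral mu (tent y delta)) < e / 5) sequentially"
  using e by (intro tendstoD) auto
 moreover have "eventually (%n. dist (s n) 0 < e / 5) sequentially" using s e by (intro tendstoD) auto
 ultimately show "eventually (%n. dist (mus n {..y}) (mu {..y}) < e) sequentially"
  using eventually_ge_at_top[of 2]
 proof eventually_elim
  case (elim n)
  then show ?case using tmu tn[OF elim(3)] unfolding dist_real_def by linarith
 qed
qed

text \<open>Pointwise convergence on a grid, bounds on increments inside the cells, tightness
  outside. The worst case is the right tail: \<open>4 * q\<close> at \<open>R\<close>,
  \<open>q\<close> for the mass beyond it and \<open>2 * q\<close> for the limit.\<close>

lemma strong_narrow_cdf_uniform:
 assumes sn: "strong_narrow_conv_with s omega mus mu" and fs: "!!n. n >= 2 ==> finite_signed_measure (mus n)"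
  and mu: "finite_signed_measure mu" and dat: "datum M (%x. mu {..x})" and bot: "((%x. mu {..x}) \<longlongrightarrow> 0) at_bot"
  and e: "e > 0"
 shows "\<exists>N. \<forall>n\<ge>N. \<forall>y. \<bar>mus n {..y} - mu {..y}\<bar> <= e"
proof -
 define q where "q = e / 8"
 have q: "q > 0" using e by (simp add: q_def)
 have tight: "tight_seq mus" and s: "s ----> 0" and omega: "mono_on {0..} omega" "(omega \<longlongrightarrow> 0) (at_right 0)"
  and inc: "!!n x y. n >= 2 ==> x <= y ==> \<bar>mus n {x<..y}\<bar> <= s n + omega \<bar>x - y\<bar>"
  using sn unfolding strong_narrow_conv_with_def modulus_of_continuity_def by blast+
 have contU: "continuous_on UNIV (%x. mu {..x})" using dat by (simp add: datum_def)
 have pw: "(%n. mus n {..y}) ----> mu {..y}" for y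
  by (rule strong_narrow_cdf[OF sn fs mu]) (use contU in \<open>auto simp: continuous_on_eq_continuous_at\<close>)
 obtain R0 where R0: "!!n. n >= 2 ==> total_variation (mus n) (UNIV - {-R0..R0}) < ennreal q"
  using tight q unfolding tight_seq_def by blast
 obtain l0 l1 where l: "!!e. e > 0 ==> \<exists>R>0. (\<forall>x\<le>-R. \<bar>mu {..x} - l0\<bar> <= e) & (\<forall>x\<ge>R. \<bar>mu {..x} - l1\<bar> <= e)"
  using datum_ends[OF dat] by blast
 obtain R1 where R1: "!!x. x >= R1 ==> \<bar>mu {..x} - l1\<bar> <= q" using l[OF q] by blast
 have "eventually (%x. dist (mu {..x}) 0 < q) at_bot" using bot q by (intro tendstoD) auto
 then obtain R2 where R2: "!!x. x <= R2 ==> \<bar>mu {..x}\<bar> < q" unfolding eventually_at_bot_linorder dist_real_def by auto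
 define R where "R = \<bar>R0\<bar> + \<bar>R1\<bar> + \<bar>R2\<bar> + 1"
 have R: "R > 0" "R >= R0" "R >= R1" "- R <= R2" by (auto simp: R_def)
 have tail: "tv (mus n) (UNIV - {-R..R}) <= q" if n: "n >= 2" for n
 proof -
  have "tv (mus n) (UNIV - {-R..R}) <= tv (mus n) (UNIV - {-R0..R0})"
   by (rule tv_mono[OF fs[OF n]]) (use R(2) in auto)
  also have "... <= q"
  proof -
   have "ennreal (tv (mus n) (UNIV - {-R0..R0})) <= ennreal q"
    using R0[OF n] total_variation_eq[OF fs[OF n], of "UNIV - {-R0..R0}"] by simp
   then show ?thesis using q by (simp add: ennreal_le_iff)
  qed
  finally show ?thesis .
 qed
 have "eventually (%r. omega r < q) (at_right 0)" using omega(2) q by (intro order_tendstoD) auto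
 then obtain d1 where d1: "d1 > 0" "!!r. 0 < r ==> r < d1 ==> omega r < q"
  unfolding eventually_at_right_field by blast
 obtain d2 where d2: "d2 > 0" "!!x y. \<bar>x - y\<bar> <= d2 ==> \<bar>mu {..x} - mu {..y}\<bar> <= q" by (rule datum_uniform[OF dat q]) (rule that)
 define delta where "delta = min d1 d2 / 2"
 have delta: "delta > 0" "delta < d1" "delta <= d2" using d1(1) d2(1) by (auto simp: delta_def)
 obtain m :: nat where m: "real m * delta > 2 * R" using delta(1) reals_Archimedean3 by blast
 define p where "p k = - R + real k * delta" for k
 have ev: "eventually (%n. \<forall>k\<in>{..m}. dist (mus n {..p k}) (mu {..p k}) < q) sequentially"
  by (rule eventually_ball_finite) (use pw q in \<open>auto intro: tendstoD\<close>)
 have "eventually (%n. dist (s n) 0 < q) sequentially" using s q by (intro tendstoD) auto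
 then have "eventually (%n. (\<forall>k\<in>{..m}. dist (mus n {..p k}) (mu {..p k}) < q) & dist (s n) 0 < q & n >= 2) sequentially"
  using ev eventually_ge_at_top[of 2] by eventually_elim blast
 then obtain N where N: "!!n. n >= N ==> (\<forall>k\<in>{..m}. dist (mus n {..p k}) (mu {..p k}) < q) & dist (s n) 0 < q & n >= 2"
  unfolding eventually_sequentially by blast
 show ?thesis
 proof (intro exI[of _ N] allI impI)
  fix n y assume "n >= N"
  note Nn = N[OF this]
  have n: "n >= 2" using Nn by blast
  have sq: "s n < q" using Nn unfolding dist_real_def by auto
  have mid: "\<bar>mus n {..y} - mu {..y}\<bar> <= 4 * q" if y: "- R <= y" "y <= R" for y
  proof -
   define k where "k = nat \<lfloor>(y + R) / delta\<rfloor>"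
   have nn: "(y + R) / delta >= 0" using y delta(1) by simp
   have k: "real k <= (y + R) / delta" "(y + R) / delta < real k + 1" using nn unfolding k_def by linarith+
   have k': "real k * delta <= y + R" "y + R < (real k + 1) * delta" using k delta(1) by (simp_all add: field_simps)
   have pk: "p k <= y" "y < p k + delta" using k' by (auto simp: p_def algebra_simps)
   have "real k * delta < real m * delta" using k'(1) y(2) m by linarith
   then have km: "k : {..m}" using delta(1) by simp
   have "\<bar>mus n {p k<..y}\<bar> <= s n + omega \<bar>p k - y\<bar>" by (rule inc[OF n pk(1)])
   also have "omega \<bar>p k - y\<bar> <= omega delta" using pk by (intro mono_onD[OF omega(1)]) auto
   also have "omega delta < q" using d1(2) delta by blast
   finally have 1: "\<bar>mus n {..y} - mus n {..p k}\<bar> <= 2 * q" using signed_measure_Ioc[OF fs[OF n] pk(1)] sq by simp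
   have 2: "\<bar>mu {..p k} - mu {..y}\<bar> <= q" using pk delta(3) by (intro d2(2)) auto
   have 3: "\<bar>mus n {..p k} - mu {..p k}\<bar> < q" using Nn km unfolding dist_real_def by blast
   show ?thesis using 1 2 3 by linarith
  qed
  have "\<bar>mus n {..y} - mu {..y}\<bar> <= 8 * q"
  proof -
   consider "y < - R" | "- R <= y" "y <= R" | "y > R" by linarith
   then show ?thesis
   proof cases
    case 1
    have "\<bar>mus n {..y}\<bar> <= tv (mus n) (UNIV - {-R..R})" using 1 by (intro abs_le_tv[OF fs[OF n]]) auto
    moreover have "\<bar>mu {..y}\<bar> < q" using R2[of y] 1 R(4) by linarith
    ultimately show ?thesis using tail[OF n] q by linarith
   next
    case 2
    then show ?thesis using mid[OF 2] q by linarith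
   next
    case 3
    have "\<bar>mus n {R<..y}\<bar> <= tv (mus n) (UNIV - {-R..R})" using R(1) by (intro abs_le_tv[OF fs[OF n]]) auto
    then have "\<bar>mus n {..y} - mus n {..R}\<bar> <= q" using signed_measure_Ioc[OF fs[OF n], of R y] 3 tail[OF n] by simp
    moreover have "\<bar>mu {..y} - l1\<bar> <= q" "\<bar>mu {..R} - l1\<bar> <= q" using R1 R(3) 3 by auto
    moreover have "\<bar>mus n {..R} - mu {..R}\<bar> <= 4 * q" using R(1) by (intro mid) auto
    ultimately show ?thesis using q by linarith
   qed
  qed
  then show "\<bar>mus n {..y} - mu {..y}\<bar> <= e" by (simp add: q_def)
 qed
qed

section \<open>Signed measures with a prescribed distribution function\<close>

lemma signed_measure_of_difference:
 assumes P: "finite_borel_measure P" and Q: "finite_borel_measure Q"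
 shows "finite_signed_measure (%A. if A : sets borel then measure P A - measure Q A else 0)"
 unfolding finite_signed_measure_def
proof (intro conjI allI impI)
 interpret P: finite_borel_measure P by fact
 interpret Q: finite_borel_measure Q by fact
 fix A :: "nat => real set" assume A: "range A \<subseteq> sets borel & disjoint_family A"
 then have "(%i. measure P (A i) - measure Q (A i)) sums (measure P (\<Union>i. A i) - measure Q (\<Union>i. A i))"
  by (intro sums_diff P.finite_measure_UNION Q.finite_measure_UNION) (auto simp: P.M_is_borel Q.M_is_borel)
 moreover have "A i : sets borel" for i using A by auto
 moreover from this have "(\<Union>i. A i) : sets borel" by auto
 ultimately show "(%i. if A i : sets borel then measure P (A i) - measure Q (A i) else 0) sums
   (if (\<Union>i. A i) : sets borel then measure P (\<Union>i. A i) - measure Q (\<Union>i. A i) else 0)" by simp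
qed auto

lemma finite_interval_measure:
 assumes m: "mono F" and rc: "!!x. continuous (at_right x) F" and b: "!!x. \<bar>F x\<bar> <= (B::real)"
 shows "finite_borel_measure (interval_measure F)"
proof -
 have le: "emeasure (interval_measure F) {- real n<..real n} <= ennreal (2 * B)" for n
 proof -
  have "emeasure (interval_measure F) {- real n<..real n} = ennreal (F (real n) - F (- real n))"
   using m rc by (intro emeasure_interval_measure_Ioc) (auto simp: mono_def)
  also have "... <= ennreal (2 * B)" using b[of "real n"] b[of "- real n"] by (intro ennreal_leI) linarith
  finally show ?thesis .
 qed
 have "emeasure (interval_measure F) (\<Union>n. {- real n<..real n}) = (SUP n. emeasure (interval_measure F) {- real n<..real n})"
  by (rule SUP_emeasure_incseq[symmetric]) (auto simp: incseq_def)
 also have "... <= ennreal (2 * B)" by (intro SUP_least le)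
 finally have "emeasure (interval_measure F) UNIV <= ennreal (2 * B)" unfolding UN_Ioc_eq_UNIV .
 then have "emeasure (interval_measure F) (space (interval_measure F)) ~= \<infinity>" by (auto simp: top_unique)
 then show ?thesis
  by (intro finite_borel_measure.intro finite_measureI) (auto simp: finite_borel_measure_axioms_def)
qed

lemma right_continuous_eqI:
 fixes f g :: "real => real"
 assumes f: "continuous (at_right x) f" and g: "continuous (at_right x) g" and D: "countable D"
  and eq: "!!y. y \<notin> D ==> f y = g y"
 shows "f x = g x"
proof (rule ccontr)
 assume ne: "f x ~= g x"
 have "((%y. f y - g y) \<longlongrightarrow> f x - g x) (at_right x)" using f g by (intro tendsto_diff) (auto simp: continuous_within)
 then have "eventually (%y. dist (f y - g y) (f x - g x) < \<bar>f x - g x\<bar>) (at_right x)" using ne by (intro tendstoD) auto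
 then obtain b where b: "b > x" "!!y. x < y ==> y < b ==> dist (f y - g y) (f x - g x) < \<bar>f x - g x\<bar>"
  unfolding eventually_at_right_field by auto
 have "\<exists>y\<in>{x<..<b}. y \<notin> D" using b(1) D by (intro open_minus_countable) auto
 then obtain y where y: "y : {x<..<b}" "y \<notin> D" by blast
 then show False using b(2)[of y] eq[OF y(2)] by (simp add: dist_real_def)
qed

text \<open>The selection theorem applies to the two variations separately, their distribution
  functions being monotone and bounded. Mass may escape to minus infinity, so the measures built
  from \<open>F\<close> and \<open>G\<close> reproduce \<open>V\<close> at first only in its
  increments; the limit 0 of \<open>V\<close> there fixes the constant.\<close>

lemma helly_signed_measure:
 assumes fs: "!!n. finite_signed_measure (mus n)" and C: "!!n. tv (mus n) UNIV <= C"
  and lim: "!!y. (%n. mus n {..y}) ----> V y" and V: "continuous_on UNIV V" "(V \<longlongrightarrow> 0) at_bot"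
 obtains mu where "finite_signed_measure mu" "!!y. mu {..y} = V y"
proof -
 define f where "f n = cdf (pos_variation (mus n))" for n
 define g where "g n = cdf (neg_variation (mus n))" for n
 have tvle: "measure (pos_variation (mus n)) UNIV <= C" "measure (neg_variation (mus n)) UNIV <= C" for n
  using C[of n] measure_nonneg[of "pos_variation (mus n)" UNIV] measure_nonneg[of "neg_variation (mus n)" UNIV] unfolding tv_def by linarith+
 have f: "continuous (at_right x) (f n)" "mono (f n)" "\<bar>f n x\<bar> <= C" for n x
 proof -
  interpret finite_borel_measure "pos_variation (mus n)" by (rule finite_pos_variation[OF fs])
  show "continuous (at_right x) (f n)" "mono (f n)" unfolding f_def by (auto intro: cdf_is_right_cont cdf_nondecreasing monoI)
  show "\<bar>f n x\<bar> <= C" using cdf_nonneg[of x] cdf_bounded[of x] tvle(1)[of n] unfolding f_def by simp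
 qed
 have g: "continuous (at_right x) (g n)" "mono (g n)" "\<bar>g n x\<bar> <= C" for n x
 proof -
  interpret finite_borel_measure "neg_variation (mus n)" by (rule finite_neg_variation[OF fs])
  show "continuous (at_right x) (g n)" "mono (g n)" unfolding g_def by (auto intro: cdf_is_right_cont cdf_nondecreasing monoI)
  show "\<bar>g n x\<bar> <= C" using cdf_nonneg[of x] cdf_bounded[of x] tvle(2)[of n] unfolding g_def by simp
 qed
 have fg: "mus n {..y} = f n y - g n y" for n y
  unfolding f_def g_def cdf_def2 by (rule jordan_decomposition[OF fs]) simp
 obtain r1 F where r1: "strict_mono r1" and F: "!!x. continuous (at_right x) F" "mono F" "!!x. \<bar>F x\<bar> <= C"
  "!!x. isCont F x ==> (%n. f (r1 n) x) ----> F x"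
  using Helly_selection[of f C, OF f] by blast
 obtain r2 G where r2: "strict_mono r2" and G: "!!x. continuous (at_right x) G" "mono G" "!!x. \<bar>G x\<bar> <= C"
  "!!x. isCont G x ==> (%n. g (r1 (r2 n)) x) ----> G x"
  using Helly_selection[of "%n. g (r1 n)" C, OF g] by blast
 have VFG: "V x = F x - G x" for x
 proof (rule right_continuous_eqI[where f = V and g = "%x. F x - G x"])
  show "continuous (at_right x) V" using V(1) by (auto simp: continuous_on_eq_continuous_at intro: continuous_at_imp_continuous_within)
  show "continuous (at_right x) (%x. F x - G x)" by (intro continuous_diff F G)
  show "countable ({a. ~ isCont F a} \<union> {a. ~ isCont G a})"
   using mono_ctble_discont[OF F(2)] mono_ctble_discont[OF G(2)] by simp
  fix y assume "y \<notin> {a. ~ isCont F a} \<union> {a. ~ isCont G a}"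
  then have c: "isCont F y" "isCont G y" by auto
  have "(%n. f (r1 (r2 n)) y) ----> F y" using LIMSEQ_subseq_LIMSEQ[OF F(4)[OF c(1)] r2] by (simp add: o_def)
  then have "(%n. mus (r1 (r2 n)) {..y}) ----> F y - G y" unfolding fg by (intro tendsto_diff G(4) c)
  moreover have "(%n. mus (r1 (r2 n)) {..y}) ----> V y"
   using LIMSEQ_subseq_LIMSEQ[OF LIMSEQ_subseq_LIMSEQ[OF lim[of y] r1] r2] by (simp add: o_def)
  ultimately show "V y = F y - G y" by (rule LIMSEQ_unique[rotated])
 qed
 define P where "P = interval_measure F"
 define Q where "Q = interval_measure G"
 interpret P: finite_borel_measure P unfolding P_def by (rule finite_interval_measure[OF F(2,1,3)])
 interpret Q: finite_borel_measure Q unfolding Q_def by (rule finite_interval_measure[OF G(2,1,3)])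
 have "measure P {..y} - measure Q {..y} = V y" for y
 proof -
  have "cdf P y - cdf P x - (cdf Q y - cdf Q x) = V y - V x" if "x < y" for x
   using P.cdf_diff_eq[OF that] Q.cdf_diff_eq[OF that] measure_interval_measure_Ioc[of x y F] measure_interval_measure_Ioc[of x y G]
    that F(1,2) G(1,2) unfolding P_def Q_def VFG by (simp add: mono_def)
  then have "eventually (%x. V y - V x = cdf P y - cdf P x - (cdf Q y - cdf Q x)) at_bot"
   using eventually_gt_at_bot[of y] by (auto simp: eventually_at_bot_dense intro!: exI[of _ y])
  moreover have "((%x. V y - V x) \<longlongrightarrow> V y - 0) at_bot" by (intro tendsto_intros V)
  ultimately have "((%x. cdf P y - cdf P x - (cdf Q y - cdf Q x)) \<longlongrightarrow> V y - 0) at_bot" by (rule Lim_transform_eventually[rotated])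
  moreover have "((%x. cdf P y - cdf P x - (cdf Q y - cdf Q x)) \<longlongrightarrow> cdf P y - 0 - (cdf Q y - 0)) at_bot"
   by (intro tendsto_intros P.cdf_lim_at_bot Q.cdf_lim_at_bot)
  ultimately have "V y - 0 = cdf P y - 0 - (cdf Q y - 0)" by (intro tendsto_unique[of at_bot]) auto
  then show ?thesis by (simp add: cdf_def2)
 qed
 then show ?thesis
  by (intro that[OF signed_measure_of_difference[OF P.finite_borel_measure_axioms Q.finite_borel_measure_axioms]]) simp
qed

text \<open>Trades a threshold for each \<open>e\<close> for one null sequence valid from
  \<open>n0\<close> on. The bound \<open>C\<close> makes the suprema finite for early indices, and
  the inserted 0 makes them nonnegative.\<close>

lemma sup_sequence:
 fixes f :: "nat => 'a => real"
 assumes b: "!!n p. n >= n0 ==> p : S ==> \<bar>f n p\<bar> <= C"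
  and u: "!!e. e > 0 ==> \<exists>N. \<forall>n\<ge>N. \<forall>p\<in>S. \<bar>f n p\<bar> <= e"
 obtains sig where "sig ----> 0" "!!n. sig n >= (0::real)" "!!n p. n >= n0 ==> p : S ==> \<bar>f n p\<bar> <= sig n"
proof -
 define sig where "sig n = (SUP y\<in>insert 0 ((%p. \<bar>f n p\<bar>) ` S). y)" for n
 have bdd: "bdd_above (insert 0 ((%p. \<bar>f n p\<bar>) ` S))" if "n >= n0" for n
  using b[OF that] by (auto intro!: bdd_aboveI[of _ "max 0 C"] simp: le_max_iff_disj)
 have up: "y <= sig n" if "y : insert 0 ((%p. \<bar>f n p\<bar>) ` S)" "n >= n0" for y n
  unfolding sig_def using cSUP_upper[of y _ "%y. y", OF that(1)] bdd[OF that(2)] by simp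
 define sig' where "sig' n = (if n >= n0 then sig n else 0)" for n
 show ?thesis
 proof (rule that[of sig'])
  show "sig' ----> 0"
  proof (rule LIMSEQ_I)
   fix e :: real assume e: "e > 0"
   obtain N where N: "!!n p. n >= N ==> p : S ==> \<bar>f n p\<bar> <= e / 2" using u[of "e / 2"] e by auto
   have "norm (sig' n - 0) < e" if n: "n >= N + n0" for n
   proof -
    have "sig n <= e / 2" unfolding sig_def by (rule cSUP_least) (use N n e in auto)
    moreover have "0 <= sig n" by (rule up) (use n in auto)
    ultimately show ?thesis using e n by (simp add: sig'_def)
   qed
   then show "\<exists>N. \<forall>n\<ge>N. norm (sig' n - 0) < e" by blast
  qed
  show "sig' n >= 0" for n using up[of 0 n] by (simp add: sig'_def)
  show "\<bar>f n p\<bar> <= sig' n" if "n >= n0" "p : S" for n p using up[of "\<bar>f n p\<bar>" n] that by (simp add: sig'_def)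
 qed
qed

text \<open>Diagonal argument: \<open>F n\<close> is evaluated along a sequence which visits \<open>u k\<close> at time \<open>N k\<close>.\<close>

lemma continuous_convergence:
 fixes f :: "real => real" and F :: "nat => real => real"
 assumes conv: "!!t tau. t : S ==> (\<forall>n\<ge>n0. tau n : S) ==> tau ----> t ==> (%n. F n (tau n)) ----> f t"
 shows "continuous_on S f"
 unfolding continuous_on_sequentially
proof (intro allI ballI impI, elim conjE)
 fix u t assume t: "t : S" and u: "\<forall>n. u n : S" "u ----> t"
 have "\<exists>N. \<forall>n\<ge>N. \<bar>F n (u k) - f (u k)\<bar> < 1 / real (Suc k)" for k
 proof -
  have "(%n. F n (u k)) ----> f (u k)" by (rule conv) (use u(1) in auto)
  then show ?thesis using LIMSEQ_D[of _ _ "1 / real (Suc k)"] by fastforce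
 qed
 then obtain A where A: "!!k n. n >= A k ==> \<bar>F n (u k) - f (u k)\<bar> < 1 / real (Suc k)" by metis
 \<comment> \<open>Strictly increasing and at least \<open>A k\<close>, so that at index
   \<open>N k\<close> the error at \<open>u k\<close> is below \<open>1 / Suc k\<close>. Off the
   range of \<open>N\<close>, \<open>tau\<close> will rest at \<open>t\<close>.\<close>
 define N where "N k = k + (\<Sum>j\<le>k. A j)" for k
 have Nm: "strict_mono N" by (rule strict_monoI_Suc) (simp add: N_def)
 have NA: "N k >= A k" for k unfolding N_def using member_le_sum[of k "{..k}" A] by simp
 define tau where "tau n = (if n : range N then u (inv N n) else t)" for n
 have tauN: "tau (N k) = u k" for k unfolding tau_def using strict_mono_imp_inj_on[OF Nm] by simp
 have "tau ----> t"
 proof (rule LIMSEQ_I)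
  fix e :: real assume e: "e > 0"
  obtain K where K: "!!k. k >= K ==> norm (u k - t) < e" using LIMSEQ_D[OF u(2) e] by blast
  have "norm (tau n - t) < e" if n: "n >= N K" for n
  proof (cases "n : range N")
   case True
   then obtain k where k: "n = N k" by blast
   then have "k >= K" using n strict_mono_less_eq[OF Nm] by simp
   then show ?thesis using K tauN k by simp
  qed (use e in \<open>simp add: tau_def\<close>)
  then show "\<exists>no. \<forall>n\<ge>no. norm (tau n - t) < e" by blast
 qed
 moreover have "tau n : S" for n using u(1) t by (simp add: tau_def)
 ultimately have "(%n. F n (tau n)) ----> f t" using t by (intro conv) auto
 from LIMSEQ_subseq_LIMSEQ[OF this Nm] have 1: "(%k. F (N k) (u k)) ----> f t" by (simp add: o_def tauN)
 have "(%k. F (N k) (u k) - f (u k)) ----> 0"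
 proof (rule Lim_null_comparison[OF _ LIMSEQ_inverse_real_of_nat])
  show "eventually (%k. norm (F (N k) (u k) - f (u k)) <= inverse (real (Suc k))) sequentially"
   using A[OF NA] by (auto intro!: always_eventually less_imp_le simp: inverse_eq_divide)
 qed
 from tendsto_diff[OF 1 this] show "(f \<circ> u) ----> f t" by (simp add: o_def)
qed

section \<open>Tightness along the particle flow\<close>

text \<open>For configurations in \<open>Zn\<close> this is the total variation of the charge
  measure on Borel sets, by \<open>charge_tv_le\<close> and \<open>charge_tv_ge\<close>.\<close>

definition abs_charge :: "nat => (nat => real) => (nat => int) => real set => real" where
 "abs_charge n x b A = (1 / real n) * (\<Sum>i=1..n. real_of_int \<bar>b i\<bar> * indicator A (x i))"

lemma charge_measure_uminus: "charge_measure n x (%i. - b i) = (%A. - charge_measure n x b A)"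
 by (rule ext) (simp add: charge_measure_def sum_negf)

lemma charge_tv_le:
 assumes A: "A : sets borel" shows "tv (charge_measure n x b) A <= abs_charge n x b A"
proof -
 have pos: "measure (pos_variation (charge_measure n x b)) A <= (1 / real n) * (\<Sum>i=1..n. real_of_int (max (b i) 0) * indicator A (x i))" for b
 proof (rule measure_pos_variation(2)[OF finite_signed_measure_charge_measure A])
  fix B assume B: "B : sets borel" "B \<subseteq> A"
  show "charge_measure n x b B <= (1 / real n) * (\<Sum>i=1..n. real_of_int (max (b i) 0) * indicator A (x i))"
  proof -
   have "charge_measure n x b B = (1 / real n) * (\<Sum>i=1..n. real_of_int (b i) * indicator B (x i))"
    using B(1) by (simp only: charge_measure_def if_True)
   also have "... <= (1 / real n) * (\<Sum>i=1..n. real_of_int (max (b i) 0) * indicator A (x i))"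
   proof (rule mult_left_mono[OF sum_mono])
    fix i show "real_of_int (b i) * indicator B (x i) <= real_of_int (max (b i) 0) * indicator A (x i)"
     using B(2) by (auto simp: indicator_def)
   qed simp
   finally show ?thesis .
  qed
 qed
 have "measure (neg_variation (charge_measure n x b)) A <= (1 / real n) * (\<Sum>i=1..n. real_of_int (max (- b i) 0) * indicator A (x i))"
  unfolding neg_variation_def using pos[of "%i. - b i"] by (simp add: charge_measure_uminus)
 then have "tv (charge_measure n x b) A <= (1 / real n) * (\<Sum>i=1..n. real_of_int (max (b i) 0) * indicator A (x i))
   + (1 / real n) * (\<Sum>i=1..n. real_of_int (max (- b i) 0) * indicator A (x i))"
  unfolding tv_def by (intro add_mono pos)
 also have "... = abs_charge n x b A"
  unfolding abs_charge_def distrib_left[symmetric] sum.distrib[symmetric] distrib_right[symmetric] of_int_add[symmetric]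
  by (intro arg_cong2[where f = "(*)"] sum.cong refl arg_cong[where f = real_of_int]) auto
 finally show ?thesis .
qed

text \<open>Charged particles occupy distinct positions, so opposite charges cannot cancel, and the
  set of positions of the positive charges realises the positive variation.\<close>

lemma charge_tv_ge:
 assumes Z: "(x, b) : Zn n" and A: "A : sets borel" shows "abs_charge n x b A <= tv (charge_measure n x b) A"
proof -
 have pos: "(1 / real n) * (\<Sum>i=1..n. real_of_int (max (b i) 0) * indicator A (x i)) <= measure (pos_variation (charge_measure n x b)) A"
  if Z: "(x, b) : Zn n" for b
 proof -
  define B where "B = A \<inter> x ` {i\<in>{1..n}. b i > 0}"
  have "finite (x ` {i\<in>{1..n}. b i > 0})" by simp
  then have B: "B : sets borel" "B \<subseteq> A" using A unfolding B_def by (auto intro!: sets.Int borel_closed finite_imp_closed simp del: One_nat_def)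
  have "(\<Sum>i=1..n. real_of_int (max (b i) 0) * indicator A (x i)) = (\<Sum>i=1..n. real_of_int (b i) * indicator B (x i))"
  proof (rule sum.cong[OF refl])
   fix i assume i: "i : {1..n}"
   consider "b i > 0" | "b i = 0" | "b i < 0" by linarith
   then show "real_of_int (max (b i) 0) * indicator A (x i) = real_of_int (b i) * indicator B (x i)"
   proof cases
    case 1
    then have "x i : B \<longleftrightarrow> x i : A" using i unfolding B_def by blast
    then show ?thesis using 1 by (simp add: indicator_def)
   next
    case 3
    have "x i \<notin> B"
    proof
     assume "x i : B"
     then obtain j where j: "j : {1..n}" "b j > 0" "x i = x j" unfolding B_def by blast
     then have "i = j" using Zn_distinct[OF Z i j(1)] 3 by simp
     then show False using j 3 by simp
    qed
    then show ?thesis using 3 by simp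
   qed simp
  qed
  then have "(1 / real n) * (\<Sum>i=1..n. real_of_int (max (b i) 0) * indicator A (x i)) = charge_measure n x b B"
   using B by (simp add: charge_measure_def)
  also have "... <= measure (pos_variation (charge_measure n x b)) A"
   by (rule measure_pos_variation(1)[OF finite_signed_measure_charge_measure A B])
  finally show ?thesis .
 qed
 have neg: "(1 / real n) * (\<Sum>i=1..n. real_of_int (max (- b i) 0) * indicator A (x i)) <= measure (neg_variation (charge_measure n x b)) A"
  unfolding neg_variation_def using pos[OF Zn_uminus[OF Z]] by (simp add: charge_measure_uminus)
 have "abs_charge n x b A = (1 / real n) * (\<Sum>i=1..n. real_of_int (max (b i) 0) * indicator A (x i))
   + (1 / real n) * (\<Sum>i=1..n. real_of_int (max (- b i) 0) * indicator A (x i))"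
  unfolding abs_charge_def distrib_left[symmetric] sum.distrib[symmetric] distrib_right[symmetric] of_int_add[symmetric]
  by (intro arg_cong2[where f = "(*)"] sum.cong refl arg_cong[where f = real_of_int]) auto
 also have "... <= tv (charge_measure n x b) A" unfolding tv_def by (intro add_mono pos neg Z)
 finally show ?thesis .
qed

lemma abs_charge_le_1:
 assumes "(x, b) : Zn n" "n >= 1" shows "abs_charge n x b A <= 1"
proof -
 have "(\<Sum>i=1..n. real_of_int \<bar>b i\<bar> * indicator A (x i)) <= (\<Sum>i=1..n. 1)"
 proof (rule sum_mono)
  fix i assume "i : {1..n}"
  from Zn_charge[OF assms(1) this] show "real_of_int \<bar>b i\<bar> * indicator A (x i) <= 1" by (auto simp: indicator_def)
 qed
 then show ?thesis using assms(2) by (simp add: abs_charge_def field_simps)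
qed

text \<open>The function is a bounded substitute for a second moment. With
  \<open>q = R^2 + y^2\<close> its second derivative is \<open>2 R^2 (q - 4 y^2) / q^3\<close>, and
  \<open>|q - 4 y^2| <= 3 q\<close> together with \<open>q >= R^2\<close> gives
  \<open>6 / R^2\<close>.\<close>

lemma confine_deriv:
 fixes R :: real assumes R: "R > 0"
 defines "f' \<equiv> %y. 2 * y * R^2 / (R^2 + y^2)^2"
 shows "((%y. y^2 / (R^2 + y^2)) has_real_derivative f' y) (at y)"
  "\<bar>f' y - f' z\<bar> <= 6 / R^2 * \<bar>y - z\<bar>"
proof -
 have s: "R^2 + y^2 > 0" for y using R by (simp add: add_pos_nonneg)
 have "((%y. y^2 / (R^2 + y^2)) has_real_derivative (2 * y * (R^2 + y^2) - y^2 * (2 * y)) / ((R^2 + y^2) * (R^2 + y^2))) (at y)"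
  using s[of y] by (auto intro!: derivative_eq_intros)
 moreover have "(2 * y * (R^2 + y^2) - y^2 * (2 * y)) / ((R^2 + y^2) * (R^2 + y^2)) = f' y"
  unfolding f'_def power2_eq_square[of "R^2 + y^2"] by (intro arg_cong2[where f = "(/)"] refl) (simp add: algebra_simps)
 ultimately show "((%y. y^2 / (R^2 + y^2)) has_real_derivative f' y) (at y)" by simp
 define f'' where "f'' y = (2 * R^2 * (R^2 + y^2)^2 - 2 * y * R^2 * (2 * (R^2 + y^2) * (2 * y))) / ((R^2 + y^2)^2 * (R^2 + y^2)^2)" for y
 have d2: "(f' has_real_derivative f'' y) (at y)" for y
  unfolding f'_def f''_def using s[of y] by (auto intro!: derivative_eq_intros)
 have bd: "\<bar>f'' y\<bar> <= 6 / R^2" for y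
 proof -
  define q where "q = R^2 + y^2"
  have q: "q > 0" "R^2 <= q" "R^2 > 0" using s[of y] R by (auto simp: q_def)
  have "2 * R^2 * q^2 - 2 * y * R^2 * (2 * q * (2 * y)) = q * (2 * R^2 * (q - 4 * y^2))"
   by (simp add: power2_eq_square algebra_simps)
  then have "f'' y = q * (2 * R^2 * (q - 4 * y^2)) / (q * q ^ 3)" unfolding f''_def q_def[symmetric] by (simp add: power2_eq_square power3_eq_cube mult_ac)
  then have e: "f'' y = 2 * R^2 * (q - 4 * y^2) / q ^ 3" using q(1) by simp
  have "\<bar>q - 4 * y^2\<bar> <= 3 * q" unfolding q_def abs_le_iff by simp
  then have "\<bar>f'' y\<bar> <= 2 * R^2 * (3 * q) / q ^ 3"
  proof -
   have "\<bar>f'' y\<bar> = 2 * R^2 * \<bar>q - 4 * y^2\<bar> / q ^ 3" unfolding e using q(1) by (simp add: abs_mult)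
   also have "... <= 2 * R^2 * (3 * q) / q ^ 3"
    using \<open>\<bar>q - 4 * y^2\<bar> <= 3 * q\<close> q(1) by (intro divide_right_mono mult_left_mono) auto
   finally show ?thesis .
  qed
  also have "... = 6 * (R^2 / q^2)" using q(1) by (simp add: power2_eq_square power3_eq_cube)
  also have "R^2 / q^2 <= 1 / R^2"
  proof -
   have "R^2 * R^2 <= q^2" unfolding power2_eq_square[of q] by (intro mult_mono q(2) less_imp_le[OF q(1)] zero_le_power2)
   then have "R^2 / q^2 <= R^2 / (R^2 * R^2)" by (rule divide_left_mono) (use q(1) R in \<open>simp_all\<close>)
   also have "R^2 / (R^2 * R^2) = 1 / R^2" using R by (simp add: power2_eq_square)
   finally show ?thesis .
  qed
  finally show ?thesis by simp
 qed
 have "norm (f' y - f' z) <= 6 / R^2 * norm (y - z)"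
  by (rule field_differentiable_bound[where S = UNIV and f' = f'']) (auto intro!: d2 bd)
 then show "\<bar>f' y - f' z\<bar> <= 6 / R^2 * \<bar>y - z\<bar>" by simp
qed

text \<open>Antisymmetry of the interaction turns \<open>g (X i)\<close> into half the difference \<open>g (X i) - g (X j)\<close>.\<close>

lemma interaction_sum:
 fixes X :: "nat => real" and beta :: "nat => int"
 assumes Z: "(X, beta) : Zn n" and n: "n >= 1" and L: "!!y z. \<bar>g y - g z\<bar> <= L * \<bar>y - z\<bar>" "L >= 0"
 shows "(1 / real n) * (\<Sum>i=1..n. real_of_int \<bar>beta i\<bar> * (g (X i) * ((1 / real n) * (\<Sum>j\<in>{1..n} - {i}. real_of_int (beta i * beta j) / (X i - X j))))) <= L / 2"
proof -
 define h where "h i j = real_of_int (beta i * beta j) / (X i - X j)" for i j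
 define S where "S = (\<Sum>i=1..n. \<Sum>j=1..n. h i j * g (X i))"
 have anti: "h j i = - h i j" for i j
  unfolding h_def using minus_divide_right[of "real_of_int (beta i * beta j)" "X i - X j"] by (simp add: mult.commute)
 have hb: "real_of_int \<bar>beta i\<bar> * h i j = h i j" if "i : {1..n}" for i j
  using Zn_charge[OF Z that] unfolding h_def by auto
 have "(\<Sum>i=1..n. real_of_int \<bar>beta i\<bar> * (g (X i) * ((1 / real n) * (\<Sum>j\<in>{1..n} - {i}. h i j)))) = (1 / real n) * S"
  unfolding S_def sum_distrib_left
 proof (rule sum.cong[OF refl])
  fix i assume i: "i : {1..n}"
  have "(\<Sum>j=1..n. 1 / real n * (h i j * g (X i))) = (\<Sum>j=1..n. real_of_int \<bar>beta i\<bar> * (g (X i) * (1 / real n * h i j)))"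
  proof (rule sum.cong[OF refl])
   fix j
   have "real_of_int \<bar>beta i\<bar> * (g (X i) * (1 / real n * h i j)) = (real_of_int \<bar>beta i\<bar> * h i j) * (g (X i) * (1 / real n))" by (simp only: mult_ac)
   then show "1 / real n * (h i j * g (X i)) = real_of_int \<bar>beta i\<bar> * (g (X i) * (1 / real n * h i j))"
    unfolding hb[OF i] by (simp only: mult_ac)
  qed
  moreover have "(\<Sum>j\<in>{1..n} - {i}. real_of_int \<bar>beta i\<bar> * (g (X i) * (1 / real n * h i j))) = (\<Sum>j=1..n. real_of_int \<bar>beta i\<bar> * (g (X i) * (1 / real n * h i j)))"
   by (rule sum.mono_neutral_left) (auto simp: h_def)
  ultimately show "(\<Sum>j\<in>{1..n} - {i}. real_of_int \<bar>beta i\<bar> * (g (X i) * (1 / real n * h i j))) = (\<Sum>j=1..n. 1 / real n * (h i j * g (X i)))" by simp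
 qed
 moreover have "2 * S <= real n * real n * L"
 proof -
  have "S = (\<Sum>i=1..n. \<Sum>j=1..n. h j i * g (X j))" unfolding S_def by (rule sum.swap)
  also have "... = - (\<Sum>i=1..n. \<Sum>j=1..n. h i j * g (X j))" unfolding sum_negf[symmetric] by (subst anti) simp
  finally have "2 * S = S - (\<Sum>i=1..n. \<Sum>j=1..n. h i j * g (X j))" by simp
  also have "... = (\<Sum>i=1..n. \<Sum>j=1..n. h i j * (g (X i) - g (X j)))"
   unfolding S_def by (simp add: sum_subtractf right_diff_distrib)
  also have "... <= (\<Sum>i=1..n. \<Sum>j=1..n. L)"
  proof (intro sum_mono)
   fix i j assume i: "i : {1..n}" and j: "j : {1..n}"
   show "h i j * (g (X i) - g (X j)) <= L"
   proof (cases "X i = X j")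
    case False
    have b: "\<bar>real_of_int (beta i * beta j)\<bar> <= 1" using Zn_charge[OF Z i] Zn_charge[OF Z j] by auto
    have "\<bar>h i j * (g (X i) - g (X j))\<bar> = \<bar>real_of_int (beta i * beta j)\<bar> * (\<bar>g (X i) - g (X j)\<bar> / \<bar>X i - X j\<bar>)"
     by (simp add: h_def abs_mult abs_divide)
    also have "... <= 1 * L"
     using b L(1)[of "X i" "X j"] False by (intro mult_mono) (auto simp: divide_simps)
    finally show ?thesis by simp
   qed (use L(2) in \<open>simp add: h_def\<close>)
  qed
  finally show ?thesis by simp
 qed
 ultimately have "(1 / real n) * (\<Sum>i=1..n. real_of_int \<bar>beta i\<bar> * (g (X i) * ((1 / real n) * (\<Sum>j\<in>{1..n} - {i}. h i j)))) = S / (real n * real n)"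
  and "S / (real n * real n) <= L / 2" using n by (simp_all add: field_simps)
 then show ?thesis unfolding h_def by linarith
qed

text \<open>The derivative of \<open>E\<close> is an interaction sum, hence at most half of the
  Lipschitz constant \<open>6 / R^2\<close>. The end \<open>c\<close> may be included because
  \<open>E\<close> only involves the positions, which are continuous, and the old charges.\<close>

lemma window_energy:
 assumes w: "window n a c x beta" and R: "R > 0" and t: "t : {a..c}"
 defines "E \<equiv> %t. (1 / real n) * (\<Sum>i=1..n. real_of_int \<bar>beta i\<bar> * ((x t i)^2 / (R^2 + (x t i)^2)))"
 shows "E t <= E a + 3 / R^2 * (t - a)"
proof (cases "t = a")
 case False
 then have at: "a < t" using t by simp
 have n: "n >= 1" using w by (simp add: window_def)
 have xc: "continuous_on {a..t} (%t. x t i)" if "i : {1..n}" for i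
 proof -
  have "continuous_on {a..c} (%t. x t i)" using w that unfolding window_def by blast
  then show ?thesis by (rule continuous_on_subset) (use t in auto)
 qed
 have nz: "R^2 + y^2 ~= 0" for y using R sum_power2_eq_zero_iff[of R y] by simp
 have cE: "continuous_on {a..t} E"
  unfolding E_def by (intro continuous_intros xc) (use nz in auto)
 define f' where "f' y = 2 * y * R^2 / (R^2 + y^2)^2" for y
 define v where "v i s = (1 / real n) * (\<Sum>j\<in>{1..n} - {i}. real_of_int (beta i * beta j) / (x s i - x s j))" for i s
 have dE: "(E has_real_derivative (1 / real n) * (\<Sum>i=1..n. real_of_int \<bar>beta i\<bar> * (f' (x s i) * v i s))) (at s)" if s: "a < s" "s < t" for s
  unfolding E_def
 proof (intro DERIV_cmult DERIV_sum)
  fix i assume i: "i : {1..n}"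
  have "s : {a<..<c}" using s t by auto
  then have "((%t. x t i) has_real_derivative v i s) (at s)" using w i unfolding window_def v_def by blast
  then show "((%t. (x t i)^2 / (R^2 + (x t i)^2)) has_real_derivative f' (x s i) * v i s) (at s)"
   by (rule DERIV_chain2[OF confine_deriv(1)[OF R, folded f'_def]])
 qed
 obtain l z where z: "a < z" "z < t" "DERIV E z :> l" "E t - E a = (t - a) * l"
  using MVT[OF at cE] dE unfolding real_differentiable_def by blast
 have Zz: "(x z, beta) : Zn n" using w z t unfolding window_def by auto
 have "l = (1 / real n) * (\<Sum>i=1..n. real_of_int \<bar>beta i\<bar> * (f' (x z i) * v i z))"
  by (rule DERIV_unique[OF z(3) dE[OF z(1,2)]])
 also have "... <= 6 / R^2 / 2"
  unfolding v_def by (rule interaction_sum[OF Zz n confine_deriv(2)[OF R, folded f'_def]]) simp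
 finally have "l <= 3 / R^2" by simp
 then have "(t - a) * l <= (t - a) * (3 / R^2)" using at by (intro mult_left_mono) auto
 then show ?thesis using z(4) by (simp add: mult.commute)
qed simp

text \<open>A collision can only lower the energy, as no \<open>|b i|\<close> grows. The energy is
  at least half of the mass outside \<open>{-R..R}\<close>, hence the factor 2; initially, particles
  in \<open>{-r..r}\<close> contribute at most \<open>r^2 / R^2\<close>.\<close>

lemma particle_flow_tail:
 assumes fl: "particle_flow n T x b" and R: "R > 0" and r: "r > 0" and t: "t : {0..T}"
 shows "abs_charge n (x t) (b t) (UNIV - {-R..R}) \<le>
  2 * (r^2 / R^2 + abs_charge n (x 0) (b 0) (UNIV - {-r..r})) + 6 * T / R^2"
proof -
 have n: "n >= 1" and Z: "!!t. t : {0..T} ==> (x t, b t) : Zn n" using fl by (auto simp: particle_flow_def)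
 have T: "T >= 0" using t by auto
 define f where "f y = y^2 / (R^2 + y^2)" for y
 have s: "R^2 + y^2 > 0" for y using R by (simp add: add_pos_nonneg)
 have f0: "f y >= 0" for y unfolding f_def using s[of y] by (simp add: less_imp_le)
 have f1: "f y <= 1" for y unfolding f_def using s[of y] by (simp add: divide_simps)
 have fR: "1 / 2 <= f y" if "\<bar>y\<bar> >= R" for y
 proof -
  have "R^2 <= y^2" using power_mono[OF that, of 2] R by simp
  then show ?thesis unfolding f_def using s[of y] by (simp add: divide_simps)
 qed
 have fr: "f y <= r^2 / R^2" if "\<bar>y\<bar> <= r" for y
 proof -
  have "y^2 <= r^2" using power_mono[OF that, of 2] by simp
  then show ?thesis unfolding f_def using R by (intro frac_le) auto
 qed
 define E where "E b t = (1 / real n) * (\<Sum>i=1..n. real_of_int \<bar>b i\<bar> * f (x t i))" for b :: "nat => int" and t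
 have Econg: "E b t = E b' t" if "!!i. i : {1..n} ==> b i = b' i" for b b' t
  unfolding E_def using that by (intro arg_cong2[where f = "(*)"] sum.cong refl) simp
 have "E (b t) t <= E (b 0) 0 + 3 / R^2 * t"
 proof (rule particle_flow_induct[OF fl _ _ _ t])
  fix a c beta t assume w: "window n a c x beta" and ac: "a < c" and b: "!!i t. i : {1..n} ==> t : {a..<c} ==> b t i = beta i"
   and Qa: "E (b a) a <= E (b 0) 0 + 3 / R^2 * a" and t: "t : {a..<c}"
  have "E beta t <= E beta a + 3 / R^2 * (t - a)" unfolding E_def f_def by (rule window_energy[OF w R]) (use t in auto)
  moreover have "E (b t) t = E beta t" "E (b a) a = E beta a" using b t ac by (auto intro!: Econg)
  ultimately show "E (b t) t <= E (b 0) 0 + 3 / R^2 * t" using Qa by (simp add: algebra_simps diff_divide_distrib)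
 next
  fix a c beta assume w: "window n a c x beta" and ac: "a < c" and b: "!!i t. i : {1..n} ==> t : {a..<c} ==> b t i = beta i"
   and dec: "!!i. i : {1..n} ==> \<bar>b c i\<bar> <= \<bar>beta i\<bar>"
   and Q: "!!t. t : {a..<c} ==> E (b t) t <= E (b 0) 0 + 3 / R^2 * t"
  have "E beta c <= E beta a + 3 / R^2 * (c - a)" unfolding E_def f_def by (rule window_energy[OF w R]) (use ac in auto)
  moreover have "E (b a) a = E beta a" using b ac by (auto intro!: Econg)
  moreover have "E (b c) c <= E beta c"
   unfolding E_def
  proof (rule mult_left_mono[OF sum_mono])
   fix i assume "i : {1..n}"
   then show "real_of_int \<bar>b c i\<bar> * f (x c i) <= real_of_int \<bar>beta i\<bar> * f (x c i)"
    by (intro mult_right_mono f0 of_int_le_iff[THEN iffD2] dec)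
  qed simp
  moreover have "E (b a) a <= E (b 0) 0 + 3 / R^2 * a" using Q ac by simp
  ultimately show "E (b c) c <= E (b 0) 0 + 3 / R^2 * c" by (simp add: algebra_simps diff_divide_distrib)
 qed simp
 also have "3 / R^2 * t <= 3 / R^2 * T" using t by (intro mult_left_mono) auto
 finally have Et: "E (b t) t <= E (b 0) 0 + 3 / R^2 * T" by simp
 have "abs_charge n (x t) (b t) (UNIV - {-R..R}) <= 2 * E (b t) t"
 proof -
  have "(\<Sum>i=1..n. real_of_int \<bar>b t i\<bar> * indicator (UNIV - {-R..R}) (x t i)) <= (\<Sum>i=1..n. 2 * (real_of_int \<bar>b t i\<bar> * f (x t i)))"
  proof (rule sum_mono)
   fix i
   have "indicator (UNIV - {-R..R}) (x t i) <= 2 * f (x t i)"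
   proof (cases "x t i : {-R..R}")
    case False
    then have "R <= \<bar>x t i\<bar>" unfolding atLeastAtMost_iff by linarith
    from fR[OF this] show ?thesis using False by simp
   qed (use f0[of "x t i"] in simp)
   then have "real_of_int \<bar>b t i\<bar> * indicator (UNIV - {-R..R}) (x t i) <= real_of_int \<bar>b t i\<bar> * (2 * f (x t i))" by (intro mult_left_mono) auto
   then show "real_of_int \<bar>b t i\<bar> * indicator (UNIV - {-R..R}) (x t i) <= 2 * (real_of_int \<bar>b t i\<bar> * f (x t i))" by simp
  qed
  then have "(1 / real n) * (\<Sum>i=1..n. real_of_int \<bar>b t i\<bar> * indicator (UNIV - {-R..R}) (x t i)) <= (1 / real n) * (\<Sum>i=1..n. 2 * (real_of_int \<bar>b t i\<bar> * f (x t i)))"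
   by (intro mult_left_mono) auto
  also have "... = 2 * E (b t) t" unfolding E_def sum_distrib_left[symmetric] by simp
  finally show ?thesis unfolding abs_charge_def .
 qed
 moreover have "E (b 0) 0 <= r^2 / R^2 + abs_charge n (x 0) (b 0) (UNIV - {-r..r})"
 proof -
  have "(\<Sum>i=1..n. real_of_int \<bar>b 0 i\<bar> * f (x 0 i)) <= (\<Sum>i=1..n. r^2 / R^2 + real_of_int \<bar>b 0 i\<bar> * indicator (UNIV - {-r..r}) (x 0 i))"
  proof (rule sum_mono)
   fix i assume i: "i : {1..n}"
   have b1: "real_of_int \<bar>b 0 i\<bar> <= 1" using Zn_charge[OF Z[of 0] i] T by auto
   have rr: "r^2 / R^2 >= 0" by simp
   have "f (x 0 i) <= r^2 / R^2 + indicator (UNIV - {-r..r}) (x 0 i)"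
   proof (cases "x 0 i : {-r..r}")
    case True
    then have "\<bar>x 0 i\<bar> <= r" unfolding atLeastAtMost_iff by linarith
    from fr[OF this] show ?thesis using True by simp
   next
    case False
    then have "indicator (UNIV - {-r..r}) (x 0 i) = (1::real)" by simp
    then show ?thesis using f1[of "x 0 i"] rr by linarith
   qed
   then have "real_of_int \<bar>b 0 i\<bar> * f (x 0 i) <= real_of_int \<bar>b 0 i\<bar> * (r^2 / R^2 + indicator (UNIV - {-r..r}) (x 0 i))"
    by (intro mult_left_mono) auto
   also have "... = real_of_int \<bar>b 0 i\<bar> * (r^2 / R^2) + real_of_int \<bar>b 0 i\<bar> * indicator (UNIV - {-r..r}) (x 0 i)" by (rule distrib_left)
   also have "real_of_int \<bar>b 0 i\<bar> * (r^2 / R^2) <= 1 * (r^2 / R^2)" using b1 rr by (rule mult_right_mono)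
   finally show "real_of_int \<bar>b 0 i\<bar> * f (x 0 i) <= r^2 / R^2 + real_of_int \<bar>b 0 i\<bar> * indicator (UNIV - {-r..r}) (x 0 i)" by simp
  qed
  then have "E (b 0) 0 <= (1 / real n) * (\<Sum>i=1..n. r^2 / R^2 + real_of_int \<bar>b 0 i\<bar> * indicator (UNIV - {-r..r}) (x 0 i))"
   unfolding E_def by (intro mult_left_mono) auto
  also have "... = r^2 / R^2 + abs_charge n (x 0) (b 0) (UNIV - {-r..r})"
   unfolding abs_charge_def sum.distrib using n by (simp add: distrib_left add_divide_distrib)
  finally show ?thesis .
 qed
 ultimately show ?thesis using Et by simp
qed

section \<open>Convergence of the particle systems\<close>

text \<open>\<open>FM\<close> at \<open>y\<close> is the value of \<open>FI\<close> slightly to the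
  left of \<open>y\<close>, and the bound passes to the limit by continuity of
  \<open>g\<close>.\<close>

lemma FM_le_of_FI_le:
 assumes FI: "!!y. FI n x b y / n <= g y" and g: "continuous_on UNIV g"
 shows "FM n x b y / n <= (g y :: real)"
proof -
 define d where "d = Min (insert 1 ((%i. y - x i) ` {i\<in>{1..n}. x i < y}))"
 have d: "d > 0" unfolding d_def by (subst Min_gr_iff) auto
 have dle: "d <= y - x i" if "i : {1..n}" "x i < y" for i
  unfolding d_def by (rule Min_le) (use that in auto)
 have eq: "FI n x b y' = FM n x b y" if y': "y - d <= y'" "y' < y" for y'
  unfolding FI_def FM_def
 proof (rule sum.cong[OF refl])
  fix i assume i: "i : {1..n}"
  have "x i <= y' \<longleftrightarrow> x i < y" using dle[OF i] y' by linarith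
  then show "(if x i <= y' then b i else 0) = (if x i < y then b i else 0)" by simp
 qed
 have "eventually (%y'. y' : {y - d<..<y}) (at_left y)" by (rule eventually_at_left_real) (use d in simp)
 then have ev: "eventually (%y'. FM n x b y / n <= g y') (at_left y)"
 proof (rule eventually_mono)
  fix y' assume "y' : {y - d<..<y}"
  then show "FM n x b y / n <= g y'" using eq[of y'] FI[of y'] by simp
 qed
 have "isCont g y" using g by (simp add: continuous_on_eq_continuous_at)
 then have "(g \<longlongrightarrow> g y) (at_left y)" by (auto simp: isCont_def intro: filterlim_at_split[THEN iffD1, THEN conjunct1])
 then show ?thesis by (rule tendsto_lowerbound[OF _ ev]) simp
qed

lemma UU_le_of_FI_le:
 assumes FI: "!!y. FI n x b y / n <= g y" and g: "continuous_on UNIV g"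
 shows "UU n x b y <= (g y :: real)"
 using FI[of y] FM_le_of_FI_le[OF FI g, of y] by (simp add: UU_def max_def)

lemma FI_uminus: "FI n x (%i. - b i) y = - FI n x b y"
 unfolding FI_def sum_negf[symmetric] by (rule sum.cong) auto

lemma particle_cdf_uniform:
 assumes u0: "datum M u0" and M: "M >= 1" and U: "ext_sub M u0 U" and W: "ext_sub M (%x. - u0 x) (%p. - U p)"
  and fl: "!!n. n >= 2 ==> particle_flow n T (x n) (b n)"
  and init: "!!n y. n >= 2 ==> \<bar>FI n (x n 0) (b n 0) y / n - u0 y\<bar> <= sig n"
  and sig: "sig ----> 0" "!!n. sig n >= 0" and e: "e > 0" and T: "T >= 0"
 shows "\<exists>N. \<forall>n\<ge>N. \<forall>t\<in>{0..T}. \<forall>y. \<bar>FI n (x n t) (b n t) y / n - U (t, y)\<bar> <= e"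
proof -
 have cu: "continuous_on UNIV u0" using u0 by (simp add: datum_def)
 obtain N1 where N1: "!!n t y. n >= N1 ==> t : {0..T} ==> UU n (x n t) (b n t) y + - U (t, y) <= e"
 proof -
  have "\<exists>N. \<forall>n\<ge>N. \<forall>t\<in>{0..T}. \<forall>y. UU n (x n t) (b n t) y + - U (t, y) <= e"
  proof (rule particle_comparison[OF u0 M W fl _ sig(1) sig(2) e T])
   fix n y assume n: "n >= (2::nat)"
   show "UU n (x n 0) (b n 0) y <= u0 y + sig n"
   proof (rule UU_le_of_FI_le[where g = "%y. u0 y + sig n"])
    show "FI n (x n 0) (b n 0) y / n <= u0 y + sig n" for y using init[OF n, of y] by linarith
    show "continuous_on UNIV (%y. u0 y + sig n)" by (intro continuous_intros cu)
   qed
  qed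
  then show ?thesis using that by blast
 qed
 obtain N2 where N2: "!!n t y. n >= N2 ==> t : {0..T} ==> UU n (x n t) (%i. - b n t i) y + U (t, y) <= e"
 proof -
  have U': "ext_sub M (%x. - (- u0 x)) U" using U by simp
  have "\<exists>N. \<forall>n\<ge>N. \<forall>t\<in>{0..T}. \<forall>y. UU n (x n t) ((%n t i. - b n t i) n t) y + U (t, y) <= e"
  proof (rule particle_comparison[OF datum_uminus[OF u0] M U' particle_flow_uminus[OF fl] _ sig(1) sig(2) e T])
   fix n y assume n: "n >= (2::nat)"
   show "UU n (x n 0) (%i. - b n 0 i) y <= - u0 y + sig n"
   proof (rule UU_le_of_FI_le[where g = "%y. - u0 y + sig n"])
    show "FI n (x n 0) (%i. - b n 0 i) y / n <= - u0 y + sig n" for y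
     using init[OF n, of y] unfolding FI_uminus of_int_minus minus_divide_left[symmetric] by linarith
    show "continuous_on UNIV (%y. - u0 y + sig n)" by (intro continuous_intros cu)
   qed
  qed
  then show ?thesis using that by blast
 qed
 show ?thesis
 proof (intro exI[of _ "max N1 N2"] allI impI ballI)
  fix n t y assume n: "n >= max N1 N2" and t: "t : {0..T}"
  have "FI n (x n t) (b n t) y / n - U (t, y) <= e" using N1[of n t y] n t FI_le_UU[of n "x n t" "b n t" y] by simp
  moreover have "- (FI n (x n t) (b n t) y / n) + U (t, y) <= e"
   using N2[of n t y] n t FI_le_UU[of n "x n t" "%i. - b n t i" y] by (simp add: FI_uminus)
  ultimately show "\<bar>FI n (x n t) (b n t) y / n - U (t, y)\<bar> <= e" by linarith
 qed
qed

section \<open>The limit function: behaviour at infinity and modulus of continuity\<close>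

lemma ext_sub_ends:
 assumes u0: "datum M u0" and U: "ext_sub M u0 U" and W: "ext_sub M (%x. - u0 x) (%p. - U p)" and e: "e > 0"
  and l: "!!e. e > 0 ==> \<exists>R>0. (\<forall>x\<le>-R. \<bar>u0 x - l0\<bar> <= e) & (\<forall>x\<ge>R. \<bar>u0 x - l1\<bar> <= e)"
 obtains R where "R > 0" "!!t x. t : {0..T} ==> x <= - R ==> \<bar>U (t, x) - l0\<bar> <= e" "!!t x. t : {0..T} ==> x >= R ==> \<bar>U (t, x) - l1\<bar> <= e"
proof -
 have M: "M > 0" using u0 by (simp add: datum_def)
 have B: "1800 * M^2 >= 0" by simp
 have l': "\<exists>R>0. (\<forall>x\<le>-R. \<bar>- u0 x - - l0\<bar> <= e) & (\<forall>x\<ge>R. \<bar>- u0 x - - l1\<bar> <= e)" if "e > 0" for e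
  using l[OF that] by (simp add: abs_minus_commute)
 note LU = ext_sub_local_bound[OF U M, of T]
 note LW = ext_sub_local_bound[OF W M, of T]
 obtain R1 where R1: "R1 > 0"
  "!!U sig S t x. local_bound (1800 * M^2) sig M u0 S U ==> t : {0..S} ==> t <= T ==> x <= - R1 ==> U (t, x) <= l0 + sig + e"
  "!!U sig S t x. local_bound (1800 * M^2) sig M u0 S U ==> t : {0..S} ==> t <= T ==> x >= R1 ==> U (t, x) <= l1 + sig + e"
  by (rule local_bound_infinity[OF u0 B e l, where ?T0.0 = T], assumption, rule that)
 obtain R2 where R2: "R2 > 0"
  "!!U sig S t x. local_bound (1800 * M^2) sig M (%x. - u0 x) S U ==> t : {0..S} ==> t <= T ==> x <= - R2 ==> U (t, x) <= - l0 + sig + e"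
  "!!U sig S t x. local_bound (1800 * M^2) sig M (%x. - u0 x) S U ==> t : {0..S} ==> t <= T ==> x >= R2 ==> U (t, x) <= - l1 + sig + e"
  by (rule local_bound_infinity[OF datum_uminus[OF u0] B e l', where ?T0.0 = T], assumption, rule that)
 show ?thesis
 proof (rule that[of "R1 + R2"])
  show "R1 + R2 > 0" using R1(1) R2(1) by simp
  fix t x assume t: "t : {0..T}"
  then have tT: "t <= T" by simp
  show "\<bar>U (t, x) - l0\<bar> <= e" if x: "x <= - (R1 + R2)"
  proof -
   have "x <= - R1" "x <= - R2" using x R1(1) R2(1) by linarith+
   from R1(2)[OF LU t tT this(1)] R2(2)[OF LW t tT this(2)] show ?thesis by linarith
  qed
  show "\<bar>U (t, x) - l1\<bar> <= e" if x: "x >= R1 + R2"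
  proof -
   have "x >= R1" "x >= R2" using x R1(1) R2(1) by linarith+
   from R1(3)[OF LU t tT this(1)] R2(3)[OF LW t tT this(2)] show ?thesis by linarith
  qed
 qed
qed

lemma ext_sub_at_bot:
 assumes u0: "datum M u0" and U: "ext_sub M u0 U" and W: "ext_sub M (%x. - u0 x) (%p. - U p)" and bot: "(u0 \<longlongrightarrow> 0) at_bot"
  and t: "t >= 0"
 shows "((%x. U (t, x)) \<longlongrightarrow> 0) at_bot"
proof -
 obtain l0 l1 where l: "!!e. e > 0 ==> \<exists>R>0. (\<forall>x\<le>-R. \<bar>u0 x - l0\<bar> <= e) & (\<forall>x\<ge>R. \<bar>u0 x - l1\<bar> <= e)"
  using datum_ends[OF u0] by blast
 have "(u0 \<longlongrightarrow> l0) at_bot"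
 proof (rule tendstoI)
  fix e :: real assume e: "e > 0"
  then obtain R where R: "\<forall>x\<le>-R. \<bar>u0 x - l0\<bar> <= e / 2" using l[of "e / 2"] by auto
  show "eventually (%x. dist (u0 x) l0 < e) at_bot"
   using eventually_le_at_bot[of "- R"] by (rule eventually_mono) (use R e in \<open>force simp: dist_real_def\<close>)
 qed
 then have l0: "l0 = 0" using bot by (intro tendsto_unique[of at_bot u0]) auto
 show ?thesis
 proof (rule tendstoI)
  fix e :: real assume e: "e > 0"
  obtain R where R: "!!s x. s : {0..t} ==> x <= - R ==> \<bar>U (s, x) - l0\<bar> <= e / 2"
   by (rule ext_sub_ends[OF u0 U W half_gt_zero[OF e] l, of t], assumption, rule that)
  show "eventually (%x. dist (U (t, x)) 0 < e) at_bot"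
   using eventually_le_at_bot[of "- R"]
  proof (rule eventually_mono)
   fix x assume "x <= - R"
   then have "\<bar>U (t, x) - l0\<bar> <= e / 2" using t by (intro R) auto
   then show "dist (U (t, x)) 0 < e" using e l0 by (simp add: dist_real_def)
  qed
 qed
qed

text \<open>\<open>omega\<close> is the largest oscillation at equal times in \<open>{0..T}\<close>.
  That it tends to 0 rests on uniform continuity on an unbounded strip: compactness in the middle,
  the limits at infinity outside.\<close>

lemma ext_sub_modulus:
 assumes u0: "datum M u0" and U: "ext_sub M u0 U" and W: "ext_sub M (%x. - u0 x) (%p. - U p)" and cont: "continuous_on HJ_cl U"
  and T: "T >= 0"
 obtains omega where "modulus_of_continuity omega" "!!t x y. t : {0..T} ==> \<bar>U (t, x) - U (t, y)\<bar> <= omega \<bar>x - y\<bar>"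
proof -
 have unif: "\<exists>delta>0. \<forall>t\<in>{0..T}. \<forall>x y. \<bar>x - y\<bar> <= delta --> \<bar>U (t, x) - U (t, y)\<bar> <= e" if e: "e > 0" for e
 proof -
  obtain l0 l1 where l: "!!e. e > 0 ==> \<exists>R>0. (\<forall>x\<le>-R. \<bar>u0 x - l0\<bar> <= e) & (\<forall>x\<ge>R. \<bar>u0 x - l1\<bar> <= e)"
   using datum_ends[OF u0] by blast
  obtain R where R: "R > 0" "!!t x. t : {0..T} ==> x <= - R ==> \<bar>U (t, x) - l0\<bar> <= e / 2" "!!t x. t : {0..T} ==> x >= R ==> \<bar>U (t, x) - l1\<bar> <= e / 2"
   by (rule ext_sub_ends[OF u0 U W half_gt_zero[OF e] l, of T], assumption, rule that)
  have "uniformly_continuous_on ({0..T} \<times> {-R-1..R+1}) U"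
   by (rule compact_uniformly_continuous[OF continuous_on_subset[OF cont]]) (auto simp: HJ_cl_def intro: compact_Times)
  then obtain d where d: "d > 0" "!!p q. p : {0..T} \<times> {-R-1..R+1} ==> q : {0..T} \<times> {-R-1..R+1} ==> dist q p < d ==> dist (U q) (U p) < e"
   using e unfolding uniformly_continuous_on_def by metis
  show ?thesis
  proof (intro exI[of _ "min 1 (d/2)"] conjI ballI allI impI)
   show "min 1 (d/2) > 0" using d(1) by simp
   fix t x y assume t: "t : {0..T}" and xy: "\<bar>x - y\<bar> <= min 1 (d/2)"
   consider "x : {-R-1..R+1}" "y : {-R-1..R+1}" | "x <= -R" "y <= -R" | "x >= R" "y >= R"
    using xy R(1) by fastforce
   then show "\<bar>U (t, x) - U (t, y)\<bar> <= e"
   proof cases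
    case 1
    have "dist (t, x) (t, y) = \<bar>x - y\<bar>" by (simp add: dist_prod_def dist_real_def)
    then have "dist (U (t, x)) (U (t, y)) < e" using 1 t xy d(1) by (intro d(2)) auto
    then show ?thesis by (simp add: dist_real_def)
   next
    case 2
    show ?thesis using R(2)[OF t 2(1)] R(2)[OF t 2(2)] by linarith
   next
    case 3
    show ?thesis using R(3)[OF t 3(1)] R(3)[OF t 3(2)] by linarith
   qed
  qed
 qed
 define V where "V r = {\<bar>U (t, x) - U (t, y)\<bar> | t x y. t : {0..T} & \<bar>x - y\<bar> <= r}" for r
 have VI: "\<bar>U (t, x) - U (t, y)\<bar> : V r" if "t : {0..T}" "\<bar>x - y\<bar> <= r" for t x y r using that unfolding V_def by blast
 have bdd: "bdd_above (V r)" for r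
 proof (rule bdd_aboveI[of _ "2 * M"])
  fix v assume "v : V r"
  then obtain t x y where v: "v = \<bar>U (t, x) - U (t, y)\<bar>" "t : {0..T}" unfolding V_def by blast
  have "\<bar>U (t, z)\<bar> <= M" for z using U v(2) by (simp add: ext_sub_def HJ_cl_def)
  from this[of x] this[of y] show "v <= 2 * M" unfolding v(1) by linarith
 qed
 have ne: "V r ~= {}" if "r >= 0" for r using VI[of 0 0 0 r] T that by auto
 define omega where "omega r = Sup (V r)" for r
 have up: "\<bar>U (t, x) - U (t, y)\<bar> <= omega r" if "t : {0..T}" "\<bar>x - y\<bar> <= r" for t x y r
  unfolding omega_def by (rule cSup_upper[OF VI[OF that] bdd])
 show ?thesis
 proof (rule that[of omega])
  show "\<bar>U (t, x) - U (t, y)\<bar> <= omega \<bar>x - y\<bar>" if "t : {0..T}" for t x y by (rule up[OF that]) simp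
  show "modulus_of_continuity omega"
   unfolding modulus_of_continuity_def
  proof (intro conjI)
   show "mono_on {0..} omega"
   proof (rule mono_onI)
    fix r s :: real assume "r : {0..}" "r <= s"
    then show "omega r <= omega s" unfolding omega_def by (intro cSup_subset_mono ne bdd) (auto simp: V_def intro: order_trans)
   qed
   have "V 0 = {0}" using VI[of 0 0 0 0] T unfolding V_def by auto
   then show "omega 0 = 0" by (simp add: omega_def)
   show "(omega \<longlongrightarrow> 0) (at_right 0)"
   proof (rule tendstoI)
    fix e :: real assume e: "e > 0"
    obtain delta where delta: "delta > 0" "\<forall>t\<in>{0..T}. \<forall>x y. \<bar>x - y\<bar> <= delta --> \<bar>U (t, x) - U (t, y)\<bar> <= e / 2"
     using unif[OF half_gt_zero[OF e]] by blast
    have "dist (omega r) 0 < e" if r: "0 < r" "r < delta" for r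
    proof -
     have "omega r <= e / 2"
      unfolding omega_def
     proof (rule cSup_least[OF ne])
      fix v assume "v : V r"
      then obtain t x y where v: "v = \<bar>U (t, x) - U (t, y)\<bar>" "t : {0..T}" "\<bar>x - y\<bar> <= r" unfolding V_def by blast
      then have "\<bar>x - y\<bar> <= delta" using r by linarith
      then show "v <= e / 2" using delta(2) v(2) unfolding v(1) by blast
     qed (use r in simp)
     moreover have "0 <= omega r" using up[of 0 0 0 r] T r by simp
     ultimately show ?thesis using e by (simp add: dist_real_def)
    qed
    then show "eventually (%r. dist (omega r) 0 < e) (at_right 0)"
     unfolding eventually_at_right_field using delta(1) by blast
   qed
  qed
 qed
qed

lemma signed_measure_no_atom:
 assumes mu: "finite_signed_measure mu" and c: "isCont (%x. mu {..x}) x"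
 shows "mu {x} = 0"
proof -
 interpret P: finite_borel_measure "pos_variation mu" by (rule finite_pos_variation[OF mu])
 interpret N: finite_borel_measure "neg_variation mu" by (rule finite_neg_variation[OF mu])
 have eq: "mu {..x} = cdf (pos_variation mu) x - cdf (neg_variation mu) x" for x
  unfolding cdf_def2 by (rule jordan_decomposition[OF mu]) simp
 have "((%x. mu {..x}) \<longlongrightarrow> measure (pos_variation mu) {..<x} - measure (neg_variation mu) {..<x}) (at_left x)"
  unfolding eq by (intro tendsto_diff P.cdf_at_left N.cdf_at_left)
 moreover have "measure (pos_variation mu) {..<x} - measure (neg_variation mu) {..<x} = mu {..<x}"
  by (rule jordan_decomposition[OF mu, symmetric]) simp
 moreover have "((%x. mu {..x}) \<longlongrightarrow> mu {..x}) (at_left x)"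
  using c by (auto simp: isCont_def intro: filterlim_at_split[THEN iffD1, THEN conjunct1])
 ultimately have "mu {..x} = mu {..<x}" by (intro tendsto_unique[of "at_left x"]) auto
 moreover have "mu ({..<x} \<union> {x}) = mu {..<x} + mu {x}" by (rule signed_measure_union[OF mu]) auto
 moreover have "{..<x} \<union> {x} = {..x}" by auto
 ultimately show ?thesis by simp
qed

text \<open>\<open>R\<close> solves \<open>K / R^2 = e / 2\<close>, which covers the terms with
  \<open>r\<close> and \<open>T\<close>; the initial tail of \<open>e / 4\<close> is doubled by
  \<open>particle_flow_tail\<close> and takes the other half.\<close>

lemma flow_tight:
 assumes fl: "!!n. n >= 2 ==> particle_flow n T (x n) (b n)" and T: "T >= 0"
  and init: "tight_seq (%n. charge_measure n (x n 0) (b n 0))" and e: "e > 0"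
 shows "\<exists>R>0. \<forall>n\<ge>2. \<forall>t\<in>{0..T}. tv (charge_measure n (x n t) (b n t)) (UNIV - {-R..R}) <= e"
proof -
 obtain r0 where r0: "!!n. n >= 2 ==> total_variation (charge_measure n (x n 0) (b n 0)) (UNIV - {-r0..r0}) < ennreal (e / 4)"
  using init e unfolding tight_seq_def by (metis divide_pos_pos zero_less_numeral)
 define r where "r = \<bar>r0\<bar> + 1"
 have r: "r > 0" "r >= r0" by (auto simp: r_def)
 have in0: "abs_charge n (x n 0) (b n 0) (UNIV - {-r..r}) <= e / 4" if n: "n >= 2" for n
 proof -
  note fs = finite_signed_measure_charge_measure[of n "x n 0" "b n 0"]
  have "(x n 0, b n 0) : Zn n" using fl[OF n] T by (simp add: particle_flow_def)
  then have "abs_charge n (x n 0) (b n 0) (UNIV - {-r..r}) <= tv (charge_measure n (x n 0) (b n 0)) (UNIV - {-r..r})"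
   by (rule charge_tv_ge) simp
  also have "... <= tv (charge_measure n (x n 0) (b n 0)) (UNIV - {-r0..r0})"
   by (rule tv_mono[OF fs]) (use r in auto)
  also have "... <= e / 4"
  proof -
   have "ennreal (tv (charge_measure n (x n 0) (b n 0)) (UNIV - {-r0..r0})) <= ennreal (e / 4)"
    using r0[OF n] total_variation_eq[OF fs, of "UNIV - {-r0..r0}"] by simp
   then show ?thesis using e by (simp add: ennreal_le_iff)
  qed
  finally show ?thesis .
 qed
 define K where "K = 2 * r^2 + 6 * T"
 have K: "K > 0" using r T by (simp add: K_def add_pos_nonneg)
 define R where "R = sqrt (K / (e / 2))"
 have R: "R > 0" "R^2 = K / (e / 2)" using K e by (auto simp: R_def)
 show ?thesis
 proof (intro exI[of _ R] conjI allI impI ballI)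
  show "R > 0" by fact
  fix n t assume n: "n >= (2::nat)" and t: "t : {0..T}"
  have "tv (charge_measure n (x n t) (b n t)) (UNIV - {-R..R}) <= abs_charge n (x n t) (b n t) (UNIV - {-R..R})"
   by (rule charge_tv_le) simp
  also have "... <= 2 * (r^2 / R^2 + abs_charge n (x n 0) (b n 0) (UNIV - {-r..r})) + 6 * T / R^2"
   by (rule particle_flow_tail[OF fl[OF n] R(1) r(1) t])
  also have "... <= K / R^2 + e / 2" using in0[OF n] by (simp add: K_def add_divide_distrib)
  also have "K / R^2 = e / 2" unfolding R(2) using K e by simp
  finally show "tv (charge_measure n (x n t) (b n t)) (UNIV - {-R..R}) <= e" by simp
 qed
qed

theorem corollary4:
  fixes T \<rho> :: real
    and x0 :: "nat \<Rightarrow> nat \<Rightarrow> real" and b0 :: "nat \<Rightarrow> nat \<Rightarrow> int"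
    and x :: "nat \<Rightarrow> real \<Rightarrow> nat \<Rightarrow> real" and b :: "nat \<Rightarrow> real \<Rightarrow> nat \<Rightarrow> int"
    and \<kappa>0 :: "real set \<Rightarrow> real"
  assumes "T > 0" and "\<rho> > 0"
    and "\<And>n. n \<ge> 2 \<Longrightarrow> (x0 n, b0 n) \<in> Zn n"
    and "finite_signed_measure \<kappa>0"
    and "strong_narrow_conv (\<lambda>n. charge_measure n (x0 n) (b0 n)) \<kappa>0"
    and "\<And>n. n \<ge> 2 \<Longrightarrow> solves_Pn n T (x0 n) (b0 n) (x n) (b n)"
  shows "\<exists>\<kappa>. HJ_measure_family \<rho> T \<kappa>0 \<kappa> \<and>
           (\<forall>\<kappa>'. HJ_measure_family \<rho> T \<kappa>0 \<kappa>' \<longrightarrow> (\<forall>t\<in>{0..T}. \<kappa>' t = \<kappa> t)) \<and>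
           (\<exists>s \<omega>. \<forall>t\<in>{0..T}. \<forall>\<tau>. (\<forall>n\<ge>2. \<tau> n \<in> {0..T}) \<and> \<tau> \<longlonglongrightarrow> t \<longrightarrow>
              strong_narrow_conv_with s \<omega>
                (\<lambda>n. charge_measure n (x n (\<tau> n)) (b n (\<tau> n))) (\<kappa> t)) \<and>
           narrowly_continuous_on {0..T} \<kappa>"
proof -
 note \<kappa>0 = assms(4)
 have T: "T >= 0" using assms(1) by simp
 define mu where "mu n t = charge_measure n (x n t) (b n t)" for n t
 have fs: "finite_signed_measure (mu n t)" for n t unfolding mu_def by (rule finite_signed_measure_charge_measure)
 have fl: "particle_flow n T (x n) (b n)" if "n >= 2" for n using solves_imp_particle_flow[OF assms(6)[OF that]] that by simp
 have start: "x n 0 i = x0 n i & b n 0 i = b0 n i" if n: "n >= 2" and i: "i : {1..n}" for n i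
  using assms(6)[OF n] i unfolding solves_Pn_def by blast
 have mu0: "mu n 0 = charge_measure n (x0 n) (b0 n)" if n: "n >= 2" for n
 proof
  fix A
  have "(\<Sum>i=1..n. real_of_int (b n 0 i) * indicator A (x n 0 i)) = (\<Sum>i=1..n. real_of_int (b0 n i) * indicator A (x0 n i) :: real)"
   by (intro sum.cong refl) (use start[OF n] in metis)
  then show "mu n 0 A = charge_measure n (x0 n) (b0 n) A" by (simp only: mu_def charge_measure_def)
 qed
 obtain s0 omega0 where sn0: "strong_narrow_conv_with s0 omega0 (%n. charge_measure n (x0 n) (b0 n)) \<kappa>0"
  using assms(5) unfolding strong_narrow_conv_def by blast
 have atom: "\<kappa>0 {y} = 0" for y using sn0 unfolding strong_narrow_conv_with_def by blast
 define u0 where "u0 = (%y. \<kappa>0 {..y})"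
 obtain M where M: "M >= 1" "datum M u0" "(u0 \<longlongrightarrow> 0) at_bot"
  by (rule signed_measure_datum[OF \<kappa>0 atom, folded u0_def]) (rule that)
 obtain U where U: "unique_HJ_solution \<rho> u0 U" "continuous_on HJ_cl U" "!!x. U (0, x) = u0 x"
  "ext_sub M u0 U" "ext_sub M (%x. - u0 x) (%p. - U p)"
  by (rule HJ_well_posed[OF M(2) assms(2)]) (rule that)
 have tvle: "tv (mu n t) UNIV <= 1" if n: "n >= 2" and t: "t : {0..T}" for n t
 proof -
  have "(x n t, b n t) : Zn n" using fl[OF n] t by (simp add: particle_flow_def)
  then have "abs_charge n (x n t) (b n t) UNIV <= 1" using n by (intro abs_charge_le_1) auto
  then show ?thesis using charge_tv_le[of UNIV n "x n t" "b n t"] unfolding mu_def by simp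
 qed
 have tight0: "tight_seq (%n. mu n 0)"
  using sn0 unfolding strong_narrow_conv_with_def tight_seq_def by (simp add: mu0)
 have tight: "\<exists>R>0. \<forall>n\<ge>2. \<forall>t\<in>{0..T}. tv (mu n t) (UNIV - {-R..R}) <= e" if "e > 0" for e
  unfolding mu_def by (rule flow_tight[OF fl T tight0[unfolded mu_def] that])
 have cdf: "mu n t {..y} = FI n (x n t) (b n t) y / n" for n t y unfolding mu_def by (rule charge_measure_atMost)
 have Mb: "\<bar>U (t, y)\<bar> <= M" if "t : {0..T}" for t y using U(4) that by (simp add: ext_sub_def)
 have mub: "\<bar>mu n t {..y}\<bar> <= 1" if "n >= 2" "t : {0..T}" for n t y
  using abs_le_tv[OF fs, of UNIV "{..y}" n t] tvle[OF that] by simp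
 \<comment> \<open>The uniform distance of the initial distribution functions; the comparison sees
   the convergence of the data only through it.\<close>
 obtain sig0 where sig0: "sig0 ----> 0" "!!n. sig0 n >= (0::real)" "!!n y. n >= 2 ==> y : UNIV ==> \<bar>charge_measure n (x0 n) (b0 n) {..y} - u0 y\<bar> <= sig0 n"
 proof (rule sup_sequence[where f = "%n y. charge_measure n (x0 n) (b0 n) {..y} - u0 y" and ?n0.0 = 2 and C = "1 + M" and S = UNIV])
  fix n y assume n: "n >= (2::nat)"
  show "\<bar>charge_measure n (x0 n) (b0 n) {..y} - u0 y\<bar> <= 1 + M"
   using mub[OF n, of 0 y] Mb[of 0 y] T unfolding mu0[OF n, symmetric] U(3)[symmetric] by simp
 next
  fix e :: real assume "e > 0"
  from strong_narrow_cdf_uniform[OF sn0 finite_signed_measure_charge_measure \<kappa>0 M(2,3)[unfolded u0_def] this]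
  show "\<exists>N. \<forall>n\<ge>N. \<forall>y\<in>UNIV. \<bar>charge_measure n (x0 n) (b0 n) {..y} - u0 y\<bar> <= e" unfolding u0_def by simp
 qed (rule that)
 have unif: "\<exists>N. \<forall>n\<ge>N. \<forall>t\<in>{0..T}. \<forall>y. \<bar>mu n t {..y} - U (t, y)\<bar> <= e" if "e > 0" for e
  unfolding cdf
 proof (rule particle_cdf_uniform[OF M(2,1) U(4,5) fl _ sig0(1,2) that T])
  fix n y assume n: "n >= (2::nat)"
  show "\<bar>FI n (x n 0) (b n 0) y / n - u0 y\<bar> <= sig0 n" using sig0(3)[OF n, of y] unfolding cdf[symmetric] mu0[OF n] by simp
 qed
 \<comment> \<open>The supremum runs over all times in \<open>{0..T}\<close>, which will make the
   rate independent of the sequence of times.\<close>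
 obtain sig where sig: "sig ----> 0" "!!n. sig n >= (0::real)"
  "!!n p. n >= 2 ==> p : {0..T} \<times> UNIV ==> \<bar>mu n (fst p) {..snd p} - U p\<bar> <= sig n"
 proof (rule sup_sequence[where f = "%n p. mu n (fst p) {..snd p} - U p" and ?n0.0 = 2 and C = "1 + M" and S = "{0..T} \<times> UNIV"])
  fix n and p :: "real \<times> real" assume n: "n >= (2::nat)" and p: "p : {0..T} \<times> UNIV"
  obtain t y where ty: "p = (t, y)" "t : {0..T}" using p by auto
  show "\<bar>mu n (fst p) {..snd p} - U p\<bar> <= 1 + M"
   using mub[OF n ty(2), of y] Mb[OF ty(2), of y] unfolding ty(1) fst_conv snd_conv by linarith
 next
  fix e :: real assume "e > 0"
  from unif[OF this] show "\<exists>N. \<forall>n\<ge>N. \<forall>p\<in>{0..T} \<times> UNIV. \<bar>mu n (fst p) {..snd p} - U p\<bar> <= e" by fastforce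
 qed (rule that)
 have sig': "\<bar>mu n t {..y} - U (t, y)\<bar> <= sig n" if "n >= 2" "t : {0..T}" for n t y
  using sig(3)[of n "(t, y)"] that by simp
 obtain omega where omega: "modulus_of_continuity omega" "!!t x y. t : {0..T} ==> \<bar>U (t, x) - U (t, y)\<bar> <= omega \<bar>x - y\<bar>"
  by (rule ext_sub_modulus[OF M(2) U(4,5,2) T]) (rule that)
 have Uc: "continuous_on UNIV (%y. U (t, y))" if "t : {0..T}" for t
  by (rule continuous_on_compose2[OF U(2)]) (use that in \<open>auto intro!: continuous_intros\<close>)
 have "\<exists>nu. finite_signed_measure nu & (\<forall>y. nu {..y} = U (t, y))" if t: "t : {0..T}" for t
 proof -
  \<comment> \<open>\<open>helly_signed_measure\<close> speaks of all indices, hence the shift by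
    2.\<close>
  have lim: "(%n. mu (n + 2) t {..y}) ----> U (t, y)" for y
  proof -
   have "(%n. mu (n + 2) t {..y} - U (t, y)) ----> 0"
    by (rule Lim_null_comparison[OF _ LIMSEQ_ignore_initial_segment[OF sig(1), of 2]]) (use sig'[OF _ t] in simp)
   then show ?thesis by (simp only: Lim_null[symmetric])
  qed
  obtain nu where "finite_signed_measure nu" "!!y. nu {..y} = U (t, y)"
   by (rule helly_signed_measure[OF fs tvle[OF _ t] lim Uc[OF t] ext_sub_at_bot[OF M(2) U(4,5) M(3)]]) (use t that in auto)
  then show ?thesis by blast
 qed
 then obtain \<kappa> where \<kappa>: "!!t. t : {0..T} ==> finite_signed_measure (\<kappa> t)" "!!t y. t : {0..T} ==> \<kappa> t {..y} = U (t, y)"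
  by metis
 have family: "HJ_measure_family \<rho> T \<kappa>0 \<kappa>"
  unfolding HJ_measure_family_def
 proof (intro conjI ballI allI exI[of _ U])
  show "unique_HJ_solution \<rho> (%x. \<kappa>0 {..x}) U" using U(1) unfolding u0_def .
  show "\<kappa> 0 {..x} = \<kappa>0 {..x}" for x using \<kappa>(2)[of 0 x] T U(3)[of x] by (simp add: u0_def)
 qed (use \<kappa> in auto)
 \<comment> \<open>At positive times the unique viscosity solution fixes the distribution function,
   at time 0 the datum does.\<close>
 have unique: "\<kappa>' t = \<kappa> t" if \<kappa>': "HJ_measure_family \<rho> T \<kappa>0 \<kappa>'" and t: "t : {0..T}" for \<kappa>' t
 proof (rule signed_measure_eqI)
  show "finite_signed_measure (\<kappa>' t)" using \<kappa>' t unfolding HJ_measure_family_def by blast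
  show "finite_signed_measure (\<kappa> t)" by (rule \<kappa>(1)[OF t])
  obtain u where u: "unique_HJ_solution \<rho> u0 u" "\<forall>t\<in>{0<..T}. \<forall>x. u (t, x) = \<kappa>' t {..x}"
   and k0: "\<forall>x. \<kappa>' 0 {..x} = \<kappa>0 {..x}"
   using \<kappa>' unfolding HJ_measure_family_def u0_def by blast
  have eq: "u p = U p" if "p : HJ_dom" for p using u(1) U(1) that unfolding unique_HJ_solution_def by blast
  show "\<kappa>' t {..y} = \<kappa> t {..y}" for y
  proof (cases "t = 0")
   case True
   then show ?thesis using k0 \<kappa>(2)[OF t, of y] U(3)[of y] by (simp add: u0_def)
  next
   case False
   then have "t : {0<..T}" using t by auto
   then have "\<kappa>' t {..y} = u (t, y)" using u(2) by simp
   also have "... = U (t, y)" using \<open>t : {0<..T}\<close> by (intro eq) (simp add: HJ_dom_def)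
   finally show ?thesis using \<kappa>(2)[OF t] by simp
  qed
 qed
 \<comment> \<open>Each end of an interval costs one \<open>sig n\<close>, and \<open>omega\<close>
   bounds the increment of \<open>U\<close>.\<close>
 have conv: "strong_narrow_conv_with (%n. 2 * sig n) omega (%n. mu n (tau n)) (\<kappa> t)"
  if t: "t : {0..T}" and tau: "\<forall>n\<ge>2. tau n : {0..T}" "tau ----> t" for t tau
  unfolding strong_narrow_conv_with_def
 proof (intro conjI allI impI)
  show "bounded_variation_seq (%n. mu n (tau n))"
   unfolding bounded_variation_seq_def
   using tvle tau(1) by (intro exI[of _ 1] allI impI) (simp add: total_variation_eq[OF fs] ennreal_leI)
  show "tight_seq (%n. mu n (tau n))"
   unfolding tight_seq_def
  proof (intro allI impI)
   fix e :: real assume e: "e > 0"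
   obtain R where R: "\<forall>n\<ge>2. \<forall>t\<in>{0..T}. tv (mu n t) (UNIV - {-R..R}) <= e / 2" using tight[OF half_gt_zero[OF e]] by blast
   show "\<exists>R. \<forall>n\<ge>2. total_variation (mu n (tau n)) (UNIV - {-R..R}) < ennreal e"
   proof (intro exI[of _ R] allI impI)
    fix n :: nat assume n: "n >= 2"
    then have "tv (mu n (tau n)) (UNIV - {-R..R}) <= e / 2" using R tau(1) by blast
    then show "total_variation (mu n (tau n)) (UNIV - {-R..R}) < ennreal e"
     using e by (simp add: total_variation_eq[OF fs] ennreal_lessI)
   qed
  qed
  show "narrow_conv (%n. mu n (tau n)) (\<kappa> t)"
  proof (rule narrow_conv_from_cdf[OF fs \<kappa>(1)[OF t]])
   show "tv (mu n (tau n)) UNIV <= 1" if "n >= 2" for n using tvle[OF that] tau(1) that by blast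
   show "\<exists>R>0. \<forall>n\<ge>2. tv (mu n (tau n)) (UNIV - {-R..R}) <= e" if "e > 0" for e using tight[OF that] tau(1) by blast
   fix y
   have "(%n. mu n (tau n) {..y} - U (tau n, y)) ----> 0"
    by (rule Lim_null_comparison[OF _ sig(1)], rule eventually_sequentiallyI[of 2]) (use sig' tau(1) in simp)
   moreover have "(%n. U (tau n, y)) ----> U (t, y)"
    by (rule continuous_on_tendsto_compose[OF U(2)])
     (use t tau in \<open>auto intro!: tendsto_intros eventually_sequentiallyI[of 2]\<close>)
   ultimately have "(%n. mu n (tau n) {..y} - U (tau n, y) + U (tau n, y)) ----> 0 + U (t, y)" by (rule tendsto_add)
   then show "(%n. mu n (tau n) {..y}) ----> \<kappa> t {..y}" using \<kappa>(2)[OF t] by simp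
  qed
  show "\<kappa> t {y} = 0" for y
   by (rule signed_measure_no_atom[OF \<kappa>(1)[OF t]]) (use Uc[OF t] \<kappa>(2)[OF t] in \<open>simp add: continuous_on_eq_continuous_at\<close>)
  show "(%n. 2 * sig n) ----> 0" using tendsto_mult[OF tendsto_const sig(1), of 2] by simp
  show "modulus_of_continuity omega" by (rule omega(1))
  fix n :: nat and y z :: real assume n: "n >= 2" and yz: "y <= z"
  have tn: "tau n : {0..T}" using tau(1) n by blast
  show "\<bar>mu n (tau n) {y<..z}\<bar> <= 2 * sig n + omega \<bar>y - z\<bar>"
   using sig'[OF n tn, of y] sig'[OF n tn, of z] omega(2)[OF tn, of y z] unfolding signed_measure_Ioc[OF fs yz] by linarith
 qed
 \<comment> \<open>Convergence along arbitrary sequences of times already forces continuity of the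
   limit in time.\<close>
 have ncont: "narrowly_continuous_on {0..T} \<kappa>"
  unfolding narrowly_continuous_on_def
 proof (intro allI impI)
  fix phi :: "real => real" assume phi: "continuous_on UNIV phi & bounded (range phi)"
  show "continuous_on {0..T} (%t. signed_integral (\<kappa> t) phi)"
  proof (rule continuous_convergence[where ?n0.0 = 2 and F = "%n t. signed_integral (mu n t) phi"])
   fix t tau assume "t : {0..T}" "\<forall>n\<ge>2. tau n : {0..T}" "tau ----> t"
   from conv[OF this] have "narrow_conv (%n. mu n (tau n)) (\<kappa> t)" unfolding strong_narrow_conv_with_def by blast
   then show "(%n. signed_integral (mu n (tau n)) phi) ----> signed_integral (\<kappa> t) phi"
    using phi unfolding narrow_conv_def by blast
  qed
 qed
 show ?thesis
 proof (intro exI[of _ \<kappa>] conjI family ncont allI impI ballI)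
  show "\<kappa>' t = \<kappa> t" if "HJ_measure_family \<rho> T \<kappa>0 \<kappa>'" "t : {0..T}" for \<kappa>' t by (rule unique[OF that])
  show "\<exists>s omega. \<forall>t\<in>{0..T}. \<forall>tau. (\<forall>n\<ge>2. tau n : {0..T}) & tau ----> t -->
       strong_narrow_conv_with s omega (%n. charge_measure n (x n (tau n)) (b n (tau n))) (\<kappa> t)"
   by (intro exI[of _ "%n. 2 * sig n"] exI[of _ omega] ballI allI impI, elim conjE) (rule conv[unfolded mu_def])
 qed
qed

end
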